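(* Let $\Sigma'$ be the branching semigroup of $G_2\subset B_3=\mathfrak{so}_7$ (embedding given by the $7$-dimensional representation of $G_2$), defined using the ordering of positive roots of $B_3$ and the monomial order on $\mathbb Z^9$ described in the context. Then $\Sigma'$ is generated, as a commutative semigroup, by $$\begin{aligned} \sigma_1&=(\pi_1;0,0,0,0,0,0,0,0,0),&\sigma_2&=(\pi_2;0,0,0,0,0,0,0,0,0),\\ \sigma_3&=(\pi_2;0,0,0,0,0,1,0,0,0),&\sigma_4&=(\pi_3;0,0,0,0,0,0,0,0,0),\\ \sigma_5&=(\pi_3;0,0,1,0,0,0,0,0,0),&\sigma_6&=(\pi_1+\pi_3;0,0,0,0,1,0,0,0,0),\\ \sigma_7&=(\pi_1+\pi_2;0,0,1,0,0,0,0,0,0) \end{aligned}$$ with the one defining relation $\sigma_4+\sigma_7=\sigma_1+\sigma_2+\sigma_5$.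
   Context: Semigroups of signatures contain the zero signature. General definitions. Let $\mathfrak g$ be a simple complex Lie algebra with a triangular decomposition and positive roots $\{\alpha_1,\dots,\alpha_N\}$ in a fixed order, root vectors $e_{\pm\alpha}$; $V(\lambda)$ is the irreducible module with highest weight $\lambda$ and highest weight vector $v_\lambda$. A signature is $\sigma=(\lambda;p_1,\dots,p_N)$ with $\lambda$ dominant and exponents $p_i\in\mathbb Z_{\ge0}$; $v(\sigma)=e_{-\alpha_1}^{p_1}\cdots e_{-\alpha_N}^{p_N}v_\lambda$. Signatures are added componentwise. Fix a monomial order on exponent tuples; it compares signatures of the same highest weight. For $0\ne\omega\in V(\lambda)^*$, $\operatorname{sign}(\omega)$ is the least signature $\sigma$ of highest weight $\lambda$ with $\langle\omega,v(\sigma)\rangle\neq0$. For a subalgebra $\mathfrak h\subset\mathfrak g$ with $U'^-$ the maximal unipotent subgroup (of the connected subgroup $H$ with Lie algebra $\mathfrak h$) corresponding to the negative roots of $\mathfrak h$, the branching semigroup is $\Sigma'=\{\operatorname{sign}(\omega)\mid\lambda\text{ dominant},\ 0\neq\omega\in(V(\lambda)^* )^{U'^-}\}$. The case at hand. $\mathfrak g=B_3$ with $\pm\varepsilon_1,\pm\varepsilon_2,\pm\varepsilon_3$ the nonzero weights of the standard representation $V(\pi_1)$. The simple roots are $\varepsilon_1-\varepsilon_2,\ \varepsilon_2-\varepsilon_3,\ \varepsilon_3$, and the fundamental weights are $\pi_1=\varepsilon_1$, $\pi_2=\varepsilon_1+\varepsilon_2$, $\pi_3=\frac12(\varepsilon_1+\varepsilon_2+\varepsilon_3)$.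 The positive roots are numbered $\alpha_1=\varepsilon_1+\varepsilon_2$, $\alpha_2=\varepsilon_1+\varepsilon_3$, $\alpha_3=\varepsilon_2+\varepsilon_3$, $\alpha_4=\varepsilon_1$, $\alpha_5=\varepsilon_3$, $\alpha_6=\varepsilon_2$, $\alpha_7=\varepsilon_1-\varepsilon_3$, $\alpha_8=\varepsilon_2-\varepsilon_3$, $\alpha_9=\varepsilon_1-\varepsilon_2$. The order on $\mathbb Z^9$ is: $\overline p>\overline q$ if $\sum p_i>\sum q_i$, and in case of a tie $\overline p>\overline q$ if $\overline p$ is smaller than $\overline q$ in the lexicographic order. $\mathfrak h=G_2$ is embedded in $\mathfrak{so}_7$ via its $7$-dimensional irreducible representation, which carries a nondegenerate symmetric invariant bilinear form. The embedding is chosen so that the Cartan subalgebra of $G_2$ is the subspace $\varepsilon_1=\varepsilon_2+\varepsilon_3$ of that of $B_3$, and the positive (resp. negative) maximal nilpotent subalgebra of $G_2$ is contained in that of $B_3$; thus $\varepsilon_1-\varepsilon_2$ and $\varepsilon_3$ restrict to the short simple root of $G_2$, and $\varepsilon_2-\varepsilon_3$ restricts to the long simple root. Let $\omega_1,\omega_2$ be the fundamental weights of $G_2$ ($\dim V(\omega_1)=7$, $\dim V(\omega_2)=14$). The generators $\sigma_1,\dots,\sigma_7$ correspond respectively to the $G_2$-highest weights $\omega_1,\ \omega_2,\ \omega_1,\ \omega_1,\ 0,\ \omega_2,\ \omega_2$. *)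

theory Defs
  imports
    "Jordan_Normal_Form.VS_Connect"
    "HOL-Library.Product_Plus"
    "HOL-Library.Function_Algebras"
    "HOL-Library.Multiset"
begin

section \<open>Matrix Lie algebras and their representations on $\mathbb C^n$\<close>

definition lie_br :: "complex mat \<Rightarrow> complex mat \<Rightarrow> complex mat" where
  "lie_br X Y = X * Y - Y * X"

text \<open>The complex Lie subalgebra of $\mathfrak{gl}_7$ generated by a set of $7\times 7$ matrices.\<close>

inductive_set lie_gen :: "complex mat set \<Rightarrow> complex mat set" for S where
  base: "X \<in> S \<Longrightarrow> X \<in> lie_gen S"
| zero: "0\<^sub>m 7 7 \<in> lie_gen S"
| add: "X \<in> lie_gen S \<Longrightarrow> Y \<in> lie_gen S \<Longrightarrow> X + Y \<in> lie_gen S"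
| smult: "X \<in> lie_gen S \<Longrightarrow> c \<cdot>\<^sub>m X \<in> lie_gen S"
| bracket: "X \<in> lie_gen S \<Longrightarrow> Y \<in> lie_gen S \<Longrightarrow> lie_br X Y \<in> lie_gen S"

definition lie_rep :: "complex mat set \<Rightarrow> nat \<Rightarrow> (complex mat \<Rightarrow> complex mat) \<Rightarrow> bool" where
  "lie_rep L n \<rho> \<longleftrightarrow>
     (\<forall>X\<in>L. \<rho> X \<in> carrier_mat n n) \<and>
     (\<forall>X\<in>L. \<forall>Y\<in>L. \<rho> (X + Y) = \<rho> X + \<rho> Y) \<and>
     (\<forall>X\<in>L. \<forall>c. \<rho> (c \<cdot>\<^sub>m X) = c \<cdot>\<^sub>m \<rho> X) \<and>
     (\<forall>X\<in>L. \<forall>Y\<in>L. \<rho> (lie_br X Y) = lie_br (\<rho> X) (\<rho> Y))"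

definition irreducible_rep :: "complex mat set \<Rightarrow> nat \<Rightarrow> (complex mat \<Rightarrow> complex mat) \<Rightarrow> bool" where
  "irreducible_rep L n \<rho> \<longleftrightarrow> lie_rep L n \<rho> \<and> n > 0 \<and>
     (\<forall>W. subspace class_ring W (module_vec TYPE(complex) n) \<longrightarrow>
          (\<forall>X\<in>L. \<forall>w\<in>W. \<rho> X *\<^sub>v w \<in> W) \<longrightarrow>
          W = {0\<^sub>v n} \<or> W = carrier_vec n)"

section \<open>The Lie algebra $B_3 = \mathfrak{so}_7$\<close>

text \<open>The form pairs the basis vector $i$ with $6-i$ (indices start at 0), so that
  diagonal matrices form a Cartan subalgebra and the basis vectors have weights
  $\varepsilon_1,\varepsilon_2,\varepsilon_3,0,-\varepsilon_3,-\varepsilon_2,-\varepsilon_1$.\<close>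

definition form7 :: "complex mat" where
  "form7 = mat 7 7 (\<lambda>(i, j). if i + j = 6 then 1 else 0)"

definition so7 :: "complex mat set" where
  "so7 = {X \<in> carrier_mat 7 7. transpose_mat X * form7 + form7 * X = 0\<^sub>m 7 7}"

definition cartan :: "complex mat set" where
  "cartan = {X \<in> so7. diagonal_mat X}"

text \<open>A weight $x\varepsilon_1+y\varepsilon_2+z\varepsilon_3$ is the triple \<open>(x, y, z)\<close>.\<close>

type_synonym weight = "complex \<times> complex \<times> complex"

fun wt :: "weight \<Rightarrow> complex mat \<Rightarrow> complex" where
  "wt (x, y, z) T = x * T $$ (0, 0) + y * T $$ (1, 1) + z * T $$ (2, 2)"

definition root_space :: "weight \<Rightarrow> complex mat set" where
  "root_space \<alpha> = {X \<in> so7. \<forall>T\<in>cartan. lie_br T X = wt \<alpha> T \<cdot>\<^sub>m X}"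

definition pos_root :: "nat \<Rightarrow> weight" where
  "pos_root i =
     [(1, 1, 0), (1, 0, 1), (0, 1, 1),
      (1, 0, 0), (0, 0, 1), (0, 1, 0),
      (1, 0, -1), (0, 1, -1), (1, -1, 0)] ! (i - 1)"

definition n_plus :: "complex mat set" where
  "n_plus = lie_gen (\<Union>i\<in>{1..9}. root_space (pos_root i))"

definition n_minus :: "complex mat set" where
  "n_minus = lie_gen (\<Union>i\<in>{1..9}. root_space (- pos_root i))"

definition \<pi>\<^sub>1 :: weight where "\<pi>\<^sub>1 = (1, 0, 0)"
definition \<pi>\<^sub>2 :: weight where "\<pi>\<^sub>2 = (1, 1, 0)"
definition \<pi>\<^sub>3 :: weight where "\<pi>\<^sub>3 = (1/2, 1/2, 1/2)"

text \<open>Dominant integral: the values on the three simple coroots are in $\mathbb Z_{\ge 0}$.\<close>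

fun dominant :: "weight \<Rightarrow> bool" where
  "dominant (x, y, z) \<longleftrightarrow> x - y \<in> \<nat> \<and> y - z \<in> \<nat> \<and> 2 * z \<in> \<nat>"

text \<open>\<open>\<rho>\<close> realizes $V(\lambda)$ on $\mathbb C^n$ and \<open>v\<close> is a highest weight vector.\<close>

definition hw_module ::
    "weight \<Rightarrow> nat \<Rightarrow> (complex mat \<Rightarrow> complex mat) \<Rightarrow> complex vec \<Rightarrow> bool" where
  "hw_module lam n \<rho> v \<longleftrightarrow> irreducible_rep so7 n \<rho> \<and>
     v \<in> carrier_vec n \<and> v \<noteq> 0\<^sub>v n \<and>
     (\<forall>X\<in>n_plus. \<rho> X *\<^sub>v v = 0\<^sub>v n) \<and>
     (\<forall>T\<in>cartan. \<rho> T *\<^sub>v v = wt lam T \<cdot>\<^sub>v v)"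

section \<open>Signatures\<close>

text \<open>An element of $\mathbb Z_{\ge 0}^9$ is a function supported on \<open>{1..9}\<close>; this makes
  componentwise addition of signatures available as \<open>(+)\<close>.\<close>

type_synonym signature = "weight \<times> (nat \<Rightarrow> nat)"

definition expos :: "(nat \<Rightarrow> nat) set" where
  "expos = {p. \<forall>i. i \<notin> {1..9} \<longrightarrow> p i = 0}"

definition expo :: "nat list \<Rightarrow> nat \<Rightarrow> nat" where
  "expo ps i = (if 1 \<le> i \<and> i \<le> length ps then ps ! (i - 1) else 0)"

definition lex_less :: "(nat \<Rightarrow> nat) \<Rightarrow> (nat \<Rightarrow> nat) \<Rightarrow> bool" where
  "lex_less p q \<longleftrightarrow> (\<exists>i\<in>{1..9}. p i < q i \<and> (\<forall>j\<in>{1..<i}. p j = q j))"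

definition expo_greater :: "(nat \<Rightarrow> nat) \<Rightarrow> (nat \<Rightarrow> nat) \<Rightarrow> bool" where
  "expo_greater p q \<longleftrightarrow>
     (\<Sum>i\<in>{1..9}. p i) > (\<Sum>i\<in>{1..9}. q i) \<or>
     (\<Sum>i\<in>{1..9}. p i) = (\<Sum>i\<in>{1..9}. q i) \<and> lex_less p q"

text \<open>$\rho(e_1)^{p_1}\cdots\rho(e_9)^{p_9}v$, where \<open>e i\<close> is the root vector for the root
  $-\alpha_i$.\<close>

definition sig_vec :: "(nat \<Rightarrow> complex mat) \<Rightarrow> (complex mat \<Rightarrow> complex mat) \<Rightarrow> complex vec \<Rightarrow>
    (nat \<Rightarrow> nat) \<Rightarrow> complex vec" where
  "sig_vec e \<rho> v p = foldr (\<lambda>i w. (\<rho> (e i) ^\<^sub>m p i) *\<^sub>v w) [1..<10] v"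

text \<open>Linear functionals on $\mathbb C^n$ are written as vectors acting by \<open>\<bullet>\<close>, the bilinear
  (not sesquilinear) scalar product.  The following says that $(\lambda;p)$ is the signature of
  \<open>\<omega>\<close>.\<close>

definition is_sign :: "(nat \<Rightarrow> complex mat) \<Rightarrow> (complex mat \<Rightarrow> complex mat) \<Rightarrow> complex vec \<Rightarrow>
    complex vec \<Rightarrow> (nat \<Rightarrow> nat) \<Rightarrow> bool" where
  "is_sign e \<rho> v \<omega> p \<longleftrightarrow> p \<in> expos \<and> \<omega> \<bullet> sig_vec e \<rho> v p \<noteq> 0 \<and>
     (\<forall>q\<in>expos. \<omega> \<bullet> sig_vec e \<rho> v q \<noteq> 0 \<longrightarrow> q = p \<or> expo_greater q p)"

section \<open>The branching semigroup\<close>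

definition mat_exp :: "nat \<Rightarrow> complex mat \<Rightarrow> complex mat" where
  "mat_exp n A = mat n n (\<lambda>(i, j). \<Sum>k. (A ^\<^sub>m k) $$ (i, j) / of_nat (fact k))"

text \<open>The image in $GL_n$ of the connected Lie group with Lie algebra \<open>N\<close> (acting via \<open>\<rho>\<close>):
  the group generated by the exponentials.  Inverses are included since $-X\in N$.\<close>

inductive_set conn_group ::
    "complex mat set \<Rightarrow> nat \<Rightarrow> (complex mat \<Rightarrow> complex mat) \<Rightarrow> complex mat set" for N n \<rho> where
  one: "1\<^sub>m n \<in> conn_group N n \<rho>"
| mult: "X \<in> N \<Longrightarrow> g \<in> conn_group N n \<rho> \<Longrightarrow> mat_exp n (\<rho> X) * g \<in> conn_group N n \<rho>"

definition dual_invariants ::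
    "complex mat set \<Rightarrow> nat \<Rightarrow> (complex mat \<Rightarrow> complex mat) \<Rightarrow> complex vec set" where
  "dual_invariants N n \<rho> = {\<omega> \<in> carrier_vec n.
     \<forall>g\<in>conn_group N n \<rho>. \<forall>w\<in>carrier_vec n. \<omega> \<bullet> (g *\<^sub>v w) = \<omega> \<bullet> w}"

text \<open>\<open>N\<close> is the Lie algebra of $U'^-$.  Every finite-dimensional module is isomorphic to one on
  some $\mathbb C^n$, and signatures are unchanged under isomorphism and under rescaling of the
  highest weight vector, so ranging over all realizations of $V(\lambda)$ is the same as fixing
  one.\<close>

definition branching_semigroup ::
    "(nat \<Rightarrow> complex mat) \<Rightarrow> complex mat set \<Rightarrow> signature set" where
  "branching_semigroup e N = {(lam, p). dominant lam \<and>
     (\<exists>n \<rho> v \<omega>. hw_module lam n \<rho> v \<and>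
        \<omega> \<in> dual_invariants N n \<rho> \<and> \<omega> \<noteq> 0\<^sub>v n \<and> is_sign e \<rho> v \<omega> p)}"

section \<open>The subalgebra $G_2$\<close>

text \<open>\<open>g2_cartan i j\<close> is $\langle\beta_j,\beta_i^\vee\rangle$, with $\beta_1$ the short and $\beta_2$
  the long simple root.\<close>

definition g2_cartan :: "nat \<Rightarrow> nat \<Rightarrow> int" where
  "g2_cartan i j = (if i = j then 2 else if i = 1 then -3 else -1)"

text \<open>Chevalley--Serre presentation.\<close>

definition g2_chevalley ::
    "(nat \<Rightarrow> complex mat) \<Rightarrow> (nat \<Rightarrow> complex mat) \<Rightarrow> (nat \<Rightarrow> complex mat) \<Rightarrow> bool" where
  "g2_chevalley E F H \<longleftrightarrow> (\<forall>i\<in>{1, 2}. \<forall>j\<in>{1, 2}.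
     lie_br (H i) (H j) = 0\<^sub>m 7 7 \<and>
     lie_br (E i) (F j) = (if i = j then H i else 0\<^sub>m 7 7) \<and>
     lie_br (H i) (E j) = of_int (g2_cartan i j) \<cdot>\<^sub>m E j \<and>
     lie_br (H i) (F j) = of_int (- g2_cartan i j) \<cdot>\<^sub>m F j \<and>
     (i \<noteq> j \<longrightarrow> (lie_br (E i) ^^ nat (1 - g2_cartan i j)) (E j) = 0\<^sub>m 7 7) \<and>
     (i \<noteq> j \<longrightarrow> (lie_br (F i) ^^ nat (1 - g2_cartan i j)) (F j) = 0\<^sub>m 7 7))"

text \<open>\<open>E, F, H\<close> are Chevalley generators of a subalgebra $G_2\subset\mathfrak{so}_7$ irreducible on
  $\mathbb C^7$, whose Cartan subalgebra is the subspace $\varepsilon_1=\varepsilon_2+\varepsilon_3$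
  and whose maximal nilpotent subalgebras are contained in those of $\mathfrak{so}_7$.\<close>

definition g2_in_so7 ::
    "(nat \<Rightarrow> complex mat) \<Rightarrow> (nat \<Rightarrow> complex mat) \<Rightarrow> (nat \<Rightarrow> complex mat) \<Rightarrow> bool" where
  "g2_in_so7 E F H \<longleftrightarrow> g2_chevalley E F H \<and>
     irreducible_rep (lie_gen {E 1, E 2, F 1, F 2, H 1, H 2}) 7 (\<lambda>X. X) \<and>
     {a \<cdot>\<^sub>m H 1 + b \<cdot>\<^sub>m H 2 | a b. True} = {T \<in> cartan. wt (1, 0, 0) T = wt (0, 1, 1) T} \<and>
     lie_gen {E 1, E 2} \<subseteq> n_plus \<and>
     lie_gen {F 1, F 2} \<subseteq> n_minus"

section \<open>Generators and relations\<close>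

definition \<sigma> :: "nat \<Rightarrow> signature" where
  "\<sigma> i =
     [(\<pi>\<^sub>1, expo [0, 0, 0, 0, 0, 0, 0, 0, 0]),
      (\<pi>\<^sub>2, expo [0, 0, 0, 0, 0, 0, 0, 0, 0]),
      (\<pi>\<^sub>2, expo [0, 0, 0, 0, 0, 1, 0, 0, 0]),
      (\<pi>\<^sub>3, expo [0, 0, 0, 0, 0, 0, 0, 0, 0]),
      (\<pi>\<^sub>3, expo [0, 0, 1, 0, 0, 0, 0, 0, 0]),
      (\<pi>\<^sub>1 + \<pi>\<^sub>3, expo [0, 0, 0, 0, 1, 0, 0, 0, 0]),
      (\<pi>\<^sub>1 + \<pi>\<^sub>2, expo [0, 0, 1, 0, 0, 0, 0, 0, 0])] ! (i - 1)"

text \<open>Multisets over an index set $I$ are the free commutative monoid on $I$.  The least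
  congruence on it containing the relation \<open>R\<close>:\<close>

inductive monoid_cong :: "('i multiset \<Rightarrow> 'i multiset \<Rightarrow> bool) \<Rightarrow>
    'i multiset \<Rightarrow> 'i multiset \<Rightarrow> bool" for R where
  rel: "R A B \<Longrightarrow> monoid_cong R A B"
| refl: "monoid_cong R A A"
| sym: "monoid_cong R A B \<Longrightarrow> monoid_cong R B A"
| trans: "monoid_cong R A B \<Longrightarrow> monoid_cong R B C \<Longrightarrow> monoid_cong R A C"
| add: "monoid_cong R A B \<Longrightarrow> monoid_cong R (A + C) (B + C)"

text \<open>\<open>S\<close> is the commutative monoid generated by \<open>g i\<close>, \<open>i \<in> I\<close>, with defining relations
  \<open>R\<close>.\<close>

definition presented_by :: "'a::comm_monoid_add set \<Rightarrow> 'i set \<Rightarrow> ('i \<Rightarrow> 'a) \<Rightarrow>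
    ('i multiset \<Rightarrow> 'i multiset \<Rightarrow> bool) \<Rightarrow> bool" where
  "presented_by S I g R \<longleftrightarrow>
     S = {\<Sum>i\<in>#A. g i | A. set_mset A \<subseteq> I} \<and>
     (\<forall>A B. set_mset A \<subseteq> I \<longrightarrow> set_mset B \<subseteq> I \<longrightarrow>
        ((\<Sum>i\<in>#A. g i) = (\<Sum>i\<in>#B. g i) \<longleftrightarrow> monoid_cong R A B))"

end

theory Submission
  imports
    Defs
    "Jordan_Normal_Form.Char_Poly"
begin

text \<open>
  Write $f_i$ for the root vector of weight $-\alpha_i$ (\<open>neg_vec i\<close>). The Lie algebra
  $\mathfrak n'$ of $U'^-$ is generated, up to scalars, by $f_8$ and $b f_5 + a f_9$ with
  $a, b \ne 0$ (\<open>g2_in_so7_negative_simple\<close>); their brackets give, again up to scalars, $b f_6 - a f_7$,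
  $b f_3 + 2a f_4$, $f_2$ and $f_1$. An invariant functional $\omega$ vanishes on
  $\mathfrak n' V(\lambda)$ (\<open>dual_invariants_iff\<close>), so in
  $\langle\omega, f_{i_1}\cdots f_{i_r} v_\lambda\rangle$ a leading $f_1, f_2, f_8$ gives $0$ and a
  leading $f_4, f_7, f_9$ may be exchanged for a multiple of $f_3, f_6, f_5$. The monomial order
  compares total degrees first; in the least degree with a nonzero value the factors of a word
  commute, because a bracket shortens the word. Hence the exponents of $\operatorname{sign}(\omega)$
  live on the indices $3, 5, 6$.

  Upper bound. The vectors $f_3, f_5, f_6$ span a Heisenberg algebra, $[f_5, f_6] = -f_3$. For fixed
  $w_1, w_2$ let $P$ be the polynomial whose coefficient of $t^j$ is the value of $\omega$ on
  $f_3^j f_5^{w_1-j} f_6^{w_2-j} v_\lambda$, normalized by signs and factorials. Putting one more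
  $f_5$, $f_9$ or $f_8$ next to $v_\lambda$ changes $P$ by an operator
  $P \mapsto \kappa (k P - (t+s) P')$ with $s = 1, \frac12, \frac12$ (\<open>value_poly_5\<close>,
  \<open>value_poly_9\<close>, \<open>value_poly_8\<close>). Writing
  $\lambda = l_1\pi_1 + l_2\pi_2 + l_3\pi_3$, the vectors $f_5^{l_3+1} v_\lambda$,
  $f_9^{l_1+1} v_\lambda$ and $f_8^{l_2+1} v_\lambda$ vanish, and this forces roots of high order of
  $P$ at $-1$ and at $-\frac12$. For the signature $(p_3, p_5, p_6)$ and $w_1 = p_3 + p_5$,
  $w_2 = p_3 + p_6$, minimality gives $\deg P = p_3$, whence
  \[ p_3 \ge \max(0, p_3 + p_5 - l_3) + \max(0, p_3 + p_5 - l_1, p_3 + p_6 - l_2) \]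
  (\<open>branching_signature_bounds\<close>). The solutions of these inequalities are exactly the sums
  of the $\sigma_i$ (\<open>sig6_decompose\<close>).

  Lower bound. If $\omega$ and $\eta$ have signatures $\sigma$ and $\tau$, then
  $\omega\otimes\eta$, evaluated on words applied to $v\otimes w$, has signature $\sigma + \tau$: the
  coproduct splits a word into two subwords, and only splittings into the two least monomials contribute to the least term
  (\<open>leading_shuffle\<close>, \<open>realizes_add\<close>). The submodule generated by $v\otimes w$
  is irreducible because all representations are chosen compatible with the adjoint of matrices, so
  that complete reducibility reduces to orthogonal projections
  (\<open>irreducible_if_cyclic\<close>, \<open>realizes_branching\<close>). So it suffices to exhibit
  one functional for each $\sigma_i$, which is done in $\mathbb C^7$, $\bigwedge^2\mathbb C^7$, the
  spin module and tensor products of these.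

  Presentation. The $\sigma_i$ span a lattice of rank $6$, and the difference of the two sides of
  $\sigma_4 + \sigma_7 = \sigma_1 + \sigma_2 + \sigma_5$ generates the kernel of
  $\mathbb Z^7 \to \mathbb Z^6$ (\<open>sum_eq_iff_monoid_cong\<close>).
\<close>

section \<open>The matrix Lie algebra and its root vectors\<close>

lemma less7: "i < (7::nat) \<longleftrightarrow> i = 0 \<or> i = 1 \<or> i = 2 \<or> i = 3 \<or> i = 4 \<or> i = 5 \<or> i = 6"
  by auto

lemma all7: "(\<forall>i<7. P i) \<longleftrightarrow> P (0::nat) \<and> P 1 \<and> P 2 \<and> P 3 \<and> P 4 \<and> P 5 \<and> P 6"
  unfolding less7 by blast

lemma sum7: "sum g {0..<7::nat} = g 0 + g 1 + g 2 + g 3 + g 4 + g 5 + (g 6 :: complex)"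
  by (simp add: eval_nat_numeral)

lemma mat7_eqI:
  assumes "A \<in> carrier_mat 7 7" "B \<in> carrier_mat 7 7" "\<forall>i<7. \<forall>j<7. A $$ (i, j) = B $$ (i, j)"
  shows "A = B"
  using assms by (intro eq_matI) auto

lemma mult7_index:
  assumes "A \<in> carrier_mat 7 7" "B \<in> carrier_mat 7 7" "i < 7" "j < 7"
  shows "(A * B) $$ (i, j) = (\<Sum>k\<in>{0..<7}. A $$ (i, k) * B $$ (k, j))"
  using assms by (auto simp: scalar_prod_def)

lemma lie_br_carrier [simp]: "A \<in> carrier_mat n n \<Longrightarrow> B \<in> carrier_mat n n \<Longrightarrow> lie_br A B \<in> carrier_mat n n"
  unfolding lie_br_def by (intro minus_carrier_mat mult_carrier_mat)

lemma lie_br_index: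
  assumes "A \<in> carrier_mat 7 7" "B \<in> carrier_mat 7 7" "i < 7" "j < 7"
  shows "lie_br A B $$ (i, j) = (\<Sum>k\<in>{0..<7}. A $$ (i, k) * B $$ (k, j) - B $$ (i, k) * A $$ (k, j))"
proof -
  have "lie_br A B $$ (i, j) = (A * B) $$ (i, j) - (B * A) $$ (i, j)"
    unfolding lie_br_def using assms by (subst index_minus_mat) auto
  thus ?thesis using assms by (simp add: mult7_index sum_subtractf del: index_mult_mat)
qed

text \<open>Membership in $\mathfrak{so}_7$ becomes skew-symmetry about the antidiagonal, so every later
  identity between elements can be checked on entries.\<close>

lemma so7_iff:
  "X \<in> so7 \<longleftrightarrow> X \<in> carrier_mat 7 7 \<and> (\<forall>i<7. \<forall>j<7. X $$ (i, j) = - X $$ (6 - j, 6 - i))"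
proof (cases "X \<in> carrier_mat 7 7")
  case True
  have e: "(X\<^sup>T * form7 + form7 * X) $$ (i, j) = X $$ (6 - j, i) + X $$ (6 - i, j)" if "i < 7" "j < 7" for i j
  proof -
    have a: "(\<Sum>k\<in>{0..<7}. X\<^sup>T $$ (i, k) * form7 $$ (k, j)) = (\<Sum>k\<in>{0..<7}. if k = 6 - j then X $$ (6 - j, i) else 0)"
      using that True by (intro sum.cong) (auto simp: form7_def)
    have b: "(\<Sum>k\<in>{0..<7}. form7 $$ (i, k) * X $$ (k, j)) = (\<Sum>k\<in>{0..<7}. if k = 6 - i then X $$ (6 - i, j) else 0)"
      using that True by (intro sum.cong) (auto simp: form7_def)
    have c: "X\<^sup>T \<in> carrier_mat 7 7" "form7 \<in> carrier_mat 7 7" using True by (auto simp: form7_def)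
    have "(X\<^sup>T * form7 + form7 * X) $$ (i, j) = (\<Sum>k\<in>{0..<7}. X\<^sup>T $$ (i, k) * form7 $$ (k, j)) + (\<Sum>k\<in>{0..<7}. form7 $$ (i, k) * X $$ (k, j))"
      unfolding mult7_index[OF c that, symmetric] mult7_index[OF c(2) True that, symmetric]
      using that True c by (subst index_add_mat) auto
    thus ?thesis using that unfolding a b by (auto simp: sum.delta)
  qed
  have "X \<in> so7 \<longleftrightarrow> (\<forall>i<7. \<forall>j<7. X $$ (6 - j, i) + X $$ (6 - i, j) = 0)"
  proof
    assume "X \<in> so7"
    hence "X\<^sup>T * form7 + form7 * X = 0\<^sub>m 7 7" by (simp add: so7_def)
    thus "\<forall>i<7. \<forall>j<7. X $$ (6 - j, i) + X $$ (6 - i, j) = 0" using e by (metis index_zero_mat(1))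
  next
    assume *: "\<forall>i<7. \<forall>j<7. X $$ (6 - j, i) + X $$ (6 - i, j) = 0"
    have "X\<^sup>T * form7 + form7 * X = 0\<^sub>m 7 7"
    proof (rule mat7_eqI)
      show "X\<^sup>T * form7 + form7 * X \<in> carrier_mat 7 7"
        using True by (intro add_carrier_mat mult_carrier_mat[of _ 7 7]) (auto simp: form7_def)
      show "\<forall>i<7. \<forall>j<7. (X\<^sup>T * form7 + form7 * X) $$ (i, j) = 0\<^sub>m 7 7 $$ (i, j)"
        using e * by (simp del: index_add_mat index_mult_mat)
    qed simp
    thus "X \<in> so7" using True by (simp add: so7_def)
  qed
  also have "\<dots> \<longleftrightarrow> (\<forall>i<7. \<forall>j<7. X $$ (i, j) = - X $$ (6 - j, 6 - i))"
  proof (intro iffI allI impI)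
    fix i j :: nat assume h: "\<forall>i<7. \<forall>j<7. X $$ (6 - j, i) + X $$ (6 - i, j) = 0" and "i < 7" "j < 7"
    hence "X $$ (6 - j, 6 - i) + X $$ (i, j) = 0" using h[rule_format, of "6 - i" j] by simp
    thus "X $$ (i, j) = - X $$ (6 - j, 6 - i)" by (simp add: eq_neg_iff_add_eq_0 add.commute)
  next
    fix i j :: nat assume h: "\<forall>i<7. \<forall>j<7. X $$ (i, j) = - X $$ (6 - j, 6 - i)" and "i < 7" "j < 7"
    have i: "6 - i < 7" "6 - (6 - i) = i" using \<open>i < 7\<close> by simp_all
    show "X $$ (6 - j, i) + X $$ (6 - i, j) = 0" unfolding h[rule_format, OF i(1) \<open>j < 7\<close>] i(2) by simp
  qed
  finally show ?thesis using True by simp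
qed (auto simp: so7_def)

lemma so7_carrier [simp]: "X \<in> so7 \<Longrightarrow> X \<in> carrier_mat 7 7"
  by (simp add: so7_iff)

lemma so7_entry: "X \<in> so7 \<Longrightarrow> i < 7 \<Longrightarrow> j < 7 \<Longrightarrow> X $$ (i, j) = - X $$ (6 - j, 6 - i)"
  unfolding so7_iff by blast

lemma so7_zero [simp]: "0\<^sub>m 7 7 \<in> so7"
  by (simp add: so7_iff)

lemma so7_add [simp]: "X \<in> so7 \<Longrightarrow> Y \<in> so7 \<Longrightarrow> X + Y \<in> so7"
proof -
  assume X: "X \<in> so7" and Y: "Y \<in> so7"
  show ?thesis unfolding so7_iff
  proof (intro conjI allI impI)
    fix i j :: nat assume ij: "i < 7" "j < 7"
    show "(X + Y) $$ (i, j) = - (X + Y) $$ (6 - j, 6 - i)"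
      using so7_entry[OF X ij] so7_entry[OF Y ij] ij carrier_matD[OF so7_carrier[OF X]] carrier_matD[OF so7_carrier[OF Y]]
      by simp
  qed (use X Y in simp)
qed

lemma so7_smult [simp]: "X \<in> so7 \<Longrightarrow> c \<cdot>\<^sub>m X \<in> so7"
proof -
  assume X: "X \<in> so7"
  show ?thesis unfolding so7_iff
  proof (intro conjI allI impI)
    fix i j :: nat assume ij: "i < 7" "j < 7"
    show "(c \<cdot>\<^sub>m X) $$ (i, j) = - (c \<cdot>\<^sub>m X) $$ (6 - j, 6 - i)"
      using so7_entry[OF X ij] ij carrier_matD[OF so7_carrier[OF X]] by simp
  qed (use X in simp)
qed

lemma so7_bracket [simp]:
  assumes X: "X \<in> so7" and Y: "Y \<in> so7" shows "lie_br X Y \<in> so7"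
  unfolding so7_iff
proof (intro conjI allI impI)
  fix i j :: nat assume ij: "i < 7" "j < 7"
  have "lie_br X Y $$ (6 - j, 6 - i) =
     (\<Sum>k\<in>{0..<7}. X $$ (6 - j, k) * Y $$ (k, 6 - i) - Y $$ (6 - j, k) * X $$ (k, 6 - i))"
    using X Y by (subst lie_br_index) auto
  also have "\<dots> = (\<Sum>k\<in>{0..<7}. X $$ (6 - j, 6 - k) * Y $$ (6 - k, 6 - i) - Y $$ (6 - j, 6 - k) * X $$ (6 - k, 6 - i))"
    by (simp add: sum7)
  also have "\<dots> = (\<Sum>k\<in>{0..<7}. X $$ (k, j) * Y $$ (i, k) - Y $$ (k, j) * X $$ (i, k))"
  proof (rule sum.cong)
    fix k :: nat assume "k \<in> {0..<7}"
    hence k: "k < 7" by simp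
    show "X $$ (6 - j, 6 - k) * Y $$ (6 - k, 6 - i) - Y $$ (6 - j, 6 - k) * X $$ (6 - k, 6 - i) =
       X $$ (k, j) * Y $$ (i, k) - Y $$ (k, j) * X $$ (i, k)"
      unfolding so7_entry[OF X k ij(2)] so7_entry[OF Y k ij(2)] so7_entry[OF X ij(1) k] so7_entry[OF Y ij(1) k] by simp
  qed simp
  also have "\<dots> = - lie_br X Y $$ (i, j)"
    using X Y ij by (subst lie_br_index) (auto simp: sum_negf[symmetric] algebra_simps intro!: sum.cong)
  finally show "lie_br X Y $$ (i, j) = - lie_br X Y $$ (6 - j, 6 - i)" by simp
qed (use X Y in auto)

definition skew_unit :: "nat \<Rightarrow> nat \<Rightarrow> complex mat" where
  "skew_unit r s = mat 7 7 (\<lambda>(i, j). (if i = r \<and> j = s then 1 else 0) - (if i = 6 - s \<and> j = 6 - r then 1 else 0))"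

text \<open>The matrix of a root vector of weight $-\alpha_k$ has two nonzero entries, exchanged by reflection
  in the antidiagonal; these are the row and the column of the one that stands further to the left.\<close>

definition root_row :: "nat \<Rightarrow> nat" where "root_row k = [5, 4, 4, 3, 3, 3, 2, 2, 1] ! (k - 1)"
definition root_col :: "nat \<Rightarrow> nat" where "root_col k = [0, 0, 1, 0, 2, 1, 0, 1, 0] ! (k - 1)"

definition neg_vec :: "nat \<Rightarrow> complex mat" where "neg_vec k = skew_unit (root_row k) (root_col k)"
definition pos_vec :: "nat \<Rightarrow> complex mat" where "pos_vec k = skew_unit (root_col k) (root_row k)"

lemma in19: "k \<in> {1..9::nat} \<longleftrightarrow> k = 1 \<or> k = 2 \<or> k = 3 \<or> k = 4 \<or> k = 5 \<or> k = 6 \<or> k = 7 \<or> k = 8 \<or> k = 9"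
  by auto

lemma skew_unit_index: "i < 7 \<Longrightarrow> j < 7 \<Longrightarrow> skew_unit r s $$ (i, j) =
  (if i = r \<and> j = s then 1 else 0) - (if i = 6 - s \<and> j = 6 - r then 1 else 0)"
  by (simp add: skew_unit_def)

lemma skew_unit_carrier [simp]: "skew_unit r s \<in> carrier_mat 7 7"
  by (simp add: skew_unit_def)

lemma skew_unit_so7 [simp]: "r < 7 \<Longrightarrow> s < 7 \<Longrightarrow> skew_unit r s \<in> so7"
proof -
  assume rs: "r < 7" "s < 7"
  show ?thesis unfolding so7_iff
  proof (intro conjI allI impI)
    fix i j :: nat assume ij: "i < 7" "j < 7"
    have lt: "6 - j < 7" "6 - i < 7" by simp_all
    have e: "(6 - j = r) = (j = 6 - r)" "(6 - i = s) = (i = 6 - s)" "(6 - j = 6 - s) = (j = s)" "(6 - i = 6 - r) = (i = r)"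
      using rs ij by arith+
    have "(i = r \<and> j = s) = (j = s \<and> i = r)" "(j = 6 - r \<and> i = 6 - s) = (i = 6 - s \<and> j = 6 - r)" by blast+
    thus "skew_unit r s $$ (i, j) = - skew_unit r s $$ (6 - j, 6 - i)"
      unfolding skew_unit_index[OF ij] skew_unit_index[OF lt] e by (simp only: minus_diff_eq)
  qed simp
qed

lemma root_lt: "k \<in> {1..9} \<Longrightarrow> root_row k < 7 \<and> root_col k < 7"
  unfolding in19 by (auto simp: root_row_def root_col_def)

lemma neg_vec_so7 [simp]: "k \<in> {1..9} \<Longrightarrow> neg_vec k \<in> so7"
  and pos_vec_so7 [simp]: "k \<in> {1..9} \<Longrightarrow> pos_vec k \<in> so7"
  using root_lt by (auto simp: neg_vec_def pos_vec_def)

definition lower_so7 :: "complex mat set" where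
  "lower_so7 = {X \<in> so7. \<forall>i<7. \<forall>j<7. i \<le> j \<longrightarrow> X $$ (i, j) = 0}"

definition upper_so7 :: "complex mat set" where
  "upper_so7 = {X \<in> so7. \<forall>i<7. \<forall>j<7. j \<le> i \<longrightarrow> X $$ (i, j) = 0}"

lemma lower_so7_decomp:
  assumes X: "X \<in> lower_so7"
  shows "X = X $$ (5,0) \<cdot>\<^sub>m neg_vec 1 + (X $$ (4,0) \<cdot>\<^sub>m neg_vec 2 + (X $$ (4,1) \<cdot>\<^sub>m neg_vec 3 +
    (X $$ (3,0) \<cdot>\<^sub>m neg_vec 4 + (X $$ (3,2) \<cdot>\<^sub>m neg_vec 5 + (X $$ (3,1) \<cdot>\<^sub>m neg_vec 6 +
    (X $$ (2,0) \<cdot>\<^sub>m neg_vec 7 + (X $$ (2,1) \<cdot>\<^sub>m neg_vec 8 + X $$ (1,0) \<cdot>\<^sub>m neg_vec 9)))))))" (is "X = ?R")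
proof (rule mat7_eqI)
  have so: "X \<in> so7" using X by (simp add: lower_so7_def)
  note en = so7_entry[OF so]
  have l: "X $$ (i, j) = 0" if "i \<le> j" "i < 7" "j < 7" for i j using X that by (simp add: lower_so7_def)
  have eqs: "X $$ (6,5) = - X $$ (1,0)" "X $$ (6,4) = - X $$ (2,0)" "X $$ (6,3) = - X $$ (3,0)" "X $$ (6,2) = - X $$ (4,0)"
      "X $$ (6,1) = - X $$ (5,0)" "X $$ (5,4) = - X $$ (2,1)" "X $$ (5,3) = - X $$ (3,1)" "X $$ (5,2) = - X $$ (4,1)"
      "X $$ (4,3) = - X $$ (3,2)"
    using en[of 6 5] en[of 6 4] en[of 6 3] en[of 6 2] en[of 6 1] en[of 5 4] en[of 5 3] en[of 5 2] en[of 4 3] by simp_all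
  have "X $$ (6,0) = - X $$ (6,0)" "X $$ (5,1) = - X $$ (5,1)" "X $$ (4,2) = - X $$ (4,2)"
    using en[of 6 0] en[of 5 1] en[of 4 2] by simp_all
  hence z: "X $$ (6,0) = 0" "X $$ (5,1) = 0" "X $$ (4,2) = 0" by simp_all
  show "X \<in> carrier_mat 7 7" using so by simp
  show "?R \<in> carrier_mat 7 7" by (simp add: neg_vec_def)
  show "\<forall>i<7. \<forall>j<7. X $$ (i, j) = ?R $$ (i, j)"
    unfolding all7 by (simp add: neg_vec_def root_row_def root_col_def skew_unit_def l eqs z del: One_nat_def)
qed

lemma upper_so7_decomp:
  assumes X: "X \<in> upper_so7"
  shows "X = X $$ (0,5) \<cdot>\<^sub>m pos_vec 1 + (X $$ (0,4) \<cdot>\<^sub>m pos_vec 2 + (X $$ (1,4) \<cdot>\<^sub>m pos_vec 3 +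
    (X $$ (0,3) \<cdot>\<^sub>m pos_vec 4 + (X $$ (2,3) \<cdot>\<^sub>m pos_vec 5 + (X $$ (1,3) \<cdot>\<^sub>m pos_vec 6 +
    (X $$ (0,2) \<cdot>\<^sub>m pos_vec 7 + (X $$ (1,2) \<cdot>\<^sub>m pos_vec 8 + X $$ (0,1) \<cdot>\<^sub>m pos_vec 9)))))))" (is "X = ?R")
proof (rule mat7_eqI)
  have so: "X \<in> so7" using X by (simp add: upper_so7_def)
  note en = so7_entry[OF so]
  have l: "X $$ (i, j) = 0" if "j \<le> i" "i < 7" "j < 7" for i j using X that by (simp add: upper_so7_def)
  have eqs: "X $$ (5,6) = - X $$ (0,1)" "X $$ (4,6) = - X $$ (0,2)" "X $$ (3,6) = - X $$ (0,3)" "X $$ (2,6) = - X $$ (0,4)"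
      "X $$ (1,6) = - X $$ (0,5)" "X $$ (4,5) = - X $$ (1,2)" "X $$ (3,5) = - X $$ (1,3)" "X $$ (2,5) = - X $$ (1,4)"
      "X $$ (3,4) = - X $$ (2,3)"
    using en[of 5 6] en[of 4 6] en[of 3 6] en[of 2 6] en[of 1 6] en[of 4 5] en[of 3 5] en[of 2 5] en[of 3 4] by simp_all
  have "X $$ (0,6) = - X $$ (0,6)" "X $$ (1,5) = - X $$ (1,5)" "X $$ (2,4) = - X $$ (2,4)"
    using en[of 0 6] en[of 1 5] en[of 2 4] by simp_all
  hence z: "X $$ (0,6) = 0" "X $$ (1,5) = 0" "X $$ (2,4) = 0" by simp_all
  show "X \<in> carrier_mat 7 7" using so by simp
  show "?R \<in> carrier_mat 7 7" by (simp add: pos_vec_def)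
  show "\<forall>i<7. \<forall>j<7. X $$ (i, j) = ?R $$ (i, j)"
    unfolding all7 by (simp add: pos_vec_def root_row_def root_col_def skew_unit_def l eqs z del: One_nat_def)
qed

definition diag7 :: "complex \<Rightarrow> complex \<Rightarrow> complex \<Rightarrow> complex mat" where
  "diag7 x y z = mat 7 7 (\<lambda>(i, j). if i = j then [x, y, z, 0, -z, -y, -x] ! i else 0)"

lemma diag7_carrier [simp]: "diag7 x y z \<in> carrier_mat 7 7" by (simp add: diag7_def)

lemma diag7_cartan [simp]: "diag7 x y z \<in> cartan"
proof -
  have "diag7 x y z \<in> so7" unfolding so7_iff all7 by (simp add: diag7_def)
  thus ?thesis by (auto simp: cartan_def diagonal_mat_def diag7_def)
qed

lemma cartan_eq_diag7:
  assumes "T \<in> cartan" shows "T = diag7 (T $$ (0,0)) (T $$ (1,1)) (T $$ (2,2))"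
proof (rule mat7_eqI)
  have so: "T \<in> so7" and d: "\<And>i j. i < 7 \<Longrightarrow> j < 7 \<Longrightarrow> i \<noteq> j \<Longrightarrow> T $$ (i, j) = 0"
    using assms carrier_matD[OF so7_carrier, of T] by (auto simp: cartan_def diagonal_mat_def)
  note en = so7_entry[OF so]
  have "T $$ (3,3) = - T $$ (3,3)" using en[of 3 3] by simp
  hence z: "T $$ (3,3) = 0" by simp
  show "T \<in> carrier_mat 7 7" using so by simp
  show "\<forall>i<7. \<forall>j<7. T $$ (i, j) = diag7 (T $$ (0,0)) (T $$ (1,1)) (T $$ (2,2)) $$ (i, j)"
    unfolding all7 using en[of 4 4] en[of 5 5] en[of 6 6] by (simp add: diag7_def d z)
qed simp

lemma lie_br_diag7_index:
  assumes "X \<in> carrier_mat 7 7" "i < 7" "j < 7"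
  shows "lie_br (diag7 x y z) X $$ (i, j) = ([x, y, z, 0, -z, -y, -x] ! i - [x, y, z, 0, -z, -y, -x] ! j) * X $$ (i, j)"
proof -
  let ?d = "[x, y, z, 0, -z, -y, -x]"
  have "lie_br (diag7 x y z) X $$ (i, j) =
     (\<Sum>k\<in>{0..<7}. (if k = i then ?d ! i * X $$ (i, j) else 0)) - (\<Sum>k\<in>{0..<7}. (if k = j then X $$ (i, j) * ?d ! j else 0))"
    unfolding sum_subtractf[symmetric] using assms
    by (subst lie_br_index) (auto intro!: sum.cong simp: diag7_def)
  thus ?thesis using assms by (simp add: algebra_simps)
qed

lemma lie_br_diag7_skew_unit:
  assumes "r < 7" "s < 7"
  shows "lie_br (diag7 x y z) (skew_unit r s) = ([x, y, z, 0, -z, -y, -x] ! r - [x, y, z, 0, -z, -y, -x] ! s) \<cdot>\<^sub>m skew_unit r s"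
  (is "?L = ?c \<cdot>\<^sub>m _")
proof (rule mat7_eqI)
  have a: "[x, y, z, 0, -z, -y, -x] ! (6 - r) = - [x, y, z, 0, -z, -y, -x] ! r" if "r < 7" for r
    using that unfolding less7 by auto
  show "\<forall>i<7. \<forall>j<7. ?L $$ (i, j) = (?c \<cdot>\<^sub>m skew_unit r s) $$ (i, j)"
    using assms by (auto simp: lie_br_diag7_index skew_unit_index a carrier_matD[OF skew_unit_carrier])
qed auto

lemma pos_vec_root_space:
  assumes k: "k \<in> {1..9}" shows "pos_vec k \<in> root_space (pos_root k)"
  unfolding root_space_def
proof (intro CollectI conjI ballI)
  show "pos_vec k \<in> so7" using k by (rule pos_vec_so7)
  fix T assume T: "T \<in> cartan"
  have "lie_br (diag7 (T $$ (0,0)) (T $$ (1,1)) (T $$ (2,2))) (pos_vec k) = wt (pos_root k) T \<cdot>\<^sub>m pos_vec k"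
    using k unfolding in19 pos_vec_def
    by (elim disjE; simp add: lie_br_diag7_skew_unit root_row_def root_col_def pos_root_def)
  thus "lie_br T (pos_vec k) = wt (pos_root k) T \<cdot>\<^sub>m pos_vec k"
    using cartan_eq_diag7[OF T] by simp
qed

text \<open>The eigenvalues of the Cartan element with
  $(\varepsilon_1,\varepsilon_2,\varepsilon_3) = (9,3,1)$. The positive roots take distinct values on
  it, so its adjoint action alone decides which entries of a root vector can be nonzero.\<close>

definition height7 :: "int list" where "height7 = [9, 3, 1, 0, -1, -3, -9]"
definition root_height :: "nat \<Rightarrow> int" where "root_height k = [12, 10, 4, 9, 1, 3, 8, 2, 6] ! (k - 1)"

lemma root_space_entry_zero:
  assumes k: "k \<in> {1..9}" and ij: "i < 7" "j < 7"
  shows "X \<in> root_space (pos_root k) \<Longrightarrow> height7 ! i - height7 ! j \<noteq> root_height k \<Longrightarrow> X $$ (i, j) = 0"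
    and "X \<in> root_space (- pos_root k) \<Longrightarrow> height7 ! i - height7 ! j \<noteq> - root_height k \<Longrightarrow> X $$ (i, j) = 0"
proof -
  have h: "[9, 3, 1, 0, -1, -3, -9] ! i = (of_int (height7 ! i) :: complex)" if "i < 7" for i
    using that unfolding less7 height7_def by (elim disjE) simp_all
  have w: "wt (pos_root k) (diag7 9 3 1) = of_int (root_height k)" "wt (- pos_root k) (diag7 9 3 1) = of_int (- root_height k)"
    using k unfolding in19 by (elim disjE; simp add: pos_root_def root_height_def diag7_def)+
  have main: "X $$ (i, j) = 0" if "lie_br (diag7 9 3 1) X = of_int m \<cdot>\<^sub>m X" "X \<in> carrier_mat 7 7" "height7 ! i - height7 ! j \<noteq> m" for m
  proof -
    have "of_int (height7 ! i - height7 ! j) * X $$ (i, j) = of_int m * X $$ (i, j)"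
      using lie_br_diag7_index[OF that(2) ij, of 9 3 1] that(1,2) ij by (auto simp: h)
    thus ?thesis using that(3) by (metis mult_cancel_right of_int_eq_iff)
  qed
  show "X $$ (i, j) = 0" if "X \<in> root_space (pos_root k)" "height7 ! i - height7 ! j \<noteq> root_height k"
    using that w(1) by (intro main[of "root_height k"]) (auto simp: root_space_def)
  show "X $$ (i, j) = 0" if "X \<in> root_space (- pos_root k)" "height7 ! i - height7 ! j \<noteq> - root_height k"
    using that w(2) by (intro main[of "- root_height k"]) (auto simp: root_space_def)
qed

lemma height7_mono: "i < 7 \<Longrightarrow> j < 7 \<Longrightarrow> i \<le> j \<Longrightarrow> height7 ! i - height7 ! j \<ge> 0"
  unfolding less7 height7_def by (elim disjE) simp_all

lemma root_height_pos: "k \<in> {1..9} \<Longrightarrow> root_height k > 0"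
  unfolding in19 by (elim disjE; simp add: root_height_def)

lemma neg_pos_vec_carrier [simp]: "neg_vec k \<in> carrier_mat 7 7" "pos_vec k \<in> carrier_mat 7 7"
  by (simp_all add: neg_vec_def pos_vec_def)

lemma zero_smult7: "A \<in> carrier_mat 7 7 \<Longrightarrow> (0::complex) \<cdot>\<^sub>m A = 0\<^sub>m 7 7"
  by (intro mat7_eqI) auto

lemma root_space_pos:
  assumes k: "k \<in> {1..9}" and X: "X \<in> root_space (pos_root k)"
  shows "X = X $$ (root_col k, root_row k) \<cdot>\<^sub>m pos_vec k"
proof -
  note z = root_space_entry_zero(1)[OF k _ _ X]
  have "X $$ (i, j) = 0" if "i < 7" "j < 7" "j \<le> i" for i j
    using z[OF that(1,2)] height7_mono[OF that(2,1,3)] root_height_pos[OF k] by auto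
  hence "X \<in> upper_so7" using X by (simp add: upper_so7_def root_space_def)
  show ?thesis
    apply (rule HOL.trans[OF upper_so7_decomp[OF \<open>X \<in> upper_so7\<close>]])
    using k unfolding in19
    by (elim disjE; simp add: root_row_def root_col_def root_height_def height7_def z zero_smult7 One_nat_def[symmetric] del: One_nat_def)
qed

lemma root_space_neg:
  assumes k: "k \<in> {1..9}" and X: "X \<in> root_space (- pos_root k)"
  shows "X = X $$ (root_row k, root_col k) \<cdot>\<^sub>m neg_vec k"
proof -
  note z = root_space_entry_zero(2)[OF k _ _ X]
  have "X $$ (i, j) = 0" if "i < 7" "j < 7" "i \<le> j" for i j
    using z[OF that(1,2)] height7_mono[OF that] root_height_pos[OF k] by auto
  hence "X \<in> lower_so7" using X by (simp add: lower_so7_def root_space_def)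
  show ?thesis
    apply (rule HOL.trans[OF lower_so7_decomp[OF \<open>X \<in> lower_so7\<close>]])
    using k unfolding in19
    by (elim disjE; simp add: root_row_def root_col_def root_height_def height7_def z zero_smult7 One_nat_def[symmetric] del: One_nat_def)
qed

lemma neg_vec_lower [simp]: "k \<in> {1..9} \<Longrightarrow> neg_vec k \<in> lower_so7"
proof -
  assume k: "k \<in> {1..9}"
  have lt: "root_col k < root_row k" "root_row k < 7"
    using k unfolding in19 by (elim disjE; simp add: root_row_def root_col_def)+
  have "skew_unit (root_row k) (root_col k) $$ (i, j) = 0" if "i < 7" "j < 7" "i \<le> j" for i j
  proof -
    have "\<not> (i = root_row k \<and> j = root_col k)" using lt(1) that(3) by auto
    moreover have "\<not> (i = 6 - root_col k \<and> j = 6 - root_row k)"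
    proof
      assume "i = 6 - root_col k \<and> j = 6 - root_row k"
      hence "6 - root_col k \<le> 6 - root_row k" using that(3) by simp
      thus False using lt by arith
    qed
    ultimately
    show ?thesis unfolding skew_unit_index[OF that(1,2)] by (simp only: if_False diff_self)
  qed
  thus ?thesis using neg_vec_so7[OF k] unfolding lower_so7_def neg_vec_def by blast
qed

section \<open>Triangular decomposition\<close>

lemma lower_so7_closed:
  "0\<^sub>m 7 7 \<in> lower_so7"
  "X \<in> lower_so7 \<Longrightarrow> Y \<in> lower_so7 \<Longrightarrow> X + Y \<in> lower_so7"
  "X \<in> lower_so7 \<Longrightarrow> c \<cdot>\<^sub>m X \<in> lower_so7"
  "X \<in> lower_so7 \<Longrightarrow> Y \<in> lower_so7 \<Longrightarrow> lie_br X Y \<in> lower_so7"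
proof -
  show "0\<^sub>m 7 7 \<in> lower_so7" by (simp add: lower_so7_def)
  show "X + Y \<in> lower_so7" if "X \<in> lower_so7" "Y \<in> lower_so7"
    using that carrier_matD[OF so7_carrier, of X] carrier_matD[OF so7_carrier, of Y] by (simp add: lower_so7_def)
  show "c \<cdot>\<^sub>m X \<in> lower_so7" if "X \<in> lower_so7"
    using that carrier_matD[OF so7_carrier, of X] by (simp add: lower_so7_def)
  show "lie_br X Y \<in> lower_so7" if "X \<in> lower_so7" "Y \<in> lower_so7"
    unfolding lower_so7_def
  proof (intro CollectI conjI allI impI)
    have so: "X \<in> so7" "Y \<in> so7" using that by (auto simp: lower_so7_def)
    thus "lie_br X Y \<in> so7" by simp
    fix i j :: nat assume ij: "i < 7" "j < 7" "i \<le> j"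
    have z: "A $$ (p, q) = 0" if "A \<in> lower_so7" "p < 7" "q < 7" "p \<le> q" for A p q
      using that by (auto simp: lower_so7_def)
    have "X $$ (i, k) * Y $$ (k, j) - Y $$ (i, k) * X $$ (k, j) = 0" if "k < 7" for k
      using z[OF \<open>X \<in> lower_so7\<close>, of i k] z[OF \<open>Y \<in> lower_so7\<close>, of i k] z[OF \<open>X \<in> lower_so7\<close>, of k j] z[OF \<open>Y \<in> lower_so7\<close>, of k j] ij that
      by (cases "i \<le> k") auto
    thus "lie_br X Y $$ (i, j) = 0" using so ij by (subst lie_br_index) auto
  qed
qed

text \<open>Brackets of strictly triangular matrices are strictly triangular, so triangularity passes from the
  root vectors to the subalgebra that they generate.\<close>

lemma n_minus_lower: "n_minus \<subseteq> lower_so7"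
proof
  fix X assume "X \<in> n_minus"
  thus "X \<in> lower_so7" unfolding n_minus_def
  proof induction
    case (base X)
    then obtain k where "k \<in> {1..9}" "X \<in> root_space (- pos_root k)" by blast
    thus ?case using root_space_neg lower_so7_closed(3) neg_vec_lower by metis
  qed (auto intro: lower_so7_closed)
qed

lemma lower_so7_transpose: "X \<in> lower_so7 \<Longrightarrow> X\<^sup>T \<in> upper_so7"
  "X \<in> upper_so7 \<Longrightarrow> X\<^sup>T \<in> lower_so7"
proof -
  have t: "X\<^sup>T \<in> so7" if X: "X \<in> so7" for X
    unfolding so7_iff
  proof (intro conjI allI impI)
    fix i j :: nat assume ij: "i < 7" "j < 7"
    show "X\<^sup>T $$ (i, j) = - X\<^sup>T $$ (6 - j, 6 - i)"
      using so7_entry[OF X ij(2) ij(1)] ij carrier_matD[OF so7_carrier[OF X]] by simp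
  qed (use X in simp)
  show "X\<^sup>T \<in> upper_so7" if "X \<in> lower_so7"
    using that carrier_matD[OF so7_carrier, of X] t[of X] by (simp add: upper_so7_def lower_so7_def)
  show "X\<^sup>T \<in> lower_so7" if "X \<in> upper_so7"
    using that carrier_matD[OF so7_carrier, of X] t[of X] by (simp add: upper_so7_def lower_so7_def)
qed

lemma n_plus_upper: "n_plus \<subseteq> upper_so7"
proof
  have tr: "pos_vec k = (neg_vec k)\<^sup>T" if "k \<in> {1..9}" for k
    using root_lt[OF that]
    by (intro mat7_eqI) (auto simp: pos_vec_def neg_vec_def skew_unit_index carrier_matD[OF skew_unit_carrier])
  have lb: "lie_br X Y = (lie_br (Y\<^sup>T) (X\<^sup>T))\<^sup>T" if "X \<in> carrier_mat 7 7" "Y \<in> carrier_mat 7 7" for X Y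
  proof (rule mat7_eqI)
    show "\<forall>i<7. \<forall>j<7. lie_br X Y $$ (i, j) = (lie_br (Y\<^sup>T) (X\<^sup>T))\<^sup>T $$ (i, j)"
    proof (intro allI impI)
      fix i j :: nat assume ij: "i < 7" "j < 7"
      have "(lie_br (Y\<^sup>T) (X\<^sup>T))\<^sup>T $$ (i, j) = lie_br (Y\<^sup>T) (X\<^sup>T) $$ (j, i)"
        using ij carrier_matD[OF lie_br_carrier[of "Y\<^sup>T" 7 "X\<^sup>T"]] that by (subst index_transpose_mat) simp_all
      thus "lie_br X Y $$ (i, j) = (lie_br (Y\<^sup>T) (X\<^sup>T))\<^sup>T $$ (i, j)"
        using ij that by (auto simp: lie_br_index intro!: sum.cong)
    qed
  qed (use that in auto)
  have ts: "(c \<cdot>\<^sub>m A)\<^sup>T = c \<cdot>\<^sub>m A\<^sup>T" for c :: complex and A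
    by (intro eq_matI) auto
  fix X assume "X \<in> n_plus"
  thus "X \<in> upper_so7" unfolding n_plus_def
  proof induction
    case (base X)
    then obtain k where k: "k \<in> {1..9}" "X \<in> root_space (pos_root k)" by blast
    have "X = (X $$ (root_col k, root_row k) \<cdot>\<^sub>m neg_vec k)\<^sup>T"
      unfolding ts tr[OF k(1), symmetric] by (rule root_space_pos[OF k])
    thus ?case using k lower_so7_closed(3) neg_vec_lower lower_so7_transpose(1) by metis
  next
    case (bracket X Y)
    hence so: "X \<in> carrier_mat 7 7" "Y \<in> carrier_mat 7 7" by (auto simp: upper_so7_def)
    show ?case unfolding lb[OF so] using bracket lower_so7_transpose lower_so7_closed(4) by blast
  next
    case (add X Y)
    thus ?case using carrier_matD[OF so7_carrier, of X] carrier_matD[OF so7_carrier, of Y] by (simp add: upper_so7_def)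
  next
    case (smult X c)
    thus ?case using carrier_matD[OF so7_carrier, of X] by (simp add: upper_so7_def)
  qed (simp add: upper_so7_def)
qed

lemma so7_triangular_decomp:
  assumes X: "X \<in> so7"
  obtains L T U where "L \<in> lower_so7" "T \<in> cartan" "U \<in> upper_so7" "X = L + (T + U)"
proof
  note cd = carrier_matD[OF so7_carrier[OF X]]
  let ?P = "\<lambda>Q. mat 7 7 (\<lambda>(i, j). if Q i j then X $$ (i, j) else 0)"
  have so: "?P Q \<in> so7" if Q: "\<And>i j. i < 7 \<Longrightarrow> j < 7 \<Longrightarrow> Q (6 - j) (6 - i) = Q i j" for Q
    unfolding so7_iff
  proof (intro conjI allI impI)
    fix i j :: nat assume ij: "i < 7" "j < 7"
    hence lt: "6 - j < 7" "6 - i < 7" by simp_all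
    show "?P Q $$ (i, j) = - ?P Q $$ (6 - j, 6 - i)"
      using so7_entry[OF X ij] ij lt Q[OF ij] by simp
  qed simp
  show "?P (\<lambda>i j. j < i) \<in> lower_so7"
  proof -
    have "?P (\<lambda>i j. j < i) \<in> so7" by (rule so) auto
    thus ?thesis by (simp add: lower_so7_def)
  qed
  show "?P (\<lambda>i j. i < j) \<in> upper_so7"
  proof -
    have "?P (\<lambda>i j. i < j) \<in> so7" by (rule so) auto
    thus ?thesis by (simp add: upper_so7_def)
  qed
  show "?P (\<lambda>i j. i = j) \<in> cartan"
  proof -
    have "?P (\<lambda>i j. i = j) \<in> so7" by (rule so) auto
    thus ?thesis by (simp add: cartan_def diagonal_mat_def)
  qed
  show "X = ?P (\<lambda>i j. j < i) + (?P (\<lambda>i j. i = j) + ?P (\<lambda>i j. i < j))"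
    using cd by (intro mat7_eqI) auto
qed

lemma lie_br_skew_unit_index:
  assumes lt: "r < 7" "s < 7" "p < 7" "q < 7" "i < 7" "j < 7"
  shows "lie_br (skew_unit r s) (skew_unit p q) $$ (i, j) =
    (if i = r then skew_unit p q $$ (s, j) else 0) - (if i = 6 - s then skew_unit p q $$ (6 - r, j) else 0) -
    (if i = p then skew_unit r s $$ (q, j) else 0) + (if i = 6 - q then skew_unit r s $$ (6 - p, j) else 0)"
proof -
  have m: "(\<Sum>k\<in>{0..<7}. skew_unit r s $$ (i, k) * B k) = (if i = r then B s else 0) - (if i = 6 - s then B (6 - r) else 0)"
    if "r < 7" "s < 7" for r s and B :: "nat \<Rightarrow> complex"
  proof -
    have "(\<Sum>k\<in>{0..<7}. skew_unit r s $$ (i, k) * B k) =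
      (\<Sum>k\<in>{0..<7}. (if k = s then (if i = r then B s else 0) else 0) - (if k = 6 - r then (if i = 6 - s then B (6 - r) else 0) else 0))"
      using lt by (intro sum.cong) (auto simp: skew_unit_index)
    also have "\<dots> = (if i = r then B s else 0) - (if i = 6 - s then B (6 - r) else 0)"
      using that unfolding sum_subtractf by (subst (1 2) sum.delta) auto
    finally show ?thesis .
  qed
  show ?thesis using lt by (simp add: lie_br_index sum_subtractf m)
qed

lemma neg_vec_brackets:
  "lie_br (neg_vec 9) (neg_vec 5) = 0\<^sub>m 7 7"
  "lie_br (neg_vec 9) (neg_vec 6) = (-1) \<cdot>\<^sub>m neg_vec 4"
  "lie_br (neg_vec 9) (neg_vec 3) = (-1) \<cdot>\<^sub>m neg_vec 2"
  "lie_br (neg_vec 5) (neg_vec 6) = (-1) \<cdot>\<^sub>m neg_vec 3"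
  "lie_br (neg_vec 5) (neg_vec 8) = neg_vec 6"
  "lie_br (neg_vec 3) (neg_vec 5) = 0\<^sub>m 7 7"
  "lie_br (neg_vec 3) (neg_vec 6) = 0\<^sub>m 7 7"
  "lie_br (neg_vec 3) (neg_vec 8) = 0\<^sub>m 7 7"
  "lie_br (neg_vec 6) (neg_vec 8) = 0\<^sub>m 7 7"
  "lie_br (neg_vec 5) (neg_vec 4) = (-1) \<cdot>\<^sub>m neg_vec 2"
  "lie_br (neg_vec 6) (neg_vec 4) = (-1) \<cdot>\<^sub>m neg_vec 1"
  "lie_br (neg_vec 3) (neg_vec 4) = 0\<^sub>m 7 7"
  "lie_br (neg_vec 3) (neg_vec 2) = 0\<^sub>m 7 7"
  "lie_br (neg_vec 5) (neg_vec 2) = 0\<^sub>m 7 7"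
  "lie_br (neg_vec 6) (neg_vec 2) = 0\<^sub>m 7 7"
  "lie_br (neg_vec 3) (neg_vec 1) = 0\<^sub>m 7 7"
  "lie_br (neg_vec 5) (neg_vec 1) = 0\<^sub>m 7 7"
  "lie_br (neg_vec 6) (neg_vec 1) = 0\<^sub>m 7 7"
  unfolding neg_vec_def
  by (rule mat7_eqI; simp add: all7 lie_br_skew_unit_index skew_unit_index root_row_def root_col_def carrier_matD[OF skew_unit_carrier])+

section \<open>The negative simple root vectors of $G_2$\<close>

text \<open>The Cartan component of $[X, Y]$ is the sum over the positive roots $\alpha_k$ of the product of
  the coordinates of $X$ and $Y$ at $\pm\alpha_k$, times the vector $\alpha_k$.\<close>

lemma lie_br_upper_lower_diag:
  assumes X: "X \<in> upper_so7" and Y: "Y \<in> lower_so7"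
  shows "lie_br X Y $$ (0,0) = X $$ (0,5) * Y $$ (5,0) + X $$ (0,4) * Y $$ (4,0) + X $$ (0,3) * Y $$ (3,0)
           + X $$ (0,2) * Y $$ (2,0) + X $$ (0,1) * Y $$ (1,0)"
    "lie_br X Y $$ (1,1) = X $$ (0,5) * Y $$ (5,0) + X $$ (1,4) * Y $$ (4,1) + X $$ (1,3) * Y $$ (3,1)
           + X $$ (1,2) * Y $$ (2,1) - X $$ (0,1) * Y $$ (1,0)"
    "lie_br X Y $$ (2,2) = X $$ (0,4) * Y $$ (4,0) + X $$ (1,4) * Y $$ (4,1) + X $$ (2,3) * Y $$ (3,2)
           - X $$ (0,2) * Y $$ (2,0) - X $$ (1,2) * Y $$ (2,1)"
proof -
  have so: "X \<in> so7" "Y \<in> so7" using X Y by (auto simp: upper_so7_def lower_so7_def)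
  have x0: "X $$ (i, j) = 0" if "j \<le> i" "i < 7" "j < 7" for i j using X that by (simp add: upper_so7_def)
  have y0: "Y $$ (i, j) = 0" if "i \<le> j" "i < 7" "j < 7" for i j using Y that by (simp add: lower_so7_def)
  have eqs: "X $$ (1,6) = - X $$ (0,5)" "Y $$ (6,1) = - Y $$ (5,0)" "X $$ (2,6) = - X $$ (0,4)" "Y $$ (6,2) = - Y $$ (4,0)"
    "X $$ (2,5) = - X $$ (1,4)" "Y $$ (5,2) = - Y $$ (4,1)"
    using so7_entry[OF so(1), of 1 6] so7_entry[OF so(2), of 6 1] so7_entry[OF so(1), of 2 6] so7_entry[OF so(2), of 6 2]
      so7_entry[OF so(1), of 2 5] so7_entry[OF so(2), of 5 2] by simp_all
  have "X $$ (0,6) = - X $$ (0,6)" "X $$ (1,5) = - X $$ (1,5)" "X $$ (2,4) = - X $$ (2,4)"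
    using so7_entry[OF so(1), of 0 6] so7_entry[OF so(1), of 1 5] so7_entry[OF so(1), of 2 4] by simp_all
  hence z: "X $$ (0,6) = 0" "X $$ (1,5) = 0" "X $$ (2,4) = 0" by simp_all
  show "lie_br X Y $$ (0,0) = X $$ (0,5) * Y $$ (5,0) + X $$ (0,4) * Y $$ (4,0) + X $$ (0,3) * Y $$ (3,0)
           + X $$ (0,2) * Y $$ (2,0) + X $$ (0,1) * Y $$ (1,0)"
    "lie_br X Y $$ (1,1) = X $$ (0,5) * Y $$ (5,0) + X $$ (1,4) * Y $$ (4,1) + X $$ (1,3) * Y $$ (3,1)
           + X $$ (1,2) * Y $$ (2,1) - X $$ (0,1) * Y $$ (1,0)"
    "lie_br X Y $$ (2,2) = X $$ (0,4) * Y $$ (4,0) + X $$ (1,4) * Y $$ (4,1) + X $$ (2,3) * Y $$ (3,2)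
           - X $$ (0,2) * Y $$ (2,0) - X $$ (1,2) * Y $$ (2,1)"
    using so by (simp_all add: lie_br_index sum7 x0 y0 eqs z del: One_nat_def)
qed

text \<open>The positive root $\alpha_k$ restricted to the Cartan subalgebra $\varepsilon_1 =
  \varepsilon_2 + \varepsilon_3$ of $G_2$, in the coordinates $(s, t) =
  (\varepsilon_2, \varepsilon_3)$.\<close>

definition restr_root :: "nat \<Rightarrow> complex \<Rightarrow> complex \<Rightarrow> complex" where
  "restr_root k s t = [2 * s + t, s + 2 * t, s + t, s + t, t, s, s, s - t, t] ! (k - 1)"

lemma eigen_entry:
  assumes "H = diag7 (s + t) s t" "lie_br H X = c \<cdot>\<^sub>m X" "X \<in> carrier_mat 7 7" "k \<in> {1..9}"
  shows "X $$ (root_col k, root_row k) * (restr_root k s t - c) = 0"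
    and "X $$ (root_row k, root_col k) * (restr_root k s t + c) = 0"
proof -
  have e: "([s + t, s, t, 0, -t, -s, -(s + t)] ! i - [s + t, s, t, 0, -t, -s, -(s + t)] ! j) * X $$ (i, j) = c * X $$ (i, j)"
    if "i < 7" "j < 7" for i j
    using lie_br_diag7_index[OF assms(3) that, of "s + t" s t] assms(1,2,3) that by auto
  have rt: "[s + t, s, t, 0, -t, -s, -(s + t)] ! root_col k - [s + t, s, t, 0, -t, -s, -(s + t)] ! root_row k = restr_root k s t"
    using assms(4) unfolding in19 by (elim disjE; simp add: root_row_def root_col_def restr_root_def)
  have "restr_root k s t * X $$ (root_col k, root_row k) = c * X $$ (root_col k, root_row k)"
    using e[of "root_col k" "root_row k"] root_lt[OF assms(4)] rt by simp
  thus "X $$ (root_col k, root_row k) * (restr_root k s t - c) = 0" by (simp add: algebra_simps)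
  have "- restr_root k s t * X $$ (root_row k, root_col k) = c * X $$ (root_row k, root_col k)"
    using e[of "root_row k" "root_col k"] root_lt[OF assms(4)] unfolding rt[symmetric] by simp
  hence "c * X $$ (root_row k, root_col k) = - (restr_root k s t * X $$ (root_row k, root_col k))" by simp
  moreover have "X $$ (root_row k, root_col k) * (restr_root k s t + c) =
    restr_root k s t * X $$ (root_row k, root_col k) + c * X $$ (root_row k, root_col k)" by (simp add: algebra_simps)
  ultimately show "X $$ (root_row k, root_col k) * (restr_root k s t + c) = 0" by simp
qed

text \<open>The pairs $(p, q)$ and $(p', q')$ are the coefficients of restricted positive roots taken by the
  two simple roots of $G_2$, $(s_i, t_i)$ are the coordinates of the coroots $H_i$, and the last three
  hypotheses say that their inner products for the trace form are proportional to the symmetrized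
  Cartan matrix. Of the $36$ choices of pairs only the expected one is consistent; the
  determinant $D$ of the pairs clears denominators, so that each case is a numerical check.\<close>

lemma g2_simple_root_pair:
  fixes p q p' q' s1 t1 s2 t2 W :: complex
  assumes pq: "(p, q) \<in> {(2,1),(1,2),(1,1),(0,1),(1,0),(1,-1)}" and pq': "(p', q') \<in> {(2,1),(1,2),(1,1),(0,1),(1,0),(1,-1)}"
    and l: "p * s1 + q * t1 = 2" "p * s2 + q * t2 = -1" "p' * s1 + q' * t1 = -3" "p' * s2 + q' * t2 = 2"
    and Q: "(s1 + t1) * (s1 + t1) + s1 * s1 + t1 * t1 = 6 * W"
      "(s2 + t2) * (s2 + t2) + s2 * s2 + t2 * t2 = 2 * W"
      "(s1 + t1) * (s2 + t2) + s1 * s2 + t1 * t2 = -3 * W"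
  shows "s1 = -1 \<and> t1 = 2 \<and> s2 = 1 \<and> t2 = -1"
proof -
  \<comment> \<open>Cramer's rule for the coordinates of the coroots.\<close>
  define D where "D = p * q' - p' * q"
  have D: "D * s1 = 2 * q' + 3 * q" "D * t1 = - 3 * p - 2 * p'" "D * s2 = - q' - 2 * q" "D * t2 = 2 * p + p'"
  proof -
    have "D * s1 = q' * (p * s1 + q * t1) - q * (p' * s1 + q' * t1)" "D * t1 = p * (p' * s1 + q' * t1) - p' * (p * s1 + q * t1)"
      "D * s2 = q' * (p * s2 + q * t2) - q * (p' * s2 + q' * t2)" "D * t2 = p * (p' * s2 + q' * t2) - p' * (p * s2 + q * t2)"
      by (simp_all add: D_def algebra_simps)
    thus "D * s1 = 2 * q' + 3 * q" "D * t1 = - 3 * p - 2 * p'" "D * s2 = - q' - 2 * q" "D * t2 = 2 * p + p'"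
      unfolding l by simp_all
  qed
  define a1 b1 a2 b2 where "a1 = 2 * q' + 3 * q" and "b1 = - 3 * p - 2 * p'" and "a2 = - q' - 2 * q" and "b2 = 2 * p + p'"
  have "(a1 + b1) * (a1 + b1) + a1 * a1 + b1 * b1 = D * D * (6 * W)"
    "(a2 + b2) * (a2 + b2) + a2 * a2 + b2 * b2 = D * D * (2 * W)"
    unfolding a1_def b1_def a2_def b2_def D[symmetric] Q[symmetric] by (simp_all add: algebra_simps)
  hence e: "(a1 + b1) * (a1 + b1) + a1 * a1 + b1 * b1 = 3 * ((a2 + b2) * (a2 + b2) + a2 * a2 + b2 * b2)" by simp
  have z: "a1 = 0" "b1 = 0" if "D = 0" using D that unfolding a1_def b1_def by simp_all
  have z2: "b2 = 0" if "D = 0" using D that unfolding b2_def by simp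
  have x: "(a1 + b1) * (a2 + b2) + a1 * a2 + b1 * b2 = D * D * (- 3 * W)"
    unfolding a1_def b1_def a2_def b2_def D[symmetric] Q[symmetric] by (simp_all add: algebra_simps)
  hence f: "2 * ((a1 + b1) * (a2 + b2) + a1 * a2 + b1 * b2) = - 3 * ((a2 + b2) * (a2 + b2) + a2 * a2 + b2 * b2)"
    using \<open>(a2 + b2) * (a2 + b2) + a2 * a2 + b2 * b2 = D * D * (2 * W)\<close> by simp
  have "p = 0 \<and> q = 1 \<and> p' = 1 \<and> q' = -1"
  proof -
    have "(p = 2 \<and> q = 1) \<or> (p = 1 \<and> q = 2) \<or> (p = 1 \<and> q = 1) \<or> (p = 0 \<and> q = 1) \<or> (p = 1 \<and> q = 0) \<or> (p = 1 \<and> q = -1)"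
      "(p' = 2 \<and> q' = 1) \<or> (p' = 1 \<and> q' = 2) \<or> (p' = 1 \<and> q' = 1) \<or> (p' = 0 \<and> q' = 1) \<or> (p' = 1 \<and> q' = 0) \<or> (p' = 1 \<and> q' = -1)"
      using pq pq' by auto
    moreover have "p * q' - p' * q = 0 \<longrightarrow> 2 * q' + 3 * q = 0 \<and> - 3 * p - 2 * p' = 0 \<and> 2 * p + p' = 0"
      using z z2 unfolding a1_def b1_def b2_def D_def by blast
    ultimately show ?thesis
      using e f unfolding a1_def b1_def a2_def b2_def by (elim disjE conjE) simp_all
  qed
  with l show ?thesis by (auto simp: algebra_simps)
qed

text \<open>An eigenvector of the restricted Cartan subalgebra can only have coordinates at those roots
  $\alpha_k$ whose restriction is its weight. Once the coroots $H_1, H_2$ are known this leaves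
  $\alpha_5, \alpha_9$ for the short simple root and $\alpha_8$ for the long one; that no coefficient
  vanishes is read off from $[E_i, F_i] = H_i$.\<close>

lemma g2_in_so7_negative_simple:
  assumes g2: "g2_in_so7 E F H"
  obtains a b c where "a \<noteq> 0" "b \<noteq> 0" "c \<noteq> 0"
    "F 1 = b \<cdot>\<^sub>m neg_vec 5 + a \<cdot>\<^sub>m neg_vec 9" "F 2 = c \<cdot>\<^sub>m neg_vec 8"
proof -
  have ch: "lie_br (E i) (F i) = H i"
    "lie_br (H i) (E j) = of_int (g2_cartan i j) \<cdot>\<^sub>m E j"
    "lie_br (H i) (F j) = of_int (- g2_cartan i j) \<cdot>\<^sub>m F j" if "i \<in> {1, 2}" "j \<in> {1, 2}" for i j
    using g2 that unfolding g2_in_so7_def g2_chevalley_def by auto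
  have sub: "lie_gen {E 1, E 2} \<subseteq> upper_so7" "lie_gen {F 1, F 2} \<subseteq> lower_so7"
    using g2 n_plus_upper n_minus_lower unfolding g2_in_so7_def by (meson order_trans)+
  have up: "E i \<in> upper_so7" if "i \<in> {1, 2}" for i
    using sub(1) lie_gen.base[of "E i" "{E 1, E 2}"] that by auto
  have low: "F i \<in> lower_so7" if "i \<in> {1, 2}" for i
    using sub(2) lie_gen.base[of "F i" "{F 1, F 2}"] that by auto
  have Ec: "E i \<in> carrier_mat 7 7" and Fc: "F i \<in> carrier_mat 7 7" if "i \<in> {1, 2}" for i
    using up[OF that] low[OF that] by (auto simp: upper_so7_def lower_so7_def)
  have Hc: "H i \<in> carrier_mat 7 7" if "i \<in> {1, 2}" for i
    using ch(1)[OF that that] Ec[OF that] Fc[OF that] lie_br_carrier by metis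
  have span: "{x \<cdot>\<^sub>m H 1 + y \<cdot>\<^sub>m H 2 | x y. True} = {T \<in> cartan. wt (1, 0, 0) T = wt (0, 1, 1) T}"
    using g2 unfolding g2_in_so7_def by blast
  have "1 \<cdot>\<^sub>m H 1 + 0 \<cdot>\<^sub>m H 2 = H 1" "0 \<cdot>\<^sub>m H 1 + 1 \<cdot>\<^sub>m H 2 = H 2"
    using Hc[of 1] Hc[of 2] by (auto intro!: mat7_eqI)
  hence "H 1 \<in> {x \<cdot>\<^sub>m H 1 + y \<cdot>\<^sub>m H 2 | x y. True}" "H 2 \<in> {x \<cdot>\<^sub>m H 1 + y \<cdot>\<^sub>m H 2 | x y. True}"
    by (metis (mono_tags, lifting) mem_Collect_eq)+
  hence Hin: "H i \<in> cartan \<and> wt (1, 0, 0) (H i) = wt (0, 1, 1) (H i)" if "i \<in> {1, 2}" for i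
    using that span by auto
  define s t where "s i = H i $$ (1,1)" and "t i = H i $$ (2,2)" for i
  have H00: "H i $$ (0,0) = s i + t i" if "i \<in> {1, 2}" for i
    using Hin[OF that] by (simp add: s_def t_def)
  have Hd: "H i = diag7 (s i + t i) (s i) (t i)" if "i \<in> {1, 2}" for i
    using cartan_eq_diag7[of "H i"] Hin[OF that] H00[OF that] by (simp add: s_def t_def)
  have nz: "\<not> (s i = 0 \<and> t i = 0)" if i: "i \<in> {1, 2}" for i
  proof
    assume z: "s i = 0 \<and> t i = 0"
    have mem: "diag7 (x + y) x y \<in> {x \<cdot>\<^sub>m H 1 + y \<cdot>\<^sub>m H 2 | x y. True}" for x y
      unfolding span by (intro CollectI conjI diag7_cartan) (simp add: diag7_def)
    have comb: "\<exists>c d. x = c * s 1 + d * s 2 \<and> y = c * t 1 + d * t 2" for x y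
    proof -
      obtain c d where cd: "diag7 (x + y) x y = c \<cdot>\<^sub>m H 1 + d \<cdot>\<^sub>m H 2" using mem[of x y] by blast
      have "diag7 (x + y) x y $$ (1,1) = c * s 1 + d * s 2" "diag7 (x + y) x y $$ (2,2) = c * t 1 + d * t 2"
        unfolding cd s_def t_def using Hc[of 1] Hc[of 2] by auto
      thus ?thesis by (auto simp: diag7_def)
    qed
    obtain c1 d1 where 1: "1 = c1 * s 1 + d1 * s 2" "0 = c1 * t 1 + d1 * t 2" using comb[of 1 0] by auto
    obtain c2 d2 where 2: "0 = c2 * s 1 + d2 * s 2" "1 = c2 * t 1 + d2 * t 2" using comb[of 0 1] by auto
    show False using 1 2 z i by auto
  qed
  define x y where "x i k = E i $$ (root_col k, root_row k)" and "y i k = F i $$ (root_row k, root_col k)" for i k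
  define u where "u i k = x i k * y i k" for i k
  have xeq: "x j k * (restr_root k (s i) (t i) - of_int (g2_cartan i j)) = 0"
    and yeq: "y j k * (restr_root k (s i) (t i) - of_int (g2_cartan i j)) = 0"
    if "i \<in> {1, 2}" "j \<in> {1, 2}" "k \<in> {1..9}" for i j k
    using eigen_entry(1)[OF Hd[OF that(1)] ch(2)[OF that(1,2)] Ec[OF that(2)] that(3)]
      eigen_entry(2)[OF Hd[OF that(1)] ch(3)[OF that(1,2)] Fc[OF that(2)] that(3)]
    by (simp_all add: x_def y_def)
  have ueq: "u j k * restr_root k (s i) (t i) = u j k * of_int (g2_cartan i j)" if "i \<in> {1, 2}" "j \<in> {1, 2}" "k \<in> {1..9}" for i j k
    using xeq[OF that] by (auto simp: u_def)
  have diag: "s i + t i = u i 1 + u i 2 + u i 4 + u i 7 + u i 9"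
    "s i = u i 1 + u i 3 + u i 6 + u i 8 - u i 9"
    "t i = u i 2 + u i 3 + u i 5 - u i 7 - u i 8" if "i \<in> {1, 2}" for i
    using lie_br_upper_lower_diag[OF up[OF that] low[OF that]] unfolding ch(1)[OF that that] H00[OF that]
    by (simp_all add: s_def t_def u_def x_def y_def root_row_def root_col_def)
  define U where "U i = u i 1 + u i 2 + u i 3 + u i 4 + u i 5 + u i 6 + u i 7 + u i 8 + u i 9" for i
  \<comment> \<open>The trace form of $H_i = [E_i, F_i]$ and $H_j$: a root $\alpha_k$ with nonzero \<open>u i k\<close> has the value of the simple root $\beta_i$ on $H_j$.\<close>
  have form: "(s i + t i) * (s j + t j) + s i * s j + t i * t j = of_int (g2_cartan j i) * U i"
    if ij: "i \<in> {1, 2}" "j \<in> {1, 2}" for i j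
  proof -
    have "(s i + t i) * (s j + t j) + s i * s j + t i * t j =
      (u i 1 + u i 2 + u i 4 + u i 7 + u i 9) * (s j + t j) + (u i 1 + u i 3 + u i 6 + u i 8 - u i 9) * s j
      + (u i 2 + u i 3 + u i 5 - u i 7 - u i 8) * t j"
      unfolding diag(1)[OF ij(1), symmetric] diag(2)[OF ij(1), symmetric] diag(3)[OF ij(1), symmetric] ..
    also have "\<dots> =
      u i 1 * (2 * s j + t j) + u i 2 * (s j + 2 * t j) + u i 3 * (s j + t j) + u i 4 * (s j + t j) + u i 5 * t j +
      u i 6 * s j + u i 7 * s j + u i 8 * (s j - t j) + u i 9 * t j"
      by (simp add: algebra_simps)
    also have "\<dots> = (\<Sum>k\<leftarrow>[1, 2, 3, 4, 5, 6, 7, 8, 9]. u i k * restr_root k (s j) (t j))"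
      by (simp add: restr_root_def)
    also have "\<dots> = (\<Sum>k\<leftarrow>[1, 2, 3, 4, 5, 6, 7, 8, 9]. u i k * of_int (g2_cartan j i))"
      by (intro arg_cong[of _ _ sum_list] map_cong HOL.refl ueq ij) auto
    also have "\<dots> = of_int (g2_cartan j i) * U i"
      by (simp add: U_def algebra_simps)
    finally show ?thesis .
  qed
  have c: "g2_cartan 1 1 = 2" "g2_cartan 2 2 = 2" "g2_cartan 1 2 = -3" "g2_cartan 2 1 = -1" by (auto simp: g2_cartan_def)
  have ex: "\<exists>p q. (p, q) \<in> {(2,1),(1,2),(1,1),(0,1),(1,0),(1,-1)} \<and>
     (\<forall>j\<in>{1,2}. p * s j + q * t j = of_int (g2_cartan j i))" if i: "i \<in> {1, 2}" for i
  proof -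
    have "\<exists>k\<in>{1..9}. u i k \<noteq> 0"
    proof (rule ccontr)
      assume "\<not> ?thesis"
      hence "\<forall>k\<in>{1..9}. u i k = 0" by blast
      thus False using diag[OF i] nz[OF i] by simp
    qed
    then obtain k where k: "k \<in> {1..9}" "u i k \<noteq> 0" by blast
    have r: "restr_root k (s j) (t j) = of_int (g2_cartan j i)" if "j \<in> {1, 2}" for j
      using ueq[OF that i k(1)] k(2) by simp
    have "\<exists>p q. (p, q) \<in> {(2,1),(1,2),(1,1),(0,1),(1,0),(1,-1)} \<and> (\<forall>s t. restr_root k s t = p * s + q * t)"
    proof -
      have "(\<forall>s t. restr_root k s t = 2 * s + 1 * t) \<or> (\<forall>s t. restr_root k s t = 1 * s + 2 * t) \<or> (\<forall>s t. restr_root k s t = 1 * s + 1 * t)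
        \<or> (\<forall>s t. restr_root k s t = 0 * s + 1 * t) \<or> (\<forall>s t. restr_root k s t = 1 * s + 0 * t) \<or> (\<forall>s t. restr_root k s t = 1 * s + (-1) * t)"
        using k(1) unfolding in19 by (elim disjE; simp add: restr_root_def)
      thus ?thesis by blast
    qed
    thus ?thesis using r by metis
  qed
  obtain p q where pq: "(p, q) \<in> {(2,1),(1,2),(1,1),(0,1),(1,0),(1,-1)}" "\<forall>j\<in>{1,2}. p * s j + q * t j = of_int (g2_cartan j 1)"
    using ex[of 1] by blast
  obtain p' q' where pq': "(p', q') \<in> {(2,1),(1,2),(1,1),(0,1),(1,0),(1,-1)}" "\<forall>j\<in>{1,2}. p' * s j + q' * t j = of_int (g2_cartan j 2)"
    using ex[of 2] by blast
  have UW: "U 1 = 3 * U 2"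
    using form[of 1 2] form[of 2 1] c by (simp add: mult.commute)
  have st: "s 1 = -1 \<and> t 1 = 2 \<and> s 2 = 1 \<and> t 2 = -1"
    using pq pq' form[of 1 1] form[of 2 2] form[of 1 2] UW c
    by (intro g2_simple_root_pair[of p q p' q' _ _ _ _ "U 2"]) auto
  have y1: "y 1 k = 0" if "k \<in> {1,2,3,4,6,7,8}" for k
    using yeq[of 1 1 k] that st by (auto simp: c c[unfolded One_nat_def] restr_root_def)
  have y2: "y 2 k = 0" if "k \<in> {1,2,3,4,5,6,7,9}" for k
    using yeq[of 1 2 k] that st by (auto simp: c c[unfolded One_nat_def] restr_root_def)
  have F1: "F 1 = y 1 5 \<cdot>\<^sub>m neg_vec 5 + y 1 9 \<cdot>\<^sub>m neg_vec 9"
    apply (rule HOL.trans[OF lower_so7_decomp[OF low]], simp)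
    using y1[of 1] y1[of 2] y1[of 3] y1[of 4] y1[of 6] y1[of 7] y1[of 8]
    by (simp add: y_def root_row_def root_col_def zero_smult7 One_nat_def[symmetric] del: One_nat_def)
  have F2: "F 2 = y 2 8 \<cdot>\<^sub>m neg_vec 8"
    apply (rule HOL.trans[OF lower_so7_decomp[OF low]], simp)
    using y2[of 1] y2[of 2] y2[of 3] y2[of 4] y2[of 5] y2[of 6] y2[of 7] y2[of 9]
    by (simp add: y_def root_row_def root_col_def zero_smult7 One_nat_def[symmetric] del: One_nat_def)
  have "y 1 9 \<noteq> 0" using diag(1)[of 1] st y1[of 1] y1[of 2] y1[of 4] y1[of 7] by (auto simp: u_def)
  moreover have "y 1 5 \<noteq> 0" using diag(3)[of 1] st y1[of 2] y1[of 3] y1[of 7] y1[of 8] by (auto simp: u_def)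
  moreover have "y 2 8 \<noteq> 0" using diag(3)[of 2] st y2[of 2] y2[of 3] y2[of 5] y2[of 7] by (auto simp: u_def)
  ultimately show ?thesis using F1 F2 that by blast
qed

section \<open>Words in root vectors and least signatures\<close>

lemma neg_vec_brackets2:
  "lie_br (neg_vec 9) (neg_vec 8) = (-1) \<cdot>\<^sub>m neg_vec 7"
  "lie_br (neg_vec 5) (neg_vec 7) = neg_vec 4"
  "lie_br (neg_vec 9) (neg_vec 7) = 0\<^sub>m 7 7"
  "lie_br (neg_vec 9) (neg_vec 4) = 0\<^sub>m 7 7"
  "lie_br (neg_vec 8) (neg_vec 2) = (-1) \<cdot>\<^sub>m neg_vec 1"
  unfolding neg_vec_def
  by (rule mat7_eqI; simp add: all7 lie_br_skew_unit_index skew_unit_index root_row_def root_col_def carrier_matD[OF skew_unit_carrier])+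

text \<open>The monomial $f_1^{p_1}\cdots f_9^{p_9}$ as a word of indices.\<close>

definition index_word :: "(nat \<Rightarrow> nat) \<Rightarrow> nat list" where
  "index_word p = concat (map (\<lambda>i. replicate (p i) i) [1..<10])"

lemma upt_1_10: "[1..<10] = [1, 2, 3, 4, 5, 6, 7, 8, 9::nat]"
  by (simp add: upt_rec)

lemma set_index_word: "set (index_word p) \<subseteq> {1..9}"
  by (auto simp: index_word_def)

lemma length_index_word: "length (index_word p) = (\<Sum>i\<in>{1..9}. p i)"
proof -
  have "length (index_word p) = sum_list (map p [1..<10])"
    by (simp add: index_word_def length_concat comp_def)
  also have "\<dots> = sum p (set [1..<10])" by (rule sum_list_distinct_conv_sum_set) simp
  also have "set [1..<10] = {1..9::nat}" by auto
  finally show ?thesis .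
qed

lemma count_index_word: "count (mset (index_word p)) i = (if i \<in> {1..9} then p i else 0)"
proof -
  have "count (mset (concat (map (\<lambda>i. replicate (p i) i) xs))) i = (if i \<in> set xs then p i else 0)" if "distinct xs" for xs :: "nat list"
    using that by (induction xs) auto
  from this[of "[1..<10]"] show ?thesis by (auto simp: index_word_def)
qed

lemma mset_index_word_count:
  assumes "set ws \<subseteq> {1..9}"
  shows "mset (index_word (count (mset ws))) = mset ws"
  by (rule multiset_eqI) (use assms in \<open>auto simp: count_index_word count_eq_zero_iff subset_iff\<close>)

text \<open>Adjacent transpositions generate the symmetric group: a function of words that is unchanged when
  neighbours are exchanged depends only on the multiset of letters.\<close>

lemma swap_invariant_imp_mset_invariant:
  assumes swap: "\<And>u x y w. mset (u @ x # y # w) = M \<Longrightarrow> g (u @ x # y # w) = g (u @ y # x # w)"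
  shows "mset xs = M \<Longrightarrow> mset ys = M \<Longrightarrow> g xs = g ys"
proof -
  have move: "mset (pre @ ys @ x # zs) = M \<Longrightarrow> g (pre @ ys @ x # zs) = g (pre @ x # ys @ zs)" for pre ys x zs
  proof (induction ys arbitrary: pre)
    case (Cons y ys)
    have "g (pre @ (y # ys) @ x # zs) = g (pre @ y # x # ys @ zs)"
      using Cons.IH[of "pre @ [y]"] Cons.prems by simp
    also have "\<dots> = g (pre @ x # y # ys @ zs)" using Cons.prems by (intro swap) simp
    finally show ?case by simp
  qed simp
  have "mset (pre @ xs) = M \<Longrightarrow> mset (pre @ ys) = M \<Longrightarrow> g (pre @ xs) = g (pre @ ys)" for pre
  proof (induction xs arbitrary: pre ys)
    case Nil
    hence "mset (pre @ ys) = mset (pre @ [])" by simp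
    hence "ys = []" by simp
    thus ?case by simp
  next
    case (Cons x xs)
    hence e: "mset (pre @ ys) = mset (pre @ x # xs)" by simp
    hence "mset ys = mset (x # xs)" by simp
    hence "x \<in> set ys" by (metis list.set_intros(1) mset_eq_setD)
    then obtain y1 y2 where ys: "ys = y1 @ x # y2" by (meson split_list)
    have "g (pre @ ys) = g (pre @ x # y1 @ y2)" using move[of pre y1 x y2] Cons.prems ys by simp
    also have "\<dots> = g (pre @ x # xs)" using Cons.IH[of "pre @ [x]" "y1 @ y2"] Cons.prems ys by simp
    finally show ?case by simp
  qed
  from this[of "[]"] show "mset xs = M \<Longrightarrow> mset ys = M \<Longrightarrow> g xs = g ys" by simp
qed

lemma replicate_so7 [simp]: "X \<in> so7 \<Longrightarrow> replicate n X \<in> lists so7"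
  by (induction n) auto

text \<open>Linear functionals on the tensor algebra of $\mathfrak{so}_7$ that factor through the universal
  enveloping algebra, as $\omega(X_1\cdots X_r v)$ does. Working with words avoids constructing the
  enveloping algebra.\<close>

locale so7_word_functional =
  fixes \<Phi> :: "complex mat list \<Rightarrow> complex"
  assumes \<Phi>_add: "\<lbrakk>u \<in> lists so7; X \<in> so7; Y \<in> so7; w \<in> lists so7\<rbrakk> \<Longrightarrow> \<Phi> (u @ (X + Y) # w) = \<Phi> (u @ X # w) + \<Phi> (u @ Y # w)"
    and \<Phi>_smult: "\<lbrakk>u \<in> lists so7; X \<in> so7; w \<in> lists so7\<rbrakk> \<Longrightarrow> \<Phi> (u @ (c \<cdot>\<^sub>m X) # w) = c * \<Phi> (u @ X # w)"
    and \<Phi>_bracket: "\<lbrakk>u \<in> lists so7; X \<in> so7; Y \<in> so7; w \<in> lists so7\<rbrakk> \<Longrightarrow>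
      \<Phi> (u @ X # Y # w) = \<Phi> (u @ Y # X # w) + \<Phi> (u @ lie_br X Y # w)"
begin

lemma \<Phi>_zero: "\<lbrakk>u \<in> lists so7; w \<in> lists so7\<rbrakk> \<Longrightarrow> \<Phi> (u @ 0\<^sub>m 7 7 # w) = 0"
  using \<Phi>_smult[of u "0\<^sub>m 7 7" w 0] by (simp add: zero_smult7)

lemma \<Phi>_swap: "\<lbrakk>u \<in> lists so7; X \<in> so7; Y \<in> so7; w \<in> lists so7; lie_br X Y = 0\<^sub>m 7 7\<rbrakk> \<Longrightarrow>
    \<Phi> (u @ X # Y # w) = \<Phi> (u @ Y # X # w)"
  using \<Phi>_bracket[of u X Y w] \<Phi>_zero[of u w] by simp

lemma \<Phi>_neg: "\<lbrakk>u \<in> lists so7; X \<in> so7; w \<in> lists so7\<rbrakk> \<Longrightarrow> \<Phi> (u @ (-1 \<cdot>\<^sub>m X) # w) = - \<Phi> (u @ X # w)"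
  by (simp add: \<Phi>_smult)

lemma \<Phi>_lower:
  assumes "u \<in> lists so7" "w \<in> lists so7" "X \<in> lower_so7" "\<And>k. k \<in> {1..9} \<Longrightarrow> \<Phi> (u @ neg_vec k # w) = 0"
  shows "\<Phi> (u @ X # w) = 0"
proof -
  have s: "\<Phi> (u @ (c \<cdot>\<^sub>m neg_vec k) # w) = 0" if "k \<in> {1..9}" for c k
    using \<Phi>_smult[OF assms(1) neg_vec_so7[OF that] assms(2)] assms(4)[OF that] by simp
  have a: "\<Phi> (u @ (Y + Z) # w) = 0 \<and> Y + Z \<in> so7"
    if "\<Phi> (u @ Y # w) = 0 \<and> Y \<in> so7" "\<Phi> (u @ Z # w) = 0 \<and> Z \<in> so7" for Y Z
    using \<Phi>_add[OF assms(1) _ _ assms(2), of Y Z] that by simp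
  have b: "\<Phi> (u @ (c \<cdot>\<^sub>m neg_vec k) # w) = 0 \<and> c \<cdot>\<^sub>m neg_vec k \<in> so7" if "k \<in> {1..9}" for c k
    using s[OF that] neg_vec_so7[OF that] by simp
  have "\<Phi> (u @ X # w) = 0 \<and> X \<in> so7"
    by (subst (1 2) lower_so7_decomp[OF assms(3)]) (intro a b; simp)
  thus ?thesis ..
qed

lemma \<Phi>_move:
  assumes c: "lie_br X Y = 0\<^sub>m 7 7" and XY: "X \<in> so7" "Y \<in> so7" and w: "w \<in> lists so7"
  shows "u \<in> lists so7 \<Longrightarrow> \<Phi> (u @ X # replicate n Y @ w) = \<Phi> (u @ replicate n Y @ X # w)"
proof (induction n arbitrary: u)
  case (Suc n)
  have "\<Phi> (u @ X # replicate (Suc n) Y @ w) = \<Phi> ((u @ [Y]) @ X # replicate n Y @ w)"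
    using \<Phi>_swap[OF Suc.prems XY, of "replicate n Y @ w"] c w XY by simp
  also have "\<dots> = \<Phi> ((u @ [Y]) @ replicate n Y @ X # w)" using Suc.prems XY by (intro Suc.IH) simp
  finally show ?case by simp
qed simp

end

locale signature_functional = so7_word_functional +
  fixes p :: "nat \<Rightarrow> nat"
  assumes p_expos: "p \<in> expos" and \<Phi>_p: "\<Phi> (map neg_vec (index_word p)) \<noteq> 0"
    and p_least: "\<And>q. q \<in> expos \<Longrightarrow> \<Phi> (map neg_vec (index_word q)) \<noteq> 0 \<Longrightarrow> q = p \<or> expo_greater q p"
begin

lemma word_so7: "set ws \<subseteq> {1..9} \<Longrightarrow> map neg_vec ws \<in> lists so7"
proof (induction ws)
  case (Cons x ws)
  hence "x \<in> {1..9}" by simp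
  hence "neg_vec x \<in> so7" by (rule neg_vec_so7)
  thus ?case using Cons by simp
qed simp

text \<open>The part of the Poincare--Birkhoff--Witt theorem that the monomial order calls for. Exchanging two
  neighbours changes the value by that of a shorter word with the bracket as a letter. As long as
  all shorter words vanish, letters may be permuted, and sorted words of degree below that of $p$
  vanish because $p$ is least.\<close>

lemma short_word_vanish_and_perm:
  "n \<le> (\<Sum>i\<in>{1..9}. p i) \<Longrightarrow>
    (\<forall>ws. set ws \<subseteq> {1..9} \<and> length ws = n \<longrightarrow> \<Phi> (map neg_vec ws) = \<Phi> (map neg_vec (index_word (count (mset ws))))) \<and>
    (n < (\<Sum>i\<in>{1..9}. p i) \<longrightarrow> (\<forall>ws. set ws \<subseteq> {1..9} \<and> length ws = n \<longrightarrow> \<Phi> (map neg_vec ws) = 0))"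
proof (induction n rule: less_induct)
  case (less n)
  have IH: "\<Phi> (map neg_vec ws) = 0" if "set ws \<subseteq> {1..9}" "length ws < n" for ws
    using less.IH[OF that(2)] less.prems that by auto
  have perm: "\<Phi> (map neg_vec ws) = \<Phi> (map neg_vec (index_word (count (mset ws))))"
    if ws: "set ws \<subseteq> {1..9}" "length ws = n" for ws
  proof (rule swap_invariant_imp_mset_invariant[where M = "mset ws" and g = "\<lambda>ws. \<Phi> (map neg_vec ws)"])
    fix u x y w assume M: "mset (u @ x # y # w) = mset ws"
    have s: "set (u @ x # y # w) \<subseteq> {1..9}" using ws(1) M by (metis mset_eq_setD)
    have l: "length (u @ x # y # w) = n" using ws(2) M by (metis mset_eq_length)
    have so: "map neg_vec u \<in> lists so7" "map neg_vec w \<in> lists so7" using s word_so7[of u] word_so7[of w] by (simp_all del: atLeastAtMost_iff)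
    have xy: "x \<in> {1..9}" "y \<in> {1..9}" using s by auto
    have "\<Phi> (map neg_vec u @ lie_br (neg_vec x) (neg_vec y) # map neg_vec w) = 0"
    proof (rule \<Phi>_lower[OF so])
      show "lie_br (neg_vec x) (neg_vec y) \<in> lower_so7" using xy by (intro lower_so7_closed(4) neg_vec_lower)
      fix k :: nat assume "k \<in> {1..9}"
      thus "\<Phi> (map neg_vec u @ neg_vec k # map neg_vec w) = 0"
        using IH[of "u @ k # w"] s l by simp
    qed
    thus "\<Phi> (map neg_vec (u @ x # y # w)) = \<Phi> (map neg_vec (u @ y # x # w))"
      using \<Phi>_bracket[OF so(1) neg_vec_so7[OF xy(1)] neg_vec_so7[OF xy(2)] so(2)] by simp
  qed (use mset_index_word_count[OF ws(1)] in auto)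
  moreover have "\<Phi> (map neg_vec ws) = 0" if n: "n < (\<Sum>i\<in>{1..9}. p i)" and ws: "set ws \<subseteq> {1..9}" "length ws = n" for ws
  proof (rule ccontr)
    let ?q = "count (mset ws)"
    assume "\<Phi> (map neg_vec ws) \<noteq> 0"
    hence nz: "\<Phi> (map neg_vec (index_word ?q)) \<noteq> 0" using perm[OF ws] by simp
    have ex: "?q \<in> expos" using ws(1) by (auto simp: expos_def count_eq_zero_iff)
    have "(\<Sum>i\<in>{1..9}. ?q i) = length (index_word ?q)" by (simp only: length_index_word)
    also have "\<dots> = n" using mset_index_word_count[OF ws(1)] ws(2) by (metis mset_eq_length)
    finally have "(\<Sum>i\<in>{1..9}. ?q i) < (\<Sum>i\<in>{1..9}. p i)" using n by simp
    moreover from p_least[OF ex nz] have "?q = p \<or> expo_greater ?q p" .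
    ultimately show False by (auto simp: expo_greater_def)
  qed
  ultimately show ?case by blast
qed

lemma short_word_vanish:
  "set ws \<subseteq> {1..9} \<Longrightarrow> length ws < (\<Sum>i\<in>{1..9}. p i) \<Longrightarrow> \<Phi> (map neg_vec ws) = 0"
  using short_word_vanish_and_perm[of "length ws"] by auto

lemma word_perm:
  assumes "mset ws = mset (index_word q)" "length ws \<le> (\<Sum>i\<in>{1..9}. p i)"
  shows "\<Phi> (map neg_vec ws) = \<Phi> (map neg_vec (index_word q))"
proof -
  have "set ws = set (index_word q)" "length ws = length (index_word q)"
    using assms(1) by (auto dest: mset_eq_setD mset_eq_length)
  thus ?thesis using short_word_vanish_and_perm[of "length ws"] assms set_index_word[of q] by metis
qed

lemma exponent_front:
  assumes i: "i \<in> {1..9}" "p i > 0" and q: "q = p(i := p i - 1)"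
  shows "\<Phi> (neg_vec i # map neg_vec (index_word q)) \<noteq> 0"
proof -
  have "mset (i # index_word q) = mset (index_word p)"
    by (rule multiset_eqI) (use i in \<open>auto simp: count_index_word q\<close>)
  moreover from this have "length (i # index_word q) = (\<Sum>i\<in>{1..9}. p i)"
    by (metis length_index_word mset_eq_length)
  ultimately have "\<Phi> (map neg_vec (i # index_word q)) = \<Phi> (map neg_vec (index_word p))" by (intro word_perm) auto
  thus ?thesis using \<Phi>_p by simp
qed

text \<open>If a leading $f_i$ is killed, then $p_i > 0$ is impossible: move one factor $f_i$ of the monomial
  of $p$ to the front, which is allowed in the degree of $p$.\<close>

lemma killed_exponent:
  assumes i: "i \<in> {1..9}" and kill: "\<And>w. w \<in> lists so7 \<Longrightarrow> \<Phi> (neg_vec i # w) = 0"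
  shows "p i = 0"
proof (rule ccontr)
  assume "p i \<noteq> 0"
  with exponent_front[OF i _ HOL.refl] kill[OF word_so7[OF set_index_word]] show False by blast
qed

text \<open>A leading $f_i$ that may be replaced by $f_j$ gives a monomial of the same degree with nonzero
  value. For $j < i$ its exponent is lexicographically larger, hence smaller in the monomial order,
  against the choice of $p$.\<close>

lemma replaced_exponent:
  assumes i: "i \<in> {1..9}" and j: "j \<in> {1..9}" "j < i"
    and rep: "\<And>w. w \<in> lists so7 \<Longrightarrow> \<Phi> (neg_vec j # w) = 0 \<Longrightarrow> \<Phi> (neg_vec i # w) = 0"
  shows "p i = 0"
proof (rule ccontr)
  assume pos: "p i \<noteq> 0"
  define q where "q = p(i := p i - 1)"
  define r where "r = q(j := p j + 1)"
  have "\<Phi> (neg_vec i # map neg_vec (index_word q)) \<noteq> 0" using exponent_front[OF i _ q_def] pos by simp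
  hence nz: "\<Phi> (map neg_vec (j # index_word q)) \<noteq> 0" using rep[OF word_so7[OF set_index_word]] by auto
  have m: "mset (j # index_word q) = mset (index_word r)"
    by (rule multiset_eqI) (use i j in \<open>auto simp: count_index_word q_def r_def\<close>)
  have m2: "mset (i # index_word q) = mset (index_word p)"
    by (rule multiset_eqI) (use i pos in \<open>auto simp: count_index_word q_def\<close>)
  have "length (j # index_word q) = length (i # index_word q)" by simp
  also have "\<dots> = (\<Sum>i\<in>{1..9}. p i)" using m2 by (metis length_index_word mset_eq_length)
  finally have l: "length (j # index_word q) = (\<Sum>i\<in>{1..9}. p i)" .
  have "\<Phi> (map neg_vec (index_word r)) \<noteq> 0" using word_perm[OF m] l nz by simp
  moreover have "r \<in> expos" using p_expos i j by (auto simp: expos_def r_def q_def)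
  ultimately have "r = p \<or> expo_greater r p" using p_least by blast
  moreover have "r j \<noteq> p j" by (simp add: r_def)
  ultimately have "expo_greater r p" by auto
  moreover have "(\<Sum>i\<in>{1..9}. r i) = (\<Sum>i\<in>{1..9}. p i)" using m l by (metis length_index_word mset_eq_length)
  ultimately have "lex_less r p" by (simp add: expo_greater_def)
  then obtain k where k: "k \<in> {1..9}" "r k < p k" "\<forall>l\<in>{1..<k}. r l = p l" by (auto simp: lex_less_def)
  show False
  proof (cases "k \<le> j")
    case True
    with k(2) j show False by (auto simp: r_def q_def split: if_splits)
  next
    case False
    with k(3) j have "r j = p j" by auto
    thus False by (simp add: r_def)
  qed
qed

end

text \<open>On a polynomial with a root of order $m$ at $-s$ the operator $k - (t+s)\frac{d}{dt}$ multiplies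
  the leading Taylor coefficient at $-s$ by $k - m$. So for $m < k$ it preserves the order of the
  root.\<close>

lemma linear_power_dvd_of_euler:
  fixes P :: "complex poly"
  assumes dvd: "[:s, 1:] ^ r dvd Polynomial.smult (of_nat k) P - [:s, 1:] * pderiv P" and rk: "r \<le> k"
  shows "[:s, 1:] ^ r dvd P"
proof (cases "P = 0")
  case False
  define L where "L = [:s, 1:]"
  define e where "e = order (-s) P"
  obtain R where R: "P = L ^ e * R" "\<not> L dvd R"
    using order_decomp[OF False, of "-s"] by (auto simp: L_def e_def)
  have L0: "L \<noteq> 0" by (simp add: L_def)
  show ?thesis
  proof (cases "r \<le> e")
    case True
    thus ?thesis unfolding R(1) L_def by (intro dvd_mult2 le_imp_power_dvd)
  next
    case False
    have dL: "pderiv L = 1" by (simp add: L_def pderiv_pCons)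
    have "L * pderiv P = L ^ e * (Polynomial.smult (of_nat e) R + L * pderiv R)"
    proof (cases e)
      case 0
      thus ?thesis unfolding R(1) by simp
    next
      case (Suc m)
      have "pderiv P = L ^ Suc m * pderiv R + R * Polynomial.smult (of_nat (Suc m)) (L ^ m)"
        unfolding R(1) Suc pderiv_mult pderiv_power_Suc dL by simp
      thus ?thesis unfolding Suc by (simp add: algebra_simps)
    qed
    hence "Polynomial.smult (of_nat k) P - L * pderiv P = L ^ e * (Polynomial.smult (of_nat k - of_nat e) R - L * pderiv R)"
      unfolding R(1) by (simp add: algebra_simps smult_diff_left)
    moreover have "L ^ Suc e dvd Polynomial.smult (of_nat k) P - L * pderiv P"
      using dvd False unfolding L_def[symmetric] by (meson Suc_leI dvd_trans le_imp_power_dvd not_le)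
    ultimately have "L ^ e * L dvd L ^ e * (Polynomial.smult (of_nat k - of_nat e) R - L * pderiv R)" by (simp add: mult.commute)
    hence "L dvd Polynomial.smult (of_nat k - of_nat e) R - L * pderiv R" using L0 by simp
    hence "L dvd Polynomial.smult (of_nat k - of_nat e) R" by (metis dvd_diff_commute dvd_triv_left dvd_diffD1 diff_add_cancel dvd_add)
    moreover have "(of_nat k - of_nat e :: complex) \<noteq> 0" using False rk by simp
    ultimately show ?thesis using R(2) by (simp add: dvd_smult_iff)
  qed
qed simp

text \<open>Read backwards from the zero polynomial: each of the operators has a factor $W - m \ge W - l$, so
  divisibility by $(t+s)^{W-l}$ is passed down to the first polynomial.\<close>

lemma linear_power_dvd_chain:
  fixes Q :: "nat \<Rightarrow> complex poly"
  assumes last: "Q (Suc l) = 0" and \<kappa>: "\<kappa> \<noteq> 0" and lW: "l < W"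
    and step: "\<And>m. m \<le> l \<Longrightarrow> Q (Suc m) = Polynomial.smult \<kappa> (Polynomial.smult (of_nat (W - m)) (Q m) - [:s, 1:] * pderiv (Q m))"
  shows "[:s, 1:] ^ (W - l) dvd Q 0"
proof -
  have "m \<le> Suc l \<Longrightarrow> [:s, 1:] ^ (W - l) dvd Q (Suc l - m)" for m
  proof (induction m)
    case 0
    thus ?case using last by simp
  next
    case (Suc m)
    define k where "k = l - m"
    have k: "Suc l - m = Suc k" "Suc l - Suc m = k" "k \<le> l" using Suc.prems by (auto simp: k_def)
    have "[:s, 1:] ^ (W - l) dvd Q (Suc k)" using Suc k by simp
    hence "[:s, 1:] ^ (W - l) dvd Polynomial.smult (of_nat (W - k)) (Q k) - [:s, 1:] * pderiv (Q k)"
      using step[OF k(3)] \<kappa> by (simp add: dvd_smult_iff)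
    moreover have "W - l \<le> W - k" using k(3) by simp
    ultimately show ?case unfolding k(2) by (rule linear_power_dvd_of_euler)
  qed
  from this[of "Suc l"] show ?thesis by simp
qed

section \<open>Exponent bounds from a generating polynomial\<close>

lemma lie_br_5_3: "lie_br (neg_vec 5) (neg_vec 3) = 0\<^sub>m 7 7"
  and lie_br_8_6: "lie_br (neg_vec 8) (neg_vec 6) = 0\<^sub>m 7 7"
  and lie_br_8_3: "lie_br (neg_vec 8) (neg_vec 3) = 0\<^sub>m 7 7"
  unfolding neg_vec_def
  by (rule mat7_eqI; simp add: all7 lie_br_skew_unit_index skew_unit_index root_row_def root_col_def carrier_matD[OF skew_unit_carrier])+

text \<open>What remains of an invariant functional with signature exponent $p$ on
  $V(l_1\pi_1 + l_2\pi_2 + l_3\pi_3)$: invariance under the two generators of $\mathfrak n'$ at the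
  front of a word, and at its end the vanishing of $f_9^{l_1+1} v$, $f_8^{l_2+1} v$ and
  $f_5^{l_3+1} v$.\<close>

locale g2_signature_functional = signature_functional +
  fixes a b :: complex and l1 l2 l3 :: nat
  assumes ab: "a \<noteq> 0" "b \<noteq> 0"
    and kill5: "w \<in> lists so7 \<Longrightarrow> a * \<Phi> (neg_vec 9 # w) = - b * \<Phi> (neg_vec 5 # w)"
    and kill8: "w \<in> lists so7 \<Longrightarrow> \<Phi> (neg_vec 8 # w) = 0"
    and right9: "u \<in> lists so7 \<Longrightarrow> \<Phi> (u @ replicate (Suc l1) (neg_vec 9)) = 0"
    and right8: "u \<in> lists so7 \<Longrightarrow> \<Phi> (u @ replicate (Suc l2) (neg_vec 8)) = 0"
    and right5: "u \<in> lists so7 \<Longrightarrow> \<Phi> (u @ replicate (Suc l3) (neg_vec 5)) = 0"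
begin

abbreviation "f \<equiv> neg_vec"

lemma f_so7 [simp]: "f 1 \<in> so7" "f 2 \<in> so7" "f 3 \<in> so7" "f 4 \<in> so7" "f 5 \<in> so7" "f 6 \<in> so7" "f 7 \<in> so7"
  "f 8 \<in> so7" "f 9 \<in> so7" "f (Suc 0) \<in> so7"
  by simp_all

lemma swap_rel:
  assumes u: "u \<in> lists so7" and w: "w \<in> lists so7"
  shows "\<Phi> (u @ f 5 # f 6 # w) = \<Phi> (u @ f 6 # f 5 # w) - \<Phi> (u @ f 3 # w)"
    "\<Phi> (u @ f 5 # f 8 # w) = \<Phi> (u @ f 8 # f 5 # w) + \<Phi> (u @ f 6 # w)"
    "\<Phi> (u @ f 9 # f 8 # w) = \<Phi> (u @ f 8 # f 9 # w) - \<Phi> (u @ f 7 # w)"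
    "\<Phi> (u @ f 5 # f 7 # w) = \<Phi> (u @ f 7 # f 5 # w) + \<Phi> (u @ f 4 # w)"
    "\<Phi> (u @ f 9 # f 6 # w) = \<Phi> (u @ f 6 # f 9 # w) - \<Phi> (u @ f 4 # w)"
    "\<Phi> (u @ f 9 # f 3 # w) = \<Phi> (u @ f 3 # f 9 # w) - \<Phi> (u @ f 2 # w)"
    "\<Phi> (u @ f 5 # f 4 # w) = \<Phi> (u @ f 4 # f 5 # w) - \<Phi> (u @ f 2 # w)"
    "\<Phi> (u @ f 6 # f 4 # w) = \<Phi> (u @ f 4 # f 6 # w) - \<Phi> (u @ f 1 # w)"
    "\<Phi> (u @ f 8 # f 2 # w) = \<Phi> (u @ f 2 # f 8 # w) - \<Phi> (u @ f 1 # w)"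
proof -
  note n = neg_vec_brackets neg_vec_brackets2
  show "\<Phi> (u @ f 5 # f 6 # w) = \<Phi> (u @ f 6 # f 5 # w) - \<Phi> (u @ f 3 # w)"
    "\<Phi> (u @ f 5 # f 8 # w) = \<Phi> (u @ f 8 # f 5 # w) + \<Phi> (u @ f 6 # w)"
    "\<Phi> (u @ f 9 # f 8 # w) = \<Phi> (u @ f 8 # f 9 # w) - \<Phi> (u @ f 7 # w)"
    "\<Phi> (u @ f 5 # f 7 # w) = \<Phi> (u @ f 7 # f 5 # w) + \<Phi> (u @ f 4 # w)"
    "\<Phi> (u @ f 9 # f 6 # w) = \<Phi> (u @ f 6 # f 9 # w) - \<Phi> (u @ f 4 # w)"
    "\<Phi> (u @ f 9 # f 3 # w) = \<Phi> (u @ f 3 # f 9 # w) - \<Phi> (u @ f 2 # w)"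
    "\<Phi> (u @ f 5 # f 4 # w) = \<Phi> (u @ f 4 # f 5 # w) - \<Phi> (u @ f 2 # w)"
    "\<Phi> (u @ f 6 # f 4 # w) = \<Phi> (u @ f 4 # f 6 # w) - \<Phi> (u @ f 1 # w)"
    "\<Phi> (u @ f 8 # f 2 # w) = \<Phi> (u @ f 2 # f 8 # w) - \<Phi> (u @ f 1 # w)"
    using \<Phi>_bracket[OF u f_so7(5) f_so7(6) w]
      \<Phi>_bracket[OF u f_so7(5) f_so7(8) w]
      \<Phi>_bracket[OF u f_so7(9) f_so7(8) w]
      \<Phi>_bracket[OF u f_so7(5) f_so7(7) w]
      \<Phi>_bracket[OF u f_so7(9) f_so7(6) w]
      \<Phi>_bracket[OF u f_so7(9) f_so7(3) w]
      \<Phi>_bracket[OF u f_so7(5) f_so7(4) w]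
      \<Phi>_bracket[OF u f_so7(6) f_so7(4) w]
      \<Phi>_bracket[OF u f_so7(8) f_so7(2) w]
    unfolding n \<Phi>_neg[OF u f_so7(1) w] \<Phi>_neg[OF u f_so7(2) w] \<Phi>_neg[OF u f_so7(3) w] \<Phi>_neg[OF u f_so7(4) w] \<Phi>_neg[OF u f_so7(7) w]
    by (simp_all only: diff_conv_add_uminus)
qed

lemma swap0: "u \<in> lists so7 \<Longrightarrow> w \<in> lists so7 \<Longrightarrow>
   (i, j) \<in> {(9,5),(9,7),(9,4),(3,5),(3,6),(3,8),(6,8),(3,4),(3,2),(5,2),(6,2),(3,1),(5,1),(6,1)} \<Longrightarrow>
   \<Phi> (u @ f i # f j # w) = \<Phi> (u @ f j # f i # w)"
  by (intro \<Phi>_swap) (auto simp: neg_vec_brackets neg_vec_brackets2 simp del: One_nat_def)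

text \<open>This lemma and the next three are the invariance under the brackets of the two generators,
  rewritten as relations between values of words.\<close>

lemma kill7:
  assumes w: "w \<in> lists so7"
  shows "b * \<Phi> (f 6 # w) = a * \<Phi> (f 7 # w)"
proof -
  have "\<Phi> (f 9 # f 8 # w) = - \<Phi> (f 7 # w)" using swap_rel(3)[of "[]" w] kill8[of "f 9 # w"] w by simp
  moreover have "\<Phi> (f 5 # f 8 # w) = \<Phi> (f 6 # w)" using swap_rel(2)[of "[]" w] kill8[of "f 5 # w"] w by simp
  ultimately show ?thesis using kill5[of "f 8 # w"] w by simp
qed

lemma kill4:
  assumes w: "w \<in> lists so7"
  shows "2 * a * \<Phi> (f 4 # w) = - b * \<Phi> (f 3 # w)"
proof -
  have 1: "\<Phi> (f 5 # f 6 # w) = \<Phi> (f 6 # f 5 # w) - \<Phi> (f 3 # w)" using swap_rel(1)[of "[]" w] w by simp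
  have 2: "\<Phi> (f 5 # f 7 # w) = \<Phi> (f 7 # f 5 # w) + \<Phi> (f 4 # w)" using swap_rel(4)[of "[]" w] w by simp
  have 3: "\<Phi> (f 9 # f 6 # w) = \<Phi> (f 6 # f 9 # w) - \<Phi> (f 4 # w)" using swap_rel(5)[of "[]" w] w by simp
  have 4: "\<Phi> (f 9 # f 7 # w) = \<Phi> (f 7 # f 9 # w)" using swap0[of "[]" w 9 7] w by simp
  have 5: "a * \<Phi> (f 9 # f 6 # w) = - b * \<Phi> (f 5 # f 6 # w)" using kill5[of "f 6 # w"] w by simp
  have 6: "a * \<Phi> (f 9 # f 7 # w) = - b * \<Phi> (f 5 # f 7 # w)" using kill5[of "f 7 # w"] w by simp
  have 7: "b * \<Phi> (f 6 # f 5 # w) = a * \<Phi> (f 7 # f 5 # w)" using kill7[of "f 5 # w"] w by simp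
  have 8: "b * \<Phi> (f 6 # f 9 # w) = a * \<Phi> (f 7 # f 9 # w)" using kill7[of "f 9 # w"] w by simp
  have "b * (2 * a * \<Phi> (f 4 # w) + b * \<Phi> (f 3 # w)) =
      b * (b * \<Phi> (f 6 # f 5 # w) - a * \<Phi> (f 7 # f 5 # w)) + a * (b * \<Phi> (f 6 # f 9 # w) - a * \<Phi> (f 7 # f 9 # w))
      - (b * (b * \<Phi> (f 5 # f 6 # w) + a * \<Phi> (f 9 # f 6 # w)) - a * (b * \<Phi> (f 5 # f 7 # w) + a * \<Phi> (f 9 # f 7 # w)))"
    unfolding 1 2 3 4 by (simp add: algebra_simps)
  also have "\<dots> = 0" using 5 6 7 8 by simp
  finally show ?thesis using ab by (simp add: add_eq_0_iff)
qed

lemma kill2: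
  assumes w: "w \<in> lists so7"
  shows "\<Phi> (f 2 # w) = 0"
proof -
  have 1: "\<Phi> (f 5 # f 4 # w) = \<Phi> (f 4 # f 5 # w) - \<Phi> (f 2 # w)" using swap_rel(7)[of "[]" w] w by simp
  have 2: "\<Phi> (f 9 # f 3 # w) = \<Phi> (f 3 # f 9 # w) - \<Phi> (f 2 # w)" using swap_rel(6)[of "[]" w] w by simp
  have 3: "\<Phi> (f 9 # f 4 # w) = \<Phi> (f 4 # f 9 # w)" using swap0[of "[]" w 9 4] w by simp
  have 4: "\<Phi> (f 3 # f 5 # w) = \<Phi> (f 5 # f 3 # w)" using swap0[of "[]" w 3 5] w by simp
  have 5: "a * \<Phi> (f 9 # f 4 # w) = - b * \<Phi> (f 5 # f 4 # w)" using kill5[of "f 4 # w"] w by simp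
  have 6: "a * \<Phi> (f 9 # f 3 # w) = - b * \<Phi> (f 5 # f 3 # w)" using kill5[of "f 3 # w"] w by simp
  have 7: "2 * a * \<Phi> (f 4 # f 5 # w) = - b * \<Phi> (f 3 # f 5 # w)" using kill4[of "f 5 # w"] w by simp
  have 8: "2 * a * \<Phi> (f 4 # f 9 # w) = - b * \<Phi> (f 3 # f 9 # w)" using kill4[of "f 9 # w"] w by simp
  have "3 * a * b * \<Phi> (f 2 # w) =
      b * (2 * a * \<Phi> (f 4 # f 5 # w) + b * \<Phi> (f 3 # f 5 # w)) + a * (2 * a * \<Phi> (f 4 # f 9 # w) + b * \<Phi> (f 3 # f 9 # w))
      - (2 * a * (b * \<Phi> (f 5 # f 4 # w) + a * \<Phi> (f 9 # f 4 # w)) + b * (b * \<Phi> (f 5 # f 3 # w) + a * \<Phi> (f 9 # f 3 # w)))"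
    unfolding 1 2 3 4 by (simp add: algebra_simps)
  also have "\<dots> = 0" using 5 6 7 8 by simp
  finally show ?thesis using ab by simp
qed

lemma kill1:
  assumes w: "w \<in> lists so7"
  shows "\<Phi> (f 1 # w) = 0"
  using swap_rel(9)[of "[]" w] kill8[of "f 2 # w"] kill2[of "f 8 # w"] w by simp

lemma heisenberg_subset: "u \<in> lists {f 3, f 5, f 6} \<Longrightarrow> u \<in> lists so7"
  by (induction u) auto

text \<open>The relations for $f_1, f_2, f_4$ hold also behind a prefix of letters $f_3, f_5, f_6$: moving
  these letters aside produces only brackets that vanish or cancel by the relations themselves.\<close>

lemma kill_under_prefix:
  "u \<in> lists {f 3, f 5, f 6} \<Longrightarrow> w \<in> lists so7 \<Longrightarrow>
    \<Phi> (u @ f 1 # w) = 0 \<and> \<Phi> (u @ f 2 # w) = 0 \<and> 2 * a * \<Phi> (u @ f 4 # w) = - b * \<Phi> (u @ f 3 # w)"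
proof (induction u arbitrary: w rule: rev_induct)
  case Nil
  thus ?case using kill1 kill2 kill4 by simp
next
  case (snoc y u)
  have u: "u \<in> lists {f 3, f 5, f 6}" and us: "u \<in> lists so7" and y: "y = f 3 \<or> y = f 5 \<or> y = f 6"
    using snoc.prems(1) heisenberg_subset[of u] by auto
  have yw: "y # w \<in> lists so7" using y snoc.prems by auto
  note IH = snoc.IH[OF u yw] snoc.IH[OF u snoc.prems(2)]
  note s = swap0[OF us snoc.prems(2)] swap_rel[OF us snoc.prems(2)]
  have "\<Phi> (u @ y # f 1 # w) = 0" using y IH s(1)[of 3 1] s(1)[of 5 1] s(1)[of 6 1] by (auto simp del: One_nat_def)
  moreover have "\<Phi> (u @ y # f 2 # w) = 0" using y IH s(1)[of 3 2] s(1)[of 5 2] s(1)[of 6 2] by auto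
  moreover have "2 * a * \<Phi> (u @ y # f 4 # w) = - b * \<Phi> (u @ y # f 3 # w)"
    using y
  proof (elim disjE)
    assume "y = f 3" thus ?thesis using IH s(1)[of 3 4] by simp
  next
    assume "y = f 5" thus ?thesis using IH s(1)[of 3 5] s(8) by simp
  next
    assume "y = f 6" thus ?thesis using IH s(1)[of 3 6] s(9) by (simp del: One_nat_def)
  qed
  ultimately show ?case by (simp del: One_nat_def)
qed

lemma replicate_append_Cons: "replicate n X @ X # w = X # replicate n X @ w"
  by (induction n) auto

lemma move_6_5:
  "u \<in> lists so7 \<Longrightarrow> w \<in> lists so7 \<Longrightarrow>
   \<Phi> (u @ replicate y (f 6) @ f 5 # w) = \<Phi> (u @ f 5 # replicate y (f 6) @ w) + of_nat y * \<Phi> (u @ f 3 # replicate (y - 1) (f 6) @ w)"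
proof (induction y arbitrary: u)
  case (Suc y)
  let ?r = "replicate y (f 6) @ w"
  have r: "?r \<in> lists so7" using Suc.prems by simp
  have "\<Phi> (u @ replicate (Suc y) (f 6) @ f 5 # w) =
     \<Phi> (u @ f 6 # f 5 # ?r) + of_nat y * \<Phi> (u @ f 6 # f 3 # replicate (y - 1) (f 6) @ w)"
    using Suc.IH[of "u @ [f 6]"] Suc.prems by simp
  also have "\<Phi> (u @ f 6 # f 5 # ?r) = \<Phi> (u @ f 5 # f 6 # ?r) + \<Phi> (u @ f 3 # ?r)"
    using swap_rel(1)[OF Suc.prems(1) r] by simp
  also have "of_nat y * \<Phi> (u @ f 6 # f 3 # replicate (y - 1) (f 6) @ w) = of_nat y * \<Phi> (u @ f 3 # ?r)"
    using swap0[of u "replicate (y - 1) (f 6) @ w" 3 6] Suc.prems by (cases y) auto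
  finally show ?case by (simp add: algebra_simps)
qed simp

lemma move_6_9:
  "u \<in> lists {f 3, f 5, f 6} \<Longrightarrow> w \<in> lists so7 \<Longrightarrow>
   \<Phi> (u @ replicate y (f 6) @ f 9 # w) = \<Phi> (u @ f 9 # replicate y (f 6) @ w) - of_nat y * (b / (2 * a)) * \<Phi> (u @ f 3 # replicate (y - 1) (f 6) @ w)"
proof (induction y arbitrary: u)
  case (Suc y)
  let ?r = "replicate y (f 6) @ w"
  have r: "?r \<in> lists so7" using Suc.prems by simp
  have us: "u \<in> lists so7" using Suc.prems heisenberg_subset by blast
  have "\<Phi> (u @ replicate (Suc y) (f 6) @ f 9 # w) =
     \<Phi> (u @ f 6 # f 9 # ?r) - of_nat y * (b / (2 * a)) * \<Phi> (u @ f 6 # f 3 # replicate (y - 1) (f 6) @ w)"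
    using Suc.IH[of "u @ [f 6]"] Suc.prems by simp
  also have "\<Phi> (u @ f 6 # f 9 # ?r) = \<Phi> (u @ f 9 # f 6 # ?r) + \<Phi> (u @ f 4 # ?r)"
    using swap_rel(5)[OF us r] by simp
  also have "\<Phi> (u @ f 4 # ?r) = - (b / (2 * a)) * \<Phi> (u @ f 3 # ?r)"
    using kill_under_prefix[OF Suc.prems(1) r] ab by (simp add: field_simps)
  also have "of_nat y * (b / (2 * a)) * \<Phi> (u @ f 6 # f 3 # replicate (y - 1) (f 6) @ w) = of_nat y * (b / (2 * a)) * \<Phi> (u @ f 3 # ?r)"
    using swap0[of u "replicate (y - 1) (f 6) @ w" 3 6] Suc.prems us by (cases y) auto
  finally show ?case by (simp add: algebra_simps add_divide_distrib)
qed simp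

lemma move_6_left:
  "u \<in> lists so7 \<Longrightarrow> w \<in> lists so7 \<Longrightarrow>
   \<Phi> (u @ f 6 # replicate x (f 5) @ w) = \<Phi> (u @ replicate x (f 5) @ f 6 # w) + of_nat x * \<Phi> (u @ f 3 # replicate (x - 1) (f 5) @ w)"
proof (induction x arbitrary: u)
  case (Suc x)
  let ?r = "replicate x (f 5) @ w"
  have r: "?r \<in> lists so7" using Suc.prems by simp
  have "\<Phi> (u @ f 6 # replicate (Suc x) (f 5) @ w) = \<Phi> (u @ f 5 # f 6 # ?r) + \<Phi> (u @ f 3 # ?r)"
    using swap_rel(1)[OF Suc.prems(1) r] by simp
  also have "\<Phi> (u @ f 5 # f 6 # ?r) = \<Phi> (u @ replicate (Suc x) (f 5) @ f 6 # w) + of_nat x * \<Phi> (u @ f 5 # f 3 # replicate (x - 1) (f 5) @ w)"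
    using Suc.IH[of "u @ [f 5]"] Suc.prems by simp
  also have "of_nat x * \<Phi> (u @ f 5 # f 3 # replicate (x - 1) (f 5) @ w) = of_nat x * \<Phi> (u @ f 3 # ?r)"
    using swap0[of u "replicate (x - 1) (f 5) @ w" 3 5] Suc.prems by (cases x) auto
  finally show ?case by (simp add: algebra_simps)
qed simp

lemma move_5_8:
  "u \<in> lists so7 \<Longrightarrow> w \<in> lists so7 \<Longrightarrow>
   \<Phi> (u @ replicate x (f 5) @ f 8 # w) = \<Phi> (u @ f 8 # replicate x (f 5) @ w)
     + of_nat x * \<Phi> (u @ replicate (x - 1) (f 5) @ f 6 # w)
     + of_nat (x choose 2) * \<Phi> (u @ f 3 # replicate (x - 2) (f 5) @ w)"
proof (induction x arbitrary: u)
  case (Suc x)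
  let ?r = "replicate x (f 5) @ w"
  have r: "?r \<in> lists so7" using Suc.prems by simp
  have "\<Phi> (u @ replicate (Suc x) (f 5) @ f 8 # w) = \<Phi> (u @ f 5 # f 8 # ?r)
      + of_nat x * \<Phi> (u @ f 5 # replicate (x - 1) (f 5) @ f 6 # w)
      + of_nat (x choose 2) * \<Phi> (u @ f 5 # f 3 # replicate (x - 2) (f 5) @ w)"
    using Suc.IH[of "u @ [f 5]"] Suc.prems by simp
  also have "\<Phi> (u @ f 5 # f 8 # ?r) = \<Phi> (u @ f 8 # f 5 # ?r) + (\<Phi> (u @ replicate x (f 5) @ f 6 # w) + of_nat x * \<Phi> (u @ f 3 # replicate (x - 1) (f 5) @ w))"
    using swap_rel(2)[OF Suc.prems(1) r] move_6_left[OF Suc.prems] by simp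
  also have "of_nat x * \<Phi> (u @ f 5 # replicate (x - 1) (f 5) @ f 6 # w) = of_nat x * \<Phi> (u @ replicate x (f 5) @ f 6 # w)"
    by (cases x) auto
  also have "of_nat (x choose 2) * \<Phi> (u @ f 5 # f 3 # replicate (x - 2) (f 5) @ w) = of_nat (x choose 2) * \<Phi> (u @ f 3 # replicate (x - 1) (f 5) @ w)"
  proof (cases "x < 2")
    case False
    hence "x - 1 = Suc (x - 2)" by simp
    thus ?thesis using swap0[of u "replicate (x - 2) (f 5) @ w" 3 5] Suc.prems by simp
  qed simp
  finally show ?case by (simp add: algebra_simps numeral_2_eq_2)
qed simp

text \<open>The values of the functional on $f_3^j f_5^x f_6^y w$, where $w$ collects the factors next to the
  highest weight vector.\<close>

definition ordered_value where "ordered_value w j x y = \<Phi> (replicate j (f 3) @ replicate x (f 5) @ replicate y (f 6) @ w)"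

text \<open>Moving the letter $f_5$, $f_9$ or $f_8$ from $w$ to the left through $f_6^y$ and $f_5^x$ expresses
  the value for the longer $w$ by values for $w$ itself. On the left $f_9$ turns into
  $-\frac{b}{a} f_5$ by invariance and $f_8$ dies; the difference between $f_5$ and $f_9$ is the
  factor $\frac12$, which comes from $[f_6, f_9] = f_4$ and $2a f_4 = -b f_3$ as against
  $[f_6, f_5] = f_3$.\<close>

lemma ordered_value_5:
  assumes w: "w \<in> lists so7"
  shows "ordered_value (f 5 # w) j x y = ordered_value w j (Suc x) y + of_nat y * ordered_value w (Suc j) x (y - 1)"
proof -
  let ?u = "replicate j (f 3) @ replicate x (f 5)"
  have "ordered_value (f 5 # w) j x y = \<Phi> (?u @ f 5 # replicate y (f 6) @ w) + of_nat y * \<Phi> (?u @ f 3 # replicate (y - 1) (f 6) @ w)"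
    unfolding ordered_value_def using move_6_5[of ?u w y] w by simp
  also have "\<Phi> (?u @ f 5 # replicate y (f 6) @ w) = ordered_value w j (Suc x) y" by (simp add: ordered_value_def replicate_append_Cons)
  also have "\<Phi> (?u @ f 3 # replicate (y - 1) (f 6) @ w) = ordered_value w (Suc j) x (y - 1)"
    unfolding ordered_value_def using \<Phi>_move[of "f 3" "f 5" "replicate (y - 1) (f 6) @ w" "replicate j (f 3)" x] w
    by (simp add: neg_vec_brackets replicate_append_Cons)
  finally show ?thesis .
qed

lemma ordered_value_9:
  assumes w: "w \<in> lists so7"
  shows "ordered_value (f 9 # w) j x y = - (b / a) * (ordered_value w j (Suc x) y + of_nat y / 2 * ordered_value w (Suc j) x (y - 1))"
proof -
  let ?u = "replicate j (f 3) @ replicate x (f 5)"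
  let ?r = "replicate y (f 6) @ w"
  have u: "?u \<in> lists {f 3, f 5, f 6}" by auto
  have r: "?r \<in> lists so7" "replicate x (f 5) @ ?r \<in> lists so7" using w by auto
  have "ordered_value (f 9 # w) j x y = \<Phi> (?u @ f 9 # ?r) - of_nat y * (b / (2 * a)) * \<Phi> (?u @ f 3 # replicate (y - 1) (f 6) @ w)"
    unfolding ordered_value_def using move_6_9[OF u w, of y] by simp
  also have "\<Phi> (?u @ f 3 # replicate (y - 1) (f 6) @ w) = ordered_value w (Suc j) x (y - 1)"
    unfolding ordered_value_def using \<Phi>_move[of "f 3" "f 5" "replicate (y - 1) (f 6) @ w" "replicate j (f 3)" x] w
    by (simp add: neg_vec_brackets replicate_append_Cons)
  also have "\<Phi> (?u @ f 9 # ?r) = \<Phi> (replicate j (f 3) @ f 9 # replicate x (f 5) @ ?r)"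
    using \<Phi>_move[of "f 9" "f 5" ?r "replicate j (f 3)" x] r by (simp add: neg_vec_brackets)
  also have "\<dots> = \<Phi> (f 9 # replicate j (f 3) @ replicate x (f 5) @ ?r)"
  proof -
    have "\<Phi> (v @ replicate j (f 3) @ f 9 # s) = \<Phi> (v @ f 9 # replicate j (f 3) @ s)"
      if "v \<in> lists {f 3, f 5, f 6}" "s \<in> lists so7" for v s
      using that(1)
    proof (induction j arbitrary: v)
      case (Suc j)
      have "\<Phi> (v @ replicate (Suc j) (f 3) @ f 9 # s) = \<Phi> (v @ f 3 # f 9 # replicate j (f 3) @ s)"
        using Suc.IH[of "v @ [f 3]"] Suc.prems by simp
      also have "\<dots> = \<Phi> (v @ f 9 # f 3 # replicate j (f 3) @ s)"
        using swap_rel(6)[of v "replicate j (f 3) @ s"] kill_under_prefix[OF Suc.prems, of "replicate j (f 3) @ s"]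
          heisenberg_subset[OF Suc.prems] that(2) by simp
      finally show ?case by simp
    qed simp
    from this[of "[]"] r show ?thesis by simp
  qed
  also have "\<dots> = - (b / a) * ordered_value w j (Suc x) y"
  proof -
    have "\<Phi> (f 5 # replicate j (f 3) @ replicate x (f 5) @ ?r) = ordered_value w j (Suc x) y"
      unfolding ordered_value_def using \<Phi>_move[of "f 5" "f 3" "replicate x (f 5) @ ?r" "[]" j] r
      by (simp add: lie_br_5_3)
    thus ?thesis using kill5[of "replicate j (f 3) @ replicate x (f 5) @ ?r"] r ab by (simp add: field_simps)
  qed
  finally show ?thesis using ab by (simp add: field_simps)
qed

lemma ordered_value_8:
  assumes w: "w \<in> lists so7"
  shows "ordered_value (f 8 # w) j x y = of_nat x * ordered_value w j (x - 1) (Suc y) + of_nat (x choose 2) * ordered_value w (Suc j) (x - 2) y"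
proof -
  let ?r = "replicate y (f 6) @ w"
  have r: "?r \<in> lists so7" using w by simp
  have "ordered_value (f 8 # w) j x y = \<Phi> (replicate j (f 3) @ replicate x (f 5) @ f 8 # ?r)"
    unfolding ordered_value_def using \<Phi>_move[of "f 8" "f 6" w "replicate j (f 3) @ replicate x (f 5)" y] w
    by (simp add: lie_br_8_6)
  also have "\<dots> = \<Phi> (replicate j (f 3) @ f 8 # replicate x (f 5) @ ?r)
     + of_nat x * \<Phi> (replicate j (f 3) @ replicate (x - 1) (f 5) @ f 6 # ?r)
     + of_nat (x choose 2) * \<Phi> (replicate j (f 3) @ f 3 # replicate (x - 2) (f 5) @ ?r)"
    by (rule move_5_8) (use r in auto)
  also have "\<Phi> (replicate j (f 3) @ f 8 # replicate x (f 5) @ ?r) = 0"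
    using \<Phi>_move[of "f 8" "f 3" "replicate x (f 5) @ ?r" "[]" j] kill8 r by (simp add: lie_br_8_3)
  finally show ?thesis by (simp add: ordered_value_def replicate_append_Cons)
qed

text \<open>Dividing by factorials and counting $-f_3 = [f_5, f_6]$ instead of $f_3$ turns the recursions into
  first-order differential operators on the generating polynomials.\<close>

definition divided_value where "divided_value w j x y = (-1) ^ j * ordered_value w j x y / (fact j * fact x * fact y)"

definition value_poly where "value_poly w w1 w2 = (\<Sum>j\<le>w1. if j \<le> w2 then Polynomial.monom (divided_value w j (w1 - j) (w2 - j)) j else 0)"

lemma coeff_value_poly: "Polynomial.coeff (value_poly w w1 w2) j = (if j \<le> w1 \<and> j \<le> w2 then divided_value w j (w1 - j) (w2 - j) else 0)"
proof -
  have "Polynomial.coeff (value_poly w w1 w2) j = (\<Sum>i\<le>w1. if i = j then (if j \<le> w2 then divided_value w j (w1 - j) (w2 - j) else 0) else 0)"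
    unfolding value_poly_def coeff_sum by (intro sum.cong) auto
  thus ?thesis by (simp add: sum.delta)
qed

lemma coeff_euler:
  fixes P :: "complex poly"
  shows "Polynomial.coeff (Polynomial.smult \<kappa> (Polynomial.smult k P - [:s, 1:] * pderiv P)) j =
    \<kappa> * ((k - of_nat j) * Polynomial.coeff P j - s * of_nat (Suc j) * Polynomial.coeff P (Suc j))"
  by (cases j) (simp_all add: mult_pCons_left coeff_pderiv algebra_simps)

lemma divided_value_5:
  assumes "w \<in> lists so7"
  shows "divided_value (f 5 # w) j x y = of_nat (Suc x) * divided_value w j (Suc x) y - (if y = 0 then 0 else of_nat (Suc j) * divided_value w (Suc j) x (y - 1))"
  by (cases y) (simp_all add: divided_value_def ordered_value_5[OF assms] divide_simps del: of_nat_Suc, simp_all add: algebra_simps)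

lemma divided_value_9:
  assumes "w \<in> lists so7"
  shows "divided_value (f 9 # w) j x y = - (b / a) * (of_nat (Suc x) * divided_value w j (Suc x) y - (if y = 0 then 0 else of_nat (Suc j) / 2 * divided_value w (Suc j) x (y - 1)))"
  using ab by (cases y) (simp_all add: divided_value_def ordered_value_9[OF assms] divide_simps del: of_nat_Suc, simp_all add: algebra_simps)

lemma of_nat_choose_two: "of_nat (Suc n choose 2) = (of_nat (Suc n) * of_nat n / 2 :: complex)"
  by (induction n) (simp_all add: numeral_2_eq_2 field_simps)

lemma divided_value_8:
  assumes "w \<in> lists so7"
  shows "divided_value (f 8 # w) j x y = (if x = 0 then 0 else of_nat (Suc y) * divided_value w j (x - 1) (Suc y)) - (if x < 2 then 0 else of_nat (Suc j) / 2 * divided_value w (Suc j) (x - 2) y)"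
proof (cases x)
  case (Suc x')
  show ?thesis
  proof (cases x')
    case (Suc x'')
    have ch: "of_nat (x choose 2) = (of_nat x * of_nat (Suc x'') / 2 :: complex)"
      unfolding \<open>x = Suc x'\<close> Suc by (rule of_nat_choose_two)
    show ?thesis unfolding divided_value_def ordered_value_8[OF assms] ch
      using \<open>x = Suc x'\<close> Suc by (simp add: divide_simps del: of_nat_Suc) (simp add: algebra_simps)
  qed (use Suc in \<open>simp add: divided_value_def ordered_value_8[OF assms] divide_simps del: of_nat_Suc\<close>)
qed (simp add: divided_value_def ordered_value_8[OF assms])

text \<open>In terms of generating polynomials this recursion and the two that follow have the same shape: an
  operator $k - (t+s)\frac{d}{dt}$ with $s = 1$ for $f_5$ and $s = \frac12$ for $f_9$ and $f_8$.\<close>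

lemma value_poly_5:
  assumes w: "w \<in> lists so7"
  shows "value_poly (f 5 # w) w1 w2 = Polynomial.smult 1 (Polynomial.smult (of_nat (Suc w1)) (value_poly w (Suc w1) w2) - [:1, 1:] * pderiv (value_poly w (Suc w1) w2))"
proof (rule poly_eqI, unfold coeff_euler)
  fix j
  show "Polynomial.coeff (value_poly (f 5 # w) w1 w2) j = 1 * ((of_nat (Suc w1) - of_nat j) * Polynomial.coeff (value_poly w (Suc w1) w2) j
      - 1 * of_nat (Suc j) * Polynomial.coeff (value_poly w (Suc w1) w2) (Suc j))"
  proof (cases "j \<le> w1 \<and> j \<le> w2")
    case True
    then obtain x y where xy: "w1 = j + x" "w2 = j + y" using le_Suc_ex by blast
    have s: "Suc (j + x) - j = Suc x" "Suc (j + x) - Suc j = x" "j + y - Suc j = y - 1" by auto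
    show ?thesis unfolding coeff_value_poly xy s by (cases y) (simp_all add: divided_value_5[OF w])
  next
    case False
    thus ?thesis by (cases "j = Suc w1") (auto simp: coeff_value_poly)
  qed
qed

lemma value_poly_9:
  assumes w: "w \<in> lists so7"
  shows "value_poly (f 9 # w) w1 w2 = Polynomial.smult (- (b / a)) (Polynomial.smult (of_nat (Suc w1)) (value_poly w (Suc w1) w2) - [:1/2, 1:] * pderiv (value_poly w (Suc w1) w2))"
proof (rule poly_eqI, unfold coeff_euler)
  fix j
  show "Polynomial.coeff (value_poly (f 9 # w) w1 w2) j = - (b / a) * ((of_nat (Suc w1) - of_nat j) * Polynomial.coeff (value_poly w (Suc w1) w2) j
      - 1 / 2 * of_nat (Suc j) * Polynomial.coeff (value_poly w (Suc w1) w2) (Suc j))"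
  proof (cases "j \<le> w1 \<and> j \<le> w2")
    case True
    then obtain x y where xy: "w1 = j + x" "w2 = j + y" using le_Suc_ex by blast
    have s: "Suc (j + x) - j = Suc x" "Suc (j + x) - Suc j = x" "j + y - Suc j = y - 1" by auto
    show ?thesis unfolding coeff_value_poly xy s by (cases y) (simp_all add: divided_value_9[OF w])
  next
    case False
    thus ?thesis by (cases "j = Suc w1") (auto simp: coeff_value_poly)
  qed
qed

lemma value_poly_8:
  assumes w: "w \<in> lists so7"
  shows "value_poly (f 8 # w) (Suc w1) w2 = Polynomial.smult 1 (Polynomial.smult (of_nat (Suc w2)) (value_poly w w1 (Suc w2)) - [:1/2, 1:] * pderiv (value_poly w w1 (Suc w2)))"
proof (rule poly_eqI, unfold coeff_euler)
  fix j
  show "Polynomial.coeff (value_poly (f 8 # w) (Suc w1) w2) j = 1 * ((of_nat (Suc w2) - of_nat j) * Polynomial.coeff (value_poly w w1 (Suc w2)) j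
      - 1 / 2 * of_nat (Suc j) * Polynomial.coeff (value_poly w w1 (Suc w2)) (Suc j))"
  proof (cases "j \<le> w1 \<and> j \<le> w2")
    case True
    then obtain x y where xy: "w1 = j + x" "w2 = j + y" using le_Suc_ex by blast
    have s: "Suc (j + x) - j = Suc x" "j + x - j = x" "j + x - Suc j = x - 1" "Suc (j + y) - j = Suc y" "Suc (j + y) - Suc j = y" "j + y - j = y" by auto
    show ?thesis unfolding coeff_value_poly xy s by (cases x) (simp_all add: divided_value_8[OF w])
  next
    case False
    thus ?thesis by (cases "j = Suc w1"; cases "j = Suc w2") (auto simp: coeff_value_poly divided_value_8[OF w])
  qed
qed

lemma value_poly_zero:
  assumes "\<And>u. u \<in> lists so7 \<Longrightarrow> \<Phi> (u @ w) = 0"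
  shows "value_poly w w1 w2 = 0"
proof -
  have "divided_value w j x y = 0" for j x y
    using assms[of "replicate j (f 3) @ replicate x (f 5) @ replicate y (f 6)"] by (simp add: divided_value_def ordered_value_def)
  thus ?thesis by (intro poly_eqI) (simp add: coeff_value_poly)
qed

lemma value_poly_dvd_5: "[:1, 1:] ^ (w1 - l3) dvd value_poly [] w1 w2"
proof (cases "l3 < w1")
  case True
  have "[:1, 1:] ^ (w1 - l3) dvd (\<lambda>m. value_poly (replicate m (f 5)) (w1 - m) w2) 0"
  proof (rule linear_power_dvd_chain[where \<kappa> = 1])
    show "value_poly (replicate (Suc l3) (f 5)) (w1 - Suc l3) w2 = 0" using right5 by (intro value_poly_zero)
    fix m assume "m \<le> l3"
    hence "w1 - m = Suc (w1 - Suc m)" using True by simp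
    thus "value_poly (replicate (Suc m) (f 5)) (w1 - Suc m) w2 = Polynomial.smult 1 (Polynomial.smult (of_nat (w1 - m)) (value_poly (replicate m (f 5)) (w1 - m) w2) -
        [:1, 1:] * pderiv (value_poly (replicate m (f 5)) (w1 - m) w2))"
      using value_poly_5[of "replicate m (f 5)" "w1 - Suc m" w2] by simp
  qed (use True in auto)
  thus ?thesis by simp
qed simp

lemma value_poly_dvd_9: "[:1/2, 1:] ^ (w1 - l1) dvd value_poly [] w1 w2"
proof (cases "l1 < w1")
  case True
  have "[:1/2, 1:] ^ (w1 - l1) dvd (\<lambda>m. value_poly (replicate m (f 9)) (w1 - m) w2) 0"
  proof (rule linear_power_dvd_chain[where \<kappa> = "- (b / a)"])
    show "value_poly (replicate (Suc l1) (f 9)) (w1 - Suc l1) w2 = 0" using right9 by (intro value_poly_zero)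
    fix m assume "m \<le> l1"
    hence "w1 - m = Suc (w1 - Suc m)" using True by simp
    thus "value_poly (replicate (Suc m) (f 9)) (w1 - Suc m) w2 = Polynomial.smult (- (b / a)) (Polynomial.smult (of_nat (w1 - m)) (value_poly (replicate m (f 9)) (w1 - m) w2) -
        [:1/2, 1:] * pderiv (value_poly (replicate m (f 9)) (w1 - m) w2))"
      using value_poly_9[of "replicate m (f 9)" "w1 - Suc m" w2] by simp
  qed (use True ab in auto)
  thus ?thesis by simp
qed simp

lemma value_poly_dvd_8: "[:1/2, 1:] ^ (w2 - l2) dvd value_poly [] w1 w2"
proof (cases "l2 < w2")
  case True
  have "[:1/2, 1:] ^ (w2 - l2) dvd (\<lambda>m. value_poly (replicate m (f 8)) (w1 + m) (w2 - m)) 0"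
  proof (rule linear_power_dvd_chain[where \<kappa> = 1])
    show "value_poly (replicate (Suc l2) (f 8)) (w1 + Suc l2) (w2 - Suc l2) = 0" using right8 by (intro value_poly_zero)
    fix m assume "m \<le> l2"
    hence "w2 - m = Suc (w2 - Suc m)" using True by simp
    thus "value_poly (replicate (Suc m) (f 8)) (w1 + Suc m) (w2 - Suc m) = Polynomial.smult 1 (Polynomial.smult (of_nat (w2 - m)) (value_poly (replicate m (f 8)) (w1 + m) (w2 - m)) -
        [:1/2, 1:] * pderiv (value_poly (replicate m (f 8)) (w1 + m) (w2 - m)))"
      using value_poly_8[of "replicate m (f 8)" "w1 + m" "w2 - Suc m"] by simp
  qed (use True in auto)
  thus ?thesis by simp
qed simp

lemma support: "i \<notin> {3, 5, 6} \<Longrightarrow> p i = 0"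
proof -
  assume i: "i \<notin> {3, 5, 6}"
  have r4: "\<Phi> (f 4 # w) = 0" if "w \<in> lists so7" "\<Phi> (f 3 # w) = 0" for w using kill4[OF that(1)] that(2) ab by simp
  have r7: "\<Phi> (f 7 # w) = 0" if "w \<in> lists so7" "\<Phi> (f 6 # w) = 0" for w using kill7[OF that(1)] that(2) ab by simp
  have r9: "\<Phi> (f 9 # w) = 0" if "w \<in> lists so7" "\<Phi> (f 5 # w) = 0" for w using kill5[OF that(1)] that(2) ab by simp
  have "p 1 = 0" "p 2 = 0" "p 8 = 0" by (rule killed_exponent; simp add: kill1 kill2 kill8 del: One_nat_def)+
  moreover have "p 4 = 0"
    by (rule replaced_exponent[of 4 3]) (simp_all add: r4)
  moreover have "p 7 = 0"
    by (rule replaced_exponent[of 7 6]) (simp_all add: r7)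
  moreover have "p 9 = 0"
    by (rule replaced_exponent[of 9 5]) (simp_all add: r9)
  moreover have "i \<notin> {1..9} \<Longrightarrow> p i = 0" using p_expos by (auto simp: expos_def)
  ultimately show ?thesis using i unfolding in19 by auto
qed

text \<open>The powers of $t+1$ and of $t+\frac12$ are coprime, so their exponents add up to at most the degree
  $p_3$ of the nonzero polynomial.\<close>

theorem exponent_bounds:
  "(p 3 + p 5 - l3) + (p 3 + p 5 - l1) \<le> p 3" "(p 3 + p 5 - l3) + (p 3 + p 6 - l2) \<le> p 3"
proof -
  define P where "P = value_poly [] (p 3 + p 5) (p 3 + p 6)"
  have sp: "p 1 = 0" "p 2 = 0" "p 4 = 0" "p 7 = 0" "p 8 = 0" "p 9 = 0" using support by auto
  have wp: "index_word p = replicate (p 3) 3 @ replicate (p 5) 5 @ replicate (p 6) 6"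
    unfolding index_word_def upt_1_10 by (simp add: sp del: One_nat_def)
  have "Polynomial.coeff P (p 3) \<noteq> 0"
    using \<Phi>_p unfolding P_def coeff_value_poly wp by (simp add: divided_value_def ordered_value_def)
  hence P0: "P \<noteq> 0" by auto
  \<comment> \<open>For $j > p_3$ the monomial has total degree $2p_3 + p_5 + p_6 - j$, less than the degree of $p$.\<close>
  have "degree P \<le> p 3"
  proof (rule degree_le, intro allI impI)
    fix j assume j: "p 3 < j"
    have N: "(\<Sum>i\<in>{1..9}. p i) = p 3 + p 5 + p 6" unfolding length_index_word[symmetric] wp by simp
    show "Polynomial.coeff P j = 0"
    proof (cases "j \<le> p 3 + p 5 \<and> j \<le> p 3 + p 6")
      case True
      have "\<Phi> (map f (replicate j 3 @ replicate (p 3 + p 5 - j) 5 @ replicate (p 3 + p 6 - j) 6)) = 0"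
        using True j by (intro short_word_vanish) (simp_all add: N[unfolded One_nat_def], auto)
      thus ?thesis by (simp add: P_def coeff_value_poly divided_value_def ordered_value_def)
    qed (auto simp: P_def coeff_value_poly)
  qed
  have main: "m + n \<le> p 3" if m: "[:1, 1:] ^ m dvd P" and n: "[:1/2, 1:] ^ n dvd P" for m n
  proof -
    obtain Q where Q: "P = [:1, 1:] ^ m * Q" using m by (auto elim: dvdE)
    have Q0: "Q \<noteq> 0" using P0 Q by auto
    have "n \<le> order (-1/2) P" using n P0 order_divides[of "-1/2" n P] by simp
    also have "\<dots> = order (-1/2) ([:1, 1:] ^ m :: complex poly) + order (-1/2) Q" using P0 unfolding Q by (rule order_mult)
    also have "order (-1/2) ([:1, 1:] ^ m :: complex poly) = 0" by (rule order_0I) simp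
    also have "0 + order (-1/2) Q \<le> degree Q" using Q0 order_degree by simp
    finally have "n \<le> degree Q" .
    moreover have "degree P = m + degree Q" unfolding Q using Q0 by (simp add: degree_mult_eq degree_power_eq)
    ultimately show ?thesis using \<open>degree P \<le> p 3\<close> by simp
  qed
  show "(p 3 + p 5 - l3) + (p 3 + p 5 - l1) \<le> p 3"
    unfolding P_def by (intro main; unfold P_def; rule value_poly_dvd_5 value_poly_dvd_9)
  show "(p 3 + p 5 - l3) + (p 3 + p 6 - l2) \<le> p 3"
    by (intro main; unfold P_def; rule value_poly_dvd_5 value_poly_dvd_8)
qed

end

section \<open>Invariance under the group and under the Lie algebra\<close>

lemma pow_mat_index_bound:
  fixes A :: "complex mat"
  assumes A: "A \<in> carrier_mat n n" and M: "\<And>i j. i < n \<Longrightarrow> j < n \<Longrightarrow> cmod (A $$ (i, j)) \<le> M" and M0: "M \<ge> 0"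
  shows "i < n \<Longrightarrow> j < n \<Longrightarrow> cmod ((A ^\<^sub>m k) $$ (i, j)) \<le> (real n * M) ^ k"
proof (induction k arbitrary: i j)
  case 0
  thus ?case using A by simp
next
  case (Suc k)
  have Ak: "A ^\<^sub>m k \<in> carrier_mat n n" using A by (rule pow_carrier_mat)
  have "(A ^\<^sub>m Suc k) $$ (i, j) = (\<Sum>l\<in>{0..<n}. (A ^\<^sub>m k) $$ (i, l) * A $$ (l, j))"
    using A Ak Suc.prems by (simp add: scalar_prod_def)
  also have "cmod \<dots> \<le> (\<Sum>l\<in>{0..<n}. (real n * M) ^ k * M)"
    using Suc M M0 by (intro sum_norm_le) (auto simp: norm_mult intro!: mult_mono)
  also have "\<dots> = (real n * M) ^ Suc k" by simp
  finally show ?case .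
qed

lemma summable_mat_exp:
  fixes A :: "complex mat"
  assumes A: "A \<in> carrier_mat n n" and ij: "i < n" "j < n"
  shows "summable (\<lambda>k. (A ^\<^sub>m k) $$ (i, j) / of_nat (fact k))"
proof -
  define M where "M = (\<Sum>i<n. \<Sum>j<n. cmod (A $$ (i, j)))"
  have M: "cmod (A $$ (i, j)) \<le> M" if "i < n" "j < n" for i j
  proof -
    have "cmod (A $$ (i, j)) \<le> (\<Sum>j<n. cmod (A $$ (i, j)))" using that by (intro member_le_sum) auto
    also have "\<dots> \<le> M" unfolding M_def
      using that by (intro member_le_sum[of i _ "\<lambda>i. \<Sum>j<n. cmod (A $$ (i, j))"]) (auto intro: sum_nonneg)
    finally show ?thesis .
  qed
  have M0: "M \<ge> 0" unfolding M_def by (intro sum_nonneg) auto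
  show ?thesis
  proof (rule summable_comparison_test')
    show "summable (\<lambda>k. inverse (fact k) * (real n * M) ^ k)" by (rule summable_exp)
    show "norm ((A ^\<^sub>m k) $$ (i, j) / of_nat (fact k)) \<le> inverse (fact k) * (real n * M) ^ k" if "k \<ge> 0" for k
      using pow_mat_index_bound[OF A M M0 ij, of k] by (simp add: norm_divide divide_simps)
  qed
qed

lemma sums_functional_mat_exp:
  fixes A :: "complex mat"
  assumes A: "A \<in> carrier_mat n n" and \<omega>: "\<omega> \<in> carrier_vec n" and w: "w \<in> carrier_vec n"
  shows "(\<lambda>k. (\<omega> \<bullet> ((A ^\<^sub>m k) *\<^sub>v w)) / of_nat (fact k)) sums (\<omega> \<bullet> (mat_exp n A *\<^sub>v w))"
proof -
  have expand: "\<omega> \<bullet> (B *\<^sub>v w) = (\<Sum>i\<in>{0..<n}. \<Sum>j\<in>{0..<n}. \<omega> $ i * (B $$ (i, j) * w $ j))" if "B \<in> carrier_mat n n" for B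
    using that \<omega> w by (simp add: scalar_prod_def sum_distrib_left)
  have "(\<lambda>k. \<Sum>i\<in>{0..<n}. \<Sum>j\<in>{0..<n}. \<omega> $ i * ((A ^\<^sub>m k) $$ (i, j) / of_nat (fact k) * w $ j)) sums
     (\<Sum>i\<in>{0..<n}. \<Sum>j\<in>{0..<n}. \<omega> $ i * ((\<Sum>k. (A ^\<^sub>m k) $$ (i, j) / of_nat (fact k)) * w $ j))"
    using summable_mat_exp[OF A] by (intro sums_sum sums_mult sums_mult2 summable_sums) auto
  also have "(\<Sum>i\<in>{0..<n}. \<Sum>j\<in>{0..<n}. \<omega> $ i * ((\<Sum>k. (A ^\<^sub>m k) $$ (i, j) / of_nat (fact k)) * w $ j)) = \<omega> \<bullet> (mat_exp n A *\<^sub>v w)"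
    by (subst expand) (auto simp: mat_exp_def)
  also have "(\<lambda>k. \<Sum>i\<in>{0..<n}. \<Sum>j\<in>{0..<n}. \<omega> $ i * ((A ^\<^sub>m k) $$ (i, j) / of_nat (fact k) * w $ j)) =
     (\<lambda>k. (\<omega> \<bullet> ((A ^\<^sub>m k) *\<^sub>v w)) / of_nat (fact k))"
    using A by (subst expand) (auto simp: sum_divide_distrib intro: pow_carrier_mat)
  finally show ?thesis .
qed

lemma pow_mat_smult:
  fixes A :: "complex mat"
  assumes A: "A \<in> carrier_mat n n"
  shows "(c \<cdot>\<^sub>m A) ^\<^sub>m k = c ^ k \<cdot>\<^sub>m (A ^\<^sub>m k)"
proof (induction k)
  case 0
  show ?case using A by (intro eq_matI) auto
next
  case (Suc k)
  have "A ^\<^sub>m k \<in> carrier_mat n n" using A by (rule pow_carrier_mat)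
  thus ?case using A Suc by (intro eq_matI) (auto simp: algebra_simps)
qed

lemma pow_mat_Suc_left:
  fixes A :: "complex mat"
  assumes A: "A \<in> carrier_mat n n"
  shows "A ^\<^sub>m Suc k = A * A ^\<^sub>m k"
proof (induction k)
  case 0
  show ?case using A by simp
next
  case (Suc k)
  have Ak: "A ^\<^sub>m k \<in> carrier_mat n n" using A by (rule pow_carrier_mat)
  have "A ^\<^sub>m Suc (Suc k) = (A * A ^\<^sub>m k) * A" using Suc by simp
  also have "\<dots> = A * A ^\<^sub>m Suc k" using assoc_mult_mat[OF A Ak A] by simp
  finally show ?case .
qed

text \<open>Invariance under $\exp(zX)$ for all $z$ makes the power series
  $\sum_k \frac{z^k}{k!}\,\omega(X^k w)$ constant, so its coefficient of $z$ vanishes. Conversely, if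
  $\omega$ kills the image of $X$, only the term $k = 0$ survives.\<close>

lemma dual_invariants_iff:
  assumes \<rho>: "\<And>X. X \<in> N \<Longrightarrow> \<rho> X \<in> carrier_mat n n"
    and sm: "\<And>X c. X \<in> N \<Longrightarrow> c \<cdot>\<^sub>m X \<in> N \<and> \<rho> (c \<cdot>\<^sub>m X) = c \<cdot>\<^sub>m \<rho> X"
  shows "\<omega> \<in> dual_invariants N n \<rho> \<longleftrightarrow>
    \<omega> \<in> carrier_vec n \<and> (\<forall>X\<in>N. \<forall>w\<in>carrier_vec n. \<omega> \<bullet> (\<rho> X *\<^sub>v w) = 0)" (is "?L \<longleftrightarrow> ?R")
proof
  assume L: ?L
  hence \<omega>: "\<omega> \<in> carrier_vec n" by (simp add: dual_invariants_def)
  have "\<omega> \<bullet> (\<rho> X *\<^sub>v w) = 0" if X: "X \<in> N" and w: "w \<in> carrier_vec n" for X w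
  proof -
    define A where "A = \<rho> X"
    have A: "A \<in> carrier_mat n n" using \<rho>[OF X] by (simp add: A_def)
    define c where "c k = (\<omega> \<bullet> ((A ^\<^sub>m k) *\<^sub>v w)) / of_nat (fact k)" for k
    have sums: "(\<lambda>k. c k * z ^ k) sums (\<omega> \<bullet> w)" for z
    proof -
      have "mat_exp n (\<rho> (z \<cdot>\<^sub>m X)) * 1\<^sub>m n \<in> conn_group N n \<rho>"
        using sm[OF X, of z] by (intro conn_group.mult conn_group.one) auto
      moreover have "mat_exp n (\<rho> (z \<cdot>\<^sub>m X)) \<in> carrier_mat n n" by (simp add: mat_exp_def)
      ultimately have "\<omega> \<bullet> (mat_exp n (z \<cdot>\<^sub>m A) *\<^sub>v w) = \<omega> \<bullet> w"
        using L w sm[OF X, of z] by (auto simp: dual_invariants_def A_def)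
      moreover have "(\<omega> \<bullet> (((z \<cdot>\<^sub>m A) ^\<^sub>m k) *\<^sub>v w)) / of_nat (fact k) = c k * z ^ k" for k
      proof -
        have Ak: "A ^\<^sub>m k \<in> carrier_mat n n" using A by (rule pow_carrier_mat)
        have "(z ^ k \<cdot>\<^sub>m (A ^\<^sub>m k)) *\<^sub>v w = z ^ k \<cdot>\<^sub>v ((A ^\<^sub>m k) *\<^sub>v w)"
          using Ak w by (intro eq_vecI) auto
        thus ?thesis using Ak \<omega> w by (simp add: pow_mat_smult[OF A] c_def)
      qed
      ultimately show ?thesis
        using sums_functional_mat_exp[of "z \<cdot>\<^sub>m A" n \<omega> w] A \<omega> w by simp
    qed
    have "summable (\<lambda>k. c k * z ^ k)" for z using sums[of z] by (auto simp: sums_iff)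
    hence "((\<lambda>x. \<Sum>k. c k * x ^ k) has_field_derivative (\<Sum>k. diffs c k * 0 ^ k)) (at 0)"
      by (rule termdiffs_strong_converges_everywhere)
    moreover have "(\<lambda>x. \<Sum>k. c k * x ^ k) = (\<lambda>x. \<omega> \<bullet> w)" using sums by (auto simp: sums_iff)
    ultimately have "(\<Sum>k. diffs c k * 0 ^ k) = 0" using DERIV_const DERIV_unique by metis
    hence "c 1 = 0" by (simp add: powser_zero diffs_def)
    thus ?thesis using A by (simp add: c_def A_def)
  qed
  thus ?R using \<omega> by blast
next
  assume R: ?R
  hence \<omega>: "\<omega> \<in> carrier_vec n" by blast
  have ex: "\<omega> \<bullet> (mat_exp n (\<rho> X) *\<^sub>v w) = \<omega> \<bullet> w" if X: "X \<in> N" and w: "w \<in> carrier_vec n" for X w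
  proof -
    note A = \<rho>[OF X]
    have z: "(\<omega> \<bullet> ((\<rho> X ^\<^sub>m k) *\<^sub>v w)) / of_nat (fact k) = 0" if k0: "k \<notin> {0}" for k
    proof -
      obtain j where k: "k = Suc j" using k0 by (cases k) auto
      have Aj: "\<rho> X ^\<^sub>m j \<in> carrier_mat n n" using A by (rule pow_carrier_mat)
      have "\<rho> X ^\<^sub>m k = \<rho> X * \<rho> X ^\<^sub>m j" unfolding k by (rule pow_mat_Suc_left[OF A])
      hence "(\<rho> X ^\<^sub>m k) *\<^sub>v w = \<rho> X *\<^sub>v (\<rho> X ^\<^sub>m j *\<^sub>v w)" using assoc_mult_mat_vec[OF A Aj w] by simp
      thus ?thesis using R X Aj w by simp
    qed
    have "(\<lambda>k. (\<omega> \<bullet> ((\<rho> X ^\<^sub>m k) *\<^sub>v w)) / of_nat (fact k)) sums (\<omega> \<bullet> w)"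
      using sums_finite[of "{0}" "\<lambda>k. (\<omega> \<bullet> ((\<rho> X ^\<^sub>m k) *\<^sub>v w)) / of_nat (fact k)"] z A w by simp
    thus ?thesis using sums_functional_mat_exp[OF A \<omega> w] sums_unique2 by blast
  qed
  have "g \<in> carrier_mat n n \<and> (\<forall>w\<in>carrier_vec n. \<omega> \<bullet> (g *\<^sub>v w) = \<omega> \<bullet> w)" if "g \<in> conn_group N n \<rho>" for g
    using that
  proof induction
    case one
    show ?case by simp
  next
    case (mult X g)
    have m: "mat_exp n (\<rho> X) \<in> carrier_mat n n" by (simp add: mat_exp_def)
    show ?case
    proof (intro conjI ballI)
      show "mat_exp n (\<rho> X) * g \<in> carrier_mat n n" using m mult by simp
      fix w :: "complex vec" assume w: "w \<in> carrier_vec n"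
      have g: "g \<in> carrier_mat n n" using mult by blast
      have "(mat_exp n (\<rho> X) * g) *\<^sub>v w = mat_exp n (\<rho> X) *\<^sub>v (g *\<^sub>v w)" using m g w by simp
      thus "\<omega> \<bullet> ((mat_exp n (\<rho> X) * g) *\<^sub>v w) = \<omega> \<bullet> w" using ex[OF mult(1), of "g *\<^sub>v w"] g w mult by simp
    qed
  qed
  thus ?L using \<omega> by (simp add: dual_invariants_def)
qed

section \<open>Bounds for the branching semigroup\<close>

definition act :: "(complex mat \<Rightarrow> complex mat) \<Rightarrow> complex mat list \<Rightarrow> complex vec \<Rightarrow> complex vec" where
  "act \<rho> ws v = foldr (\<lambda>X w. \<rho> X *\<^sub>v w) ws v"

lemma act_simps [simp]: "act \<rho> [] v = v" "act \<rho> (X # ws) v = \<rho> X *\<^sub>v act \<rho> ws v"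
  by (simp_all add: act_def)

lemma act_append: "act \<rho> (u @ w) v = act \<rho> u (act \<rho> w v)"
  by (simp add: act_def)

lemma mult_mat_vec_smult: "A \<in> carrier_mat n m \<Longrightarrow> v \<in> carrier_vec m \<Longrightarrow> (c \<cdot>\<^sub>m A) *\<^sub>v v = c \<cdot>\<^sub>v (A *\<^sub>v (v :: complex vec))"
  by (intro eq_vecI) auto

lemma mult_mat_vec_minus: "A \<in> carrier_mat n m \<Longrightarrow> B \<in> carrier_mat n m \<Longrightarrow> v \<in> carrier_vec m \<Longrightarrow>
   (A - B) *\<^sub>v v = A *\<^sub>v v - B *\<^sub>v (v :: complex vec)"
  by (intro eq_vecI) (auto simp: scalar_prod_def left_diff_distrib sum_subtractf)

lemma nonzero_vec_entry: "v \<in> carrier_vec n \<Longrightarrow> v \<noteq> 0\<^sub>v n \<Longrightarrow> \<exists>i<n. v $ i \<noteq> (0 :: complex)"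
  by (metis carrier_vecD eq_vecI index_zero_vec)

locale so7_rep =
  fixes n :: nat and \<rho> :: "complex mat \<Rightarrow> complex mat"
  assumes rep: "lie_rep so7 n \<rho>"
begin

lemma \<rho>_carrier [simp]: "X \<in> so7 \<Longrightarrow> \<rho> X \<in> carrier_mat n n"
  and \<rho>_add: "X \<in> so7 \<Longrightarrow> Y \<in> so7 \<Longrightarrow> \<rho> (X + Y) = \<rho> X + \<rho> Y"
  and \<rho>_smult: "X \<in> so7 \<Longrightarrow> \<rho> (c \<cdot>\<^sub>m X) = c \<cdot>\<^sub>m \<rho> X"
  and \<rho>_bracket: "X \<in> so7 \<Longrightarrow> Y \<in> so7 \<Longrightarrow> \<rho> (lie_br X Y) = lie_br (\<rho> X) (\<rho> Y)"
  using rep by (auto simp: lie_rep_def)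

lemma \<rho>_carrier_vec [simp]: "X \<in> so7 \<Longrightarrow> w \<in> carrier_vec n \<Longrightarrow> \<rho> X *\<^sub>v w \<in> carrier_vec n"
  by (rule mult_mat_vec_carrier) simp_all

lemma act_carrier [simp]: "ws \<in> lists so7 \<Longrightarrow> v \<in> carrier_vec n \<Longrightarrow> act \<rho> ws v \<in> carrier_vec n"
  by (induction ws) auto

lemma act_add: "ws \<in> lists so7 \<Longrightarrow> v \<in> carrier_vec n \<Longrightarrow> w \<in> carrier_vec n \<Longrightarrow> act \<rho> ws (v + w) = act \<rho> ws v + act \<rho> ws w"
  by (induction ws) (auto simp: mult_add_distrib_mat_vec[of _ n n])

lemma act_smult: "ws \<in> lists so7 \<Longrightarrow> v \<in> carrier_vec n \<Longrightarrow> act \<rho> ws (c \<cdot>\<^sub>v v) = c \<cdot>\<^sub>v act \<rho> ws v"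
  by (induction ws) (auto simp: mult_mat_vec[of _ n n])

lemma bracket_vec:
  assumes "X \<in> so7" "Y \<in> so7" "w \<in> carrier_vec n"
  shows "\<rho> X *\<^sub>v (\<rho> Y *\<^sub>v w) = \<rho> Y *\<^sub>v (\<rho> X *\<^sub>v w) + \<rho> (lie_br X Y) *\<^sub>v w"
proof -
  have "\<rho> (lie_br X Y) *\<^sub>v w = (\<rho> X * \<rho> Y) *\<^sub>v w - (\<rho> Y * \<rho> X) *\<^sub>v w"
  proof -
    have e: "\<rho> (lie_br X Y) = \<rho> X * \<rho> Y - \<rho> Y * \<rho> X"
      unfolding \<rho>_bracket[OF assms(1,2)] by (simp only: lie_br_def)
    show ?thesis unfolding e
      by (rule mult_mat_vec_minus[of _ n n]) (use assms in \<open>auto intro: mult_carrier_mat[of _ n n]\<close>)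
  qed
  also have "\<dots> = \<rho> X *\<^sub>v (\<rho> Y *\<^sub>v w) - \<rho> Y *\<^sub>v (\<rho> X *\<^sub>v w)"
    using assms by (simp add: assoc_mult_mat_vec[of _ n n _ n])
  finally have *: "\<rho> (lie_br X Y) *\<^sub>v w = \<rho> X *\<^sub>v (\<rho> Y *\<^sub>v w) - \<rho> Y *\<^sub>v (\<rho> X *\<^sub>v w)" .
  have c: "\<rho> X *\<^sub>v (\<rho> Y *\<^sub>v w) \<in> carrier_vec n" "\<rho> Y *\<^sub>v (\<rho> X *\<^sub>v w) \<in> carrier_vec n" using assms by simp_all
  show ?thesis unfolding * using c carrier_matD[OF \<rho>_carrier[OF assms(1)]] carrier_matD[OF \<rho>_carrier[OF assms(2)]]
    by (intro eq_vecI) auto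
qed

lemma word_functional:
  assumes v: "v \<in> carrier_vec n" and \<omega>: "\<omega> \<in> carrier_vec n"
  shows "so7_word_functional (\<lambda>ws. \<omega> \<bullet> act \<rho> ws v)"
proof
  fix u w X Y assume u: "u \<in> lists so7" and X: "X \<in> so7" and Y: "Y \<in> so7" and w: "w \<in> lists so7"
  let ?w = "act \<rho> w v"
  have wc: "?w \<in> carrier_vec n" using w v by simp
  show "\<omega> \<bullet> act \<rho> (u @ (X + Y) # w) v = \<omega> \<bullet> act \<rho> (u @ X # w) v + \<omega> \<bullet> act \<rho> (u @ Y # w) v"
    using u X Y wc \<omega> by (simp add: act_append \<rho>_add add_mult_distrib_mat_vec[of _ n n] act_add scalar_prod_add_distrib[of _ n])
  show "\<omega> \<bullet> act \<rho> (u @ X # Y # w) v = \<omega> \<bullet> act \<rho> (u @ Y # X # w) v + \<omega> \<bullet> act \<rho> (u @ lie_br X Y # w) v"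
    using u X Y wc \<omega> by (simp add: act_append bracket_vec[OF X Y] act_add scalar_prod_add_distrib[of _ n])
next
  fix u w X c assume u: "u \<in> lists so7" and X: "X \<in> so7" and w: "w \<in> lists so7"
  show "\<omega> \<bullet> act \<rho> (u @ (c \<cdot>\<^sub>m X) # w) v = c * (\<omega> \<bullet> act \<rho> (u @ X # w) v)"
    using u X w v \<omega> by (simp add: act_append \<rho>_smult mult_mat_vec_smult[of _ n n] act_smult)
qed

lemma sig_vec_eq_act:
  assumes e: "\<And>i. i \<in> {1..9} \<Longrightarrow> e i = \<kappa> i \<cdot>\<^sub>m neg_vec i \<and> \<kappa> i \<noteq> 0" and v: "v \<in> carrier_vec n"
  shows "\<exists>c. c \<noteq> 0 \<and> sig_vec e \<rho> v p = c \<cdot>\<^sub>v act \<rho> (map neg_vec (index_word p)) v"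
proof -
  have pow: "(\<rho> (e i) ^\<^sub>m k) *\<^sub>v w = \<kappa> i ^ k \<cdot>\<^sub>v act \<rho> (replicate k (neg_vec i)) w" if i: "i \<in> {1..9}" and w: "w \<in> carrier_vec n" for i k w
    using w
  proof (induction k arbitrary: w)
    case 0
    have "\<rho> (e i) \<in> carrier_mat n n" using e[OF i] neg_vec_so7[OF i] by auto
    thus ?case using 0 by simp
  next
    case (Suc k)
    have c: "\<rho> (e i) \<in> carrier_mat n n" "\<rho> (neg_vec i) \<in> carrier_mat n n" using e[OF i] neg_vec_so7[OF i] by auto
    hence pc: "\<rho> (e i) ^\<^sub>m k \<in> carrier_mat n n" by (auto intro: pow_carrier_mat)
    have rl: "replicate k (neg_vec i) \<in> lists so7" using neg_vec_so7[OF i] by (induction k) auto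
    have "(\<rho> (e i) ^\<^sub>m Suc k) *\<^sub>v w = (\<rho> (e i) ^\<^sub>m k) *\<^sub>v (\<rho> (e i) *\<^sub>v w)"
      using assoc_mult_mat_vec[OF pc c(1) Suc.prems] by simp
    also have "\<rho> (e i) *\<^sub>v w = \<kappa> i \<cdot>\<^sub>v (\<rho> (neg_vec i) *\<^sub>v w)"
      using e[OF i] neg_vec_so7[OF i] c Suc.prems by (simp add: \<rho>_smult mult_mat_vec_smult[of _ n n])
    also have "(\<rho> (e i) ^\<^sub>m k) *\<^sub>v \<dots> = \<kappa> i \<cdot>\<^sub>v (\<kappa> i ^ k \<cdot>\<^sub>v act \<rho> (replicate k (neg_vec i)) (\<rho> (neg_vec i) *\<^sub>v w))"
      using Suc.IH[of "\<rho> (neg_vec i) *\<^sub>v w"] c pc Suc.prems by (simp add: mult_mat_vec[of _ n n])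
    also have "act \<rho> (replicate k (neg_vec i)) (\<rho> (neg_vec i) *\<^sub>v w) = act \<rho> (replicate (Suc k) (neg_vec i)) w"
      unfolding replicate_Suc replicate_append_same[symmetric] by (simp add: act_append)
    finally show ?case by (simp add: smult_smult_assoc)
  qed
  have main: "set is \<subseteq> {1..9} \<Longrightarrow> \<exists>c. c \<noteq> 0 \<and> foldr (\<lambda>i w. (\<rho> (e i) ^\<^sub>m p i) *\<^sub>v w) is v =
     c \<cdot>\<^sub>v act \<rho> (map neg_vec (concat (map (\<lambda>i. replicate (p i) i) is))) v" for "is"
  proof (induction "is")
    case Nil
    show ?case by (intro exI[of _ 1]) simp
  next
    case (Cons i "is")
    let ?W = "map neg_vec (concat (map (\<lambda>i. replicate (p i) i) is))"
    obtain c where c: "c \<noteq> 0" "foldr (\<lambda>i w. (\<rho> (e i) ^\<^sub>m p i) *\<^sub>v w) is v = c \<cdot>\<^sub>v act \<rho> ?W v"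
      using Cons by auto
    have i: "i \<in> {1..9}" and "set is \<subseteq> {1..9}" using Cons.prems by auto
    hence "set ?W \<subseteq> so7" by auto
    hence W: "?W \<in> lists so7" by blast
    have "set (replicate (p i) (neg_vec i)) \<subseteq> so7" using neg_vec_so7[OF i] by auto
    hence R: "replicate (p i) (neg_vec i) \<in> lists so7" by blast
    have Wc: "act \<rho> ?W v \<in> carrier_vec n" using W v by simp
    have "foldr (\<lambda>i w. (\<rho> (e i) ^\<^sub>m p i) *\<^sub>v w) (i # is) v = \<kappa> i ^ p i \<cdot>\<^sub>v act \<rho> (replicate (p i) (neg_vec i)) (c \<cdot>\<^sub>v act \<rho> ?W v)"
      using c pow[OF i, of "c \<cdot>\<^sub>v act \<rho> ?W v" "p i"] Wc by simp
    also have "\<dots> = (\<kappa> i ^ p i * c) \<cdot>\<^sub>v act \<rho> (map neg_vec (concat (map (\<lambda>i. replicate (p i) i) (i # is)))) v"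
      using Wc R by (simp add: act_smult act_append smult_smult_assoc map_replicate)
    finally show ?case using c(1) e[OF i] by (intro exI[of _ "\<kappa> i ^ p i * c"]) simp
  qed
  have "set [1..<10] \<subseteq> {1..9::nat}" by auto
  from main[OF this] show ?thesis unfolding sig_vec_def index_word_def .
qed

text \<open>Rescaling the root vectors multiplies each value by a nonzero constant and so does not affect
  signatures; from here on only the standard root vectors occur.\<close>

lemma is_sign_iff:
  assumes e: "\<And>i. i \<in> {1..9} \<Longrightarrow> e i = \<kappa> i \<cdot>\<^sub>m neg_vec i \<and> \<kappa> i \<noteq> 0"
    and v: "v \<in> carrier_vec n" and \<omega>: "\<omega> \<in> carrier_vec n"
  shows "is_sign e \<rho> v \<omega> p \<longleftrightarrow> p \<in> expos \<and> \<omega> \<bullet> act \<rho> (map neg_vec (index_word p)) v \<noteq> 0 \<and>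
     (\<forall>q\<in>expos. \<omega> \<bullet> act \<rho> (map neg_vec (index_word q)) v \<noteq> 0 \<longrightarrow> q = p \<or> expo_greater q p)"
proof -
  have "\<omega> \<bullet> sig_vec e \<rho> v q \<noteq> 0 \<longleftrightarrow> \<omega> \<bullet> act \<rho> (map neg_vec (index_word q)) v \<noteq> 0" for q
  proof -
    obtain c where c: "c \<noteq> 0" "sig_vec e \<rho> v q = c \<cdot>\<^sub>v act \<rho> (map neg_vec (index_word q)) v"
      using sig_vec_eq_act[OF e v] by blast
    have "set (map neg_vec (index_word q)) \<subseteq> so7" using set_index_word[of q] by auto
    hence "map neg_vec (index_word q) \<in> lists so7" by blast
    hence "act \<rho> (map neg_vec (index_word q)) v \<in> carrier_vec n" using v by simp
    thus ?thesis using c \<omega> by simp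
  qed
  thus ?thesis unfolding is_sign_def by simp
qed

end

lemma finite_eigenvalues:
  fixes A :: "complex mat"
  assumes "A \<in> carrier_mat n n" shows "finite {k. eigenvalue A k}"
proof -
  have "char_poly A \<noteq> 0" using degree_monic_char_poly[OF assms] by auto
  hence "finite {k. poly (char_poly A) k = 0}" by (rule poly_roots_finite)
  thus ?thesis using eigenvalue_root_char_poly[OF assms] by simp
qed

text \<open>In an $\mathfrak{sl}_2$-module, $E F^{k+1} v = (k+1)(m-k) F^k v$ for a primitive vector $v$ of
  weight $m$. The vectors $F^k v$ have distinct $H$-eigenvalues, so some power kills $v$; the least
  such power can only be $m+1$.\<close>

lemma sl2_lowering_power_vanish:
  fixes E F H :: "complex mat"
  assumes c: "E \<in> carrier_mat n n" "F \<in> carrier_mat n n" "H \<in> carrier_mat n n" and v: "v \<in> carrier_vec n"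
    and EF: "\<And>w. w \<in> carrier_vec n \<Longrightarrow> E *\<^sub>v (F *\<^sub>v w) = F *\<^sub>v (E *\<^sub>v w) + H *\<^sub>v w"
    and HF: "\<And>w. w \<in> carrier_vec n \<Longrightarrow> H *\<^sub>v (F *\<^sub>v w) = F *\<^sub>v (H *\<^sub>v w) + (- 2) \<cdot>\<^sub>v (F *\<^sub>v w)"
    and Ev: "E *\<^sub>v v = 0\<^sub>v n" and Hv: "H *\<^sub>v v = of_nat m \<cdot>\<^sub>v v"
  shows "((\<lambda>w. F *\<^sub>v w) ^^ Suc m) v = 0\<^sub>v n"
proof -
  define V where "V k = ((\<lambda>w. F *\<^sub>v w) ^^ k) v" for k
  have V0: "V 0 = v" and VS: "V (Suc k) = F *\<^sub>v V k" for k by (simp_all add: V_def)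
  have Vc: "V k \<in> carrier_vec n" for k
  proof (induction k)
    case (Suc k) thus ?case unfolding VS using c by simp
  qed (simp add: V0 v)
  have H: "H *\<^sub>v V k = (of_nat m - 2 * of_nat k) \<cdot>\<^sub>v V k" for k
  proof (induction k)
    case 0 thus ?case by (simp add: V0 Hv)
  next
    case (Suc k)
    have "H *\<^sub>v V (Suc k) = (of_nat m - 2 * of_nat k) \<cdot>\<^sub>v (F *\<^sub>v V k) + (- 2) \<cdot>\<^sub>v (F *\<^sub>v V k)"
      unfolding VS using HF[OF Vc] Suc c Vc by (simp add: mult_mat_vec[of _ n n])
    also have "\<dots> = (of_nat m - 2 * of_nat (Suc k)) \<cdot>\<^sub>v V (Suc k)"
      unfolding VS by (subst add_smult_distrib_vec[symmetric]) (simp add: algebra_simps)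
    finally show ?case .
  qed
  have E: "E *\<^sub>v V (Suc k) = (of_nat (Suc k) * (of_nat m - of_nat k)) \<cdot>\<^sub>v V k" for k
  proof (induction k)
    case 0
    have "F *\<^sub>v 0\<^sub>v n = 0\<^sub>v n" using c by (intro eq_vecI) auto
    thus ?case using EF[OF Vc, of 0] Ev Hv v unfolding VS by (simp add: V0)
  next
    case (Suc k)
    have "E *\<^sub>v V (Suc (Suc k)) = F *\<^sub>v (E *\<^sub>v V (Suc k)) + H *\<^sub>v V (Suc k)" unfolding VS[of "Suc k"] using EF[OF Vc] .
    also have "F *\<^sub>v (E *\<^sub>v V (Suc k)) = (of_nat (Suc k) * (of_nat m - of_nat k)) \<cdot>\<^sub>v V (Suc k)"
      unfolding Suc using mult_mat_vec[OF c(2) Vc[of k]] by (simp only: VS)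
    also have "\<dots> + H *\<^sub>v V (Suc k) = (of_nat (Suc (Suc k)) * (of_nat m - of_nat (Suc k))) \<cdot>\<^sub>v V (Suc k)"
      unfolding H by (subst add_smult_distrib_vec[symmetric]) (simp add: algebra_simps)
    finally show ?case .
  qed
  have "\<exists>k. V k = 0\<^sub>v n"
  proof (rule ccontr)
    assume "\<nexists>k. V k = 0\<^sub>v n"
    hence "eigenvalue H (of_nat m - 2 * of_nat k)" for k
      unfolding eigenvalue_def eigenvector_def using c Vc H by (intro exI[of _ "V k"]) auto
    hence "range (\<lambda>k. of_nat m - 2 * of_nat k) \<subseteq> {k. eigenvalue H k}" by blast
    hence "finite (range (\<lambda>k::nat. of_nat m - 2 * of_nat k :: complex))" using finite_eigenvalues[OF c(3)] finite_subset by blast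
    moreover have "inj (\<lambda>k::nat. of_nat m - 2 * of_nat k :: complex)" by (rule injI) simp
    ultimately show False using finite_imageD infinite_UNIV_nat by blast
  qed
  define k where "k = (LEAST k. V k = 0\<^sub>v n)"
  have k: "V k = 0\<^sub>v n" unfolding k_def by (rule LeastI_ex) fact
  have least: "V j \<noteq> 0\<^sub>v n" if "j < k" for j using not_less_Least that unfolding k_def by blast
  have zero: "V (Suc m) = 0\<^sub>v n" if "V j = 0\<^sub>v n" "j \<le> Suc m" for j
  proof -
    have "V (j + i) = 0\<^sub>v n" for i
    proof (induction i)
      case (Suc i)
      thus ?case using c VS by (auto intro!: eq_vecI)
    qed (simp add: that)
    from this[of "Suc m - j"] show ?thesis using that by simp
  qed
  show ?thesis
  proof (cases k)
    case 0
    hence "V (Suc m) = 0\<^sub>v n" using zero[OF k] by simp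
    thus ?thesis unfolding V_def .
  next
    case (Suc j)
    have "E *\<^sub>v 0\<^sub>v n = 0\<^sub>v n" using c by (intro eq_vecI) auto
    hence "(of_nat (Suc j) * (of_nat m - of_nat j)) \<cdot>\<^sub>v V j = 0\<^sub>v n" using E[of j] k Suc by simp
    moreover obtain i where "i < n" "V j $ i \<noteq> 0" using least[of j] Suc nonzero_vec_entry[OF Vc[of j]] by auto
    ultimately have "of_nat (Suc j) * (of_nat m - of_nat j :: complex) = 0"
      using Vc[of j] by (metis carrier_vecD index_smult_vec(1) index_zero_vec(1) mult_eq_0_iff)
    hence "of_nat m = (of_nat j :: complex)" by (simp del: of_nat_Suc)
    hence "k = Suc m" using Suc by simp
    thus ?thesis using k unfolding V_def by simp
  qed
qed

lemma pos_neg_brackets: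
  "lie_br (1 \<cdot>\<^sub>m pos_vec 9) (neg_vec 9) = diag7 1 (-1) 0"
  "lie_br (1 \<cdot>\<^sub>m pos_vec 8) (neg_vec 8) = diag7 0 1 (-1)"
  "lie_br (2 \<cdot>\<^sub>m pos_vec 5) (neg_vec 5) = diag7 0 0 2"
proof -
  have sm: "lie_br (c \<cdot>\<^sub>m X) Y = c \<cdot>\<^sub>m lie_br X Y" if "X \<in> carrier_mat 7 7" "Y \<in> carrier_mat 7 7" for c X Y
    using that by (intro mat7_eqI allI impI)
      (auto simp: lie_br_index sum_distrib_left algebra_simps carrier_matD[OF lie_br_carrier[of X 7 Y]] intro!: sum.cong)
  have o: "1 \<cdot>\<^sub>m A = A" for A :: "complex mat" by (intro eq_matI) auto
  have b: "lie_br (pos_vec 9) (neg_vec 9) = diag7 1 (-1) 0" "lie_br (pos_vec 8) (neg_vec 8) = diag7 0 1 (-1)"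
    "2 \<cdot>\<^sub>m lie_br (pos_vec 5) (neg_vec 5) = diag7 0 0 2"
    unfolding neg_vec_def pos_vec_def
    by (rule mat7_eqI; simp add: all7 lie_br_skew_unit_index skew_unit_index root_row_def root_col_def diag7_def
        carrier_matD[OF skew_unit_carrier] carrier_matD[OF lie_br_carrier[OF skew_unit_carrier skew_unit_carrier]])+
  show "lie_br (1 \<cdot>\<^sub>m pos_vec 9) (neg_vec 9) = diag7 1 (-1) 0"
    "lie_br (1 \<cdot>\<^sub>m pos_vec 8) (neg_vec 8) = diag7 0 1 (-1)"
    "lie_br (2 \<cdot>\<^sub>m pos_vec 5) (neg_vec 5) = diag7 0 0 2"
    using o b by (simp_all add: sm)
qed

lemma diag_neg_brackets:
  "lie_br (diag7 1 (-1) 0) (neg_vec 9) = (- 2) \<cdot>\<^sub>m neg_vec 9"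
  "lie_br (diag7 0 1 (-1)) (neg_vec 8) = (- 2) \<cdot>\<^sub>m neg_vec 8"
  "lie_br (diag7 0 0 2) (neg_vec 5) = (- 2) \<cdot>\<^sub>m neg_vec 5"
  unfolding neg_vec_def by (simp_all add: lie_br_diag7_skew_unit root_row_def root_col_def)

lemma pos_vec_n_plus: "k \<in> {1..9} \<Longrightarrow> c \<cdot>\<^sub>m pos_vec k \<in> n_plus"
  unfolding n_plus_def using pos_vec_root_space by (intro lie_gen.smult lie_gen.base) blast

lemma hw_module_lowering_vanish:
  assumes hw: "hw_module lam n \<rho> v" and k: "k \<in> {1..9}" and T: "T \<in> cartan"
    and br: "lie_br (c \<cdot>\<^sub>m pos_vec k) (neg_vec k) = T" "lie_br T (neg_vec k) = (- 2) \<cdot>\<^sub>m neg_vec k"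
    and m: "wt lam T = of_nat m"
  shows "act \<rho> (replicate (Suc m) (neg_vec k)) v = 0\<^sub>v n"
proof -
  interpret so7_rep n \<rho> using hw by unfold_locales (simp add: hw_module_def irreducible_rep_def)
  have v: "v \<in> carrier_vec n" using hw by (simp add: hw_module_def)
  have so: "c \<cdot>\<^sub>m pos_vec k \<in> so7" "neg_vec k \<in> so7" "T \<in> so7" using k T by (auto simp: cartan_def)
  have "act \<rho> (replicate j (neg_vec k)) v = ((\<lambda>w. \<rho> (neg_vec k) *\<^sub>v w) ^^ j) v" for j
    by (induction j) auto
  moreover have "((\<lambda>w. \<rho> (neg_vec k) *\<^sub>v w) ^^ Suc m) v = 0\<^sub>v n"
  proof (rule sl2_lowering_power_vanish[where E = "\<rho> (c \<cdot>\<^sub>m pos_vec k)" and H = "\<rho> T"])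
    fix w :: "complex vec" assume w: "w \<in> carrier_vec n"
    show "\<rho> (c \<cdot>\<^sub>m pos_vec k) *\<^sub>v (\<rho> (neg_vec k) *\<^sub>v w) = \<rho> (neg_vec k) *\<^sub>v (\<rho> (c \<cdot>\<^sub>m pos_vec k) *\<^sub>v w) + \<rho> T *\<^sub>v w"
      using bracket_vec[OF so(1,2) w] br by simp
    show "\<rho> T *\<^sub>v (\<rho> (neg_vec k) *\<^sub>v w) = \<rho> (neg_vec k) *\<^sub>v (\<rho> T *\<^sub>v w) + (- 2) \<cdot>\<^sub>v (\<rho> (neg_vec k) *\<^sub>v w)"
      using bracket_vec[OF so(3,2) w] br so w by (simp add: \<rho>_smult mult_mat_vec_smult[of _ n n])
  next
    show "\<rho> (c \<cdot>\<^sub>m pos_vec k) *\<^sub>v v = 0\<^sub>v n" using hw pos_vec_n_plus[OF k] by (simp add: hw_module_def)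
    show "\<rho> T *\<^sub>v v = of_nat m \<cdot>\<^sub>v v" using hw T m by (simp add: hw_module_def)
  qed (use so v in auto)
  ultimately show ?thesis by simp
qed

lemma root_vectors_scaled:
  assumes "\<And>i. i \<in> {1..9} \<Longrightarrow> e i \<in> root_space (- pos_root i) \<and> e i \<noteq> 0\<^sub>m 7 7"
  obtains \<kappa> where "\<And>i. i \<in> {1..9} \<Longrightarrow> e i = \<kappa> i \<cdot>\<^sub>m neg_vec i \<and> \<kappa> i \<noteq> 0"
proof
  fix i :: nat assume i: "i \<in> {1..9}"
  show "e i = e i $$ (root_row i, root_col i) \<cdot>\<^sub>m neg_vec i \<and> e i $$ (root_row i, root_col i) \<noteq> 0"
  proof
    show 1: "e i = e i $$ (root_row i, root_col i) \<cdot>\<^sub>m neg_vec i"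
      using root_space_neg[OF i] assms[OF i] by blast
    show "e i $$ (root_row i, root_col i) \<noteq> 0"
    proof
      assume "e i $$ (root_row i, root_col i) = 0"
      hence "e i = 0 \<cdot>\<^sub>m neg_vec i" using 1 by metis
      thus False using assms[OF i] by (simp add: zero_smult7)
    qed
  qed
qed

lemma g2_lower_subset:
  assumes "g2_in_so7 E F H"
  shows "lie_gen {F 1, F 2} \<subseteq> lower_so7"
  using assms n_minus_lower unfolding g2_in_so7_def by (meson order_trans)

text \<open>Every invariant functional on $V(\lambda)$ induces a word functional to which the bounds of the
  preceding sections apply. Since subtraction of natural numbers is truncated, the two inequalities
  are $p_3 \ge \max(0, p_3+p_5-l_3) + \max(0, p_3+p_5-l_1)$ and its companion for $l_2$.\<close>

theorem branching_signature_bounds: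
  assumes e: "\<And>i. i \<in> {1..9} \<Longrightarrow> e i \<in> root_space (- pos_root i) \<and> e i \<noteq> 0\<^sub>m 7 7"
    and g2: "g2_in_so7 E F H" and mem: "(lam, p) \<in> branching_semigroup e (lie_gen {F 1, F 2})"
  obtains l1 l2 l3 where "lam = (of_nat l1 + of_nat l2 + of_nat l3 / 2, of_nat l2 + of_nat l3 / 2, of_nat l3 / 2)"
    "\<And>i. i \<notin> {3, 5, 6} \<Longrightarrow> p i = 0"
    "(p 3 + p 5 - l3) + (p 3 + p 5 - l1) \<le> p 3" "(p 3 + p 5 - l3) + (p 3 + p 6 - l2) \<le> p 3"
proof -
  obtain n \<rho> v \<omega> where dom: "dominant lam" and hw: "hw_module lam n \<rho> v"
    and \<omega>: "\<omega> \<in> dual_invariants (lie_gen {F 1, F 2}) n \<rho>" and sign: "is_sign e \<rho> v \<omega> p"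
    using mem unfolding branching_semigroup_def by blast
  interpret so7_rep n \<rho> using hw by unfold_locales (simp add: hw_module_def irreducible_rep_def)
  have v: "v \<in> carrier_vec n" using hw by (simp add: hw_module_def)
  obtain x y z where lam: "lam = (x, y, z)" by (cases lam) auto
  obtain l1 where l1: "x - y = of_nat l1" using dom lam by (auto elim: Nats_cases)
  obtain l2 where l2: "y - z = of_nat l2" using dom lam by (auto elim: Nats_cases)
  obtain l3 where l3: "2 * z = of_nat l3" using dom lam by (auto elim: Nats_cases)
  obtain \<kappa> where \<kappa>: "\<And>i. i \<in> {1..9} \<Longrightarrow> e i = \<kappa> i \<cdot>\<^sub>m neg_vec i \<and> \<kappa> i \<noteq> 0"
    using root_vectors_scaled[OF e] by blast
  obtain a b c where abc: "a \<noteq> 0" "b \<noteq> 0" "c \<noteq> 0" "F 1 = b \<cdot>\<^sub>m neg_vec 5 + a \<cdot>\<^sub>m neg_vec 9" "F 2 = c \<cdot>\<^sub>m neg_vec 8"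
    using g2_in_so7_negative_simple[OF g2] by blast
  have sub: "X \<in> so7" if "X \<in> lie_gen {F 1, F 2}" for X
    using g2_lower_subset[OF g2] that by (auto simp: lower_so7_def)
  have inv: "\<omega> \<in> carrier_vec n \<and> (\<forall>X\<in>lie_gen {F 1, F 2}. \<forall>w\<in>carrier_vec n. \<omega> \<bullet> (\<rho> X *\<^sub>v w) = 0)"
    using \<omega> by (subst (asm) dual_invariants_iff) (auto simp: sub \<rho>_smult intro: lie_gen.smult)
  hence \<omega>c: "\<omega> \<in> carrier_vec n" by blast
  define \<Phi> where "\<Phi> ws = \<omega> \<bullet> act \<rho> ws v" for ws
  interpret so7_word_functional \<Phi> unfolding \<Phi>_def using word_functional[OF v \<omega>c] .
  have kill: "\<Phi> (X # w) = 0" if "X \<in> {F 1, F 2}" "w \<in> lists so7" for X w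
  proof -
    have "X \<in> lie_gen {F 1, F 2}" using that(1) by (rule lie_gen.base)
    thus ?thesis using inv that v by (simp add: \<Phi>_def)
  qed
  have sg: "p \<in> expos \<and> \<Phi> (map neg_vec (index_word p)) \<noteq> 0 \<and>
     (\<forall>q\<in>expos. \<Phi> (map neg_vec (index_word q)) \<noteq> 0 \<longrightarrow> q = p \<or> expo_greater q p)"
    unfolding \<Phi>_def using is_sign_iff[of e \<kappa> v \<omega> p] \<kappa> v \<omega>c sign by blast
  have right: "\<Phi> (u @ replicate (Suc m) (neg_vec k)) = 0"
    if "act \<rho> (replicate (Suc m) (neg_vec k)) v = 0\<^sub>v n" "u \<in> lists so7" for u m k
  proof -
    have "act \<rho> u (0\<^sub>v n) = act \<rho> u (0 \<cdot>\<^sub>v 0\<^sub>v n)" by (intro arg_cong[of _ _ "act \<rho> u"] eq_vecI) auto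
    also have "\<dots> = 0 \<cdot>\<^sub>v act \<rho> u (0\<^sub>v n)" using that by (intro act_smult) auto
    finally have "\<omega> \<bullet> act \<rho> u (0\<^sub>v n) = \<omega> \<bullet> (0 \<cdot>\<^sub>v act \<rho> u (0\<^sub>v n))" by (rule arg_cong)
    also have "\<dots> = 0" using that \<omega>c by simp
    finally show ?thesis unfolding \<Phi>_def act_append that(1) .
  qed
  have w: "wt lam (diag7 1 (-1) 0) = of_nat l1" "wt lam (diag7 0 1 (-1)) = of_nat l2" "wt lam (diag7 0 0 2) = of_nat l3"
    using l1 l2 l3 by (simp_all add: lam diag7_def algebra_simps)
  interpret g2_signature_functional \<Phi> p a b l1 l2 l3
  proof unfold_locales
    show "p \<in> expos" "\<Phi> (map neg_vec (index_word p)) \<noteq> 0" using sg by auto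
    show "q = p \<or> expo_greater q p" if "q \<in> expos" "\<Phi> (map neg_vec (index_word q)) \<noteq> 0" for q
      using sg that by blast
    show "a \<noteq> 0" "b \<noteq> 0" using abc by auto
    show "\<Phi> (neg_vec 8 # w) = 0" if "w \<in> lists so7" for w
      using kill[of "F 2" w] \<Phi>_smult[of "[]" "neg_vec 8" w c] that abc by simp
    show "a * \<Phi> (neg_vec 9 # w) = - b * \<Phi> (neg_vec 5 # w)" if "w \<in> lists so7" for w
      using kill[of "F 1" w] \<Phi>_add[of "[]" "b \<cdot>\<^sub>m neg_vec 5" "a \<cdot>\<^sub>m neg_vec 9" w] \<Phi>_smult[of "[]" "neg_vec 9" w a]
        \<Phi>_smult[of "[]" "neg_vec 5" w b] that abc by (simp add: add_eq_0_iff)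
    show "\<Phi> (u @ replicate (Suc l1) (neg_vec 9)) = 0" if "u \<in> lists so7" for u
      using that by (intro right hw_module_lowering_vanish[OF hw _ _ pos_neg_brackets(1) diag_neg_brackets(1) w(1)]) auto
    show "\<Phi> (u @ replicate (Suc l2) (neg_vec 8)) = 0" if "u \<in> lists so7" for u
      using that by (intro right hw_module_lowering_vanish[OF hw _ _ pos_neg_brackets(2) diag_neg_brackets(2) w(2)]) auto
    show "\<Phi> (u @ replicate (Suc l3) (neg_vec 5)) = 0" if "u \<in> lists so7" for u
      using that by (intro right hw_module_lowering_vanish[OF hw _ _ pos_neg_brackets(3) diag_neg_brackets(3) w(3)]) auto
  qed
  have "z = 2 * z / 2" by simp
  hence "z = of_nat l3 / 2" unfolding l3 .
  moreover from this have "y = of_nat l2 + of_nat l3 / 2" using l2 by (simp add: algebra_simps)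
  moreover from this have "x = of_nat l1 + of_nat l2 + of_nat l3 / 2" using l1 by (simp add: algebra_simps)
  ultimately show ?thesis using that[of l1 l2 l3] lam support exponent_bounds by blast
qed

section \<open>Tensor products of representations\<close>

text \<open>The conjugate transpose. It preserves $\mathfrak{so}_7$ and exchanges the two triangular parts;
  representations that commute with it are the unitary ones for the compact real form.\<close>

definition adj :: "complex mat \<Rightarrow> complex mat" where
  "adj A = mat (dim_col A) (dim_row A) (\<lambda>(i, j). cnj (A $$ (j, i)))"

lemma adj_carrier [simp]: "A \<in> carrier_mat n m \<Longrightarrow> adj A \<in> carrier_mat m n"
  by (auto simp: adj_def)

lemma adj_index [simp]: "A \<in> carrier_mat n m \<Longrightarrow> i < m \<Longrightarrow> j < n \<Longrightarrow> adj A $$ (i, j) = cnj (A $$ (j, i))"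
  by (auto simp: adj_def)

lemma adj_so7 [simp]: "X \<in> so7 \<Longrightarrow> adj X \<in> so7"
proof -
  assume X: "X \<in> so7"
  show ?thesis unfolding so7_iff
  proof (intro conjI allI impI)
    fix i j :: nat assume ij: "i < 7" "j < 7"
    hence lt: "6 - j < 7" "6 - i < 7" by simp_all
    show "adj X $$ (i, j) = - adj X $$ (6 - j, 6 - i)"
      unfolding adj_index[OF so7_carrier[OF X] ij] adj_index[OF so7_carrier[OF X] lt] so7_entry[OF X ij(2) ij(1)] by simp
  qed (use X in simp)
qed

lemma sum_div_mod:
  fixes n m :: nat and g :: "nat \<Rightarrow> nat \<Rightarrow> complex"
  shows "(\<Sum>i\<in>{0..<n * m}. g (i div m) (i mod m)) = (\<Sum>a\<in>{0..<n}. \<Sum>b\<in>{0..<m}. g a b)"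
proof -
  have "(\<Sum>i\<in>{0..<n * m}. g (i div m) (i mod m)) = (\<Sum>(a, b)\<in>{0..<n} \<times> {0..<m}. g a b)"
  proof (rule sum.reindex_bij_witness[where j = "\<lambda>i. (i div m, i mod m)" and i = "\<lambda>(a, b). a * m + b"])
    fix i assume "i \<in> {0..<n * m}"
    hence i: "i < n * m" by simp
    hence "m > 0" by (cases m) auto
    thus "(i div m, i mod m) \<in> {0..<n} \<times> {0..<m}" using i by (simp add: less_mult_imp_div_less)
  next
    fix x assume "x \<in> {0..<n} \<times> {0..<m}"
    then obtain a b where x: "x = (a, b)" "a < n" "b < m" by auto
    have "a * m + b < Suc a * m" using x by simp
    also have "\<dots> \<le> n * m" using x by (intro mult_le_mono1) simp
    finally show "(case x of (a, b) \<Rightarrow> a * m + b) \<in> {0..<n * m}" using x by simp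
  qed auto
  thus ?thesis by (simp add: sum.cartesian_product)
qed

definition kron :: "complex mat \<Rightarrow> complex mat \<Rightarrow> complex mat" where
  "kron A B = mat (dim_row A * dim_row B) (dim_col A * dim_col B)
     (\<lambda>(i, j). A $$ (i div dim_row B, j div dim_col B) * B $$ (i mod dim_row B, j mod dim_col B))"

text \<open>The indexing by quotient and remainder identifies $\mathbb C^n\otimes\mathbb C^m$ with
  $\mathbb C^{nm}$.\<close>

definition kron_vec :: "complex vec \<Rightarrow> complex vec \<Rightarrow> complex vec" where
  "kron_vec x y = vec (dim_vec x * dim_vec y) (\<lambda>i. x $ (i div dim_vec y) * y $ (i mod dim_vec y))"

lemma kron_carrier [simp]: "A \<in> carrier_mat n n' \<Longrightarrow> B \<in> carrier_mat m m' \<Longrightarrow> kron A B \<in> carrier_mat (n * m) (n' * m')"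
  by (auto simp: kron_def)

lemma kron_index: "A \<in> carrier_mat n n' \<Longrightarrow> B \<in> carrier_mat m m' \<Longrightarrow> i < n * m \<Longrightarrow> j < n' * m' \<Longrightarrow>
    kron A B $$ (i, j) = A $$ (i div m, j div m') * B $$ (i mod m, j mod m')"
  by (auto simp: kron_def)

lemma kron_vec_carrier [simp]: "x \<in> carrier_vec n \<Longrightarrow> y \<in> carrier_vec m \<Longrightarrow> kron_vec x y \<in> carrier_vec (n * m)"
  by (auto simp: kron_vec_def)

lemma kron_vec_index: "x \<in> carrier_vec n \<Longrightarrow> y \<in> carrier_vec m \<Longrightarrow> i < n * m \<Longrightarrow>
   kron_vec x y $ i = x $ (i div m) * y $ (i mod m)"
  by (auto simp: kron_vec_def)

lemma div_mod_less: "i < n * m \<Longrightarrow> i div m < n \<and> i mod m < (m :: nat)"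
  by (cases "m = 0") (auto simp: less_mult_imp_div_less)

lemma kron_mult:
  assumes "A \<in> carrier_mat n n" "B \<in> carrier_mat m m" "C \<in> carrier_mat n n" "D \<in> carrier_mat m m"
  shows "kron A B * kron C D = kron (A * C) (B * D)"
proof (rule eq_matI)
  have AC: "A * C \<in> carrier_mat n n" and BD: "B * D \<in> carrier_mat m m" using assms by auto
  note k = kron_carrier[OF assms(1,2)] kron_carrier[OF assms(3,4)] kron_carrier[OF AC BD]
  show "dim_row (kron A B * kron C D) = dim_row (kron (A * C) (B * D))"
    "dim_col (kron A B * kron C D) = dim_col (kron (A * C) (B * D))" using k by auto
  fix i j assume "i < dim_row (kron (A * C) (B * D))" "j < dim_col (kron (A * C) (B * D))"
  hence ij: "i < n * m" "j < n * m" using k by auto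
  have "(kron A B * kron C D) $$ (i, j) = (\<Sum>l\<in>{0..<n * m}. kron A B $$ (i, l) * kron C D $$ (l, j))"
    using k ij by (simp add: scalar_prod_def)
  also have "\<dots> = (\<Sum>l\<in>{0..<n * m}. (A $$ (i div m, l div m) * B $$ (i mod m, l mod m)) * (C $$ (l div m, j div m) * D $$ (l mod m, j mod m)))"
    using ij by (intro sum.cong HOL.refl) (simp add: kron_index[OF assms(1,2)] kron_index[OF assms(3,4)])
  also have "\<dots> = (\<Sum>a\<in>{0..<n}. \<Sum>b\<in>{0..<m}. (A $$ (i div m, a) * B $$ (i mod m, b)) * (C $$ (a, j div m) * D $$ (b, j mod m)))"
    by (rule sum_div_mod)
  also have "\<dots> = (\<Sum>a\<in>{0..<n}. A $$ (i div m, a) * C $$ (a, j div m)) * (\<Sum>b\<in>{0..<m}. B $$ (i mod m, b) * D $$ (b, j mod m))"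
    by (simp add: sum_product algebra_simps)
  also have "\<dots> = kron (A * C) (B * D) $$ (i, j)"
    using assms div_mod_less[OF ij(1)] div_mod_less[OF ij(2)] by (subst kron_index[OF AC BD ij]) (simp add: scalar_prod_def)
  finally show "(kron A B * kron C D) $$ (i, j) = kron (A * C) (B * D) $$ (i, j)" .
qed

lemma kron_mult_vec:
  assumes "A \<in> carrier_mat n n" "B \<in> carrier_mat m m" "x \<in> carrier_vec n" "y \<in> carrier_vec m"
  shows "kron A B *\<^sub>v kron_vec x y = kron_vec (A *\<^sub>v x) (B *\<^sub>v y)"
proof (rule eq_vecI)
  have Ax: "A *\<^sub>v x \<in> carrier_vec n" and By: "B *\<^sub>v y \<in> carrier_vec m" using assms by auto
  note k = kron_carrier[OF assms(1,2)] kron_vec_carrier[OF assms(3,4)] kron_vec_carrier[OF Ax By]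
  show "dim_vec (kron A B *\<^sub>v kron_vec x y) = dim_vec (kron_vec (A *\<^sub>v x) (B *\<^sub>v y))" using k by auto
  fix i assume "i < dim_vec (kron_vec (A *\<^sub>v x) (B *\<^sub>v y))"
  hence i: "i < n * m" using k by auto
  have "(kron A B *\<^sub>v kron_vec x y) $ i = (\<Sum>l\<in>{0..<n * m}. kron A B $$ (i, l) * kron_vec x y $ l)"
    using k i by (simp add: scalar_prod_def)
  also have "\<dots> = (\<Sum>l\<in>{0..<n * m}. (A $$ (i div m, l div m) * B $$ (i mod m, l mod m)) * (x $ (l div m) * y $ (l mod m)))"
    using i by (intro sum.cong HOL.refl) (simp add: kron_index[OF assms(1,2)] kron_vec_index[OF assms(3,4)])
  also have "\<dots> = (\<Sum>a\<in>{0..<n}. \<Sum>b\<in>{0..<m}. (A $$ (i div m, a) * B $$ (i mod m, b)) * (x $ a * y $ b))"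
    by (rule sum_div_mod)
  also have "\<dots> = (\<Sum>a\<in>{0..<n}. A $$ (i div m, a) * x $ a) * (\<Sum>b\<in>{0..<m}. B $$ (i mod m, b) * y $ b)"
    by (simp add: sum_product algebra_simps)
  also have "\<dots> = kron_vec (A *\<^sub>v x) (B *\<^sub>v y) $ i"
    using assms div_mod_less[OF i] by (subst kron_vec_index[OF Ax By i]) (simp add: scalar_prod_def)
  finally show "(kron A B *\<^sub>v kron_vec x y) $ i = kron_vec (A *\<^sub>v x) (B *\<^sub>v y) $ i" .
qed

lemma kron_vec_scalar_prod:
  assumes "a \<in> carrier_vec n" "b \<in> carrier_vec m" "x \<in> carrier_vec n" "y \<in> carrier_vec m"
  shows "kron_vec a b \<bullet> kron_vec x y = (a \<bullet> x) * (b \<bullet> y)"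
proof -
  have "kron_vec a b \<bullet> kron_vec x y = (\<Sum>l\<in>{0..<n * m}. (a $ (l div m) * b $ (l mod m)) * (x $ (l div m) * y $ (l mod m)))"
    unfolding scalar_prod_def carrier_vecD[OF kron_vec_carrier[OF assms(3,4)]]
    by (intro sum.cong) (auto simp: kron_vec_index[OF assms(1,2)] kron_vec_index[OF assms(3,4)])
  also have "\<dots> = (\<Sum>i\<in>{0..<n}. \<Sum>j\<in>{0..<m}. (a $ i * b $ j) * (x $ i * y $ j))"
    by (rule sum_div_mod)
  also have "\<dots> = (a \<bullet> x) * (b \<bullet> y)"
    using assms by (simp add: scalar_prod_def sum_product algebra_simps)
  finally show ?thesis .
qed

lemma scalar_prod_mult_mat_vec:
  fixes A :: "complex mat"
  assumes "A \<in> carrier_mat n m" "\<xi> \<in> carrier_vec n" "u \<in> carrier_vec m"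
  shows "\<xi> \<bullet> (A *\<^sub>v u) = (A\<^sup>T *\<^sub>v \<xi>) \<bullet> u"
proof -
  have "\<xi> \<bullet> (A *\<^sub>v u) = (\<Sum>i\<in>{0..<n}. \<Sum>j\<in>{0..<m}. \<xi> $ i * (A $$ (i, j) * u $ j))"
    using assms by (simp add: scalar_prod_def sum_distrib_left)
  also have "\<dots> = (\<Sum>j\<in>{0..<m}. \<Sum>i\<in>{0..<n}. \<xi> $ i * (A $$ (i, j) * u $ j))" by (rule sum.swap)
  also have "\<dots> = (A\<^sup>T *\<^sub>v \<xi>) \<bullet> u"
    using assms by (simp add: scalar_prod_def sum_distrib_right sum_distrib_left algebra_simps)
  finally show ?thesis .
qed

definition tensor_rep :: "nat \<Rightarrow> (complex mat \<Rightarrow> complex mat) \<Rightarrow> nat \<Rightarrow> (complex mat \<Rightarrow> complex mat) \<Rightarrow> complex mat \<Rightarrow> complex mat" where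
  "tensor_rep n \<rho> m \<tau> X = kron (\<rho> X) (1\<^sub>m m) + kron (1\<^sub>m n) (\<tau> X)"

lemma kron_add_left: "A \<in> carrier_mat n n \<Longrightarrow> A' \<in> carrier_mat n n \<Longrightarrow> B \<in> carrier_mat m m \<Longrightarrow> kron (A + A') B = kron A B + kron A' B"
proof (rule eq_matI, goal_cases)
  case (1 i j)
  hence ij: "i < n * m" "j < n * m" by (auto simp: kron_def)
  have A: "A + A' \<in> carrier_mat n n" using 1 by simp
  show ?case using 1 ij div_mod_less[OF ij(1)] div_mod_less[OF ij(2)]
    by (subst index_add_mat) (auto simp: kron_index[OF A 1(3) ij] kron_index[OF 1(1) 1(3) ij] kron_index[OF 1(2) 1(3) ij] kron_def algebra_simps)
qed (auto simp: kron_def)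

lemma kron_add_right: "A \<in> carrier_mat n n \<Longrightarrow> B \<in> carrier_mat m m \<Longrightarrow> B' \<in> carrier_mat m m \<Longrightarrow> kron A (B + B') = kron A B + kron A B'"
proof (rule eq_matI, goal_cases)
  case (1 i j)
  hence ij: "i < n * m" "j < n * m" by (auto simp: kron_def)
  have A: "B + B' \<in> carrier_mat m m" using 1 by simp
  show ?case using 1 ij div_mod_less[OF ij(1)] div_mod_less[OF ij(2)]
    by (subst index_add_mat) (auto simp: kron_index[OF 1(1) A ij] kron_index[OF 1(1) 1(2) ij] kron_index[OF 1(1) 1(3) ij] kron_def algebra_simps)
qed (auto simp: kron_def)

lemma kron_smult_left: "A \<in> carrier_mat n n \<Longrightarrow> B \<in> carrier_mat m m \<Longrightarrow> kron (c \<cdot>\<^sub>m A) B = c \<cdot>\<^sub>m kron A B"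
proof (rule eq_matI, goal_cases)
  case (1 i j)
  hence ij: "i < n * m" "j < n * m" by (auto simp: kron_def)
  have A: "c \<cdot>\<^sub>m A \<in> carrier_mat n n" using 1 by simp
  show ?case using 1 ij div_mod_less[OF ij(1)] div_mod_less[OF ij(2)]
    by (auto simp: kron_index[OF A 1(2) ij] kron_index[OF 1(1) 1(2) ij] kron_def)
qed (auto simp: kron_def)

lemma kron_smult_right: "A \<in> carrier_mat n n \<Longrightarrow> B \<in> carrier_mat m m \<Longrightarrow> kron A (c \<cdot>\<^sub>m B) = c \<cdot>\<^sub>m kron A B"
proof (rule eq_matI, goal_cases)
  case (1 i j)
  hence ij: "i < n * m" "j < n * m" by (auto simp: kron_def)
  have A: "c \<cdot>\<^sub>m B \<in> carrier_mat m m" using 1 by simp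
  show ?case using 1 ij div_mod_less[OF ij(1)] div_mod_less[OF ij(2)]
    by (auto simp: kron_index[OF 1(1) A ij] kron_index[OF 1(1) 1(2) ij] kron_def)
qed (auto simp: kron_def)

lemma minus_eq_add_smult: "A \<in> carrier_mat n m \<Longrightarrow> B \<in> carrier_mat n m \<Longrightarrow> A - B = A + (-1) \<cdot>\<^sub>m (B :: complex mat)"
  by (intro eq_matI) auto

lemma adj_kron: "A \<in> carrier_mat n n \<Longrightarrow> B \<in> carrier_mat m m \<Longrightarrow> adj (kron A B) = kron (adj A) (adj B)"
proof (rule eq_matI, goal_cases)
  case (1 i j)
  hence ij: "i < n * m" "j < n * m" by (auto simp: kron_def adj_def)
  show ?case using 1 ij div_mod_less[OF ij(1)] div_mod_less[OF ij(2)]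
    by (simp add: kron_index[OF adj_carrier[OF 1(1)] adj_carrier[OF 1(2)] ij] kron_index[OF 1(1) 1(2) ij(2,1)]
      adj_index[OF kron_carrier[OF 1(1,2)]])
qed (auto simp: kron_def adj_def)

lemma adj_add: "A \<in> carrier_mat n m \<Longrightarrow> B \<in> carrier_mat n m \<Longrightarrow> adj (A + B) = adj A + adj B"
  by (rule eq_matI) (auto simp: adj_def)

lemma adj_one [simp]: "adj (1\<^sub>m n) = 1\<^sub>m n"
  by (rule eq_matI) (auto simp: adj_def)

lemma commutator_cancel:
  fixes A :: "complex mat"
  assumes "A \<in> carrier_mat N N" "A' \<in> carrier_mat N N" "B \<in> carrier_mat N N" "B' \<in> carrier_mat N N"
    "K \<in> carrier_mat N N" "L \<in> carrier_mat N N"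
  shows "(A + K + (L + B)) - (A' + L + (K + B')) = (A + (-1) \<cdot>\<^sub>m A') + (B + (-1) \<cdot>\<^sub>m B')"
  using assms by (intro eq_matI) (auto simp: algebra_simps)

lemma lie_rep_tensor:
  assumes \<rho>: "lie_rep so7 n \<rho>" and \<tau>: "lie_rep so7 m \<tau>"
  shows "lie_rep so7 (n * m) (tensor_rep n \<rho> m \<tau>)"
  unfolding lie_rep_def
proof (intro conjI ballI allI)
  interpret R: so7_rep n \<rho> by unfold_locales fact
  interpret S: so7_rep m \<tau> by unfold_locales fact
  note o = one_carrier_mat[of n] one_carrier_mat[of m]
  fix X assume X: "X \<in> so7"
  note r = R.\<rho>_carrier[OF X] and s = S.\<rho>_carrier[OF X]
  show "tensor_rep n \<rho> m \<tau> X \<in> carrier_mat (n * m) (n * m)" using r s by (simp add: tensor_rep_def)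
  show "tensor_rep n \<rho> m \<tau> (c \<cdot>\<^sub>m X) = c \<cdot>\<^sub>m tensor_rep n \<rho> m \<tau> X" for c
    unfolding tensor_rep_def R.\<rho>_smult[OF X] S.\<rho>_smult[OF X] kron_smult_left[OF r o(2)] kron_smult_right[OF o(1) s]
    by (rule add_smult_distrib_left_mat[symmetric, OF kron_carrier kron_carrier]) (use r s in auto)
  fix Y assume Y: "Y \<in> so7"
  note r' = R.\<rho>_carrier[OF Y] and s' = S.\<rho>_carrier[OF Y]
  note K = kron_carrier[OF r o(2)] kron_carrier[OF r' o(2)] kron_carrier[OF o(1) s] kron_carrier[OF o(1) s']
  show "tensor_rep n \<rho> m \<tau> (X + Y) = tensor_rep n \<rho> m \<tau> X + tensor_rep n \<rho> m \<tau> Y"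
    unfolding tensor_rep_def R.\<rho>_add[OF X Y] S.\<rho>_add[OF X Y] kron_add_left[OF r r' o(2)] kron_add_right[OF o(1) s s']
    using K by (intro eq_matI) auto
  let ?P = "kron (\<rho> X) (1\<^sub>m m)" and ?P' = "kron (\<rho> Y) (1\<^sub>m m)" and ?Q = "kron (1\<^sub>m n) (\<tau> X)" and ?Q' = "kron (1\<^sub>m n) (\<tau> Y)"
  have pp: "?P * ?P' = kron (\<rho> X * \<rho> Y) (1\<^sub>m m)" "?P' * ?P = kron (\<rho> Y * \<rho> X) (1\<^sub>m m)"
    "?Q * ?Q' = kron (1\<^sub>m n) (\<tau> X * \<tau> Y)" "?Q' * ?Q = kron (1\<^sub>m n) (\<tau> Y * \<tau> X)"
    "?P * ?Q' = kron (\<rho> X) (\<tau> Y)" "?Q' * ?P = kron (\<rho> X) (\<tau> Y)"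
    "?Q * ?P' = kron (\<rho> Y) (\<tau> X)" "?P' * ?Q = kron (\<rho> Y) (\<tau> X)"
    using r s r' s' by (simp_all add: kron_mult[of _ n _ m])
  have c: "\<rho> X * \<rho> Y \<in> carrier_mat n n" "\<rho> Y * \<rho> X \<in> carrier_mat n n" "\<tau> X * \<tau> Y \<in> carrier_mat m m" "\<tau> Y * \<tau> X \<in> carrier_mat m m"
    using r s r' s' by auto
  have "lie_br (?P + ?Q) (?P' + ?Q') = (?P * ?P' + ?Q * ?P' + (?P * ?Q' + ?Q * ?Q')) - (?P' * ?P + ?Q' * ?P + (?P' * ?Q + ?Q' * ?Q))"
    unfolding lie_br_def using K
    by (simp add: add_mult_distrib_mat[of _ "n*m" "n*m" _ _ "n*m"] mult_add_distrib_mat[of _ "n*m" "n*m" _ "n*m"] add_carrier_mat[of _ "n*m" "n*m"])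
  also have "\<dots> = (?P * ?P' + (-1) \<cdot>\<^sub>m (?P' * ?P)) + (?Q * ?Q' + (-1) \<cdot>\<^sub>m (?Q' * ?Q))"
    unfolding pp
    by (rule commutator_cancel[OF kron_carrier[OF c(1) o(2)] kron_carrier[OF c(2) o(2)] kron_carrier[OF o(1) c(3)]
      kron_carrier[OF o(1) c(4)] kron_carrier[OF r' s] kron_carrier[OF r s']])
  also have "\<dots> = tensor_rep n \<rho> m \<tau> (lie_br X Y)"
    unfolding tensor_rep_def R.\<rho>_bracket[OF X Y] S.\<rho>_bracket[OF X Y]
    unfolding lie_br_def minus_eq_add_smult[OF c(1,2)] minus_eq_add_smult[OF c(3,4)]
    unfolding kron_add_left[OF c(1) smult_carrier_mat[OF c(2)] o(2)] kron_add_right[OF o(1) c(3) smult_carrier_mat[OF c(4)]]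
      kron_smult_left[OF c(2) o(2)] kron_smult_right[OF o(1) c(4)] pp ..
  finally show "tensor_rep n \<rho> m \<tau> (lie_br X Y) = lie_br (tensor_rep n \<rho> m \<tau> X) (tensor_rep n \<rho> m \<tau> Y)"
    unfolding tensor_rep_def ..
qed

lemma tensor_rep_kron_vec:
  assumes "\<rho> X \<in> carrier_mat n n" "\<tau> X \<in> carrier_mat m m" "x \<in> carrier_vec n" "y \<in> carrier_vec m"
  shows "tensor_rep n \<rho> m \<tau> X *\<^sub>v kron_vec x y = kron_vec (\<rho> X *\<^sub>v x) y + kron_vec x (\<tau> X *\<^sub>v y)"
proof -
  have "tensor_rep n \<rho> m \<tau> X *\<^sub>v kron_vec x y = kron (\<rho> X) (1\<^sub>m m) *\<^sub>v kron_vec x y + kron (1\<^sub>m n) (\<tau> X) *\<^sub>v kron_vec x y"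
    unfolding tensor_rep_def using assms by (intro add_mult_distrib_mat_vec[of _ "n*m" "n*m"]) auto
  thus ?thesis using assms by (simp add: kron_mult_vec[of _ n _ m])
qed

lemma adj_tensor_rep:
  assumes "lie_rep so7 n \<rho>" "lie_rep so7 m \<tau>" "X \<in> so7" "\<rho> (adj X) = adj (\<rho> X)" "\<tau> (adj X) = adj (\<tau> X)"
  shows "tensor_rep n \<rho> m \<tau> (adj X) = adj (tensor_rep n \<rho> m \<tau> X)"
proof -
  have c: "\<rho> X \<in> carrier_mat n n" "\<tau> X \<in> carrier_mat m m" using assms by (auto simp: lie_rep_def)
  show ?thesis unfolding tensor_rep_def
    using c assms(4,5) kron_carrier[OF c(1) one_carrier_mat[of m]] kron_carrier[OF one_carrier_mat[of n] c(2)]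
    by (simp add: adj_add[of _ "n*m" "n*m"] adj_kron[of _ n _ m])
qed

section \<open>Unitary highest weight representations\<close>

lemma adj_adj [simp]: "adj (adj A) = A"
  by (rule eq_matI) (auto simp: adj_def)

lemma adj_mult:
  assumes "A \<in> carrier_mat n m" "B \<in> carrier_mat m k"
  shows "adj (A * B) = adj B * adj A"
proof (rule eq_matI)
  fix i j assume "i < dim_row (adj B * adj A)" "j < dim_col (adj B * adj A)"
  hence ij: "i < k" "j < n" using assms by (auto simp: adj_def)
  have "adj (A * B) $$ (i, j) = (\<Sum>l\<in>{0..<m}. cnj (A $$ (j, l)) * cnj (B $$ (l, i)))"
    using assms ij by (simp add: adj_def scalar_prod_def)
  also have "\<dots> = (adj B * adj A) $$ (i, j)"
    using assms ij by (simp add: adj_def scalar_prod_def mult.commute)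
  finally show "adj (A * B) $$ (i, j) = (adj B * adj A) $$ (i, j)" .
qed (use assms in \<open>auto simp: adj_def\<close>)

lemma mat_eq_by_vec:
  fixes A :: "complex mat"
  assumes "A \<in> carrier_mat n m" "B \<in> carrier_mat n m" "\<And>x. x \<in> carrier_vec m \<Longrightarrow> A *\<^sub>v x = B *\<^sub>v x"
  shows "A = B"
proof (rule eq_matI)
  fix i j assume "i < dim_row B" "j < dim_col B"
  hence ij: "i < n" "j < m" using assms by auto
  have "C $$ (i, j) = (C *\<^sub>v unit_vec m j) $ i" if "C \<in> carrier_mat n m" for C :: "complex mat"
    using that ij by (simp add: scalar_prod_right_unit)
  thus "A $$ (i, j) = B $$ (i, j)" using assms assms(3)[of "unit_vec m j"] by simp
qed (use assms in auto)

definition ip :: "complex vec \<Rightarrow> complex vec \<Rightarrow> complex" where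
  "ip u x = map_vec cnj u \<bullet> x"

lemma ip_adj:
  assumes "A \<in> carrier_mat n m" "u \<in> carrier_vec n" "x \<in> carrier_vec m"
  shows "ip u (A *\<^sub>v x) = ip (adj A *\<^sub>v u) x"
proof -
  have "A\<^sup>T *\<^sub>v map_vec cnj u = map_vec cnj (adj A *\<^sub>v u)"
    using assms by (intro eq_vecI) (auto simp: adj_def scalar_prod_def)
  thus ?thesis unfolding ip_def using assms by (subst scalar_prod_mult_mat_vec[of _ n m]) auto
qed

lemma ip_add: "u \<in> carrier_vec n \<Longrightarrow> x \<in> carrier_vec n \<Longrightarrow> y \<in> carrier_vec n \<Longrightarrow> ip u (x + y) = ip u x + ip u y"
  unfolding ip_def by (rule scalar_prod_add_distrib) auto

lemma ip_smult: "u \<in> carrier_vec n \<Longrightarrow> x \<in> carrier_vec n \<Longrightarrow> ip u (c \<cdot>\<^sub>v x) = c * ip u x"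
  unfolding ip_def by simp

lemma ip_self: "u \<in> carrier_vec n \<Longrightarrow> ip u u = of_real (\<Sum>i\<in>{0..<n}. (cmod (u $ i))\<^sup>2)"
  unfolding ip_def scalar_prod_def of_real_sum
  by (intro sum.cong) (auto simp: complex_norm_square[symmetric] mult.commute)

lemma ip_self_eq_0:
  assumes "u \<in> carrier_vec n" "ip u u = 0" shows "u = 0\<^sub>v n"
proof -
  have "(\<Sum>i\<in>{0..<n}. (cmod (u $ i))\<^sup>2) = 0" using assms ip_self by (metis of_real_eq_0_iff)
  hence "\<forall>i\<in>{0..<n}. (cmod (u $ i))\<^sup>2 = 0" by (subst (asm) sum_nonneg_eq_0_iff) auto
  thus ?thesis using assms(1) by (intro eq_vecI) auto
qed

lemma adj_dim [simp]: "dim_row (adj A) = dim_col A" "dim_col (adj A) = dim_row A"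
  by (simp_all add: adj_def)

lemma orthonormal_columns_cancel:
  assumes "P \<in> carrier_mat n m" "adj P * P = 1\<^sub>m m" "x \<in> carrier_vec m"
  shows "adj P *\<^sub>v (P *\<^sub>v x) = x"
proof -
  have "adj P *\<^sub>v (P *\<^sub>v x) = (adj P * P) *\<^sub>v x"
    by (rule assoc_mult_mat_vec[symmetric, OF adj_carrier[OF assms(1)] assms(1,3)])
  thus ?thesis using assms by simp
qed

lemma orthonormal_columns_bound:
  assumes P: "P \<in> carrier_mat n m" and o: "adj P * P = 1\<^sub>m m"
  shows "m \<le> n"
proof (rule ccontr)
  assume "\<not> m \<le> n"
  hence nm: "n < m" by simp
  define A where "A = mat m m (\<lambda>(i, j). if i < n then P $$ (i, j) else 0)"
  define B where "B = mat m m (\<lambda>(i, j). if j < n then adj P $$ (i, j) else 0)"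
  have "B * A = 1\<^sub>m m"
  proof (rule eq_matI)
    fix i j assume "i < dim_row (1\<^sub>m m :: complex mat)" "j < dim_col (1\<^sub>m m :: complex mat)"
    hence ij: "i < m" "j < m" by auto
    have "(B * A) $$ (i, j) = (\<Sum>l\<in>{0..<m}. if l < n then adj P $$ (i, l) * P $$ (l, j) else 0)"
      using ij by (auto simp: A_def B_def scalar_prod_def intro!: sum.cong)
    also have "\<dots> = (\<Sum>l\<in>{0..<n}. adj P $$ (i, l) * P $$ (l, j))"
      using nm by (intro sum.mono_neutral_cong_right) auto
    also have "\<dots> = (adj P * P) $$ (i, j)" using P ij by (simp add: scalar_prod_def)
    finally show "(B * A) $$ (i, j) = 1\<^sub>m m $$ (i, j)" unfolding o .
  qed (auto simp: A_def B_def)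
  hence "A * B = 1\<^sub>m m" by (intro mat_mult_left_right_inverse[of B]) (auto simp: A_def B_def)
  hence "(A * B) $$ (n, n) = 1" using nm by simp
  moreover have "(A * B) $$ (n, n) = 0" using nm by (simp add: A_def B_def scalar_prod_def)
  ultimately show False by simp
qed

text \<open>A subspace of $\mathbb C^n$ as the image of an isometry. The columns are collected one at a time by
  orthogonal projection; a family of orthonormal columns in the subspace of maximal length spans
  it.\<close>

lemma orthonormal_basis_exists:
  assumes W: "W \<subseteq> carrier_vec n" "0\<^sub>v n \<in> W" "\<And>x y. x \<in> W \<Longrightarrow> y \<in> W \<Longrightarrow> x + y \<in> W" "\<And>c x. x \<in> W \<Longrightarrow> c \<cdot>\<^sub>v x \<in> W"
  obtains m P where "P \<in> carrier_mat n m" "adj P * P = 1\<^sub>m m" "W = {P *\<^sub>v x | x. x \<in> carrier_vec m}"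
proof -
  define Q where "Q m \<longleftrightarrow> (\<exists>P\<in>carrier_mat n m. adj P * P = 1\<^sub>m m \<and> (\<forall>x\<in>carrier_vec m. P *\<^sub>v x \<in> W))" for m
  have "Q 0" unfolding Q_def
  proof (intro bexI[of _ "0\<^sub>m n 0"] conjI ballI)
    show "adj (0\<^sub>m n 0) * 0\<^sub>m n 0 = 1\<^sub>m 0" by (rule eq_matI) (auto simp: adj_def)
    fix x :: "complex vec" assume "x \<in> carrier_vec 0"
    hence "0\<^sub>m n 0 *\<^sub>v x = 0\<^sub>v n" by (intro eq_vecI) (auto simp: scalar_prod_def)
    thus "0\<^sub>m n 0 *\<^sub>v x \<in> W" using W by simp
  qed simp
  moreover have "\<forall>m. Q m \<longrightarrow> m < Suc n" unfolding Q_def using orthonormal_columns_bound by (auto simp: less_Suc_eq_le)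
  ultimately obtain m where m: "Q m" "\<forall>k. Q k \<longrightarrow> k \<le> m"
    using ex_has_greatest_nat[of Q 0 "\<lambda>k. k" "Suc n"] by auto
  then obtain P where P: "P \<in> carrier_mat n m" "adj P * P = 1\<^sub>m m" "\<And>x. x \<in> carrier_vec m \<Longrightarrow> P *\<^sub>v x \<in> W"
    unfolding Q_def by blast
  have aP: "adj P \<in> carrier_mat m n" using P by simp
  have "w \<in> {P *\<^sub>v x | x. x \<in> carrier_vec m}" if w: "w \<in> W" for w
  proof (rule ccontr)
    assume notin: "w \<notin> {P *\<^sub>v x | x. x \<in> carrier_vec m}"
    have wc: "w \<in> carrier_vec n" using w W by blast
    define y where "y = adj P *\<^sub>v w"
    have y: "y \<in> carrier_vec m" using aP wc by (simp add: y_def)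
    define z where "z = w + (-1) \<cdot>\<^sub>v (P *\<^sub>v y)"
    have Py: "P *\<^sub>v y \<in> W" "P *\<^sub>v y \<in> carrier_vec n" using P y by auto
    have z: "z \<in> W" "z \<in> carrier_vec n" using W w wc Py unfolding z_def by auto
    have "adj P *\<^sub>v (P *\<^sub>v y) = y" by (rule orthonormal_columns_cancel[OF P(1,2) y])
    hence az: "adj P *\<^sub>v z = 0\<^sub>v m"
      unfolding z_def using aP wc Py y
      by (subst mult_add_distrib_mat_vec[of _ m n]) (auto simp: mult_mat_vec[of _ m n] y_def[symmetric] intro!: eq_vecI)
    have "z \<noteq> 0\<^sub>v n"
    proof
      assume z0: "z = 0\<^sub>v n"
      have "w = P *\<^sub>v y"
      proof (rule eq_vecI)
        fix i assume i: "i < dim_vec (P *\<^sub>v y)"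
        hence "z $ i = 0" using z0 P by simp
        thus "w $ i = (P *\<^sub>v y) $ i" using i wc Py by (simp add: z_def)
      qed (use wc Py P in auto)
      thus False using notin y by blast
    qed
    define s where "s = (\<Sum>i\<in>{0..<n}. (cmod (z $ i))\<^sup>2)"
    have "ip z z = of_real s" unfolding s_def by (rule ip_self[OF z(2)])
    hence "s \<noteq> 0" using ip_self_eq_0[OF z(2)] \<open>z \<noteq> 0\<^sub>v n\<close> by auto
    moreover have "s \<ge> 0" unfolding s_def by (intro sum_nonneg) auto
    ultimately have s: "s > 0" by simp
    define u where "u = of_real (1 / sqrt s) \<cdot>\<^sub>v z"
    have u: "u \<in> W" "u \<in> carrier_vec n" using W z unfolding u_def by auto
    have au: "adj P *\<^sub>v u = 0\<^sub>v m" unfolding u_def using aP z az by (auto simp: mult_mat_vec[of _ m n] intro!: eq_vecI)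
    have uu: "(\<Sum>i\<in>{0..<n}. cnj (u $ i) * u $ i) = 1"
    proof -
      have "(\<Sum>i\<in>{0..<n}. cnj (u $ i) * u $ i) = ip u u" using u by (simp add: ip_def scalar_prod_def)
      also have "\<dots> = of_real (\<Sum>i\<in>{0..<n}. (cmod (u $ i))\<^sup>2)" using ip_self[OF u(2)] .
      also have "(\<Sum>i\<in>{0..<n}. (cmod (u $ i))\<^sup>2) = (\<Sum>i\<in>{0..<n}. (cmod (z $ i))\<^sup>2 / s)"
        using z s by (intro sum.cong) (auto simp: u_def norm_mult norm_divide power_mult_distrib power_divide)
      also have "\<dots> = 1" using s by (simp add: sum_divide_distrib[symmetric] s_def[symmetric])
      finally show ?thesis by simp
    qed
    define P' where "P' = mat n (Suc m) (\<lambda>(i, j). if j < m then P $$ (i, j) else u $ i)"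
    have P': "P' \<in> carrier_mat n (Suc m)" by (simp add: P'_def)
    have pu: "(\<Sum>l\<in>{0..<n}. cnj (P $$ (l, i)) * u $ l) = 0" if "i < m" for i
    proof -
      have "(adj P *\<^sub>v u) $ i = (\<Sum>l\<in>{0..<n}. cnj (P $$ (l, i)) * u $ l)"
        using that aP P u by (simp add: scalar_prod_def)
      thus ?thesis using au that by simp
    qed
    have pp: "(\<Sum>l\<in>{0..<n}. cnj (P $$ (l, i)) * P $$ (l, j)) = (if i = j then 1 else 0)" if "i < m" "j < m" for i j
    proof -
      have "(adj P * P) $$ (i, j) = (\<Sum>l\<in>{0..<n}. cnj (P $$ (l, i)) * P $$ (l, j))"
        using that P(1) by (simp add: scalar_prod_def)
      thus ?thesis unfolding P(2) using that by auto
    qed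
    have "adj P' * P' = 1\<^sub>m (Suc m)"
    proof (rule eq_matI)
      fix i j assume "i < dim_row (1\<^sub>m (Suc m) :: complex mat)" "j < dim_col (1\<^sub>m (Suc m) :: complex mat)"
      hence ij: "i < Suc m" "j < Suc m" by auto
      have e: "(adj P' * P') $$ (i, j) = (\<Sum>l\<in>{0..<n}. cnj (P' $$ (l, i)) * P' $$ (l, j))"
        using ij P' by (simp add: scalar_prod_def)
      have up: "(\<Sum>l\<in>{0..<n}. cnj (u $ l) * P $$ (l, j)) = 0" if "j < m"
      proof -
        have "(\<Sum>l\<in>{0..<n}. cnj (u $ l) * P $$ (l, j)) = cnj (\<Sum>l\<in>{0..<n}. cnj (P $$ (l, j)) * u $ l)"
          by (simp add: mult.commute)
        thus ?thesis using pu[OF that] by simp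
      qed
      show "(adj P' * P') $$ (i, j) = 1\<^sub>m (Suc m) $$ (i, j)"
        unfolding e using ij by (cases "i < m"; cases "j < m") (auto simp: P'_def pp pu up uu)
    qed (use P' in \<open>auto simp: adj_def\<close>)
    moreover have "P' *\<^sub>v x \<in> W" if x: "x \<in> carrier_vec (Suc m)" for x
    proof -
      define x' where "x' = vec m (\<lambda>i. x $ i)"
      have "P' *\<^sub>v x = P *\<^sub>v x' + (x $ m) \<cdot>\<^sub>v u"
      proof (rule eq_vecI)
        show "dim_vec (P' *\<^sub>v x) = dim_vec (P *\<^sub>v x' + (x $ m) \<cdot>\<^sub>v u)" using P' P u by simp
        fix i assume "i < dim_vec (P *\<^sub>v x' + (x $ m) \<cdot>\<^sub>v u)"
        hence i: "i < n" using u by simp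
        have "(P' *\<^sub>v x) $ i = (\<Sum>j\<in>{0..<Suc m}. P' $$ (i, j) * x $ j)"
          using i P' x by (simp add: scalar_prod_def)
        also have "\<dots> = (\<Sum>j\<in>{0..<m}. P $$ (i, j) * x' $ j) + u $ i * x $ m"
          using i by (simp add: P'_def x'_def)
        also have "\<dots> = (P *\<^sub>v x' + (x $ m) \<cdot>\<^sub>v u) $ i"
          using i P u by (simp add: scalar_prod_def x'_def)
        finally show "(P' *\<^sub>v x) $ i = (P *\<^sub>v x' + (x $ m) \<cdot>\<^sub>v u) $ i" .
      qed
      moreover have "P *\<^sub>v x' \<in> W" using P(3)[of x'] by (simp add: x'_def)
      ultimately show ?thesis using W(3) W(4) u by simp
    qed
    ultimately have "Q (Suc m)" unfolding Q_def using P' by blast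
    thus False using m by fastforce
  qed
  hence "W = {P *\<^sub>v x | x. x \<in> carrier_vec m}" using P by blast
  thus ?thesis using that P by blast
qed

text \<open>By the triangular decomposition, the submodule generated by a highest weight vector.\<close>

inductive_set lower_cyclic :: "(complex mat \<Rightarrow> complex mat) \<Rightarrow> complex vec \<Rightarrow> complex vec set" for \<rho> v where
  base: "v \<in> lower_cyclic \<rho> v"
| add: "x \<in> lower_cyclic \<rho> v \<Longrightarrow> y \<in> lower_cyclic \<rho> v \<Longrightarrow> x + y \<in> lower_cyclic \<rho> v"
| smult: "x \<in> lower_cyclic \<rho> v \<Longrightarrow> c \<cdot>\<^sub>v x \<in> lower_cyclic \<rho> v"
| act: "X \<in> lower_so7 \<Longrightarrow> x \<in> lower_cyclic \<rho> v \<Longrightarrow> \<rho> X *\<^sub>v x \<in> lower_cyclic \<rho> v"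

locale unitary_hw_rep = so7_rep +
  fixes lam :: weight and v :: "complex vec"
  assumes adj_\<rho>: "X \<in> so7 \<Longrightarrow> \<rho> (adj X) = adj (\<rho> X)"
    and v: "v \<in> carrier_vec n" and v0: "v \<noteq> 0\<^sub>v n"
    and upper_v: "X \<in> upper_so7 \<Longrightarrow> \<rho> X *\<^sub>v v = 0\<^sub>v n"
    and cartan_v: "T \<in> cartan \<Longrightarrow> \<rho> T *\<^sub>v v = wt lam T \<cdot>\<^sub>v v"
begin

lemma cyclic_carrier: "x \<in> lower_cyclic \<rho> v \<Longrightarrow> x \<in> carrier_vec n"
  by (induction rule: lower_cyclic.induct) (auto simp: v lower_so7_def)

lemma cyclic_invariant:
  assumes "x \<in> lower_cyclic \<rho> v" "X \<in> so7"
  shows "\<rho> X *\<^sub>v x \<in> lower_cyclic \<rho> v"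
  using assms
proof (induction arbitrary: X rule: lower_cyclic.induct)
  case base
  obtain L T U where d: "L \<in> lower_so7" "T \<in> cartan" "U \<in> upper_so7" "X = L + (T + U)"
    using so7_triangular_decomp[OF base] by blast
  have so: "L \<in> so7" "T \<in> so7" "U \<in> so7" using d by (auto simp: lower_so7_def cartan_def upper_so7_def)
  have "\<rho> X *\<^sub>v v = \<rho> L *\<^sub>v v + (\<rho> T *\<^sub>v v + \<rho> U *\<^sub>v v)"
    unfolding d(4) using so v by (simp add: \<rho>_add add_mult_distrib_mat_vec[of _ n n])
  also have "\<dots> = \<rho> L *\<^sub>v v + wt lam T \<cdot>\<^sub>v v" using upper_v[OF d(3)] cartan_v[OF d(2)] v by simp
  finally show ?case using d(1) by (auto intro: lower_cyclic.intros)
next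
  case (add x y)
  have "\<rho> X *\<^sub>v (x + y) = \<rho> X *\<^sub>v x + \<rho> X *\<^sub>v y"
    using add cyclic_carrier by (intro mult_add_distrib_mat_vec[of _ n n]) auto
  thus ?case using add by (auto intro: lower_cyclic.add)
next
  case (smult x c)
  have "\<rho> X *\<^sub>v (c \<cdot>\<^sub>v x) = c \<cdot>\<^sub>v (\<rho> X *\<^sub>v x)"
    using smult cyclic_carrier by (intro mult_mat_vec[of _ n n]) auto
  thus ?case using smult by (auto intro: lower_cyclic.smult)
next
  case (act Y x)
  have Y: "Y \<in> so7" using act by (simp add: lower_so7_def)
  have "\<rho> X *\<^sub>v (\<rho> Y *\<^sub>v x) = \<rho> Y *\<^sub>v (\<rho> X *\<^sub>v x) + \<rho> (lie_br X Y) *\<^sub>v x"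
    using act Y cyclic_carrier by (intro bracket_vec) auto
  moreover have "\<rho> Y *\<^sub>v (\<rho> X *\<^sub>v x) \<in> lower_cyclic \<rho> v" by (rule lower_cyclic.act[OF act(1) act(3)[OF act(4)]])
  moreover have "\<rho> (lie_br X Y) *\<^sub>v x \<in> lower_cyclic \<rho> v" by (rule act(3)[OF so7_bracket[OF act(4) Y]])
  ultimately show ?case by (simp add: lower_cyclic.add)
qed

lemma orthogonal_to_cyclic:
  assumes u: "u \<in> carrier_vec n" "\<And>X. X \<in> upper_so7 \<Longrightarrow> \<rho> X *\<^sub>v u = 0\<^sub>v n" "ip u v = 0"
    and x: "x \<in> lower_cyclic \<rho> v"
  shows "ip u x = 0"
  using x
proof (induction rule: lower_cyclic.induct)
  case (act X x)
  have X: "X \<in> so7" using act by (simp add: lower_so7_def)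
  have "adj X \<in> upper_so7"
    using act(1) adj_so7[OF X] adj_index[OF so7_carrier[OF X]] by (simp add: lower_so7_def upper_so7_def)
  hence "adj (\<rho> X) *\<^sub>v u = 0\<^sub>v n" using u(2) adj_\<rho>[OF X] by metis
  moreover have "ip u (\<rho> X *\<^sub>v x) = ip (adj (\<rho> X) *\<^sub>v u) x"
    using X u(1) cyclic_carrier[OF act(2)] by (intro ip_adj) auto
  moreover have "ip (0\<^sub>v n) x = 0" using cyclic_carrier[OF act(2)] by (simp add: ip_def scalar_prod_def)
  ultimately show ?case by simp
qed (use u cyclic_carrier in \<open>auto simp: ip_add[of _ n] ip_smult[of _ n]\<close>)

text \<open>The orthogonal projection $\pi$ onto an invariant subspace commutes with a unitary representation.
  The component of $\pi v$ orthogonal to $v$ is killed by the upper triangular part, hence is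
  orthogonal to everything generated from $v$, so it is zero and $\pi v = c v$. As $v$ generates the
  module, $\pi = c$, and $\pi^2 = \pi$ leaves $c = 0$ or $c = 1$.\<close>

lemma irreducible_if_cyclic:
  assumes cyc: "lower_cyclic \<rho> v = carrier_vec n"
  shows "irreducible_rep so7 n \<rho>"
  unfolding irreducible_rep_def
proof (intro conjI allI impI)
  show "lie_rep so7 n \<rho>" by (rule rep)
  show "n > 0" using v v0 by (cases n) auto
  fix W assume sub: "VectorSpace.subspace class_ring W (module_vec TYPE(complex) n)"
    and inv: "\<forall>X\<in>so7. \<forall>w\<in>W. \<rho> X *\<^sub>v w \<in> W"
  have W: "W \<subseteq> carrier_vec n" "0\<^sub>v n \<in> W" "\<And>x y. x \<in> W \<Longrightarrow> y \<in> W \<Longrightarrow> x + y \<in> W" "\<And>c x. x \<in> W \<Longrightarrow> c \<cdot>\<^sub>v x \<in> W"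
    using sub unfolding VectorSpace.subspace_def submodule_def by (auto simp: module_vec_simps class_ring_simps)
  obtain m P where P: "P \<in> carrier_mat n m" "adj P * P = 1\<^sub>m m" "W = {P *\<^sub>v x | x. x \<in> carrier_vec m}"
    by (rule orthonormal_basis_exists[OF W])
  have aP: "adj P \<in> carrier_mat m n" using P by simp
  define \<pi> where "\<pi> x = P *\<^sub>v (adj P *\<^sub>v x)" for x
  have \<pi>c: "\<pi> x \<in> carrier_vec n" if "x \<in> carrier_vec n" for x
    unfolding \<pi>_def by (rule mult_mat_vec_carrier[OF P(1) mult_mat_vec_carrier[OF aP that]])
  have \<pi>W: "\<pi> x \<in> W" if "x \<in> carrier_vec n" for x
    unfolding P(3) \<pi>_def by (intro CollectI exI[of _ "adj P *\<^sub>v x"] conjI HOL.refl mult_mat_vec_carrier[OF aP that])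
  have \<pi>id: "\<pi> w = w" if w: "w \<in> W" for w
  proof -
    obtain x where x: "w = P *\<^sub>v x" "x \<in> carrier_vec m" using w unfolding P(3) by blast
    have "adj P *\<^sub>v (P *\<^sub>v x) = x" by (rule orthonormal_columns_cancel[OF P(1,2) x(2)])
    thus ?thesis by (simp add: \<pi>_def x)
  qed
  have PXP: "P * (adj P * (\<rho> X * P)) = \<rho> X * P" if X: "X \<in> so7" for X
  proof (rule mat_eq_by_vec)
    note rX = \<rho>_carrier[OF X]
    show "P * (adj P * (\<rho> X * P)) \<in> carrier_mat n m" "\<rho> X * P \<in> carrier_mat n m" using P aP rX by auto
    fix x :: "complex vec" assume x: "x \<in> carrier_vec m"
    have "P *\<^sub>v x \<in> W" unfolding P(3) using x by blast
    hence "\<rho> X *\<^sub>v (P *\<^sub>v x) \<in> W" using inv X by blast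
    hence "\<pi> (\<rho> X *\<^sub>v (P *\<^sub>v x)) = \<rho> X *\<^sub>v (P *\<^sub>v x)" by (rule \<pi>id)
    moreover have "(\<rho> X * P) *\<^sub>v x = \<rho> X *\<^sub>v (P *\<^sub>v x)" using rX P x by simp
    moreover have "(P * (adj P * (\<rho> X * P))) *\<^sub>v x = P *\<^sub>v (adj P *\<^sub>v ((\<rho> X * P) *\<^sub>v x))"
      using P(1) aP rX x by (simp add: assoc_mult_mat_vec[of _ n m _ m] assoc_mult_mat_vec[of _ m n _ m] mult_carrier_mat[of _ n n] mult_carrier_mat[of _ m n])
    ultimately show "(P * (adj P * (\<rho> X * P))) *\<^sub>v x = (\<rho> X * P) *\<^sub>v x" by (simp add: \<pi>_def)
  qed
  \<comment> \<open>Invariance of the subspace under $X$ and under its adjoint.\<close>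
  have commute: "\<pi> (\<rho> X *\<^sub>v x) = \<rho> X *\<^sub>v \<pi> x" if X: "X \<in> so7" and x: "x \<in> carrier_vec n" for X x
  proof -
    note rX = \<rho>_carrier[OF X]
    have a: "\<rho> (adj X) = adj (\<rho> X)" using adj_\<rho>[OF X] .
    have arX: "adj (\<rho> X) \<in> carrier_mat n n" using rX by simp
    have c1: "adj (\<rho> X) * P \<in> carrier_mat n m" using arX P by simp
    have c2: "adj P * (adj (\<rho> X) * P) \<in> carrier_mat m m" using aP c1 by simp
    have "adj (P * (adj P * (adj (\<rho> X) * P))) = adj (adj (\<rho> X) * P)"
      using PXP[OF adj_so7[OF X]] a by simp
    hence e: "(adj P * \<rho> X * P) * adj P = adj P * \<rho> X"
      using adj_mult[OF P(1) c2] adj_mult[OF aP c1] adj_mult[OF arX P(1)] by simp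
    have "\<pi> (\<rho> X *\<^sub>v x) = P *\<^sub>v ((adj P * \<rho> X) *\<^sub>v x)" unfolding \<pi>_def using aP rX x by simp
    also have "\<dots> = P *\<^sub>v (((adj P * \<rho> X * P) * adj P) *\<^sub>v x)" unfolding e ..
    also have "((adj P * \<rho> X * P) * adj P) *\<^sub>v x = (adj P * (\<rho> X * P)) *\<^sub>v (adj P *\<^sub>v x)"
      using aP rX P(1) x by (subst assoc_mult_mat_vec[of _ m m _ n]) (auto simp: assoc_mult_mat[of _ m n _ n _ m])
    also have "P *\<^sub>v \<dots> = (P * (adj P * (\<rho> X * P))) *\<^sub>v (adj P *\<^sub>v x)"
      by (rule assoc_mult_mat_vec[symmetric, OF P(1) mult_carrier_mat[OF aP mult_carrier_mat[OF rX P(1)]] mult_mat_vec_carrier[OF aP x]])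
    also have "\<dots> = \<rho> X *\<^sub>v \<pi> x" unfolding PXP[OF X] \<pi>_def
      by (rule assoc_mult_mat_vec[OF rX P(1) mult_mat_vec_carrier[OF aP x]])
    finally show ?thesis .
  qed
  define c where "c = ip v (\<pi> v) / ip v v"
  have vv: "ip v v \<noteq> 0" using ip_self_eq_0[OF v] v0 by blast
  define u where "u = \<pi> v + (- c) \<cdot>\<^sub>v v"
  have u: "u \<in> carrier_vec n" using \<pi>c[OF v] v by (simp add: u_def)
  have "ip v u = 0" unfolding u_def using \<pi>c[OF v] v vv by (simp add: ip_add[of _ n] ip_smult[of _ n] c_def)
  moreover have "ip u v = cnj (ip v u)" using u v by (auto simp: ip_def scalar_prod_def mult.commute intro!: sum.cong)
  ultimately have uv: "ip u v = 0" by simp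
  have uk: "\<rho> X *\<^sub>v u = 0\<^sub>v n" if X: "X \<in> upper_so7" for X
  proof -
    have so: "X \<in> so7" using X by (simp add: upper_so7_def)
    have "\<rho> X *\<^sub>v u = \<rho> X *\<^sub>v \<pi> v + (- c) \<cdot>\<^sub>v (\<rho> X *\<^sub>v v)"
      unfolding u_def using so v \<pi>c[OF v] by (simp add: mult_add_distrib_mat_vec[of _ n n] mult_mat_vec[of _ n n])
    also have "\<rho> X *\<^sub>v \<pi> v = \<pi> (0\<^sub>v n)" using commute[OF so v] upper_v[OF X] by simp
    also have "\<pi> (0\<^sub>v n) = 0\<^sub>v n" using \<pi>id W(2) by blast
    finally show ?thesis using upper_v[OF X] by (auto intro!: eq_vecI)
  qed
  have "ip u u = 0" using orthogonal_to_cyclic[OF u uk uv, of u] cyc u by simp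
  hence u0: "u = 0\<^sub>v n" using ip_self_eq_0[OF u] by blast
  have \<pi>v: "\<pi> v = c \<cdot>\<^sub>v v"
  proof (rule eq_vecI)
    fix i assume i: "i < dim_vec (c \<cdot>\<^sub>v v)"
    hence "u $ i = 0" using u0 v by simp
    thus "\<pi> v $ i = (c \<cdot>\<^sub>v v) $ i" using i v \<pi>c[OF v] by (simp add: u_def)
  qed (use v \<pi>c[OF v] in auto)
  have \<pi>all: "\<pi> x = c \<cdot>\<^sub>v x" if "x \<in> lower_cyclic \<rho> v" for x
    using that
  proof (induction rule: lower_cyclic.induct)
    case (add x y)
    note xy = cyclic_carrier[OF add(1)] cyclic_carrier[OF add(2)]
    have "\<pi> (x + y) = \<pi> x + \<pi> y" unfolding \<pi>_def mult_add_distrib_mat_vec[OF aP xy]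
      by (rule mult_add_distrib_mat_vec[OF P(1) mult_mat_vec_carrier[OF aP xy(1)] mult_mat_vec_carrier[OF aP xy(2)]])
    thus ?case using add xy by (simp add: smult_add_distrib_vec)
  next
    case (smult x d)
    note x = cyclic_carrier[OF smult(1)]
    have "\<pi> (d \<cdot>\<^sub>v x) = d \<cdot>\<^sub>v \<pi> x" unfolding \<pi>_def mult_mat_vec[OF aP x]
      by (rule mult_mat_vec[OF P(1) mult_mat_vec_carrier[OF aP x]])
    thus ?case using smult by (simp add: smult_smult_assoc mult.commute)
  next
    case (act X x)
    have so: "X \<in> so7" using act by (simp add: lower_so7_def)
    show ?case using commute[OF so cyclic_carrier[OF act(2)]] act so cyclic_carrier[OF act(2)]
      by (simp add: mult_mat_vec[of _ n n])
  qed (rule \<pi>v)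
  have "\<pi> (\<pi> v) = \<pi> v" using \<pi>id \<pi>W v by blast
  hence "c \<cdot>\<^sub>v (c \<cdot>\<^sub>v v) = c \<cdot>\<^sub>v v" using \<pi>all[of "c \<cdot>\<^sub>v v"] v cyc \<pi>v by simp
  moreover obtain i where i: "i < n" "v $ i \<noteq> 0" using nonzero_vec_entry[OF v v0] by auto
  ultimately have "c * (c * v $ i) = c * v $ i" using v by (metis carrier_vecD index_smult_vec(1) index_smult_vec(2))
  hence "c = 0 \<or> c = 1" using i by simp
  thus "W = {0\<^sub>v n} \<or> W = carrier_vec n"
  proof
    assume c: "c = 0"
    have "w = 0\<^sub>v n" if w: "w \<in> W" for w
    proof -
      have wc: "w \<in> carrier_vec n" using w W by blast
      hence "w \<in> lower_cyclic \<rho> v" unfolding cyc .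
      hence "\<pi> w = 0 \<cdot>\<^sub>v w" using \<pi>all unfolding c by blast
      hence e: "w = 0 \<cdot>\<^sub>v w" using \<pi>id[OF w] by metis
      show ?thesis
      proof (rule eq_vecI)
        fix i assume "i < dim_vec (0\<^sub>v n :: complex vec)"
        hence i: "i < n" by simp
        have "w $ i = (0 \<cdot>\<^sub>v w) $ i" by (rule arg_cong[OF e])
        also have "\<dots> = 0" using i wc by simp
        finally show "w $ i = 0\<^sub>v n $ i" using i by simp
      qed (use wc in simp)
    qed
    thus ?thesis using W(2) by blast
  next
    assume c: "c = 1"
    have "x \<in> W" if "x \<in> carrier_vec n" for x
    proof -
      have "\<pi> x = x" using \<pi>all[of x] that unfolding cyc c by simp
      thus ?thesis using \<pi>W[OF that] by simp
    qed
    thus ?thesis using W(1) by blast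
  qed
qed

end

section \<open>Addition of signatures\<close>

lemma sum_expo_add: "(\<Sum>i\<in>{1..9}. (p + q) i) = (\<Sum>i\<in>{1..9}. p i) + (\<Sum>i\<in>{1..9::nat}. q i :: nat)"
  by (simp add: sum.distrib)

lemma lex_less_add:
  assumes "lex_less q p" "lex_less r s \<or> r = s" shows "lex_less (q + r) (p + s)"
proof -
  obtain i where i: "i \<in> {1..9}" "q i < p i" "\<forall>j\<in>{1..<i}. q j = p j" using assms(1) by (auto simp: lex_less_def)
  from assms(2) show ?thesis
  proof
    assume "r = s" thus ?thesis unfolding lex_less_def by (intro bexI[OF _ i(1)]) (use i in auto)
  next
    assume "lex_less r s"
    then obtain j where j: "j \<in> {1..9}" "r j < s j" "\<forall>k\<in>{1..<j}. r k = s k" by (auto simp: lex_less_def)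
    consider "i < j" | "i = j" | "j < i" by linarith
    thus ?thesis
    proof cases
      case 1
      thus ?thesis unfolding lex_less_def by (intro bexI[OF _ i(1)]) (use i j in auto)
    next
      case 2
      thus ?thesis unfolding lex_less_def by (intro bexI[OF _ i(1)]) (use i j in auto)
    next
      case 3
      thus ?thesis unfolding lex_less_def by (intro bexI[OF _ j(1)]) (use i j in auto)
    qed
  qed
qed

lemma expo_greater_add:
  assumes "expo_greater q p" "expo_greater r s \<or> r = s" shows "expo_greater (q + r) (p + s)"
  using assms lex_less_add[of q p r s] unfolding expo_greater_def sum_expo_add by auto

lemma expo_greater_irrefl: "\<not> expo_greater p p"
  by (auto simp: expo_greater_def lex_less_def)

text \<open>The condition of \<open>is_sign\<close> for an arbitrary function of exponents in place of the values of
  a functional.\<close>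

definition leading :: "((nat \<Rightarrow> nat) \<Rightarrow> complex) \<Rightarrow> (nat \<Rightarrow> nat) \<Rightarrow> bool" where
  "leading S p \<longleftrightarrow> p \<in> expos \<and> S p \<noteq> 0 \<and> (\<forall>q\<in>expos. S q \<noteq> 0 \<longrightarrow> q = p \<or> expo_greater q p)"

text \<open>All ways to distribute the letters of a word over two subwords: the coproduct of the enveloping
  algebra on a product of primitive elements.\<close>

fun splits :: "'a list \<Rightarrow> ('a list \<times> 'a list) list" where
  "splits [] = [([], [])]"
| "splits (x # xs) = map (\<lambda>(a, b). (x # a, b)) (splits xs) @ map (\<lambda>(a, b). (a, x # b)) (splits xs)"

lemma splits_mset: "(a, b) \<in> set (splits ws) \<Longrightarrow> mset a + mset b = mset ws"
  by (induction ws arbitrary: a b) auto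

lemma splits_sorted: "(a, b) \<in> set (splits ws) \<Longrightarrow> sorted ws \<Longrightarrow> sorted a \<and> sorted b"
proof (induction ws arbitrary: a b)
  case (Cons x ws)
  have sub: "set a' \<subseteq> set ws \<and> set b' \<subseteq> set ws" if "(a', b') \<in> set (splits ws)" for a' b'
  proof -
    have "set_mset (mset a' + mset b') = set_mset (mset ws)" using splits_mset[OF that] by simp
    thus ?thesis by auto
  qed
  show ?case using Cons.prems Cons.IH sub by fastforce
qed simp

lemma splits_map: "splits (map f ws) = map (\<lambda>(a, b). (map f a, map f b)) (splits ws)"
  by (induction ws) (auto simp: comp_def case_prod_beta)

lemma splits_append: "(a, b) \<in> set (splits u) \<Longrightarrow> (c, d) \<in> set (splits w) \<Longrightarrow> (a @ c, b @ d) \<in> set (splits (u @ w))"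
  by (induction u arbitrary: a b) (auto simp: image_iff, force+)

lemma splits_Cons:
  assumes "(a, b) \<in> set (splits ws)"
  shows "(x # a, b) \<in> set (splits (x # ws))" "(a, x # b) \<in> set (splits (x # ws))"
  using assms by force+

lemma splits_replicate: "(replicate j x, replicate k x) \<in> set (splits (replicate (j + k) x))"
proof (induction j)
  case 0
  show ?case
  proof (induction k)
    case (Suc k)
    show ?case using splits_Cons(2)[OF Suc, of x] by simp
  qed simp
next
  case (Suc j)
  show ?case using splits_Cons(1)[OF Suc, of x] by simp
qed

lemma splits_index_word: "(index_word p, index_word q) \<in> set (splits (index_word (p + q)))"
proof -
  have "(concat (map (\<lambda>i. replicate (p i) i) is), concat (map (\<lambda>i. replicate (q i) i) is)) \<in>
    set (splits (concat (map (\<lambda>i. replicate ((p + q) i) i) is)))" for "is" :: "nat list"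
  proof (induction "is")
    case (Cons i "is")
    have r: "(replicate (p i) i, replicate (q i) i) \<in> set (splits (replicate ((p + q) i) i))" using splits_replicate[of "p i" i "q i"] by simp
    show ?case using splits_append[OF r Cons] by simp
  qed simp
  thus ?thesis unfolding index_word_def .
qed

lemma sorted_index_word: "sorted (index_word p)"
proof -
  have "sorted is \<Longrightarrow> sorted (concat (map (\<lambda>i. replicate (p i) i) is))" for "is" :: "nat list"
    by (induction "is") (auto simp: sorted_append)
  thus ?thesis by (simp add: index_word_def del: upt_rec)
qed

lemma sorted_eq_index_word: "sorted a \<Longrightarrow> set a \<subseteq> {1..9} \<Longrightarrow> a = index_word (count (mset a))"
  using mset_index_word_count[of a] sorted_index_word[of "count (mset a)"]
  by (metis properties_for_sort)

lemma count_in_expos: "set a \<subseteq> {1..9} \<Longrightarrow> count (mset a) \<in> expos"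
  by (auto simp: expos_def count_eq_zero_iff)

text \<open>The monomial order is compatible with addition, so a splitting of the word of $q$ with nonzero
  value forces $q \ge p_1 + p_2$, and equality forces the two subwords to be the monomials of $p_1$
  and $p_2$. The coefficient of that term is the number of such splittings, which is positive, so
  nothing cancels.\<close>

lemma leading_shuffle:
  fixes \<phi>1 \<phi>2 :: "nat list \<Rightarrow> complex"
  assumes 1: "leading (\<lambda>q. \<phi>1 (index_word q)) p1" and 2: "leading (\<lambda>q. \<phi>2 (index_word q)) p2"
  shows "leading (\<lambda>q. \<Sum>(a, b)\<leftarrow>splits (index_word q). \<phi>1 a * \<phi>2 b) (p1 + p2)"
proof -
  have split: "\<exists>qa qb. a = index_word qa \<and> b = index_word qb \<and> qa \<in> expos \<and> qb \<in> expos \<and> qa + qb = q"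
    if ab: "(a, b) \<in> set (splits (index_word q))" and q: "q \<in> expos" for a b q
  proof -
    have m: "mset a + mset b = mset (index_word q)" using splits_mset[OF ab] .
    have "set a \<union> set b = set (index_word q)" using m by (metis set_mset_mset set_mset_union)
    hence s: "set a \<subseteq> {1..9}" "set b \<subseteq> {1..9}" using set_index_word[of q] by auto
    have "count (mset a) + count (mset b) = q"
    proof
      fix i
      have "count (mset a) i + count (mset b) i = count (mset (index_word q)) i" using m by (metis count_union)
      thus "(count (mset a) + count (mset b)) i = q i" using q by (auto simp: count_index_word expos_def)
    qed
    thus ?thesis using splits_sorted[OF ab sorted_index_word] s sorted_eq_index_word count_in_expos by blast
  qed
  have pe: "p1 \<in> expos" "p2 \<in> expos" using 1 2 by (auto simp: leading_def)
  hence pp: "p1 + p2 \<in> expos" by (auto simp: expos_def)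
  have grows: "(qa = p1 \<or> expo_greater qa p1) \<and> (qb = p2 \<or> expo_greater qb p2)"
    if "\<phi>1 (index_word qa) * \<phi>2 (index_word qb) \<noteq> 0" "qa \<in> expos" "qb \<in> expos" for qa qb
    using that 1 2 by (auto simp: leading_def)
  have cmp: "(qa = p1 \<and> qb = p2) \<or> expo_greater (qa + qb) (p1 + p2)"
    if "(qa = p1 \<or> expo_greater qa p1) \<and> (qb = p2 \<or> expo_greater qb p2)" for qa qb
    using that expo_greater_add[of qa p1 qb p2] expo_greater_add[of qb p2 qa p1] by (auto simp: add.commute)
  let ?c = "\<phi>1 (index_word p1) * \<phi>2 (index_word p2)"
  have c0: "?c \<noteq> 0" using 1 2 by (auto simp: leading_def)
  define L0 where "L0 = splits (index_word (p1 + p2))"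
  have val: "\<phi>1 a * \<phi>2 b = (if (a, b) = (index_word p1, index_word p2) then ?c else 0)" if ab: "(a, b) \<in> set L0" for a b
  proof (cases "\<phi>1 a * \<phi>2 b = 0")
    case True
    thus ?thesis using c0 by auto
  next
    case False
    obtain qa qb where q: "a = index_word qa" "b = index_word qb" "qa \<in> expos" "qb \<in> expos" "qa + qb = p1 + p2"
      using split[OF ab[unfolded L0_def] pp] by blast
    have "qa = p1 \<and> qb = p2"
      using cmp[OF grows[of qa qb]] False q expo_greater_irrefl by auto
    thus ?thesis using q by simp
  qed
  have "(\<Sum>(a, b)\<leftarrow>L. \<phi>1 a * \<phi>2 b) = of_nat (length (filter ((=) (index_word p1, index_word p2)) L)) * ?c"
    if "set L \<subseteq> set L0" for L
    using that
  proof (induction L)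
    case (Cons x L)
    obtain a b where x: "x = (a, b)" by (cases x)
    have ab: "(a, b) \<in> set L0" using Cons.prems x by simp
    have IH: "(\<Sum>(a, b)\<leftarrow>L. \<phi>1 a * \<phi>2 b) = of_nat (length (filter ((=) (index_word p1, index_word p2)) L)) * ?c"
      using Cons by simp
    show ?case
    proof (cases "(a, b) = (index_word p1, index_word p2)")
      case True
      thus ?thesis using IH x by (simp add: algebra_simps)
    next
      case False
      have "\<phi>1 a * \<phi>2 b = 0" unfolding val[OF ab] using False by (simp only: if_False)
      thus ?thesis using IH x False by auto
    qed
  qed simp
  from this[of L0] have S: "(\<Sum>(a, b)\<leftarrow>L0. \<phi>1 a * \<phi>2 b) = of_nat (length (filter ((=) (index_word p1, index_word p2)) L0)) * ?c" by simp
  have "filter ((=) (index_word p1, index_word p2)) L0 \<noteq> []"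
    using splits_index_word[of p1 p2] by (auto simp: filter_empty_conv L0_def)
  hence nz: "(\<Sum>(a, b)\<leftarrow>L0. \<phi>1 a * \<phi>2 b) \<noteq> 0" unfolding S using c0 by simp
  moreover have "q = p1 + p2 \<or> expo_greater q (p1 + p2)"
    if q: "q \<in> expos" "(\<Sum>(a, b)\<leftarrow>splits (index_word q). \<phi>1 a * \<phi>2 b) \<noteq> 0" for q
  proof -
    have "\<exists>(a, b)\<in>set (splits (index_word q)). \<phi>1 a * \<phi>2 b \<noteq> 0"
    proof (rule ccontr)
      assume "\<not> ?thesis"
      hence "map (\<lambda>(a, b). \<phi>1 a * \<phi>2 b) (splits (index_word q)) = map (\<lambda>_. 0) (splits (index_word q))"
        by (intro map_cong) auto
      hence "(\<Sum>(a, b)\<leftarrow>splits (index_word q). \<phi>1 a * \<phi>2 b) = (\<Sum>_\<leftarrow>splits (index_word q). 0)" by (rule arg_cong)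
      thus False using q by simp
    qed
    then obtain a b where ab: "(a, b) \<in> set (splits (index_word q))" "\<phi>1 a * \<phi>2 b \<noteq> 0" by blast
    obtain qa qb where "a = index_word qa" "b = index_word qb" "qa \<in> expos" "qb \<in> expos" "qa + qb = q"
      using split[OF ab(1) q(1)] by blast
    thus ?thesis using cmp[OF grows[of qa qb]] ab(2) by auto
  qed
  ultimately show ?thesis unfolding leading_def L0_def using pp by blast
qed

lemma kron_vec_zero: "y \<in> carrier_vec m \<Longrightarrow> kron_vec (0\<^sub>v n) y = 0\<^sub>v (n * m)" "x \<in> carrier_vec n \<Longrightarrow> kron_vec x (0\<^sub>v m) = 0\<^sub>v (n * m)"
proof -
  show "kron_vec (0\<^sub>v n) y = 0\<^sub>v (n * m)" if "y \<in> carrier_vec m"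
    using that by (intro eq_vecI) (auto simp: kron_vec_def div_mod_less)
  show "kron_vec x (0\<^sub>v m) = 0\<^sub>v (n * m)" if "x \<in> carrier_vec n"
    using that by (intro eq_vecI) (auto simp: kron_vec_def div_mod_less)
qed

lemma kron_vec_smult: "x \<in> carrier_vec n \<Longrightarrow> y \<in> carrier_vec m \<Longrightarrow> kron_vec (c \<cdot>\<^sub>v x) y = c \<cdot>\<^sub>v kron_vec x y"
  "x \<in> carrier_vec n \<Longrightarrow> y \<in> carrier_vec m \<Longrightarrow> kron_vec x (c \<cdot>\<^sub>v y) = c \<cdot>\<^sub>v kron_vec x y"
proof -
  assume xy: "x \<in> carrier_vec n" "y \<in> carrier_vec m"
  show "kron_vec (c \<cdot>\<^sub>v x) y = c \<cdot>\<^sub>v kron_vec x y"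
    using xy by (intro eq_vecI) (auto simp: kron_vec_def div_mod_less)
  show "kron_vec x (c \<cdot>\<^sub>v y) = c \<cdot>\<^sub>v kron_vec x y"
    using xy by (intro eq_vecI) (auto simp: kron_vec_def div_mod_less)
qed

lemma eq_zero_if_zero_on_kron:
  assumes \<xi>: "\<xi> \<in> carrier_vec (n * m)" and z: "\<And>x y. x \<in> carrier_vec n \<Longrightarrow> y \<in> carrier_vec m \<Longrightarrow> \<xi> \<bullet> kron_vec x y = 0"
  shows "\<xi> = 0\<^sub>v (n * m)"
proof (rule eq_vecI)
  fix i assume "i < dim_vec (0\<^sub>v (n * m) :: complex vec)"
  hence i: "i < n * m" by simp
  note dm = div_mod_less[OF i]
  have "unit_vec (n * m) i = kron_vec (unit_vec n (i div m)) (unit_vec m (i mod m))"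
  proof (rule eq_vecI)
    fix l assume "l < dim_vec (kron_vec (unit_vec n (i div m)) (unit_vec m (i mod m)) :: complex vec)"
    hence l: "l < n * m" by (simp add: kron_vec_def)
    have "(l = i) = (l div m = i div m \<and> l mod m = i mod m)" by (metis div_mult_mod_eq)
    thus "unit_vec (n * m) i $ l = kron_vec (unit_vec n (i div m)) (unit_vec m (i mod m)) $ l"
      using l i dm div_mod_less[OF l] by (simp add: kron_vec_def unit_vec_def)
  qed (simp add: kron_vec_def)
  hence "\<xi> \<bullet> unit_vec (n * m) i = 0" using z[of "unit_vec n (i div m)" "unit_vec m (i mod m)"] by simp
  thus "\<xi> $ i = 0\<^sub>v (n * m) $ i" using \<xi> i by simp
qed (use \<xi> in simp)

text \<open>The decomposable vectors span a tensor product, so identities between functionals may be tested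
  on them.\<close>

lemma tensor_functional_eq:
  assumes \<rho>: "lie_rep so7 n \<rho>" and \<tau>: "lie_rep so7 m \<tau>" and X: "X \<in> so7"
    and \<omega>: "\<omega> \<in> carrier_vec (n * m)" and \<eta>: "\<eta> \<in> carrier_vec (n * m)"
    and z: "\<And>x y. x \<in> carrier_vec n \<Longrightarrow> y \<in> carrier_vec m \<Longrightarrow>
      \<omega> \<bullet> kron_vec (\<rho> X *\<^sub>v x) y + \<omega> \<bullet> kron_vec x (\<tau> X *\<^sub>v y) = \<eta> \<bullet> kron_vec x y"
    and w: "w \<in> carrier_vec (n * m)"
  shows "\<omega> \<bullet> (tensor_rep n \<rho> m \<tau> X *\<^sub>v w) = \<eta> \<bullet> w"
proof -
  have rX: "\<rho> X \<in> carrier_mat n n" "\<tau> X \<in> carrier_mat m m" using \<rho> \<tau> X by (auto simp: lie_rep_def)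
  let ?T = "tensor_rep n \<rho> m \<tau> X"
  have T: "?T \<in> carrier_mat (n * m) (n * m)" using lie_rep_tensor[OF \<rho> \<tau>] X by (auto simp: lie_rep_def)
  have \<xi>: "?T\<^sup>T *\<^sub>v \<omega> - \<eta> \<in> carrier_vec (n * m)" using T \<omega> \<eta> by simp
  have "?T\<^sup>T *\<^sub>v \<omega> - \<eta> = 0\<^sub>v (n * m)"
  proof (rule eq_zero_if_zero_on_kron[OF \<xi>])
    fix x y :: "complex vec" assume xy: "x \<in> carrier_vec n" "y \<in> carrier_vec m"
    have k: "kron_vec (\<rho> X *\<^sub>v x) y \<in> carrier_vec (n * m)" "kron_vec x (\<tau> X *\<^sub>v y) \<in> carrier_vec (n * m)"
      using rX xy by (auto intro!: kron_vec_carrier)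
    have "(?T\<^sup>T *\<^sub>v \<omega>) \<bullet> kron_vec x y = \<omega> \<bullet> (?T *\<^sub>v kron_vec x y)"
      using scalar_prod_mult_mat_vec[OF T \<omega>] xy by simp
    also have "\<dots> = \<omega> \<bullet> kron_vec (\<rho> X *\<^sub>v x) y + \<omega> \<bullet> kron_vec x (\<tau> X *\<^sub>v y)"
      unfolding tensor_rep_kron_vec[where \<rho> = \<rho> and \<tau> = \<tau>, OF rX xy] using \<omega> k by (rule scalar_prod_add_distrib)
    finally show "(?T\<^sup>T *\<^sub>v \<omega> - \<eta>) \<bullet> kron_vec x y = 0"
      using z[OF xy] T \<omega> \<eta> xy by (subst minus_scalar_prod_distrib[of _ "n * m"]) auto
  qed
  hence "(?T\<^sup>T *\<^sub>v \<omega> - \<eta>) \<bullet> w = 0" using w by simp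
  hence "(?T\<^sup>T *\<^sub>v \<omega>) \<bullet> w = \<eta> \<bullet> w" using T \<omega> \<eta> w by (subst (asm) minus_scalar_prod_distrib[of _ "n * m"]) auto
  thus ?thesis using scalar_prod_mult_mat_vec[OF T \<omega> w] by simp
qed

lemma tensor_functional_vanish:
  assumes \<rho>: "lie_rep so7 n \<rho>" and \<tau>: "lie_rep so7 m \<tau>" and X: "X \<in> so7" and \<omega>: "\<omega> \<in> carrier_vec (n * m)"
    and z: "\<And>x y. x \<in> carrier_vec n \<Longrightarrow> y \<in> carrier_vec m \<Longrightarrow> \<omega> \<bullet> kron_vec (\<rho> X *\<^sub>v x) y + \<omega> \<bullet> kron_vec x (\<tau> X *\<^sub>v y) = 0"
    and w: "w \<in> carrier_vec (n * m)"
  shows "\<omega> \<bullet> (tensor_rep n \<rho> m \<tau> X *\<^sub>v w) = 0"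
proof -
  have "\<omega> \<bullet> (tensor_rep n \<rho> m \<tau> X *\<^sub>v w) = 0\<^sub>v (n * m) \<bullet> w"
  proof (rule tensor_functional_eq[OF \<rho> \<tau> X \<omega> zero_carrier_vec _ w])
    fix x y :: "complex vec" assume xy: "x \<in> carrier_vec n" "y \<in> carrier_vec m"
    show "\<omega> \<bullet> kron_vec (\<rho> X *\<^sub>v x) y + \<omega> \<bullet> kron_vec x (\<tau> X *\<^sub>v y) = 0\<^sub>v (n * m) \<bullet> kron_vec x y"
      using z[OF xy] kron_vec_carrier[OF xy] by simp
  qed
  thus ?thesis using w by simp
qed

lemma act_tensor:
  assumes \<rho>: "lie_rep so7 n \<rho>" and \<tau>: "lie_rep so7 m \<tau>" and x: "x \<in> carrier_vec n" and y: "y \<in> carrier_vec m"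
  shows "ws \<in> lists so7 \<Longrightarrow> \<xi> \<in> carrier_vec (n * m) \<Longrightarrow> \<xi> \<bullet> act (tensor_rep n \<rho> m \<tau>) ws (kron_vec x y) =
     (\<Sum>(a, b)\<leftarrow>splits ws. \<xi> \<bullet> kron_vec (act \<rho> a x) (act \<tau> b y))"
proof (induction ws arbitrary: \<xi>)
  case (Cons X ws)
  interpret R: so7_rep n \<rho> by unfold_locales fact
  interpret S: so7_rep m \<tau> by unfold_locales fact
  interpret T: so7_rep "n * m" "tensor_rep n \<rho> m \<tau>" by unfold_locales (rule lie_rep_tensor[OF \<rho> \<tau>])
  let ?T = "tensor_rep n \<rho> m \<tau> X"
  have X: "X \<in> so7" and ws: "ws \<in> lists so7" using Cons.prems(1) by simp_all
  have Tc: "?T \<in> carrier_mat (n * m) (n * m)" using X by (rule T.\<rho>_carrier)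
  have "\<xi> \<bullet> act (tensor_rep n \<rho> m \<tau>) (X # ws) (kron_vec x y) = (?T\<^sup>T *\<^sub>v \<xi>) \<bullet> act (tensor_rep n \<rho> m \<tau>) ws (kron_vec x y)"
    using scalar_prod_mult_mat_vec[OF Tc Cons.prems(2)] ws x y by simp
  also have "\<dots> = (\<Sum>(a, b)\<leftarrow>splits ws. (?T\<^sup>T *\<^sub>v \<xi>) \<bullet> kron_vec (act \<rho> a x) (act \<tau> b y))"
    using Tc Cons.prems(2) ws by (intro Cons.IH) simp_all
  also have "\<dots> = (\<Sum>(a, b)\<leftarrow>splits ws. \<xi> \<bullet> kron_vec (act \<rho> (X # a) x) (act \<tau> b y) + \<xi> \<bullet> kron_vec (act \<rho> a x) (act \<tau> (X # b) y))"
  proof (intro arg_cong[of _ _ sum_list] map_cong HOL.refl, clarify)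
    fix a b assume ab: "(a, b) \<in> set (splits ws)"
    have "set_mset (mset a + mset b) = set_mset (mset ws)" using splits_mset[OF ab] by simp
    hence so: "a \<in> lists so7" "b \<in> lists so7" using ws by auto
    have c: "act \<rho> a x \<in> carrier_vec n" "act \<tau> b y \<in> carrier_vec m" using so x y by simp_all
    have c2: "\<rho> X *\<^sub>v act \<rho> a x \<in> carrier_vec n" "\<tau> X *\<^sub>v act \<tau> b y \<in> carrier_vec m" using c X by simp_all
    have "(?T\<^sup>T *\<^sub>v \<xi>) \<bullet> kron_vec (act \<rho> a x) (act \<tau> b y) = \<xi> \<bullet> (?T *\<^sub>v kron_vec (act \<rho> a x) (act \<tau> b y))"
      using scalar_prod_mult_mat_vec[OF Tc Cons.prems(2)] c by simp
    also have "\<dots> = \<xi> \<bullet> kron_vec (\<rho> X *\<^sub>v act \<rho> a x) (act \<tau> b y) + \<xi> \<bullet> kron_vec (act \<rho> a x) (\<tau> X *\<^sub>v act \<tau> b y)"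
      unfolding tensor_rep_kron_vec[where \<rho> = \<rho> and \<tau> = \<tau>, OF R.\<rho>_carrier[OF X] S.\<rho>_carrier[OF X] c]
      using Cons.prems(2) c c2 by (intro scalar_prod_add_distrib) auto
    finally show "(?T\<^sup>T *\<^sub>v \<xi>) \<bullet> kron_vec (act \<rho> a x) (act \<tau> b y) =
       \<xi> \<bullet> kron_vec (act \<rho> (X # a) x) (act \<tau> b y) + \<xi> \<bullet> kron_vec (act \<rho> a x) (act \<tau> (X # b) y)" by simp
  qed
  also have "\<dots> = (\<Sum>(a, b)\<leftarrow>splits (X # ws). \<xi> \<bullet> kron_vec (act \<rho> a x) (act \<tau> b y))"
    by (simp add: comp_def split_def sum_list_addf)
  finally show ?case .
qed simp

text \<open>A highest weight vector in a unitary representation, without irreducibility: in this form the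
  data pass to tensor products.\<close>

definition hw_data :: "weight \<Rightarrow> nat \<Rightarrow> (complex mat \<Rightarrow> complex mat) \<Rightarrow> complex vec \<Rightarrow> bool" where
  "hw_data lam n \<rho> v \<longleftrightarrow> lie_rep so7 n \<rho> \<and> (\<forall>X\<in>so7. \<rho> (adj X) = adj (\<rho> X)) \<and> v \<in> carrier_vec n \<and>
     (\<forall>X\<in>upper_so7. \<rho> X *\<^sub>v v = 0\<^sub>v n) \<and> (\<forall>T\<in>cartan. \<rho> T *\<^sub>v v = wt lam T \<cdot>\<^sub>v v)"

text \<open>The pair $(\lambda; p)$ is the signature of an invariant functional on some unitary representation,
  evaluated on the words applied to a vector of highest weight $\lambda$.\<close>

definition realizes :: "complex mat set \<Rightarrow> weight \<Rightarrow> (nat \<Rightarrow> nat) \<Rightarrow> bool" where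
  "realizes N lam p \<longleftrightarrow> (\<exists>n \<rho> v \<omega>. hw_data lam n \<rho> v \<and> \<omega> \<in> carrier_vec n \<and>
     (\<forall>X\<in>N. \<forall>w\<in>carrier_vec n. \<omega> \<bullet> (\<rho> X *\<^sub>v w) = 0) \<and>
     leading (\<lambda>q. \<omega> \<bullet> act \<rho> (map neg_vec (index_word q)) v) p)"

lemma wt_add: "wt (lam + mu) T = wt lam T + wt mu T"
  by (cases lam; cases mu) (auto simp: algebra_simps)

lemma hw_data_tensor:
  assumes 1: "hw_data lam n \<rho> v" and 2: "hw_data mu m \<tau> w"
  shows "hw_data (lam + mu) (n * m) (tensor_rep n \<rho> m \<tau>) (kron_vec v w)"
proof -
  have r: "lie_rep so7 n \<rho>" "lie_rep so7 m \<tau>" and v: "v \<in> carrier_vec n" and w: "w \<in> carrier_vec m"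
    using 1 2 by (auto simp: hw_data_def)
  have c: "\<rho> X \<in> carrier_mat n n" "\<tau> X \<in> carrier_mat m m" if "X \<in> so7" for X using r that by (auto simp: lie_rep_def)
  note T = tensor_rep_kron_vec[where \<rho> = \<rho> and \<tau> = \<tau>, OF c v w]
  show ?thesis unfolding hw_data_def
  proof (intro conjI ballI)
    show "lie_rep so7 (n * m) (tensor_rep n \<rho> m \<tau>)" using r by (rule lie_rep_tensor)
    show "tensor_rep n \<rho> m \<tau> (adj X) = adj (tensor_rep n \<rho> m \<tau> X)" if "X \<in> so7" for X
      using 1 2 that by (intro adj_tensor_rep[OF r]) (auto simp: hw_data_def)
    show "kron_vec v w \<in> carrier_vec (n * m)" using v w by simp
    show "tensor_rep n \<rho> m \<tau> X *\<^sub>v kron_vec v w = 0\<^sub>v (n * m)" if X: "X \<in> upper_so7" for X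
    proof -
      have so: "X \<in> so7" using X by (simp add: upper_so7_def)
      have "\<rho> X *\<^sub>v v = 0\<^sub>v n" "\<tau> X *\<^sub>v w = 0\<^sub>v m" using 1 2 X by (auto simp: hw_data_def)
      thus ?thesis using T[OF so so] v w by (simp add: kron_vec_zero)
    qed
    show "tensor_rep n \<rho> m \<tau> X *\<^sub>v kron_vec v w = wt (lam + mu) X \<cdot>\<^sub>v kron_vec v w" if X: "X \<in> cartan" for X
    proof -
      have so: "X \<in> so7" using X by (simp add: cartan_def)
      have "\<rho> X *\<^sub>v v = wt lam X \<cdot>\<^sub>v v" "\<tau> X *\<^sub>v w = wt mu X \<cdot>\<^sub>v w" using 1 2 X by (auto simp: hw_data_def)
      thus ?thesis using T[OF so so] v w by (simp add: kron_vec_smult add_smult_distrib_vec wt_add)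
    qed
  qed
qed

theorem realizes_add:
  assumes N: "N \<subseteq> so7" and 1: "realizes N lam p" and 2: "realizes N mu q"
  shows "realizes N (lam + mu) (p + q)"
proof -
  obtain n \<rho> v \<omega> where a: "hw_data lam n \<rho> v" "\<omega> \<in> carrier_vec n"
      "\<And>X w. X \<in> N \<Longrightarrow> w \<in> carrier_vec n \<Longrightarrow> \<omega> \<bullet> (\<rho> X *\<^sub>v w) = 0"
      "leading (\<lambda>q. \<omega> \<bullet> act \<rho> (map neg_vec (index_word q)) v) p"
    using 1 unfolding realizes_def by blast
  obtain m \<tau> w \<eta> where b: "hw_data mu m \<tau> w" "\<eta> \<in> carrier_vec m"
      "\<And>X w. X \<in> N \<Longrightarrow> w \<in> carrier_vec m \<Longrightarrow> \<eta> \<bullet> (\<tau> X *\<^sub>v w) = 0"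
      "leading (\<lambda>q. \<eta> \<bullet> act \<tau> (map neg_vec (index_word q)) w) q"
    using 2 unfolding realizes_def by blast
  have r: "lie_rep so7 n \<rho>" "lie_rep so7 m \<tau>" and v: "v \<in> carrier_vec n" and w: "w \<in> carrier_vec m"
    using a(1) b(1) by (auto simp: hw_data_def)
  interpret R: so7_rep n \<rho> by unfold_locales fact
  interpret S: so7_rep m \<tau> by unfold_locales fact
  have k: "kron_vec \<omega> \<eta> \<in> carrier_vec (n * m)" using a b by simp
  have inv: "kron_vec \<omega> \<eta> \<bullet> (tensor_rep n \<rho> m \<tau> X *\<^sub>v z) = 0" if X: "X \<in> N" and z: "z \<in> carrier_vec (n * m)" for X z
  proof (rule tensor_functional_vanish[OF r _ k _ z])
    show so: "X \<in> so7" using X N by blast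
    fix x y :: "complex vec" assume xy: "x \<in> carrier_vec n" "y \<in> carrier_vec m"
    show "kron_vec \<omega> \<eta> \<bullet> kron_vec (\<rho> X *\<^sub>v x) y + kron_vec \<omega> \<eta> \<bullet> kron_vec x (\<tau> X *\<^sub>v y) = 0"
      using a b xy so X by (simp add: kron_vec_scalar_prod[of _ n _ m])
  qed
  have "leading (\<lambda>q. \<Sum>(x, y)\<leftarrow>splits (index_word q). (\<omega> \<bullet> act \<rho> (map neg_vec x) v) * (\<eta> \<bullet> act \<tau> (map neg_vec y) w)) (p + q)"
    by (rule leading_shuffle[OF a(4) b(4)])
  also have "(\<lambda>q. \<Sum>(x, y)\<leftarrow>splits (index_word q). (\<omega> \<bullet> act \<rho> (map neg_vec x) v) * (\<eta> \<bullet> act \<tau> (map neg_vec y) w)) =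
     (\<lambda>q. kron_vec \<omega> \<eta> \<bullet> act (tensor_rep n \<rho> m \<tau>) (map neg_vec (index_word q)) (kron_vec v w))"
  proof
    fix q
    have so: "map neg_vec ws \<in> lists so7" if "set ws \<subseteq> {1..9}" for ws
      using that neg_vec_so7 by (induction ws) (auto simp del: atLeastAtMost_iff)
    have "kron_vec \<omega> \<eta> \<bullet> act (tensor_rep n \<rho> m \<tau>) (map neg_vec (index_word q)) (kron_vec v w) =
      (\<Sum>(x, y)\<leftarrow>splits (map neg_vec (index_word q)). kron_vec \<omega> \<eta> \<bullet> kron_vec (act \<rho> x v) (act \<tau> y w))"
      by (rule act_tensor[OF r v w so[OF set_index_word] k])
    also have "\<dots> = (\<Sum>(x, y)\<leftarrow>splits (index_word q). kron_vec \<omega> \<eta> \<bullet> kron_vec (act \<rho> (map neg_vec x) v) (act \<tau> (map neg_vec y) w))"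
      unfolding splits_map by (simp add: comp_def split_def)
    also have "\<dots> = (\<Sum>(x, y)\<leftarrow>splits (index_word q). (\<omega> \<bullet> act \<rho> (map neg_vec x) v) * (\<eta> \<bullet> act \<tau> (map neg_vec y) w))"
    proof (intro arg_cong[of _ _ sum_list] map_cong HOL.refl, clarify)
      fix x y assume xy: "(x, y) \<in> set (splits (index_word q))"
      have "set x \<union> set y = set (index_word q)" using splits_mset[OF xy] by (metis set_mset_mset set_mset_union)
      hence "set x \<subseteq> {1..9}" "set y \<subseteq> {1..9}" using set_index_word[of q] by auto
      hence "act \<rho> (map neg_vec x) v \<in> carrier_vec n" "act \<tau> (map neg_vec y) w \<in> carrier_vec m"
        using so v w by auto
      thus "kron_vec \<omega> \<eta> \<bullet> kron_vec (act \<rho> (map neg_vec x) v) (act \<tau> (map neg_vec y) w) =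
         (\<omega> \<bullet> act \<rho> (map neg_vec x) v) * (\<eta> \<bullet> act \<tau> (map neg_vec y) w)"
        using a(2) b(2) by (intro kron_vec_scalar_prod)
    qed
    finally show "(\<Sum>(x, y)\<leftarrow>splits (index_word q). (\<omega> \<bullet> act \<rho> (map neg_vec x) v) * (\<eta> \<bullet> act \<tau> (map neg_vec y) w)) =
      kron_vec \<omega> \<eta> \<bullet> act (tensor_rep n \<rho> m \<tau>) (map neg_vec (index_word q)) (kron_vec v w)" by simp
  qed
  finally show ?thesis unfolding realizes_def
    using hw_data_tensor[OF a(1) b(1)] k inv by blast
qed

text \<open>Restriction to the submodule generated by $v$ does not change the values of the functional on words
  applied to $v$, and that submodule is irreducible. An isometry onto it transports the
  representation to matrices, compatibly with adjoints. Invariance under the generators extends to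
  the whole subalgebra because the annihilated condition is stable under brackets.\<close>

theorem realizes_branching:
  assumes e: "\<And>i. i \<in> {1..9} \<Longrightarrow> e i = \<kappa> i \<cdot>\<^sub>m neg_vec i \<and> \<kappa> i \<noteq> 0"
    and N: "lie_gen N \<subseteq> so7" and dom: "dominant lam" and re: "realizes N lam p"
  shows "(lam, p) \<in> branching_semigroup e (lie_gen N)"
proof -
  obtain n \<rho> v \<omega> where d: "hw_data lam n \<rho> v" "\<omega> \<in> carrier_vec n"
      "\<And>X w. X \<in> N \<Longrightarrow> w \<in> carrier_vec n \<Longrightarrow> \<omega> \<bullet> (\<rho> X *\<^sub>v w) = 0"
      and lead: "leading (\<lambda>q. \<omega> \<bullet> act \<rho> (map neg_vec (index_word q)) v) p"
    using re unfolding realizes_def by blast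
  have NN: "N \<subseteq> so7" using N lie_gen.base by blast
  have so: "map neg_vec (index_word q) \<in> lists so7" for q
  proof -
    have "set (map neg_vec (index_word q)) \<subseteq> so7" using set_index_word[of q] by auto
    thus ?thesis by blast
  qed
  have v: "v \<in> carrier_vec n" and rep: "lie_rep so7 n \<rho>" using d(1) by (auto simp: hw_data_def)
  have v0: "v \<noteq> 0\<^sub>v n"
  proof
    assume v0: "v = 0\<^sub>v n"
    interpret so7_rep n \<rho> by unfold_locales fact
    have "act \<rho> ws v = 0\<^sub>v n" if "ws \<in> lists so7" for ws
      using that
    proof (induction ws)
      case (Cons X ws)
      have "\<rho> X *\<^sub>v 0\<^sub>v n = 0\<^sub>v n" using carrier_matD[OF \<rho>_carrier[OF Cons.hyps(1)]] by (intro eq_vecI) (auto simp: scalar_prod_def)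
      thus ?case using Cons by simp
    qed (simp add: v0)
    thus False using lead so d(2) by (simp add: leading_def)
  qed
  interpret unitary_hw_rep n \<rho> lam v
    using d(1) v0 by unfold_locales (auto simp: hw_data_def)
  let ?M = "lower_cyclic \<rho> v"
  have Mc: "?M \<subseteq> carrier_vec n" using cyclic_carrier by blast
  have "0 \<cdot>\<^sub>v v \<in> ?M" by (intro lower_cyclic.intros)
  moreover have "0 \<cdot>\<^sub>v v = 0\<^sub>v n" using v by (intro eq_vecI) auto
  ultimately have M0: "0\<^sub>v n \<in> ?M" by simp
  obtain m P where P: "P \<in> carrier_mat n m" "adj P * P = 1\<^sub>m m" "?M = {P *\<^sub>v x | x. x \<in> carrier_vec m}"
    by (rule orthonormal_basis_exists[OF Mc M0 lower_cyclic.add lower_cyclic.smult])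
  have aP: "adj P \<in> carrier_mat m n" using P by simp
  have Pid: "P *\<^sub>v (adj P *\<^sub>v x) = x" if x: "x \<in> ?M" for x
  proof -
    obtain y where y: "x = P *\<^sub>v y" "y \<in> carrier_vec m" using x unfolding P(3) by blast
    have "adj P *\<^sub>v (P *\<^sub>v y) = y" by (rule orthonormal_columns_cancel[OF P(1,2) y(2)])
    thus ?thesis using y by simp
  qed
  have idP: "adj P *\<^sub>v (P *\<^sub>v y) = y" if "y \<in> carrier_vec m" for y
    by (rule orthonormal_columns_cancel[OF P(1,2) that])
  have PM: "P *\<^sub>v y \<in> ?M" if "y \<in> carrier_vec m" for y using that unfolding P(3) by blast
  define \<tau> where "\<tau> X = adj P * (\<rho> X * P)" for X
  have \<tau>c: "\<tau> X \<in> carrier_mat m m" if "X \<in> so7" for X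
    unfolding \<tau>_def using aP P(1) \<rho>_carrier[OF that] by (intro mult_carrier_mat[of _ m n] mult_carrier_mat[of _ n n])
  have \<tau>v: "\<tau> X *\<^sub>v y = adj P *\<^sub>v (\<rho> X *\<^sub>v (P *\<^sub>v y))" if "X \<in> so7" "y \<in> carrier_vec m" for X y
    unfolding \<tau>_def using aP P(1) \<rho>_carrier[OF that(1)] that(2)
    by (simp add: assoc_mult_mat_vec[of _ m n _ m] assoc_mult_mat_vec[of _ n n _ m] mult_carrier_mat[of _ n n])
  have Pint: "P *\<^sub>v (\<tau> X *\<^sub>v y) = \<rho> X *\<^sub>v (P *\<^sub>v y)" if "X \<in> so7" "y \<in> carrier_vec m" for X y
    unfolding \<tau>v[OF that] by (rule Pid) (rule cyclic_invariant[OF PM[OF that(2)] that(1)])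
  have Pinj: "x = y" if "P *\<^sub>v x = P *\<^sub>v y" "x \<in> carrier_vec m" "y \<in> carrier_vec m" for x y
    using idP that by metis
  have trep: "lie_rep so7 m \<tau>"
    unfolding lie_rep_def
  proof (intro conjI ballI allI)
    fix X assume X: "X \<in> so7"
    show "\<tau> X \<in> carrier_mat m m" using X by (rule \<tau>c)
    show "\<tau> (c \<cdot>\<^sub>m X) = c \<cdot>\<^sub>m \<tau> X" for c
    proof (rule mat_eq_by_vec)
      show "\<tau> (c \<cdot>\<^sub>m X) \<in> carrier_mat m m" "c \<cdot>\<^sub>m \<tau> X \<in> carrier_mat m m" using X \<tau>c by auto
      fix y :: "complex vec" assume y: "y \<in> carrier_vec m"
      show "\<tau> (c \<cdot>\<^sub>m X) *\<^sub>v y = (c \<cdot>\<^sub>m \<tau> X) *\<^sub>v y"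
        using X y P(1) aP \<tau>c[OF X] \<rho>_carrier[OF X] by (simp add: \<tau>v \<rho>_smult mult_mat_vec_smult[of _ n n] mult_mat_vec_smult[of _ m m] mult_mat_vec[of _ m n])
    qed
    fix Y assume Y: "Y \<in> so7"
    show "\<tau> (X + Y) = \<tau> X + \<tau> Y"
    proof (rule mat_eq_by_vec)
      show "\<tau> (X + Y) \<in> carrier_mat m m" "\<tau> X + \<tau> Y \<in> carrier_mat m m" using X Y \<tau>c by auto
      fix y :: "complex vec" assume y: "y \<in> carrier_vec m"
      show "\<tau> (X + Y) *\<^sub>v y = (\<tau> X + \<tau> Y) *\<^sub>v y"
        using X Y y P(1) aP \<tau>c[OF X] \<tau>c[OF Y] \<rho>_carrier[OF X] \<rho>_carrier[OF Y]
        by (simp add: \<tau>v \<rho>_add add_mult_distrib_mat_vec[of _ n n] add_mult_distrib_mat_vec[of _ m m] mult_add_distrib_mat_vec[of _ m n])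
    qed
    show "\<tau> (lie_br X Y) = lie_br (\<tau> X) (\<tau> Y)"
    proof (rule mat_eq_by_vec)
      show "\<tau> (lie_br X Y) \<in> carrier_mat m m" "lie_br (\<tau> X) (\<tau> Y) \<in> carrier_mat m m" using X Y \<tau>c by auto
      fix y :: "complex vec" assume y: "y \<in> carrier_vec m"
      have c: "\<tau> X *\<^sub>v (\<tau> Y *\<^sub>v y) \<in> carrier_vec m" "\<tau> Y *\<^sub>v (\<tau> X *\<^sub>v y) \<in> carrier_vec m" "\<tau> (lie_br X Y) *\<^sub>v y \<in> carrier_vec m"
        "\<tau> Y *\<^sub>v y \<in> carrier_vec m" "\<tau> X *\<^sub>v y \<in> carrier_vec m"
        using X Y y \<tau>c mult_mat_vec_carrier so7_bracket by meson+
      have Py: "P *\<^sub>v y \<in> carrier_vec n" using P(1) y by simp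
      have "P *\<^sub>v (\<tau> X *\<^sub>v (\<tau> Y *\<^sub>v y)) = \<rho> X *\<^sub>v (\<rho> Y *\<^sub>v (P *\<^sub>v y))"
        unfolding Pint[OF X c(4)] Pint[OF Y y] ..
      also have "\<dots> = \<rho> Y *\<^sub>v (\<rho> X *\<^sub>v (P *\<^sub>v y)) + \<rho> (lie_br X Y) *\<^sub>v (P *\<^sub>v y)"
        by (rule bracket_vec[OF X Y Py])
      also have "\<dots> = P *\<^sub>v (\<tau> Y *\<^sub>v (\<tau> X *\<^sub>v y)) + P *\<^sub>v (\<tau> (lie_br X Y) *\<^sub>v y)"
        unfolding Pint[OF Y c(5)] Pint[OF X y] Pint[OF so7_bracket[OF X Y] y] ..
      also have "\<dots> = P *\<^sub>v (\<tau> Y *\<^sub>v (\<tau> X *\<^sub>v y) + \<tau> (lie_br X Y) *\<^sub>v y)"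
        by (rule mult_add_distrib_mat_vec[symmetric, OF P(1) c(2,3)])
      finally have e: "\<tau> X *\<^sub>v (\<tau> Y *\<^sub>v y) = \<tau> Y *\<^sub>v (\<tau> X *\<^sub>v y) + \<tau> (lie_br X Y) *\<^sub>v y"
        by (rule Pinj[OF _ c(1) add_carrier_vec[OF c(2,3)]])
      have cancel: "u + w - u = w" if "u \<in> carrier_vec m" "w \<in> carrier_vec m" for u w :: "complex vec"
        using that by (intro eq_vecI) auto
      have "lie_br (\<tau> X) (\<tau> Y) *\<^sub>v y = \<tau> X *\<^sub>v (\<tau> Y *\<^sub>v y) - \<tau> Y *\<^sub>v (\<tau> X *\<^sub>v y)"
        using \<tau>c[OF X] \<tau>c[OF Y] y by (simp add: lie_br_def minus_mult_distrib_mat_vec[of _ m m] assoc_mult_mat_vec[of _ m m _ m] mult_carrier_mat[of _ m m])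
      also have "\<dots> = \<tau> (lie_br X Y) *\<^sub>v y" unfolding e by (rule cancel[OF c(2,3)])
      finally show "\<tau> (lie_br X Y) *\<^sub>v y = lie_br (\<tau> X) (\<tau> Y) *\<^sub>v y" by simp
    qed
  qed
  define v' where "v' = adj P *\<^sub>v v"
  have v'c: "v' \<in> carrier_vec m" using aP v by (simp add: v'_def)
  have Pv': "P *\<^sub>v v' = v" unfolding v'_def by (rule Pid) (rule lower_cyclic.base)
  have P0: "P *\<^sub>v 0\<^sub>v m = 0\<^sub>v n" using P(1) by (intro eq_vecI) auto
  have Tu: "unitary_hw_rep m \<tau> lam v'"
  proof
    show "lie_rep so7 m \<tau>" by (rule trep)
    show "\<tau> (adj X) = adj (\<tau> X)" if X: "X \<in> so7" for X
    proof -
      note rX = \<rho>_carrier[OF X]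
      have c: "adj (\<rho> X) \<in> carrier_mat n n" using rX by simp
      have "adj (\<tau> X) = (adj P * adj (\<rho> X)) * P"
        unfolding \<tau>_def using adj_mult[OF aP mult_carrier_mat[OF rX P(1)]] adj_mult[OF rX P(1)] by simp
      also have "\<dots> = adj P * (adj (\<rho> X) * P)" using aP c P(1) by (rule assoc_mult_mat)
      finally show ?thesis unfolding \<tau>_def adj_\<rho>[OF X] by simp
    qed
    show "v' \<in> carrier_vec m" by (rule v'c)
    show "v' \<noteq> 0\<^sub>v m" using Pv' P0 v0 by auto
    show "\<tau> X *\<^sub>v v' = 0\<^sub>v m" if X: "X \<in> upper_so7" for X
    proof -
      have so: "X \<in> so7" using X by (simp add: upper_so7_def)
      have "\<tau> X *\<^sub>v v' = adj P *\<^sub>v 0\<^sub>v n" unfolding \<tau>v[OF so v'c] Pv' upper_v[OF X] ..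
      thus ?thesis using P(1) by (auto intro!: eq_vecI simp: scalar_prod_def)
    qed
    show "\<tau> T *\<^sub>v v' = wt lam T \<cdot>\<^sub>v v'" if T: "T \<in> cartan" for T
    proof -
      have so: "T \<in> so7" using T by (simp add: cartan_def)
      show ?thesis unfolding \<tau>v[OF so v'c] Pv' cartan_v[OF T] using aP v by (simp add: v'_def mult_mat_vec[of _ m n])
    qed
  qed
  interpret T: unitary_hw_rep m \<tau> lam v' by (rule Tu)
  have image: "adj P *\<^sub>v x \<in> lower_cyclic \<tau> v'" if "x \<in> ?M" for x
    using that
  proof (induction rule: lower_cyclic.induct)
    case base
    show ?case unfolding v'_def[symmetric] by (rule lower_cyclic.base)
  next
    case (add x y)
    have "adj P *\<^sub>v (x + y) = adj P *\<^sub>v x + adj P *\<^sub>v y"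
      using aP cyclic_carrier[OF add(1)] cyclic_carrier[OF add(2)] by (rule mult_add_distrib_mat_vec)
    thus ?case using add by (auto intro: lower_cyclic.add)
  next
    case (smult x c)
    have "adj P *\<^sub>v (c \<cdot>\<^sub>v x) = c \<cdot>\<^sub>v (adj P *\<^sub>v x)"
      using aP cyclic_carrier[OF smult(1)] by (rule mult_mat_vec)
    thus ?case using smult by (auto intro: lower_cyclic.smult)
  next
    case (act X x)
    have so: "X \<in> so7" using act by (simp add: lower_so7_def)
    have ac: "adj P *\<^sub>v x \<in> carrier_vec m" using aP cyclic_carrier[OF act(2)] by simp
    have "adj P *\<^sub>v (\<rho> X *\<^sub>v x) = \<tau> X *\<^sub>v (adj P *\<^sub>v x)"
      unfolding \<tau>v[OF so ac] Pid[OF act(2)] ..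
    thus ?case using act by (auto intro: lower_cyclic.act)
  qed
  have "y \<in> lower_cyclic \<tau> v'" if "y \<in> carrier_vec m" for y
    using image[OF PM[OF that]] unfolding idP[OF that] .
  hence cyc: "lower_cyclic \<tau> v' = carrier_vec m" using T.cyclic_carrier by blast
  have hw: "hw_module lam m \<tau> v'"
    unfolding hw_module_def using T.irreducible_if_cyclic[OF cyc] T.v T.v0 T.upper_v T.cartan_v n_plus_upper by blast
  define \<eta> where "\<eta> = P\<^sup>T *\<^sub>v \<omega>"
  have \<eta>c: "\<eta> \<in> carrier_vec m" using P(1) d(2) by (simp add: \<eta>_def)
  have \<eta>: "\<eta> \<bullet> y = \<omega> \<bullet> (P *\<^sub>v y)" if "y \<in> carrier_vec m" for y
    unfolding \<eta>_def using scalar_prod_mult_mat_vec[OF P(1) d(2) that] by simp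
  have inv: "\<eta> \<bullet> (\<tau> X *\<^sub>v y) = 0" if "X \<in> lie_gen N" "y \<in> carrier_vec m" for X y
    using that
  proof (induction arbitrary: y rule: lie_gen.induct)
    case (base X)
    have so: "X \<in> so7" using base NN by blast
    show ?case using \<eta>[of "\<tau> X *\<^sub>v y"] Pint[OF so base(2)] d(3)[OF base(1), of "P *\<^sub>v y"] T.\<rho>_carrier_vec[OF so base(2)] P(1) base(2) by simp
  next
    case zero
    have "\<tau> (0\<^sub>m 7 7) = 0 \<cdot>\<^sub>m \<tau> (0\<^sub>m 7 7)" using T.\<rho>_smult[OF so7_zero, of 0] by (simp add: zero_smult7)
    hence "\<tau> (0\<^sub>m 7 7) *\<^sub>v y = (0 \<cdot>\<^sub>m \<tau> (0\<^sub>m 7 7)) *\<^sub>v y" by (rule arg_cong)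
    also have "\<dots> = 0 \<cdot>\<^sub>v (\<tau> (0\<^sub>m 7 7) *\<^sub>v y)"
      by (rule mult_mat_vec_smult[OF T.\<rho>_carrier[OF so7_zero] zero])
    finally have "\<eta> \<bullet> (\<tau> (0\<^sub>m 7 7) *\<^sub>v y) = \<eta> \<bullet> (0 \<cdot>\<^sub>v (\<tau> (0\<^sub>m 7 7) *\<^sub>v y))" by (rule arg_cong)
    also have "\<dots> = 0 * (\<eta> \<bullet> (\<tau> (0\<^sub>m 7 7) *\<^sub>v y))"
      by (rule scalar_prod_smult_distrib[OF \<eta>c mult_mat_vec_carrier[OF T.\<rho>_carrier[OF so7_zero] zero]])
    finally show ?case by simp
  next
    case (add X Y)
    have so: "X \<in> so7" "Y \<in> so7" using add.hyps N by auto
    show ?case using add so \<eta>c by (simp add: T.\<rho>_add add_mult_distrib_mat_vec[of _ m m] scalar_prod_add_distrib[of _ m])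
  next
    case (smult X c)
    have so: "X \<in> so7" using smult.hyps N by auto
    show ?case using smult so \<eta>c by (simp add: T.\<rho>_smult mult_mat_vec_smult[of _ m m])
  next
    case (bracket X Y)
    have so: "X \<in> so7" "Y \<in> so7" using bracket.hyps N by auto
    have "\<eta> \<bullet> (\<tau> X *\<^sub>v (\<tau> Y *\<^sub>v y)) = \<eta> \<bullet> (\<tau> Y *\<^sub>v (\<tau> X *\<^sub>v y)) + \<eta> \<bullet> (\<tau> (lie_br X Y) *\<^sub>v y)"
      using T.bracket_vec[OF so bracket.prems] so \<eta>c bracket.prems by (simp add: scalar_prod_add_distrib[of _ m])
    thus ?case using bracket.IH so bracket.prems by simp
  qed
  have dual: "\<eta> \<in> dual_invariants (lie_gen N) m \<tau>"
  proof (subst dual_invariants_iff)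
    show "\<tau> X \<in> carrier_mat m m" if "X \<in> lie_gen N" for X using that N T.\<rho>_carrier by blast
    show "c \<cdot>\<^sub>m X \<in> lie_gen N \<and> \<tau> (c \<cdot>\<^sub>m X) = c \<cdot>\<^sub>m \<tau> X" if "X \<in> lie_gen N" for X c
      using that N T.\<rho>_smult lie_gen.smult by blast
  qed (use inv \<eta>c in auto)
  have acts: "act \<tau> ws v' \<in> carrier_vec m \<and> P *\<^sub>v act \<tau> ws v' = act \<rho> ws v" if "ws \<in> lists so7" for ws
    using that
  proof (induction ws)
    case Nil
    show ?case using v'c Pv' by simp
  next
    case (Cons X ws)
    thus ?case using Pint by simp
  qed
  have "\<eta> \<bullet> act \<tau> (map neg_vec (index_word q)) v' = \<omega> \<bullet> act \<rho> (map neg_vec (index_word q)) v" for q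
    using \<eta> acts[OF so[of q]] by simp
  hence lead': "leading (\<lambda>q. \<eta> \<bullet> act \<tau> (map neg_vec (index_word q)) v') p" using lead by simp
  have sign: "is_sign e \<tau> v' \<eta> p"
    by (rule iffD2[OF T.is_sign_iff[OF e v'c \<eta>c] lead'[unfolded leading_def]])
  have "\<eta> \<noteq> 0\<^sub>v m"
  proof
    assume "\<eta> = 0\<^sub>v m"
    hence "\<eta> \<bullet> act \<tau> (map neg_vec (index_word p)) v' = 0" using acts[OF so[of p]] by simp
    thus False using lead' by (simp add: leading_def)
  qed
  thus ?thesis unfolding branching_semigroup_def using dom hw dual sign by blast
qed

section \<open>The spin representation\<close>

definition half_root :: complex where "half_root = of_real (1 / sqrt 2)"

lemma half_root: "half_root * half_root = 1 / 2" "half_root * (half_root * x) = x / 2" "cnj half_root = half_root" "half_root \<noteq> 0"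
proof -
  have "half_root * half_root = of_real ((1 / sqrt 2) * (1 / sqrt 2))" unfolding half_root_def of_real_mult ..
  also have "(1 / sqrt 2) * (1 / sqrt 2) = (1 / 2 :: real)" by simp
  finally show r: "half_root * half_root = 1 / 2" by simp
  show "half_root * (half_root * x) = x / 2" unfolding mult.assoc[symmetric] r by simp
  show "cnj half_root = half_root" "half_root \<noteq> 0" by (simp_all add: half_root_def)
qed

text \<open>The spin representation in the exterior algebra $\bigwedge\mathbb C^3$, with the basis ordered so
  that the weights are $\frac12(\pm1,\pm1,\pm1)$ in lexicographically decreasing order and the signs
  normalized so that the matrix of the adjoint is the adjoint of the matrix; the entries with
  $1/\sqrt2$ belong to the short roots.\<close>

definition spin_entries :: "complex mat \<Rightarrow> complex list list" where
  "spin_entries X = [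
   [X $$ (0,0) / 2 + X $$ (1,1) / 2 + X $$ (2,2) / 2, half_root * X $$ (2,3), - half_root * X $$ (1,3), X $$ (1,4), half_root * X $$ (0,3), - X $$ (0,4), X $$ (0,5), 0],
   [half_root * X $$ (3,2), X $$ (0,0) / 2 + X $$ (1,1) / 2 - X $$ (2,2) / 2, X $$ (1,2), half_root * X $$ (1,3), - X $$ (0,2), - half_root * X $$ (0,3), 0, X $$ (0,5)],
   [- half_root * X $$ (3,1), X $$ (2,1), X $$ (0,0) / 2 - X $$ (1,1) / 2 + X $$ (2,2) / 2, half_root * X $$ (2,3), X $$ (0,1), 0, - half_root * X $$ (0,3), X $$ (0,4)],
   [X $$ (4,1), half_root * X $$ (3,1), half_root * X $$ (3,2), X $$ (0,0) / 2 - X $$ (1,1) / 2 - X $$ (2,2) / 2, 0, X $$ (0,1), X $$ (0,2), half_root * X $$ (0,3)],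
   [half_root * X $$ (3,0), - X $$ (2,0), X $$ (1,0), 0, - X $$ (0,0) / 2 + X $$ (1,1) / 2 + X $$ (2,2) / 2, half_root * X $$ (2,3), - half_root * X $$ (1,3), X $$ (1,4)],
   [- X $$ (4,0), - half_root * X $$ (3,0), 0, X $$ (1,0), half_root * X $$ (3,2), - X $$ (0,0) / 2 + X $$ (1,1) / 2 - X $$ (2,2) / 2, X $$ (1,2), half_root * X $$ (1,3)],
   [X $$ (5,0), 0, - half_root * X $$ (3,0), X $$ (2,0), - half_root * X $$ (3,1), X $$ (2,1), - X $$ (0,0) / 2 - X $$ (1,1) / 2 + X $$ (2,2) / 2, half_root * X $$ (2,3)],
   [0, X $$ (5,0), X $$ (4,0), half_root * X $$ (3,0), X $$ (4,1), half_root * X $$ (3,1), half_root * X $$ (3,2), - X $$ (0,0) / 2 - X $$ (1,1) / 2 - X $$ (2,2) / 2]]"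

definition spin :: "complex mat \<Rightarrow> complex mat" where
  "spin X = mat 8 8 (\<lambda>(i, j). spin_entries X ! i ! j)"

lemma less8: "i < (8::nat) \<longleftrightarrow> i = 0 \<or> i = 1 \<or> i = 2 \<or> i = 3 \<or> i = 4 \<or> i = 5 \<or> i = 6 \<or> i = 7"
  by auto

lemma sum8: "sum g {0..<8::nat} = g 0 + g 1 + g 2 + g 3 + g 4 + g 5 + g 6 + (g 7 :: complex)"
  by (simp add: eval_nat_numeral)

lemma spin_carrier [simp]: "spin X \<in> carrier_mat 8 8" by (simp add: spin_def)

lemma spin_index: "i < 8 \<Longrightarrow> j < 8 \<Longrightarrow> spin X $$ (i, j) = spin_entries X ! i ! j" by (simp add: spin_def)

lemma mat8_eqI:
  assumes "A \<in> carrier_mat 8 8" "B \<in> carrier_mat 8 8"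
    "\<And>i j. i \<in> {0,1,2,3,4,5,6,7} \<Longrightarrow> j \<in> {0,1,2,3,4,5,6,7} \<Longrightarrow> A $$ (i, j) = B $$ (i, j)"
  shows "A = B"
  using assms by (intro eq_matI) (auto simp: less8)

lemma so7_dependent_entries:
  assumes "X \<in> so7"
  shows "X $$ (1,6) = - X $$ (0,5)" "X $$ (2,6) = - X $$ (0,4)" "X $$ (3,6) = - X $$ (0,3)" "X $$ (4,6) = - X $$ (0,2)" "X $$ (5,6) = - X $$ (0,1)"
    "X $$ (6,6) = - X $$ (0,0)" "X $$ (2,5) = - X $$ (1,4)" "X $$ (3,5) = - X $$ (1,3)" "X $$ (4,5) = - X $$ (1,2)" "X $$ (5,5) = - X $$ (1,1)"
    "X $$ (6,5) = - X $$ (1,0)" "X $$ (3,4) = - X $$ (2,3)" "X $$ (4,4) = - X $$ (2,2)" "X $$ (5,4) = - X $$ (2,1)" "X $$ (6,4) = - X $$ (2,0)"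
    "X $$ (4,3) = - X $$ (3,2)" "X $$ (5,3) = - X $$ (3,1)" "X $$ (6,3) = - X $$ (3,0)" "X $$ (5,2) = - X $$ (4,1)" "X $$ (6,2) = - X $$ (4,0)"
    "X $$ (6,1) = - X $$ (5,0)" "X $$ (0,6) = 0" "X $$ (1,5) = 0" "X $$ (2,4) = 0" "X $$ (3,3) = 0" "X $$ (4,2) = 0" "X $$ (5,1) = 0" "X $$ (6,0) = 0"
proof -
  note e = so7_entry[OF assms]
  show "X $$ (1,6) = - X $$ (0,5)" "X $$ (2,6) = - X $$ (0,4)" "X $$ (3,6) = - X $$ (0,3)" "X $$ (4,6) = - X $$ (0,2)" "X $$ (5,6) = - X $$ (0,1)"
    "X $$ (6,6) = - X $$ (0,0)" "X $$ (2,5) = - X $$ (1,4)" "X $$ (3,5) = - X $$ (1,3)" "X $$ (4,5) = - X $$ (1,2)" "X $$ (5,5) = - X $$ (1,1)"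
    "X $$ (6,5) = - X $$ (1,0)" "X $$ (3,4) = - X $$ (2,3)" "X $$ (4,4) = - X $$ (2,2)" "X $$ (5,4) = - X $$ (2,1)" "X $$ (6,4) = - X $$ (2,0)"
    "X $$ (4,3) = - X $$ (3,2)" "X $$ (5,3) = - X $$ (3,1)" "X $$ (6,3) = - X $$ (3,0)" "X $$ (5,2) = - X $$ (4,1)" "X $$ (6,2) = - X $$ (4,0)"
    "X $$ (6,1) = - X $$ (5,0)"
    using e[of 1 6] e[of 2 6] e[of 3 6] e[of 4 6] e[of 5 6] e[of 6 6] e[of 2 5] e[of 3 5] e[of 4 5] e[of 5 5] e[of 6 5]
      e[of 3 4] e[of 4 4] e[of 5 4] e[of 6 4] e[of 4 3] e[of 5 3] e[of 6 3] e[of 5 2] e[of 6 2] e[of 6 1] by simp_all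
  have "X $$ (0,6) = - X $$ (0,6)" "X $$ (1,5) = - X $$ (1,5)" "X $$ (2,4) = - X $$ (2,4)" "X $$ (3,3) = - X $$ (3,3)"
    "X $$ (4,2) = - X $$ (4,2)" "X $$ (5,1) = - X $$ (5,1)" "X $$ (6,0) = - X $$ (6,0)"
    using e[of 0 6] e[of 1 5] e[of 2 4] e[of 3 3] e[of 4 2] e[of 5 1] e[of 6 0] by simp_all
  thus "X $$ (0,6) = 0" "X $$ (1,5) = 0" "X $$ (2,4) = 0" "X $$ (3,3) = 0" "X $$ (4,2) = 0" "X $$ (5,1) = 0" "X $$ (6,0) = 0"
    by simp_all
qed

lemma lie_br_index8:
  assumes "A \<in> carrier_mat 8 8" "B \<in> carrier_mat 8 8" "i < 8" "j < 8"
  shows "lie_br A B $$ (i, j) = (\<Sum>k\<in>{0..<8}. A $$ (i, k) * B $$ (k, j) - B $$ (i, k) * A $$ (k, j))"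
proof -
  have "lie_br A B $$ (i, j) = (A * B) $$ (i, j) - (B * A) $$ (i, j)"
    unfolding lie_br_def using assms by (subst index_minus_mat) auto
  thus ?thesis using assms by (simp add: scalar_prod_def sum_subtractf)
qed

lemma nth_list8: "[a0,a1,a2,a3,a4,a5,a6,a7] ! 0 = a0" "[a0,a1,a2,a3,a4,a5,a6,a7] ! 1 = a1" "[a0,a1,a2,a3,a4,a5,a6,a7] ! 2 = a2"
  "[a0,a1,a2,a3,a4,a5,a6,a7] ! 3 = a3" "[a0,a1,a2,a3,a4,a5,a6,a7] ! 4 = a4" "[a0,a1,a2,a3,a4,a5,a6,a7] ! 5 = a5"
  "[a0,a1,a2,a3,a4,a5,a6,a7] ! 6 = a6" "[a0,a1,a2,a3,a4,a5,a6,a7] ! 7 = a7"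
  by simp_all

text \<open>Both sides are bilinear in the entries of $X$ and $Y$, so each of the $64$ entries is a polynomial
  identity once the dependent entries of $X$ and $Y$ are eliminated.\<close>

lemma spin_bracket:
  assumes X: "X \<in> so7" and Y: "Y \<in> so7"
  shows "spin (lie_br X Y) = lie_br (spin X) (spin Y)"
proof (rule mat8_eqI)
  have b: "lie_br X Y $$ (p, q) = X $$ (p, 0) * Y $$ (0, q) - Y $$ (p, 0) * X $$ (0, q) + (X $$ (p, 1) * Y $$ (1, q) - Y $$ (p, 1) * X $$ (1, q))
     + (X $$ (p, 2) * Y $$ (2, q) - Y $$ (p, 2) * X $$ (2, q)) + (X $$ (p, 3) * Y $$ (3, q) - Y $$ (p, 3) * X $$ (3, q))
     + (X $$ (p, 4) * Y $$ (4, q) - Y $$ (p, 4) * X $$ (4, q)) + (X $$ (p, 5) * Y $$ (5, q) - Y $$ (p, 5) * X $$ (5, q))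
     + (X $$ (p, 6) * Y $$ (6, q) - Y $$ (p, 6) * X $$ (6, q))" if "p < 7" "q < 7" for p q
    using X Y that by (simp add: lie_br_index sum7)
  show "lie_br (spin X) (spin Y) \<in> carrier_mat 8 8" by simp
  fix i j :: nat assume ij: "i \<in> {0,1,2,3,4,5,6,7}" "j \<in> {0,1,2,3,4,5,6,7}"
  hence lt: "i < 8" "j < 8" by auto
  have R: "lie_br (spin X) (spin Y) $$ (i, j) = (\<Sum>k\<in>{0..<8}. spin_entries X ! i ! k * spin_entries Y ! k ! j - spin_entries Y ! i ! k * spin_entries X ! k ! j)"
    using lt by (simp add: lie_br_index8 spin_index)
  show "spin (lie_br X Y) $$ (i, j) = lie_br (spin X) (spin Y) $$ (i, j)"
    unfolding R spin_index[OF lt] sum8 using ij unfolding insert_iff empty_iff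
    by (elim disjE FalseE; hypsubst; unfold spin_entries_def nth_list8;
       simp add: b so7_dependent_entries[OF X] so7_dependent_entries[OF Y] del: One_nat_def; simp add: algebra_simps half_root add_divide_distrib diff_divide_distrib)
qed simp

lemma spin_rep: "lie_rep so7 8 spin"
  unfolding lie_rep_def
proof (intro conjI ballI allI)
  fix X assume X: "X \<in> so7"
  note Xd = carrier_matD[OF so7_carrier[OF X]]
  show "spin X \<in> carrier_mat 8 8" by simp
  show "spin (c \<cdot>\<^sub>m X) = c \<cdot>\<^sub>m spin X" for c
  proof (rule mat8_eqI)
    fix i j :: nat assume ij: "i \<in> {0,1,2,3,4,5,6,7}" "j \<in> {0,1,2,3,4,5,6,7}"
    hence lt: "i < 8" "j < 8" by auto
    have "(c \<cdot>\<^sub>m spin X) $$ (i, j) = c * spin_entries X ! i ! j" using lt by (simp add: spin_def)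
    thus "spin (c \<cdot>\<^sub>m X) $$ (i, j) = (c \<cdot>\<^sub>m spin X) $$ (i, j)"
      unfolding spin_index[OF lt] using ij unfolding insert_iff empty_iff
      by (elim disjE FalseE; hypsubst; simp only: spin_entries_def nth_list8;
         simp add: Xd algebra_simps add_divide_distrib diff_divide_distrib del: One_nat_def)
  qed auto
  fix Y assume Y: "Y \<in> so7"
  note Yd = carrier_matD[OF so7_carrier[OF Y]]
  show "spin (X + Y) = spin X + spin Y"
  proof (rule mat8_eqI)
    fix i j :: nat assume ij: "i \<in> {0,1,2,3,4,5,6,7}" "j \<in> {0,1,2,3,4,5,6,7}"
    hence lt: "i < 8" "j < 8" by auto
    have "(spin X + spin Y) $$ (i, j) = spin_entries X ! i ! j + spin_entries Y ! i ! j" using lt by (simp add: spin_def)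
    thus "spin (X + Y) $$ (i, j) = (spin X + spin Y) $$ (i, j)"
      unfolding spin_index[OF lt] using ij unfolding insert_iff empty_iff
      by (elim disjE FalseE; hypsubst; simp only: spin_entries_def nth_list8;
         simp add: Xd Yd algebra_simps add_divide_distrib diff_divide_distrib del: One_nat_def)
  qed auto
  show "spin (lie_br X Y) = lie_br (spin X) (spin Y)" using X Y by (rule spin_bracket)
qed

lemma spin_adj:
  assumes X: "X \<in> so7" shows "spin (adj X) = adj (spin X)"
proof (rule mat8_eqI)
  note a = adj_index[OF so7_carrier[OF X]]
  fix i j :: nat assume ij: "i \<in> {0,1,2,3,4,5,6,7}" "j \<in> {0,1,2,3,4,5,6,7}"
  hence lt: "i < 8" "j < 8" by auto
  have "adj (spin X) $$ (i, j) = cnj (spin_entries X ! j ! i)" using lt by (simp add: adj_index[OF spin_carrier] spin_index)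
  thus "spin (adj X) $$ (i, j) = adj (spin X) $$ (i, j)"
    unfolding spin_index[OF lt] using ij unfolding insert_iff empty_iff
    by (elim disjE FalseE; hypsubst; simp only: spin_entries_def nth_list8; simp add: a half_root)
qed (auto intro: adj_carrier)

section \<open>Invariant functionals realizing the generators\<close>

definition single :: "nat \<Rightarrow> nat \<Rightarrow> nat" where "single k = (\<lambda>i. if i = k then 1 else 0)"

lemma index_word_zero: "index_word 0 = []"
  by (simp add: index_word_def)

lemma index_word_single: "k \<in> {1..9} \<Longrightarrow> index_word (single k) = [k]"
proof -
  assume k: "k \<in> {1..9}"
  have "count (mset [k]) = single k" by (auto simp: single_def)
  thus ?thesis using sorted_eq_index_word[of "[k]"] k by simp
qed

lemma expos_sum_zero: "q \<in> expos \<Longrightarrow> (\<Sum>i\<in>{1..9}. q i) = 0 \<Longrightarrow> q = 0"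
proof
  fix i assume "q \<in> expos" "(\<Sum>i\<in>{1..9}. q i) = 0"
  thus "q i = 0 i" by (cases "i \<in> {1..9}") (auto simp: expos_def)
qed

lemma expos_sum_one:
  assumes q: "q \<in> expos" "(\<Sum>i\<in>{1..9}. q i) = 1"
  obtains j where "j \<in> {1..9}" "q = single j"
proof -
  obtain j where j: "j \<in> {1..9}" "q j \<noteq> 0" using q(2) by (metis sum.neutral zero_neq_one)
  have s: "(\<Sum>i\<in>{1..9}. q i) = q j + (\<Sum>i\<in>{1..9} - {j}. q i)" using j(1) by (intro sum.remove) auto
  have z: "q j = 1" "(\<Sum>i\<in>{1..9} - {j}. q i) = 0" using s q(2) j(2) by linarith+
  have others: "\<forall>i\<in>{1..9} - {j}. q i = 0" using z(2) by (subst (asm) sum_eq_0_iff) simp_all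
  have "q = single j"
  proof
    fix i
    show "q i = single j i"
    proof (cases "i \<in> {1..9}")
      case True
      thus ?thesis using others z(1) by (cases "i = j") (simp_all add: single_def)
    next
      case False
      moreover have "i \<noteq> j" using False j(1) by blast
      ultimately show ?thesis using q(1) by (simp add: expos_def single_def)
    qed
  qed
  thus ?thesis using that j(1) by blast
qed

text \<open>The inner product with the highest weight vector is invariant under all lower triangular elements,
  because their adjoints kill that vector; its signature has exponent $0$.\<close>

lemma hw_realizes_zero:
  assumes hw: "hw_data lam n \<rho> v" and v0: "v \<noteq> 0\<^sub>v n" and N: "N \<subseteq> lower_so7"
  shows "realizes N lam 0"
  unfolding realizes_def
proof (intro exI conjI ballI)
  show "hw_data lam n \<rho> v" by fact
  have v: "v \<in> carrier_vec n" using hw by (simp add: hw_data_def)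
  show "map_vec cnj v \<in> carrier_vec n" using v by simp
  show "map_vec cnj v \<bullet> (\<rho> X *\<^sub>v w) = 0" if X: "X \<in> N" and w: "w \<in> carrier_vec n" for X w
  proof -
    have so: "X \<in> so7" using X N by (auto simp: lower_so7_def)
    have "X \<in> lower_so7" using X N by blast
    hence up: "adj X \<in> upper_so7"
      using adj_so7[OF so] adj_index[OF so7_carrier[OF so]] by (simp add: lower_so7_def upper_so7_def)
    have "adj (\<rho> X) *\<^sub>v v = 0\<^sub>v n" using hw so up unfolding hw_data_def by metis
    moreover have "\<rho> X \<in> carrier_mat n n" using hw so by (auto simp: hw_data_def lie_rep_def)
    ultimately have "ip v (\<rho> X *\<^sub>v w) = ip (0\<^sub>v n) w" using ip_adj[of "\<rho> X" n n v w] v w by simp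
    also have "\<dots> = 0" using w by (auto simp: ip_def scalar_prod_def)
    finally show ?thesis by (simp add: ip_def)
  qed
  have "map_vec cnj v \<bullet> v \<noteq> 0" using ip_self_eq_0[OF v] v0 by (auto simp: ip_def)
  moreover have "q = 0 \<or> expo_greater q 0" if "q \<in> expos" for q
    using expos_sum_zero[OF that] by (auto simp: expo_greater_def)
  ultimately show "leading (\<lambda>q. map_vec cnj v \<bullet> act \<rho> (map neg_vec (index_word q)) v) 0"
    by (auto simp: leading_def index_word_zero expos_def)
qed

text \<open>An exponent of total degree one is least as soon as degree zero contributes nothing and no
  lexicographically larger exponent of degree one, that is, no smaller index, does.\<close>

lemma hw_realizes_single:
  assumes hw: "hw_data lam n \<rho> v" and \<omega>: "\<omega> \<in> carrier_vec n"
    and inv: "\<And>X w. X \<in> N \<Longrightarrow> w \<in> carrier_vec n \<Longrightarrow> \<omega> \<bullet> (\<rho> X *\<^sub>v w) = 0"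
    and k: "k \<in> {1..9}" and z: "\<omega> \<bullet> v = 0" and nz: "\<omega> \<bullet> (\<rho> (neg_vec k) *\<^sub>v v) \<noteq> 0"
    and less: "\<And>j. j \<in> {1..<k} \<Longrightarrow> \<omega> \<bullet> (\<rho> (neg_vec j) *\<^sub>v v) = 0"
  shows "realizes N lam (single k)"
proof -
  let ?S = "\<lambda>q. \<omega> \<bullet> act \<rho> (map neg_vec (index_word q)) v"
  have S1: "?S (single j) = \<omega> \<bullet> (\<rho> (neg_vec j) *\<^sub>v v)" if "j \<in> {1..9}" for j
    using index_word_single[OF that] by simp
  have sum1: "(\<Sum>i\<in>{1..9}. single k i) = 1" using k by (simp add: single_def)
  have "q = single k \<or> expo_greater q (single k)" if q: "q \<in> expos" "?S q \<noteq> 0" for q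
  proof -
    have "(\<Sum>i\<in>{1..9}. q i) \<noteq> 0"
    proof
      assume "(\<Sum>i\<in>{1..9}. q i) = 0"
      hence "q = 0" using expos_sum_zero q by blast
      thus False using q z by (simp add: index_word_zero)
    qed
    then consider "(\<Sum>i\<in>{1..9}. q i) = 1" | "(\<Sum>i\<in>{1..9}. q i) > 1" by linarith
    thus ?thesis
    proof cases
      case 1
      then obtain j where j: "j \<in> {1..9}" "q = single j" using expos_sum_one q by blast
      have "\<not> j < k"
      proof
        assume "j < k"
        hence "?S q = 0" using less[of j] j S1[OF j(1)] by simp
        thus False using q by simp
      qed
      then consider "j = k" | "k < j" by linarith
      thus ?thesis
      proof cases
        assume kj: "k < j"
        have "lex_less q (single k)" unfolding lex_less_def
          by (intro bexI[OF _ k]) (use kj j in \<open>auto simp: single_def\<close>)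
        thus ?thesis using 1 sum1 by (simp add: expo_greater_def)
      qed (use j in simp)
    next
      case 2
      thus ?thesis using sum1 by (simp add: expo_greater_def)
    qed
  qed
  hence "leading ?S (single k)" using nz S1[OF k] k by (auto simp: leading_def expos_def single_def)
  thus ?thesis unfolding realizes_def using hw \<omega> inv by blast
qed

text \<open>Functionals on a tensor product given by their matrix of coefficients.\<close>

definition kernel_vec :: "nat \<Rightarrow> nat \<Rightarrow> (nat \<Rightarrow> nat \<Rightarrow> complex) \<Rightarrow> complex vec" where
  "kernel_vec n m g = vec (n * m) (\<lambda>i. g (i div m) (i mod m))"

lemma kernel_vec_carrier [simp]: "kernel_vec n m g \<in> carrier_vec (n * m)"
  by (simp add: kernel_vec_def)

lemma kernel_vec_kron:
  assumes "x \<in> carrier_vec n" "y \<in> carrier_vec m"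
  shows "kernel_vec n m g \<bullet> kron_vec x y = (\<Sum>i\<in>{0..<n}. \<Sum>j\<in>{0..<m}. g i j * (x $ i * y $ j))"
proof -
  have "kernel_vec n m g \<bullet> kron_vec x y = (\<Sum>l\<in>{0..<n * m}. g (l div m) (l mod m) * (x $ (l div m) * y $ (l mod m)))"
    using carrier_vecD[OF kron_vec_carrier[OF assms]] unfolding scalar_prod_def
    by (intro sum.cong) (auto simp: kernel_vec_def kron_vec_index[OF assms])
  also have "\<dots> = (\<Sum>i\<in>{0..<n}. \<Sum>j\<in>{0..<m}. g i j * (x $ i * y $ j))" by (rule sum_div_mod)
  finally show ?thesis .
qed

lemma mult_mat_unit_vec_index: "A \<in> carrier_mat n m \<Longrightarrow> i < n \<Longrightarrow> j < m \<Longrightarrow> (A *\<^sub>v unit_vec m j) $ i = (A $$ (i, j) :: complex)"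
  by (simp add: scalar_prod_right_unit)

abbreviation "e7 \<equiv> (unit_vec 7 :: nat \<Rightarrow> complex vec)"

lemma std_rep: "lie_rep so7 7 (\<lambda>X. X)"
  by (simp add: lie_rep_def)

lemma hw_std: "hw_data (1, 0, 0) 7 (\<lambda>X. X) (e7 0)"
  unfolding hw_data_def
proof (intro conjI ballI)
  show "X *\<^sub>v e7 0 = 0\<^sub>v 7" if "X \<in> upper_so7" for X
  proof (rule eq_vecI)
    have X: "X \<in> carrier_mat 7 7" using that by (simp add: upper_so7_def)
    thus "dim_vec (X *\<^sub>v e7 0) = dim_vec (0\<^sub>v 7 :: complex vec)" by simp
    fix i assume "i < dim_vec (0\<^sub>v 7 :: complex vec)"
    thus "(X *\<^sub>v e7 0) $ i = 0\<^sub>v 7 $ i" using that X by (simp add: mult_mat_unit_vec_index[of X 7 7] upper_so7_def)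
  qed
  show "T *\<^sub>v e7 0 = wt (1, 0, 0) T \<cdot>\<^sub>v e7 0" if "T \<in> cartan" for T
  proof (rule eq_vecI)
    have T: "T \<in> carrier_mat 7 7" using that by (simp add: cartan_def)
    thus "dim_vec (T *\<^sub>v e7 0) = dim_vec (wt (1, 0, 0) T \<cdot>\<^sub>v e7 0)" by simp
    fix i assume "i < dim_vec (wt (1, 0, 0) T \<cdot>\<^sub>v e7 0)"
    thus "(T *\<^sub>v e7 0) $ i = (wt (1, 0, 0) T \<cdot>\<^sub>v e7 0) $ i"
      using that T by (auto simp: mult_mat_unit_vec_index[of T 7 7] cartan_def diagonal_mat_def)
  qed
qed (simp_all add: std_rep)

abbreviation "tensor_square \<equiv> tensor_rep 7 (\<lambda>X. X) 7 (\<lambda>X. X)"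
text \<open>The highest weight vector $e_0\wedge e_1$ of $\bigwedge^2\mathbb C^7$.\<close>

definition "wedge01 = kron_vec (e7 0) (e7 1) + (-1) \<cdot>\<^sub>v kron_vec (e7 1) (e7 0)"

lemma wedge01_carrier [simp]: "wedge01 \<in> carrier_vec (7 * 7)"
  unfolding wedge01_def by (intro add_carrier_vec smult_carrier_vec[THEN iffD2] kron_vec_carrier) auto

lemma tensor_square_rep: "lie_rep so7 (7 * 7) tensor_square"
  by (rule lie_rep_tensor[OF std_rep std_rep])

lemma tensor_square_wedge01:
  assumes X: "X \<in> so7"
  shows "tensor_square X *\<^sub>v wedge01 = (kron_vec (X *\<^sub>v e7 0) (e7 1) + kron_vec (e7 0) (X *\<^sub>v e7 1)) +
    (-1) \<cdot>\<^sub>v (kron_vec (X *\<^sub>v e7 1) (e7 0) + kron_vec (e7 1) (X *\<^sub>v e7 0))"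
proof -
  have T: "tensor_square X \<in> carrier_mat (7 * 7) (7 * 7)" using tensor_square_rep X unfolding lie_rep_def by blast
  have k: "kron_vec (e7 i) (e7 j) \<in> carrier_vec (7 * 7)" for i j by (rule kron_vec_carrier) auto
  note t = tensor_rep_kron_vec[of "\<lambda>X. X" X 7 "\<lambda>X. X" 7, OF so7_carrier[OF X] so7_carrier[OF X] unit_vec_carrier unit_vec_carrier]
  have "tensor_square X *\<^sub>v wedge01 = tensor_square X *\<^sub>v kron_vec (e7 0) (e7 1) + tensor_square X *\<^sub>v ((-1) \<cdot>\<^sub>v kron_vec (e7 1) (e7 0))"
    unfolding wedge01_def by (rule mult_add_distrib_mat_vec[OF T k]) (use k in simp)
  thus ?thesis unfolding mult_mat_vec[OF T k] t .
qed

lemma functional_wedge01: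
  assumes X: "X \<in> so7" and \<omega>: "\<omega> \<in> carrier_vec (7 * 7)"
  shows "\<omega> \<bullet> (tensor_square X *\<^sub>v wedge01) = \<omega> \<bullet> kron_vec (X *\<^sub>v e7 0) (e7 1) + \<omega> \<bullet> kron_vec (e7 0) (X *\<^sub>v e7 1)
    - \<omega> \<bullet> kron_vec (X *\<^sub>v e7 1) (e7 0) - \<omega> \<bullet> kron_vec (e7 1) (X *\<^sub>v e7 0)"
proof -
  have Xe: "X *\<^sub>v e7 i \<in> carrier_vec 7" for i using so7_carrier[OF X] by simp
  have k: "kron_vec (X *\<^sub>v e7 i) (e7 j) \<in> carrier_vec (7 * 7)" "kron_vec (e7 j) (X *\<^sub>v e7 i) \<in> carrier_vec (7 * 7)" for i j
    using Xe by (intro kron_vec_carrier; simp)+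
  show ?thesis unfolding tensor_square_wedge01[OF X]
    using \<omega> k by (simp add: scalar_prod_add_distrib[of _ "7 * 7"] add_carrier_vec[of _ "7 * 7"] del: mult_numeral_left semiring_norm)
qed

lemma hw_wedge: "hw_data (1, 1, 0) (7 * 7) tensor_square wedge01"
  unfolding hw_data_def
proof (intro conjI ballI)
  show "lie_rep so7 (7 * 7) tensor_square" by (rule tensor_square_rep)
  show "tensor_square (adj X) = adj (tensor_square X)" if "X \<in> so7" for X
    by (rule adj_tensor_rep[OF std_rep std_rep that]) simp_all
  have act1: "X *\<^sub>v e7 0 = c \<cdot>\<^sub>v e7 0 \<Longrightarrow> X *\<^sub>v e7 1 = d \<cdot>\<^sub>v e7 1 + s \<cdot>\<^sub>v e7 0 \<Longrightarrow> X \<in> so7 \<Longrightarrow>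
      tensor_square X *\<^sub>v wedge01 = (c + d) \<cdot>\<^sub>v wedge01" for X c d s
  proof -
    assume h: "X *\<^sub>v e7 0 = c \<cdot>\<^sub>v e7 0" "X *\<^sub>v e7 1 = d \<cdot>\<^sub>v e7 1 + s \<cdot>\<^sub>v e7 0" and X: "X \<in> so7"
    show ?thesis unfolding tensor_square_wedge01[OF X] h unfolding wedge01_def
    proof (rule eq_vecI, goal_cases)
      case (1 i)
      hence i: "i < 7 * 7" by (simp add: kron_vec_def)
      have dm: "i div 7 < 7" "i mod 7 < 7" using div_mod_less[OF i] by simp_all
      show ?case using i dm by (simp add: kron_vec_def algebra_simps)
    qed (simp add: kron_vec_def)
  qed
  show "tensor_square X *\<^sub>v wedge01 = 0\<^sub>v (7 * 7)" if X: "X \<in> upper_so7" for X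
  proof -
    have so: "X \<in> so7" using X by (simp add: upper_so7_def)
    have "X *\<^sub>v e7 0 = 0 \<cdot>\<^sub>v e7 0" "X *\<^sub>v e7 1 = 0 \<cdot>\<^sub>v e7 1 + X $$ (0,1) \<cdot>\<^sub>v e7 0"
      using X so7_carrier[OF so] by (auto intro!: eq_vecI simp: mult_mat_unit_vec_index[of X 7 7] upper_so7_def carrier_matD[OF so7_carrier[OF so]])
    from act1[OF this so] have "tensor_square X *\<^sub>v wedge01 = 0 \<cdot>\<^sub>v wedge01" by simp
    also have "\<dots> = 0\<^sub>v (7 * 7)" using carrier_vecD[OF wedge01_carrier] by (intro eq_vecI) auto
    finally show ?thesis .
  qed
  show "tensor_square T *\<^sub>v wedge01 = wt (1, 1, 0) T \<cdot>\<^sub>v wedge01" if T: "T \<in> cartan" for T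
  proof -
    have so: "T \<in> so7" using T by (simp add: cartan_def)
    have "T *\<^sub>v e7 0 = T $$ (0,0) \<cdot>\<^sub>v e7 0" "T *\<^sub>v e7 1 = T $$ (1,1) \<cdot>\<^sub>v e7 1 + 0 \<cdot>\<^sub>v e7 0"
      using T so7_carrier[OF so] by (auto intro!: eq_vecI simp: mult_mat_unit_vec_index[of T 7 7] cartan_def diagonal_mat_def carrier_matD[OF so7_carrier[OF so]])
    from act1[OF this so] show ?thesis by simp
  qed
qed (rule wedge01_carrier)

lemma hw_spin: "hw_data (1/2, 1/2, 1/2) 8 spin (unit_vec 8 0)"
  unfolding hw_data_def
proof (intro conjI ballI)
  show "spin (adj X) = adj (spin X)" if "X \<in> so7" for X using that by (rule spin_adj)
  show "spin X *\<^sub>v unit_vec 8 0 = 0\<^sub>v 8" if X: "X \<in> upper_so7" for X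
  proof (rule eq_vecI)
    fix i assume "i < dim_vec (0\<^sub>v 8 :: complex vec)"
    hence i: "i < 8" by simp
    have z: "X $$ (i, j) = 0" if "j \<le> i" "i < 7" "j < 7" for i j using X that by (simp add: upper_so7_def)
    show "(spin X *\<^sub>v unit_vec 8 0) $ i = 0\<^sub>v 8 $ i"
      using i unfolding mult_mat_unit_vec_index[OF spin_carrier i, of 0, simplified] spin_index[OF i, of 0, simplified] unfolding less8
      by (elim disjE; simp add: spin_entries_def z)
  qed (simp add: carrier_matD[OF spin_carrier])
  show "spin T *\<^sub>v unit_vec 8 0 = wt (1/2, 1/2, 1/2) T \<cdot>\<^sub>v unit_vec 8 0" if T: "T \<in> cartan" for T
  proof (rule eq_vecI)
    fix i assume "i < dim_vec (wt (1/2, 1/2, 1/2) T \<cdot>\<^sub>v (unit_vec 8 0 :: complex vec))"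
    hence i: "i < 8" by simp
    have z: "T $$ (i, j) = 0" if "i \<noteq> j" "i < 7" "j < 7" for i j
      using T that carrier_matD[OF so7_carrier, of T] by (auto simp: cartan_def diagonal_mat_def)
    show "(spin T *\<^sub>v unit_vec 8 0) $ i = (wt (1/2, 1/2, 1/2) T \<cdot>\<^sub>v unit_vec 8 0) $ i"
      using i unfolding mult_mat_unit_vec_index[OF spin_carrier i, of 0, simplified] spin_index[OF i, of 0, simplified] unfolding less8
      by (elim disjE; simp add: spin_entries_def z)
  qed (simp add: carrier_matD[OF spin_carrier])
qed (simp_all add: spin_rep)

lemma hw_trivial: "hw_data 0 1 (\<lambda>_. 0\<^sub>m 1 1) (unit_vec 1 0)"
proof -
  have "lie_br (0\<^sub>m 1 1) (0\<^sub>m 1 1) = 0\<^sub>m 1 1" by (intro eq_matI) (auto simp: lie_br_def scalar_prod_def)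
  moreover have "adj (0\<^sub>m 1 1) = 0\<^sub>m 1 1" by (intro eq_matI) (auto simp: adj_def)
  moreover have "0\<^sub>m 1 1 *\<^sub>v unit_vec 1 0 = (0\<^sub>v 1 :: complex vec)" by (intro eq_vecI) (auto simp: scalar_prod_def)
  moreover have "0 \<cdot>\<^sub>v unit_vec 1 0 = (0\<^sub>v 1 :: complex vec)" by (intro eq_vecI) auto
  moreover have "wt 0 T = 0" for T by (simp add: zero_prod_def)
  moreover have "c \<cdot>\<^sub>m 0\<^sub>m 1 1 = (0\<^sub>m 1 1 :: complex mat)" for c by (intro eq_matI) auto
  ultimately show ?thesis unfolding hw_data_def lie_rep_def by (simp del: One_nat_def)
qed

locale g2_negative_part =
  fixes a b c :: complex and F1 F2 :: "complex mat"
  assumes ab: "a \<noteq> 0" "b \<noteq> 0"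
    and F1: "F1 = b \<cdot>\<^sub>m neg_vec 5 + a \<cdot>\<^sub>m neg_vec 9" and F2: "F2 = c \<cdot>\<^sub>m neg_vec 8"
begin

lemma F_lower: "{F1, F2} \<subseteq> lower_so7"
  unfolding F1 F2 by (auto intro!: lower_so7_closed)

lemma F_so7: "F1 \<in> so7" "F2 \<in> so7"
  using F_lower by (auto simp: lower_so7_def)

lemma F1_index: "i < 7 \<Longrightarrow> j < 7 \<Longrightarrow> F1 $$ (i, j) = b * skew_unit 3 2 $$ (i, j) + a * skew_unit 1 0 $$ (i, j)"
  and F2_index: "i < 7 \<Longrightarrow> j < 7 \<Longrightarrow> F2 $$ (i, j) = c * skew_unit 2 1 $$ (i, j)"
  by (simp_all add: F1 F2 neg_vec_def root_row_def root_col_def carrier_matD[OF skew_unit_carrier])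

lemma std_apply:
  assumes X: "X \<in> so7" and x: "x \<in> carrier_vec 7" and i: "i < 7"
  shows "(X *\<^sub>v x) $ i = X $$ (i,0) * x $ 0 + X $$ (i,1) * x $ 1 + X $$ (i,2) * x $ 2 + X $$ (i,3) * x $ 3
    + X $$ (i,4) * x $ 4 + X $$ (i,5) * x $ 5 + X $$ (i,6) * x $ 6"
  using so7_carrier[OF X] x i by (simp add: scalar_prod_def sum7)

lemma F_std:
  assumes x: "x \<in> carrier_vec 7"
  shows "(F1 *\<^sub>v x) $ 0 = 0" "(F1 *\<^sub>v x) $ 1 = a * x $ 0" "(F1 *\<^sub>v x) $ 2 = 0" "(F1 *\<^sub>v x) $ 3 = b * x $ 2" "(F1 *\<^sub>v x) $ 4 = - b * x $ 3"
    "(F2 *\<^sub>v x) $ 0 = 0" "(F2 *\<^sub>v x) $ 1 = 0" "(F2 *\<^sub>v x) $ 2 = c * x $ 1" "(F2 *\<^sub>v x) $ 3 = 0" "(F2 *\<^sub>v x) $ 4 = 0"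
  using x F_so7 by (simp_all add: std_apply F1_index F2_index skew_unit_index del: One_nat_def)

lemma spin_apply:
  assumes x: "x \<in> carrier_vec 8" and i: "i < 8"
  shows "(spin X *\<^sub>v x) $ i = spin_entries X ! i ! 0 * x $ 0 + spin_entries X ! i ! 1 * x $ 1 + spin_entries X ! i ! 2 * x $ 2
    + spin_entries X ! i ! 3 * x $ 3 + spin_entries X ! i ! 4 * x $ 4 + spin_entries X ! i ! 5 * x $ 5 + spin_entries X ! i ! 6 * x $ 6 + spin_entries X ! i ! 7 * x $ 7"
  using x i by (simp add: scalar_prod_def sum8 spin_def)

lemma F_spin:
  assumes x: "x \<in> carrier_vec 8"
  shows "(spin F1 *\<^sub>v x) $ 0 = 0" "(spin F1 *\<^sub>v x) $ 1 = half_root * b * x $ 0" "(spin F1 *\<^sub>v x) $ 3 = half_root * b * x $ 2" "(spin F1 *\<^sub>v x) $ 4 = a * x $ 2"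
    "(spin F2 *\<^sub>v x) $ 0 = 0" "(spin F2 *\<^sub>v x) $ 1 = 0" "(spin F2 *\<^sub>v x) $ 3 = 0" "(spin F2 *\<^sub>v x) $ 4 = 0"
  using x by (simp_all add: spin_apply spin_entries_def F1_index F2_index skew_unit_index del: One_nat_def)

text \<open>On $\bigwedge^2\mathbb C^7$ these are multiples of two components of the projection
  $\bigwedge^2\mathbb C^7\to\mathbb C^7$ given by the cross product of $G_2$: \<open>cross0\<close> is
  invariant under $\mathfrak n'$, and \<open>cross1\<close> is moved to a multiple of it by the short
  simple root vector.\<close>

definition "cross0 = kernel_vec 7 7 (\<lambda>i j. if i = 1 \<and> j = 2 then b else if i = 2 \<and> j = 1 then - b else if i = 0 \<and> j = 3 then - a else if i = 3 \<and> j = 0 then a else 0)"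
definition "cross1 = kernel_vec 7 7 (\<lambda>i j. if i = 0 \<and> j = 4 then 2 * a * a else if i = 4 \<and> j = 0 then - 2 * a * a
   else if i = 1 \<and> j = 3 then a * b else if i = 3 \<and> j = 1 then - a * b else 0)"

lemma cross_carrier [simp]: "cross0 \<in> carrier_vec (7 * 7)" "cross1 \<in> carrier_vec (7 * 7)"
  unfolding cross0_def cross1_def by (rule kernel_vec_carrier)+

lemma cross0_kron: "x \<in> carrier_vec 7 \<Longrightarrow> y \<in> carrier_vec 7 \<Longrightarrow>
    cross0 \<bullet> kron_vec x y = b * (x $ 1 * y $ 2 - x $ 2 * y $ 1) - a * (x $ 0 * y $ 3 - x $ 3 * y $ 0)"
  unfolding cross0_def by (subst kernel_vec_kron) (simp_all add: sum7 algebra_simps del: One_nat_def)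

lemma cross1_kron: "x \<in> carrier_vec 7 \<Longrightarrow> y \<in> carrier_vec 7 \<Longrightarrow>
    cross1 \<bullet> kron_vec x y = 2 * a * a * (x $ 0 * y $ 4 - x $ 4 * y $ 0) + a * b * (x $ 1 * y $ 3 - x $ 3 * y $ 1)"
  unfolding cross1_def by (subst kernel_vec_kron) (simp_all add: sum7 algebra_simps del: One_nat_def)

lemma F_carrier_vec: "x \<in> carrier_vec 7 \<Longrightarrow> F1 *\<^sub>v x \<in> carrier_vec 7" "x \<in> carrier_vec 7 \<Longrightarrow> F2 *\<^sub>v x \<in> carrier_vec 7"
  using so7_carrier[OF F_so7(1)] so7_carrier[OF F_so7(2)] by auto

lemma cross0_invariant:
  assumes X: "X \<in> {F1, F2}" and w: "w \<in> carrier_vec (7 * 7)"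
  shows "cross0 \<bullet> (tensor_square X *\<^sub>v w) = 0"
proof (rule tensor_functional_vanish[OF std_rep std_rep _ cross_carrier(1) _ w])
  show "X \<in> so7" using X F_so7 by blast
  fix x y :: "complex vec" assume xy: "x \<in> carrier_vec 7" "y \<in> carrier_vec 7"
  show "cross0 \<bullet> kron_vec (X *\<^sub>v x) y + cross0 \<bullet> kron_vec x (X *\<^sub>v y) = 0"
    using X xy F_carrier_vec by (elim insertE emptyE) (simp_all add: cross0_kron F_std algebra_simps del: One_nat_def index_mult_mat_vec)
qed

lemma cross1_F:
  assumes w: "w \<in> carrier_vec (7 * 7)"
  shows "cross1 \<bullet> (tensor_square F1 *\<^sub>v w) = a * b * (cross0 \<bullet> w)" "cross1 \<bullet> (tensor_square F2 *\<^sub>v w) = 0"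
proof -
  have "cross1 \<bullet> (tensor_square F1 *\<^sub>v w) = ((a * b) \<cdot>\<^sub>v cross0) \<bullet> w"
  proof (rule tensor_functional_eq[OF std_rep std_rep F_so7(1) cross_carrier(2) _ _ w])
    show "(a * b) \<cdot>\<^sub>v cross0 \<in> carrier_vec (7 * 7)" by (intro smult_carrier_vec[THEN iffD2] cross_carrier)
    fix x y :: "complex vec" assume xy: "x \<in> carrier_vec 7" "y \<in> carrier_vec 7"
    have "((a * b) \<cdot>\<^sub>v cross0) \<bullet> kron_vec x y = a * b * (cross0 \<bullet> kron_vec x y)"
      by (rule smult_scalar_prod_distrib[OF cross_carrier(1)]) (rule kron_vec_carrier[OF xy])
    thus "cross1 \<bullet> kron_vec (F1 *\<^sub>v x) y + cross1 \<bullet> kron_vec x (F1 *\<^sub>v y) = ((a * b) \<cdot>\<^sub>v cross0) \<bullet> kron_vec x y"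
      using xy F_carrier_vec by (simp add: cross0_kron cross1_kron F_std algebra_simps del: One_nat_def index_mult_mat_vec)
  qed
  also have "\<dots> = a * b * (cross0 \<bullet> w)" by (rule smult_scalar_prod_distrib[OF cross_carrier(1) w])
  finally show "cross1 \<bullet> (tensor_square F1 *\<^sub>v w) = a * b * (cross0 \<bullet> w)" .
  show "cross1 \<bullet> (tensor_square F2 *\<^sub>v w) = 0"
  proof (rule tensor_functional_vanish[OF std_rep std_rep F_so7(2) cross_carrier(2) _ w])
    fix x y :: "complex vec" assume xy: "x \<in> carrier_vec 7" "y \<in> carrier_vec 7"
    show "cross1 \<bullet> kron_vec (F2 *\<^sub>v x) y + cross1 \<bullet> kron_vec x (F2 *\<^sub>v y) = 0"
      using xy F_carrier_vec by (simp add: cross1_kron F_std algebra_simps del: One_nat_def index_mult_mat_vec)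
  qed
qed

lemma cross_values:
  assumes X: "X \<in> so7"
  shows "cross0 \<bullet> (tensor_square X *\<^sub>v wedge01) = - 2 * b * X $$ (2,0) - 2 * a * X $$ (3,1)"
    "cross1 \<bullet> (tensor_square X *\<^sub>v wedge01) = 4 * a * a * X $$ (4,1) - 2 * a * b * X $$ (3,0)"
proof -
  have Xe: "X *\<^sub>v e7 i \<in> carrier_vec 7" for i using so7_carrier[OF X] by simp
  have v: "(X *\<^sub>v e7 j) $ i = X $$ (i, j)" if "i < 7" "j < 7" for i j
    by (rule mult_mat_unit_vec_index[OF so7_carrier[OF X] that])
  have u: "e7 j $ i = (if i = j then 1 else 0)" if "i < 7" "j < 7" for i j using that by simp
  show "cross0 \<bullet> (tensor_square X *\<^sub>v wedge01) = - 2 * b * X $$ (2,0) - 2 * a * X $$ (3,1)"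
    unfolding functional_wedge01[OF X cross_carrier(1)]
    using Xe by (simp add: cross0_kron v u algebra_simps del: One_nat_def index_mult_mat_vec index_unit_vec)
  show "cross1 \<bullet> (tensor_square X *\<^sub>v wedge01) = 4 * a * a * X $$ (4,1) - 2 * a * b * X $$ (3,0)"
    unfolding functional_wedge01[OF X cross_carrier(2)]
    using Xe by (simp add: cross1_kron v u algebra_simps del: One_nat_def index_mult_mat_vec index_unit_vec)
qed

lemma cross_wedge01: "cross0 \<bullet> wedge01 = 0" "cross1 \<bullet> wedge01 = 0"
proof -
  have k: "kron_vec (e7 i) (e7 j) \<in> carrier_vec (7 * 7)" for i j by (rule kron_vec_carrier) auto
  have u: "e7 j $ i = (if i = j then 1 else 0)" if "i < 7" "j < 7" for i j using that by simp
  have d: "\<omega> \<bullet> wedge01 = \<omega> \<bullet> kron_vec (e7 0) (e7 1) - \<omega> \<bullet> kron_vec (e7 1) (e7 0)" if "\<omega> \<in> carrier_vec (7 * 7)" for \<omega>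
    unfolding wedge01_def using that k
    by (simp add: scalar_prod_add_distrib[of _ "7 * 7"] del: mult_numeral_left semiring_norm)
  show "cross0 \<bullet> wedge01 = 0" "cross1 \<bullet> wedge01 = 0"
    by (simp_all add: d[OF cross_carrier(1)] d[OF cross_carrier(2)] cross0_kron cross1_kron u del: One_nat_def index_unit_vec)
qed

lemma neg_vec_entry:
  "k \<in> {1..9} \<Longrightarrow> i < 7 \<Longrightarrow> j < 7 \<Longrightarrow> neg_vec k $$ (i, j) = skew_unit (root_row k) (root_col k) $$ (i, j)"
  by (simp add: neg_vec_def)

lemma small_index: "j \<in> {1..<3::nat} \<longleftrightarrow> j = 1 \<or> j = 2" "j \<in> {1..<5::nat} \<longleftrightarrow> j = 1 \<or> j = 2 \<or> j = 3 \<or> j = 4"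
  "j \<in> {1..<6::nat} \<longleftrightarrow> j = 1 \<or> j = 2 \<or> j = 3 \<or> j = 4 \<or> j = 5"
  by auto

lemma realizes_wedge: "realizes {F1, F2} (1, 1, 0) (single 6)"
proof (rule hw_realizes_single[OF hw_wedge cross_carrier(1) cross0_invariant])
  show "cross0 \<bullet> wedge01 = 0" by (rule cross_wedge01)
  show "cross0 \<bullet> (tensor_square (neg_vec 6) *\<^sub>v wedge01) \<noteq> 0"
    using ab by (simp add: cross_values neg_vec_entry skew_unit_index root_row_def root_col_def del: One_nat_def)
  fix j :: nat assume "j \<in> {1..<6}"
  thus "cross0 \<bullet> (tensor_square (neg_vec j) *\<^sub>v wedge01) = 0" unfolding small_index
    by (elim disjE) (simp_all add: cross_values neg_vec_entry skew_unit_index root_row_def root_col_def del: One_nat_def)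
qed auto

text \<open>Restricted to $G_2$ the spin module is $\mathbb C\oplus V(\omega_1)$; this is the functional
  invariant under all of $G_2$.\<close>

definition "spinor = a \<cdot>\<^sub>v unit_vec 8 3 + (- (half_root * b)) \<cdot>\<^sub>v unit_vec 8 4"

lemma spinor_prod: "w \<in> carrier_vec 8 \<Longrightarrow> spinor \<bullet> w = a * w $ 3 - half_root * b * w $ 4"
  unfolding spinor_def by (subst add_scalar_prod_distrib[of _ 8]) (auto simp: scalar_prod_left_unit[of _ 8])

lemma spin_top: "i < 8 \<Longrightarrow> (spin X *\<^sub>v unit_vec 8 0) $ i = spin_entries X ! i ! 0"
  using mult_mat_unit_vec_index[OF spin_carrier, of i 0 X] spin_index[of i 0 X] by simp

lemma realizes_spinor: "realizes {F1, F2} (1/2, 1/2, 1/2) (single 3)"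
proof (rule hw_realizes_single[OF hw_spin])
  show "spinor \<in> carrier_vec 8" by (simp add: spinor_def)
  have c: "spin X *\<^sub>v w \<in> carrier_vec 8" if "w \<in> carrier_vec 8" for X w
    using mult_mat_vec_carrier[OF spin_carrier that] .
  show "spinor \<bullet> (spin X *\<^sub>v w) = 0" if "X \<in> {F1, F2}" "w \<in> carrier_vec 8" for X w
    using that c by (elim insertE emptyE) (simp_all add: spinor_prod F_spin del: index_mult_mat_vec)
  show "spinor \<bullet> unit_vec 8 0 = 0" unfolding spinor_prod[OF unit_vec_carrier] by simp
  show "spinor \<bullet> (spin (neg_vec 3) *\<^sub>v unit_vec 8 0) \<noteq> 0"
    using ab c by (simp add: spinor_prod spin_top spin_entries_def neg_vec_entry skew_unit_index root_row_def root_col_def del: One_nat_def index_mult_mat_vec)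
  fix j :: nat assume "j \<in> {1..<3}"
  thus "spinor \<bullet> (spin (neg_vec j) *\<^sub>v unit_vec 8 0) = 0" unfolding small_index
    using c by (elim disjE) (simp_all add: spinor_prod spin_top spin_entries_def neg_vec_entry skew_unit_index root_row_def root_col_def del: One_nat_def index_mult_mat_vec)
qed auto

definition "mixed = kernel_vec 7 8 (\<lambda>i j. if i = 0 \<and> j = 1 then a else if i = 1 \<and> j = 0 then - (half_root * b) else 0)"

lemma mixed_kron: "x \<in> carrier_vec 7 \<Longrightarrow> y \<in> carrier_vec 8 \<Longrightarrow> mixed \<bullet> kron_vec x y = a * x $ 0 * y $ 1 - half_root * b * x $ 1 * y $ 0"
  unfolding mixed_def by (subst kernel_vec_kron) (simp_all add: sum7 sum8 algebra_simps del: One_nat_def)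

lemma realizes_mixed: "realizes {F1, F2} ((1, 0, 0) + (1/2, 1/2, 1/2)) (single 5)"
proof (rule hw_realizes_single[OF hw_data_tensor[OF hw_std hw_spin]])
  show m: "mixed \<in> carrier_vec (7 * 8)" unfolding mixed_def by (rule kernel_vec_carrier)
  have c: "spin X *\<^sub>v w \<in> carrier_vec 8" if "w \<in> carrier_vec 8" for X w
    using mult_mat_vec_carrier[OF spin_carrier that] .
  show "mixed \<bullet> (tensor_rep 7 (\<lambda>X. X) 8 spin X *\<^sub>v w) = 0" if X: "X \<in> {F1, F2}" and w: "w \<in> carrier_vec (7 * 8)" for X w
  proof (rule tensor_functional_vanish[OF std_rep spin_rep _ m _ w])
    show "X \<in> so7" using X F_so7 by blast
    fix x y :: "complex vec" assume xy: "x \<in> carrier_vec 7" "y \<in> carrier_vec 8"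
    show "mixed \<bullet> kron_vec (X *\<^sub>v x) y + mixed \<bullet> kron_vec x (spin X *\<^sub>v y) = 0"
      using X xy F_carrier_vec c by (elim insertE emptyE) (simp_all add: mixed_kron F_std F_spin algebra_simps del: One_nat_def index_mult_mat_vec)
  qed
  have u: "e7 j $ i = (if i = j then 1 else 0)" if "i < 7" "j < 7" for i j using that by simp
  have u8: "unit_vec 8 j $ i = (if i = j then 1 else 0 :: complex)" if "i < 8" "j < 8" for i j using that by simp
  show "mixed \<bullet> kron_vec (e7 0) (unit_vec 8 0) = 0" by (simp add: mixed_kron u u8 del: One_nat_def index_unit_vec)
  have val: "mixed \<bullet> (tensor_rep 7 (\<lambda>X. X) 8 spin X *\<^sub>v kron_vec (e7 0) (unit_vec 8 0)) = a * half_root * X $$ (3,2) - half_root * b * X $$ (1,0)"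
    if X: "X \<in> so7" for X
  proof -
    have Xe: "X *\<^sub>v e7 0 \<in> carrier_vec 7" using so7_carrier[OF X] by simp
    have "mixed \<bullet> (tensor_rep 7 (\<lambda>X. X) 8 spin X *\<^sub>v kron_vec (e7 0) (unit_vec 8 0)) =
       mixed \<bullet> kron_vec (X *\<^sub>v e7 0) (unit_vec 8 0) + mixed \<bullet> kron_vec (e7 0) (spin X *\<^sub>v unit_vec 8 0)"
      unfolding tensor_rep_kron_vec[of "\<lambda>X. X" X 7 spin 8, OF so7_carrier[OF X] spin_carrier unit_vec_carrier unit_vec_carrier]
      by (rule scalar_prod_add_distrib[OF m kron_vec_carrier[OF Xe unit_vec_carrier] kron_vec_carrier[OF unit_vec_carrier c[OF unit_vec_carrier]]])
    also have "\<dots> = a * half_root * X $$ (3,2) - half_root * b * X $$ (1,0)"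
      using Xe c by (simp add: mixed_kron u u8 spin_top spin_entries_def mult_mat_unit_vec_index[OF so7_carrier[OF X]] algebra_simps
         del: One_nat_def index_mult_mat_vec index_unit_vec)
    finally show ?thesis .
  qed
  show "mixed \<bullet> (tensor_rep 7 (\<lambda>X. X) 8 spin (neg_vec 5) *\<^sub>v kron_vec (e7 0) (unit_vec 8 0)) \<noteq> 0"
    using ab half_root(4) by (simp add: val neg_vec_entry skew_unit_index root_row_def root_col_def del: One_nat_def)
  fix j :: nat assume "j \<in> {1..<5}"
  thus "mixed \<bullet> (tensor_rep 7 (\<lambda>X. X) 8 spin (neg_vec j) *\<^sub>v kron_vec (e7 0) (unit_vec 8 0)) = 0" unfolding small_index
    by (elim disjE) (simp_all add: val neg_vec_entry skew_unit_index root_row_def root_col_def del: One_nat_def)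
qed auto

text \<open>The invariant combination of $x_0\otimes$ \<open>cross1\<close> and $x_1\otimes$ \<open>cross0\<close>: the
  short simple root vector takes $x_1$ to a multiple of $x_0$ and \<open>cross1\<close> to a multiple of
  \<open>cross0\<close>, and the two contributions cancel.\<close>

definition "adjoint_hw = kron_vec (e7 0) cross1 + (- b) \<cdot>\<^sub>v kron_vec (e7 1) cross0"

lemma adjoint_hw_carrier [simp]: "adjoint_hw \<in> carrier_vec (7 * (7 * 7))"
  unfolding adjoint_hw_def by (intro add_carrier_vec smult_carrier_vec[THEN iffD2] kron_vec_carrier unit_vec_carrier cross_carrier)

lemma adjoint_hw_kron:
  assumes x: "x \<in> carrier_vec 7" and w: "w \<in> carrier_vec (7 * 7)"
  shows "adjoint_hw \<bullet> kron_vec x w = x $ 0 * (cross1 \<bullet> w) - b * x $ 1 * (cross0 \<bullet> w)"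
proof -
  have k: "kron_vec (e7 0) cross1 \<in> carrier_vec (7 * (7 * 7))" "kron_vec (e7 1) cross0 \<in> carrier_vec (7 * (7 * 7))"
    "kron_vec x w \<in> carrier_vec (7 * (7 * 7))" using x w by (intro kron_vec_carrier unit_vec_carrier cross_carrier; assumption?)+
  have "adjoint_hw \<bullet> kron_vec x w = kron_vec (e7 0) cross1 \<bullet> kron_vec x w + (- b) * (kron_vec (e7 1) cross0 \<bullet> kron_vec x w)"
    unfolding adjoint_hw_def
    by (subst add_scalar_prod_distrib[OF k(1) smult_carrier_vec[THEN iffD2, OF k(2)] k(3)]) (simp only: smult_scalar_prod_distrib[OF k(2,3)])
  also have "kron_vec (e7 0) cross1 \<bullet> kron_vec x w = x $ 0 * (cross1 \<bullet> w)"
    using kron_vec_scalar_prod[OF unit_vec_carrier cross_carrier(2) x w, of 0] x by (simp add: scalar_prod_left_unit[of _ 7])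
  also have "kron_vec (e7 1) cross0 \<bullet> kron_vec x w = x $ 1 * (cross0 \<bullet> w)"
    using kron_vec_scalar_prod[OF unit_vec_carrier cross_carrier(1) x w, of 1] x by (simp add: scalar_prod_left_unit[of _ 7])
  finally show ?thesis by simp
qed

lemma realizes_adjoint: "realizes {F1, F2} ((1, 0, 0) + (1, 1, 0)) (single 3)"
proof (rule hw_realizes_single[OF hw_data_tensor[OF hw_std hw_wedge] adjoint_hw_carrier])
  let ?T = "tensor_rep 7 (\<lambda>X. X) (7 * 7) tensor_square"
  have c: "tensor_square X *\<^sub>v w \<in> carrier_vec (7 * 7)" if "X \<in> so7" "w \<in> carrier_vec (7 * 7)" for X w
    using tensor_square_rep that mult_mat_vec_carrier unfolding lie_rep_def by blast
  show "adjoint_hw \<bullet> (?T X *\<^sub>v w) = 0" if X: "X \<in> {F1, F2}" and w: "w \<in> carrier_vec (7 * (7 * 7))" for X w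
  proof (rule tensor_functional_vanish[OF std_rep tensor_square_rep _ adjoint_hw_carrier _ w])
    show so: "X \<in> so7" using X F_so7 by blast
    fix x y :: "complex vec" assume x: "x \<in> carrier_vec 7" and y: "y \<in> carrier_vec (7 * 7)"
    have Xx: "X *\<^sub>v x \<in> carrier_vec 7" using so7_carrier[OF so] x by simp
    have e: "adjoint_hw \<bullet> kron_vec (X *\<^sub>v x) y + adjoint_hw \<bullet> kron_vec x (tensor_square X *\<^sub>v y) =
      (X *\<^sub>v x) $ 0 * (cross1 \<bullet> y) - b * (X *\<^sub>v x) $ 1 * (cross0 \<bullet> y) + (x $ 0 * (cross1 \<bullet> (tensor_square X *\<^sub>v y)) - b * x $ 1 * (cross0 \<bullet> (tensor_square X *\<^sub>v y)))"
      unfolding adjoint_hw_kron[OF Xx y] adjoint_hw_kron[OF x c[OF so y]] ..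
    have "X = F1 \<or> X = F2" using X by blast
    thus "adjoint_hw \<bullet> kron_vec (X *\<^sub>v x) y + adjoint_hw \<bullet> kron_vec x (tensor_square X *\<^sub>v y) = 0"
      unfolding e cross0_invariant[OF X y]
      by (elim disjE) (simp_all only: F_std[OF x] cross1_F[OF y], simp_all add: algebra_simps)
  qed
  have u: "e7 j $ i = (if i = j then 1 else 0)" if "i < 7" "j < 7" for i j using that by simp
  show "adjoint_hw \<bullet> kron_vec (e7 0) wedge01 = 0"
    unfolding adjoint_hw_kron[OF unit_vec_carrier wedge01_carrier] cross_wedge01 by simp
  have val: "adjoint_hw \<bullet> (?T X *\<^sub>v kron_vec (e7 0) wedge01) = 4 * a * a * X $$ (4,1) - 2 * a * b * X $$ (3,0)"
    if X: "X \<in> so7" for X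
  proof -
    have Xe: "X *\<^sub>v e7 0 \<in> carrier_vec 7" using so7_carrier[OF X] by simp
    have TX: "tensor_square X \<in> carrier_mat (7 * 7) (7 * 7)" using tensor_square_rep X unfolding lie_rep_def by blast
    have "adjoint_hw \<bullet> (?T X *\<^sub>v kron_vec (e7 0) wedge01) =
       adjoint_hw \<bullet> kron_vec (X *\<^sub>v e7 0) wedge01 + adjoint_hw \<bullet> kron_vec (e7 0) (tensor_square X *\<^sub>v wedge01)"
      unfolding tensor_rep_kron_vec[of "\<lambda>X. X" X 7 tensor_square "7 * 7", OF so7_carrier[OF X] TX unit_vec_carrier wedge01_carrier]
      by (rule scalar_prod_add_distrib[OF adjoint_hw_carrier kron_vec_carrier[OF Xe wedge01_carrier] kron_vec_carrier[OF unit_vec_carrier c[OF X wedge01_carrier]]])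
    also have "\<dots> = 4 * a * a * X $$ (4,1) - 2 * a * b * X $$ (3,0)"
      unfolding adjoint_hw_kron[OF Xe wedge01_carrier] adjoint_hw_kron[OF unit_vec_carrier c[OF X wedge01_carrier]] cross_wedge01 cross_values[OF X]
      by (simp add: u del: index_unit_vec index_mult_mat_vec)
    finally show ?thesis .
  qed
  have vk: "adjoint_hw \<bullet> (?T (neg_vec k) *\<^sub>v kron_vec (e7 0) wedge01) = 4 * a * a * neg_vec k $$ (4,1) - 2 * a * b * neg_vec k $$ (3,0)"
    if "k \<in> {1..9}" for k by (rule val[OF neg_vec_so7[OF that]])
  have "4 * a * a * neg_vec 3 $$ (4,1) - 2 * a * b * neg_vec 3 $$ (3,0) \<noteq> 0"
    using ab by (simp add: neg_vec_entry skew_unit_index root_row_def root_col_def del: One_nat_def)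
  thus "adjoint_hw \<bullet> (?T (neg_vec 3) *\<^sub>v kron_vec (e7 0) wedge01) \<noteq> 0" by (subst vk) simp_all
  fix j :: nat assume j: "j \<in> {1..<3}"
  hence "j \<in> {1..9}" by simp
  note vk[OF this]
  also have "4 * a * a * neg_vec j $$ (4,1) - 2 * a * b * neg_vec j $$ (3,0) = 0"
    using j unfolding small_index
    by (elim disjE) (simp_all add: neg_vec_entry skew_unit_index root_row_def root_col_def del: One_nat_def)
  finally show "adjoint_hw \<bullet> (?T (neg_vec j) *\<^sub>v kron_vec (e7 0) wedge01) = 0" .
qed auto

lemma wedge01_nonzero: "wedge01 \<noteq> 0\<^sub>v (7 * 7)"
proof
  assume "wedge01 = 0\<^sub>v (7 * 7)"
  hence "wedge01 $ 1 = 0\<^sub>v (7 * 7) $ 1" by (rule arg_cong)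
  also have "\<dots> = 0" by simp
  finally have "wedge01 $ 1 = 0" .
  moreover have "wedge01 $ 1 = 1" by (simp add: wedge01_def kron_vec_def)
  ultimately show False by simp
qed

lemma unit_vec_nonzero: "i < n \<Longrightarrow> unit_vec n i \<noteq> (0\<^sub>v n :: complex vec)"
  by (metis index_unit_vec(1) index_zero_vec(1) zero_neq_one)

lemma realizes_highest: "realizes {F1, F2} 0 0" "realizes {F1, F2} (1, 0, 0) 0" "realizes {F1, F2} (1, 1, 0) 0" "realizes {F1, F2} (1/2, 1/2, 1/2) 0"
proof -
  show "realizes {F1, F2} 0 0" by (rule hw_realizes_zero[OF hw_trivial unit_vec_nonzero F_lower]) simp
  show "realizes {F1, F2} (1, 0, 0) 0" by (rule hw_realizes_zero[OF hw_std unit_vec_nonzero F_lower]) simp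
  show "realizes {F1, F2} (1, 1, 0) 0" by (rule hw_realizes_zero[OF hw_wedge wedge01_nonzero F_lower])
  show "realizes {F1, F2} (1/2, 1/2, 1/2) 0" by (rule hw_realizes_zero[OF hw_spin unit_vec_nonzero F_lower]) simp
qed

end

section \<open>The monoid generated by the seven signatures\<close>

text \<open>All signatures that occur, parametrized by the coefficients of the highest weight with respect to
  the fundamental weights and by the exponents at $3, 5, 6$.\<close>

definition sig6 :: "nat \<Rightarrow> nat \<Rightarrow> nat \<Rightarrow> nat \<Rightarrow> nat \<Rightarrow> nat \<Rightarrow> signature" where
  "sig6 l1 l2 l3 n3 n5 n6 =
     ((of_nat l1 + of_nat l2 + of_nat l3 / 2, of_nat l2 + of_nat l3 / 2, of_nat l3 / 2),
      (\<lambda>i. if i = 3 then n3 else if i = 5 then n5 else if i = 6 then n6 else 0))"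

lemma sig6_add: "sig6 l1 l2 l3 n3 n5 n6 + sig6 l1' l2' l3' n3' n5' n6' =
    sig6 (l1 + l1') (l2 + l2') (l3 + l3') (n3 + n3') (n5 + n5') (n6 + n6')"
  by (auto simp: sig6_def add_divide_distrib fun_eq_iff)

lemma sig6_zero: "sig6 0 0 0 0 0 0 = 0"
  by (auto simp: sig6_def fun_eq_iff zero_prod_def)

lemma sig6_inject:
  "sig6 l1 l2 l3 n3 n5 n6 = sig6 l1' l2' l3' n3' n5' n6' \<longleftrightarrow>
     l1 = l1' \<and> l2 = l2' \<and> l3 = l3' \<and> n3 = n3' \<and> n5 = n5' \<and> n6 = n6'" (is "?L \<longleftrightarrow> ?R")
proof
  assume L: ?L
  hence l: "(of_nat l1 + of_nat l2 + of_nat l3 / 2 :: complex) = of_nat l1' + of_nat l2' + of_nat l3' / 2"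
    "(of_nat l2 + of_nat l3 / 2 :: complex) = of_nat l2' + of_nat l3' / 2"
    "(of_nat l3 / 2 :: complex) = of_nat l3' / 2"
    and f: "(\<lambda>i::nat. if i = 3 then n3 else if i = 5 then n5 else if i = 6 then n6 else 0) =
      (\<lambda>i. if i = 3 then n3' else if i = 5 then n5' else if i = 6 then n6' else 0)"
    by (auto simp: sig6_def)
  have "l3 = l3'" using l(3) by simp
  moreover from this have "l2 = l2'" using l(2) by simp
  moreover from calculation have "l1 = l1'" using l(1) by simp
  ultimately show ?R using fun_cong[OF f, of 3] fun_cong[OF f, of 5] fun_cong[OF f, of 6] by simp
qed simp

lemma \<sigma>_eq_sig6:
  "\<sigma> 1 = sig6 1 0 0 0 0 0" "\<sigma> 2 = sig6 0 1 0 0 0 0" "\<sigma> 3 = sig6 0 1 0 0 0 1" "\<sigma> 4 = sig6 0 0 1 0 0 0"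
  "\<sigma> 5 = sig6 0 0 1 1 0 0" "\<sigma> 6 = sig6 1 0 1 0 1 0" "\<sigma> 7 = sig6 1 1 0 1 0 0"
proof -
  have e: "expo ps = (\<lambda>i. if i = 3 then a else if i = 5 then b else if i = 6 then c else 0)"
    if "ps = [0, 0, a, 0, b, c, 0, 0, 0]" for ps a b c
  proof
    fix i :: nat
    have "i = 0 \<or> i = 1 \<or> i = 2 \<or> i = 3 \<or> i = 4 \<or> i = 5 \<or> i = 6 \<or> i = 7 \<or> i = 8 \<or> i = 9 \<or> i > 9" by arith
    thus "expo ps i = (if i = 3 then a else if i = 5 then b else if i = 6 then c else 0)"
      by (elim disjE) (simp_all add: expo_def that)
  qed
  show "\<sigma> 1 = sig6 1 0 0 0 0 0" "\<sigma> 2 = sig6 0 1 0 0 0 0" "\<sigma> 3 = sig6 0 1 0 0 0 1" "\<sigma> 4 = sig6 0 0 1 0 0 0"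
    "\<sigma> 5 = sig6 0 0 1 1 0 0" "\<sigma> 6 = sig6 1 0 1 0 1 0" "\<sigma> 7 = sig6 1 1 0 1 0 0"
    by (simp_all add: \<sigma>_def sig6_def \<pi>\<^sub>1_def \<pi>\<^sub>2_def \<pi>\<^sub>3_def e)
qed

lemma sum_\<sigma>:
  assumes "set_mset A \<subseteq> {1..7}"
  shows "(\<Sum>i\<in>#A. \<sigma> i) = sig6 (count A 1 + count A 6 + count A 7) (count A 2 + count A 3 + count A 7)
     (count A 4 + count A 5 + count A 6) (count A 5 + count A 7) (count A 6) (count A 3)"
  using assms
proof (induction A)
  case empty
  show ?case by (simp add: sig6_zero)
next
  case (add x A)
  have "x \<in> {1..7}" using add.prems by simp
  then consider "x = 1" | "x = 2" | "x = 3" | "x = 4" | "x = 5" | "x = 6" | "x = 7" by fastforce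
  thus ?case
    using add \<sigma>_eq_sig6 by cases (simp_all add: sig6_add sig6_inject del: One_nat_def)
qed

abbreviation relation47 :: "nat multiset \<Rightarrow> nat multiset \<Rightarrow> bool" where
  "relation47 \<equiv> (\<lambda>A B. A = {#4, 7#} \<and> B = {#1, 2, 5#})"

lemma monoid_cong_sum_eq:
  "monoid_cong relation47 A B \<Longrightarrow> (\<Sum>i\<in>#A. \<sigma> i) = (\<Sum>i\<in>#B. \<sigma> i)"
proof (induction rule: monoid_cong.induct)
  case (rel A B)
  thus ?case by (simp add: \<sigma>_eq_sig6 sig6_add del: One_nat_def)
qed simp_all

lemma monoid_cong_repeat:
  "monoid_cong R A B \<Longrightarrow> monoid_cong R (repeat_mset k A + C) (repeat_mset k B + C)"
proof (induction k arbitrary: C)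
  case 0
  show ?case by (simp add: monoid_cong.refl)
next
  case (Suc k)
  have "monoid_cong R (repeat_mset k A + (A + C)) (repeat_mset k B + (A + C))" using Suc by blast
  moreover have "monoid_cong R (A + (repeat_mset k B + C)) (B + (repeat_mset k B + C))"
    using Suc.prems by (rule monoid_cong.add)
  ultimately show ?case by (auto simp: ac_simps intro: monoid_cong.trans)
qed

text \<open>The counts of two multisets with the same sum differ by $k$ times $(1,1,0,-1,1,0,-1)$. For $k\ge0$
  the multiset with more letters $4$ contains $k$ copies of $\{4, 7\}$, and replacing them by
  $\{1, 2, 5\}$ gives the other one.\<close>

lemma sum_eq_imp_monoid_cong:
  assumes A: "set_mset A \<subseteq> {1..7}" and B: "set_mset B \<subseteq> {1..7}"
    and eq: "(\<Sum>i\<in>#A. \<sigma> i) = (\<Sum>i\<in>#B. \<sigma> i)" and le: "count A 4 \<le> count B 4"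
  shows "monoid_cong relation47 B A"
proof -
  define k where "k = count B 4 - count A 4"
  have c: "count B 4 = count A 4 + k" "count A 5 = count B 5 + k" "count B 7 = count A 7 + k" "count A 1 = count B 1 + k"
    "count A 2 = count B 2 + k" "count A 6 = count B 6" "count A 3 = count B 3"
    using eq le unfolding sum_\<sigma>[OF A] sum_\<sigma>[OF B] sig6_inject k_def by linarith+
  have out: "count A x = 0 \<and> count B x = 0" if "x \<notin> {1..7}" for x
    using that A B by (meson count_eq_zero_iff subsetD)
  define C where "C = B - repeat_mset k {#4, 7#}"
  have "repeat_mset k {#4, 7#} \<subseteq># B" using c by (auto simp: subseteq_mset_def)
  hence "B = repeat_mset k {#4, 7#} + C" by (simp add: C_def)
  moreover have "A = repeat_mset k {#1, 2, 5#} + C"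
  proof (rule multiset_eqI)
    fix x
    show "count A x = count (repeat_mset k {#1, 2, 5#} + C) x"
    proof (cases "x \<in> {1..7}")
      case True
      then consider "x = 1" | "x = 2" | "x = 3" | "x = 4" | "x = 5" | "x = 6" | "x = 7" by fastforce
      thus ?thesis by cases (use c in \<open>simp_all add: C_def del: One_nat_def\<close>)
    next
      case False
      hence "x \<noteq> 1" "x \<noteq> 2" "x \<noteq> 5" "x \<noteq> 4" "x \<noteq> 7" by auto
      thus ?thesis using out[OF False] by (simp add: C_def)
    qed
  qed
  ultimately show ?thesis
    using monoid_cong_repeat[OF monoid_cong.rel[of relation47 "{#4, 7#}" "{#1, 2, 5#}"], of k C] by simp
qed

lemma sum_eq_iff_monoid_cong:
  assumes "set_mset A \<subseteq> {1..7}" "set_mset B \<subseteq> {1..7}"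
  shows "(\<Sum>i\<in>#A. \<sigma> i) = (\<Sum>i\<in>#B. \<sigma> i) \<longleftrightarrow> monoid_cong relation47 A B"
  using sum_eq_imp_monoid_cong[OF assms] sum_eq_imp_monoid_cong[OF assms(2,1)] monoid_cong_sum_eq[of A B]
  by (metis monoid_cong.sym nle_le)

text \<open>The solution uses $\sigma_7$ only as often as $n_3 + n_5$ exceeds $l_3$; then $\sigma_6$ and
  $\sigma_3$ carry the exponents at $5$ and $6$, $\sigma_5$ the rest of $n_3$, and the remaining part
  of the weight is filled by $\sigma_1, \sigma_2, \sigma_4$. The hypotheses are what makes these
  multiplicities nonnegative.\<close>

lemma sig6_decompose:
  assumes b: "(n3 + n5 - l3) + (n3 + n5 - l1) \<le> n3" "(n3 + n5 - l3) + (n3 + n6 - l2) \<le> n3"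
  shows "\<exists>A. set_mset A \<subseteq> {1..7} \<and> (\<Sum>i\<in>#A. \<sigma> i) = sig6 l1 l2 l3 n3 n5 n6"
proof -
  \<comment> \<open>Truncated: $\sigma_7$ is needed only when the spinor weight $l_3\pi_3$ cannot carry all factors.\<close>
  define n7 where "n7 = n3 + n5 - l3"
  define A :: "nat multiset" where "A = replicate_mset (l1 - n5 - n7) 1 + replicate_mset (l2 - n6 - n7) 2 +
    replicate_mset n6 3 + replicate_mset (l3 - (n3 - n7) - n5) 4 + replicate_mset (n3 - n7) 5 + replicate_mset n5 6 + replicate_mset n7 7"
  have s: "set_mset A \<subseteq> {1..7}" by (auto simp: A_def)
  have "count A 1 = l1 - n5 - n7" "count A 2 = l2 - n6 - n7" "count A 3 = n6" "count A 4 = l3 - (n3 - n7) - n5"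
    "count A 5 = n3 - n7" "count A 6 = n5" "count A 7 = n7"
    by (simp_all add: A_def)
  moreover have "l1 \<ge> n5 + n7" "l2 \<ge> n6 + n7" "n3 \<ge> n7" "l3 \<ge> (n3 - n7) + n5"
    using b by (auto simp: n7_def)
  ultimately have "(\<Sum>i\<in>#A. \<sigma> i) = sig6 l1 l2 l3 n3 n5 n6"
    unfolding sum_\<sigma>[OF s] sig6_inject by simp
  thus ?thesis using s by blast
qed

section \<open>The branching semigroup of $G_2$ in $\mathfrak{so}_7$\<close>

lemma dominant_sig6: "dominant (fst (sig6 l1 l2 l3 n3 n5 n6))"
  by (simp add: sig6_def)

lemma \<sigma>_single:
  "\<sigma> 1 = ((1, 0, 0), 0)" "\<sigma> 2 = ((1, 1, 0), 0)" "\<sigma> 3 = ((1, 1, 0), single 6)" "\<sigma> 4 = ((1/2, 1/2, 1/2), 0)"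
  "\<sigma> 5 = ((1/2, 1/2, 1/2), single 3)" "\<sigma> 6 = ((1, 0, 0) + (1/2, 1/2, 1/2), single 5)"
  "\<sigma> 7 = ((1, 0, 0) + (1, 1, 0), single 3)"
  unfolding \<sigma>_eq_sig6 by (simp_all add: sig6_def single_def fun_eq_iff)

text \<open>The empty sum is realized by the trivial representation, so the branching semigroup contains the
  zero signature.\<close>

lemma (in g2_negative_part) realizes_sum:
  assumes "set_mset A \<subseteq> {1..7}"
  shows "realizes {F1, F2} (fst (\<Sum>i\<in>#A. \<sigma> i)) (snd (\<Sum>i\<in>#A. \<sigma> i))"
  using assms
proof (induction A)
  case empty
  show ?case using realizes_highest(1) by (simp only: image_mset_empty sum_mset.empty fst_zero snd_zero)
next
  case (add i A)
  have "i = 1 \<or> i = 2 \<or> i = 3 \<or> i = 4 \<or> i = 5 \<or> i = 6 \<or> i = 7" using add.prems by auto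
  hence "realizes {F1, F2} (fst (\<sigma> i)) (snd (\<sigma> i))"
    using realizes_highest realizes_wedge realizes_spinor realizes_mixed realizes_adjoint
    by (elim disjE) (simp_all only: \<sigma>_single fst_conv snd_conv)
  moreover have "realizes {F1, F2} (fst (\<Sum>i\<in>#A. \<sigma> i)) (snd (\<Sum>i\<in>#A. \<sigma> i))" using add by simp
  moreover have "{F1, F2} \<subseteq> so7" using F_so7 by simp
  ultimately have "realizes {F1, F2} (fst (\<sigma> i) + fst (\<Sum>i\<in>#A. \<sigma> i)) (snd (\<sigma> i) + snd (\<Sum>i\<in>#A. \<sigma> i))"
    by (intro realizes_add)
  thus ?case by (simp only: image_mset_add_mset sum_mset.add_mset fst_add snd_add)
qed

theorem mainTheorem8:
  fixes e E F H :: "nat \<Rightarrow> complex mat"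
  assumes "\<And>i. i \<in> {1..9} \<Longrightarrow> e i \<in> root_space (- pos_root i) \<and> e i \<noteq> 0\<^sub>m 7 7"
    and "g2_in_so7 E F H"
  shows "presented_by (branching_semigroup e (lie_gen {F 1, F 2})) {1..7} \<sigma>
           (\<lambda>A B. A = {#4, 7#} \<and> B = {#1, 2, 5#})"
proof -
  obtain \<kappa> where \<kappa>: "\<And>i. i \<in> {1..9} \<Longrightarrow> e i = \<kappa> i \<cdot>\<^sub>m neg_vec i \<and> \<kappa> i \<noteq> 0"
    using root_vectors_scaled[OF assms(1)] by blast
  obtain a b c where abc: "a \<noteq> 0" "b \<noteq> 0" and F: "F 1 = b \<cdot>\<^sub>m neg_vec 5 + a \<cdot>\<^sub>m neg_vec 9" "F 2 = c \<cdot>\<^sub>m neg_vec 8"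
    using g2_in_so7_negative_simple[OF assms(2)] by blast
  interpret g2_negative_part a b c "F 1" "F 2" by unfold_locales (fact abc F)+
  have L: "lie_gen {F 1, F 2} \<subseteq> so7" using g2_lower_subset[OF assms(2)] by (auto simp: lower_so7_def)
  have "branching_semigroup e (lie_gen {F 1, F 2}) = {\<Sum>i\<in>#A. \<sigma> i | A. set_mset A \<subseteq> {1..7}}"
  proof (intro equalityI subsetI)
    fix s assume "s \<in> branching_semigroup e (lie_gen {F 1, F 2})"
    moreover obtain lam p where s: "s = (lam, p)" by (cases s)
    ultimately have mem: "(lam, p) \<in> branching_semigroup e (lie_gen {F 1, F 2})" by simp
    obtain l1 l2 l3 where lam: "lam = (of_nat l1 + of_nat l2 + of_nat l3 / 2, of_nat l2 + of_nat l3 / 2, of_nat l3 / 2)"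
      and p: "\<And>i. i \<notin> {3, 5, 6} \<Longrightarrow> p i = 0"
      and bounds: "(p 3 + p 5 - l3) + (p 3 + p 5 - l1) \<le> p 3" "(p 3 + p 5 - l3) + (p 3 + p 6 - l2) \<le> p 3"
    proof (rule branching_signature_bounds[OF _ assms(2) mem])
      show "e i \<in> root_space (- pos_root i) \<and> e i \<noteq> 0\<^sub>m 7 7" if "i \<in> {1..9}" for i
        using assms(1)[OF that] .
    qed (rule that, assumption, blast+)
    have eq: "s = sig6 l1 l2 l3 (p 3) (p 5) (p 6)"
      unfolding s lam sig6_def using p by (auto simp: fun_eq_iff)
    obtain A where A: "set_mset A \<subseteq> {1..7}" "(\<Sum>i\<in>#A. \<sigma> i) = sig6 l1 l2 l3 (p 3) (p 5) (p 6)"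
      using sig6_decompose[OF bounds] by blast
    show "s \<in> {\<Sum>i\<in>#A. \<sigma> i | A. set_mset A \<subseteq> {1..7}}"
      unfolding eq by (intro CollectI exI[of _ A] conjI A(1) A(2)[symmetric])
  next
    fix s assume "s \<in> {\<Sum>i\<in>#A. \<sigma> i | A. set_mset A \<subseteq> {1..7}}"
    then obtain A where A: "set_mset A \<subseteq> {1..7}" and s: "s = (\<Sum>i\<in>#A. \<sigma> i)" by blast
    have "(fst s, snd s) \<in> branching_semigroup e (lie_gen {F 1, F 2})"
    proof (rule realizes_branching[OF _ L])
      show "e i = \<kappa> i \<cdot>\<^sub>m neg_vec i \<and> \<kappa> i \<noteq> 0" if "i \<in> {1..9}" for i using \<kappa>[OF that] .
      show "dominant (fst s)" unfolding s sum_\<sigma>[OF A] by (rule dominant_sig6)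
      show "realizes {F 1, F 2} (fst s) (snd s)" unfolding s by (rule realizes_sum[OF A])
    qed
    thus "s \<in> branching_semigroup e (lie_gen {F 1, F 2})" by simp
  qed
  moreover have "(\<Sum>i\<in>#A. \<sigma> i) = (\<Sum>i\<in>#B. \<sigma> i) \<longleftrightarrow> monoid_cong (\<lambda>A B. A = {#4, 7#} \<and> B = {#1, 2, 5#}) A B"
    if "set_mset A \<subseteq> {1..7}" "set_mset B \<subseteq> {1..7}" for A B
    by (rule sum_eq_iff_monoid_cong[OF that])
  ultimately show ?thesis unfolding presented_by_def by blast
qed

end
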